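(* Let $\gamma,h \in C^\infty([0,T] \times [-\pi,\pi])$ be real-valued functions $\gamma(\alpha,t),h(\alpha,t)$, $2\pi$-periodic in $\alpha$, describing a classical vortex sheet solution $u$ of the two-dimensional Euler equations on $[0,T]$ (position $\zeta(\alpha,t)=\alpha+i\,h(\alpha,t)$ and vorticity density $\gamma$), and suppose the total circulation is zero: $$\int_{-\pi}^{\pi}\gamma(\alpha,t)\,d\alpha=0\quad\text{for all }t\in[0,T].$$ Then the energy of the vortex sheet is conserved: $\int_{(-\pi,\pi)\times\mathbb{R}}|u(x,t)|^2dx=\int_{(-\pi,\pi)\times\mathbb{R}}|u(x,0)|^2dx$ for all $t\in[0,T]$.
   Context: A classical ($2\pi$-periodic, 2D) vortex sheet with data $(h,\gamma)$ is a weak solution of the Euler equations with vorticity concentrated on the moving graph $\{(\alpha,h(\alpha,t))\}$: identifying $\mathbb{R}^2$ with $\mathbb{C}$, with $z=x_1+ix_2$, $u=u_1+iu_2$ and $\zeta(\alpha,t)=\alpha+ih(\alpha,t)$, the velocity off the sheet is given by the Biot–Savart law $$\bar u(z,t)=\frac1{4\pi i}\int_{-\pi}^{\pi}\cot\Big(\frac{z-\zeta(\alpha,t)}2\Big)\gamma(\alpha,t)\,d\alpha .$$ The field $u$ is $2\pi$-periodic in $x_1$. Weak solution is understood on the domain $\Omega=(\mathbb{R}/2\pi\mathbb{Z})\times\mathbb{R}$: $u\in C_w([0,T];L^2(\Omega))$, $\nabla_x\cdot u(t)=0$ in the sense of distributions, and for every $\psi\in C_0^\infty([0,T]\times\Omega)$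 (compact support; not required to vanish at $t=0,T$) with $\nabla_x\cdot\psi=0$ and all $0\le t\le T$, $$\int_{\Omega}u(t)\cdot\psi(t)-\int_{\Omega}u(0)\cdot\psi(0)-\int_0^t\int_{\Omega}u\cdot\partial_s\psi=\int_0^t\int_{\Omega}(u\otimes u):\nabla\psi,\qquad A:B=\mathrm{Tr}[AB].$$ *)

theory Defs
  imports "HOL-Analysis.Analysis"
begin

text \<open>
  The plane is identified with \<^typ>\<open>complex\<close>; the real inner product on \<^typ>\<open>complex\<close> is the
  Euclidean one. A function on \<open>\<Omega> = (\<real>/2\<pi>\<int>) \<times> \<real>\<close> is a function on \<^typ>\<open>complex\<close> that is
  \<open>2\<pi>\<close>-periodic in the real part, and integrals over \<open>\<Omega>\<close> are taken over one open period strip.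
\<close>

definition strip :: "complex set" where
  "strip = {z. - pi < Re z \<and> Re z < pi}"

definition x_periodic :: "(complex \<Rightarrow> 'b) \<Rightarrow> bool" where
  "x_periodic f \<longleftrightarrow> (\<forall>z. f (z + of_real (2 * pi)) = f z)"

text \<open>
  Derivatives are taken relative to \<open>S\<close>. Below, \<open>S\<close> is either the whole space or
  \<open>[0,T] \<times> E\<close> with \<open>0 < T\<close>, where such derivatives are unique and are one-sided in time at the
  end points.
\<close>

primrec Ck_on :: "nat \<Rightarrow> 'a::euclidean_space set \<Rightarrow> ('a \<Rightarrow> 'b::real_normed_vector) \<Rightarrow> bool" where
  "Ck_on 0 S f \<longleftrightarrow> continuous_on S f"
| "Ck_on (Suc k) S f \<longleftrightarrow>
     (\<exists>f'. (\<forall>x\<in>S. (f has_derivative f' x) (at x within S)) \<and> (\<forall>v. Ck_on k S (\<lambda>x. f' x v)))"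

definition smooth_on :: "'a::euclidean_space set \<Rightarrow> ('a \<Rightarrow> 'b::real_normed_vector) \<Rightarrow> bool" where
  "smooth_on S f \<longleftrightarrow> (\<forall>k. Ck_on k S f)"

definition gradient :: "(complex \<Rightarrow> real) \<Rightarrow> complex \<Rightarrow> complex" where
  "gradient \<phi> z = Complex (frechet_derivative \<phi> (at z) 1) (frechet_derivative \<phi> (at z) \<i>)"

definition divergence :: "(complex \<Rightarrow> complex) \<Rightarrow> complex \<Rightarrow> real" where
  "divergence \<psi> z =
     Re (frechet_derivative \<psi> (at z) 1) + Im (frechet_derivative \<psi> (at z) \<i>)"

text \<open>
  \<open>(v \<otimes> v) : \<nabla>\<psi> = Tr[(v \<otimes> v) \<nabla>\<psi>] = \<Sum>\<^sub>i \<Sum>\<^sub>j v\<^sub>i v\<^sub>j \<partial>\<^sub>j \<psi>\<^sub>i\<close> at the point \<open>z\<close>; the standard basis of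
  \<^typ>\<open>complex\<close> is \<open>{1, \<i>}\<close>.
\<close>

definition tensor_grad :: "complex \<Rightarrow> (complex \<Rightarrow> complex) \<Rightarrow> complex \<Rightarrow> real" where
  "tensor_grad v \<psi> z =
     (\<Sum>i\<in>Basis. \<Sum>j\<in>Basis. (v \<bullet> i) * (v \<bullet> j) * (frechet_derivative \<psi> (at z) j \<bullet> i))"

definition L2_field :: "(complex \<Rightarrow> complex) \<Rightarrow> bool" where
  "L2_field v \<longleftrightarrow>
     set_borel_measurable lebesgue strip v \<and> set_integrable lebesgue strip (\<lambda>z. (norm (v z))\<^sup>2)"

text \<open>
  Compactness of the support is a condition on \<open>Im z\<close> only, the horizontal direction and the
  closed time interval being compact.
\<close>

definition test_fun :: "(complex \<Rightarrow> real) \<Rightarrow> bool" where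
  "test_fun \<phi> \<longleftrightarrow> smooth_on UNIV \<phi> \<and> x_periodic \<phi> \<and> (\<exists>R. \<forall>z. R < \<bar>Im z\<bar> \<longrightarrow> \<phi> z = 0)"

definition test_field :: "real \<Rightarrow> (real \<Rightarrow> complex \<Rightarrow> complex) \<Rightarrow> bool" where
  "test_field T \<psi> \<longleftrightarrow>
     smooth_on ({0..T} \<times> UNIV) (\<lambda>(t, z). \<psi> t z) \<and>
     (\<forall>t\<in>{0..T}. x_periodic (\<psi> t)) \<and>
     (\<exists>R. \<forall>t\<in>{0..T}. \<forall>z. R < \<bar>Im z\<bar> \<longrightarrow> \<psi> t z = 0)"

definition weakly_continuous_L2 :: "real \<Rightarrow> (real \<Rightarrow> complex \<Rightarrow> complex) \<Rightarrow> bool" where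
  "weakly_continuous_L2 T u \<longleftrightarrow>
     (\<forall>t\<in>{0..T}. L2_field (u t)) \<and>
     (\<forall>w. L2_field w \<longrightarrow> continuous_on {0..T} (\<lambda>t. LINT z:strip|lebesgue. u t z \<bullet> w z))"

definition weak_euler_solution :: "real \<Rightarrow> (real \<Rightarrow> complex \<Rightarrow> complex) \<Rightarrow> bool" where
  "weak_euler_solution T u \<longleftrightarrow>
     (\<forall>t\<in>{0..T}. x_periodic (u t)) \<and>
     weakly_continuous_L2 T u \<and>
     (\<forall>t\<in>{0..T}. \<forall>\<phi>. test_fun \<phi> \<longrightarrow> (LINT z:strip|lebesgue. u t z \<bullet> gradient \<phi> z) = 0) \<and>
     (\<forall>\<psi>. test_field T \<psi> \<and> (\<forall>t\<in>{0..T}. \<forall>z. divergence (\<psi> t) z = 0) \<longrightarrow>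
        (\<forall>t\<in>{0..T}.
           (LINT z:strip|lebesgue. u t z \<bullet> \<psi> t z) - (LINT z:strip|lebesgue. u 0 z \<bullet> \<psi> 0 z)
           - (LINT s:{0..t}|lebesgue. LINT z:strip|lebesgue.
                u s z \<bullet> vector_derivative (\<lambda>r. \<psi> r z) (at s within {0..T}))
           = (LINT s:{0..t}|lebesgue. LINT z:strip|lebesgue. tensor_grad (u s z) (\<psi> s) z)))"

definition sheet_point :: "(real \<Rightarrow> real \<Rightarrow> real) \<Rightarrow> real \<Rightarrow> real \<Rightarrow> complex" where
  "sheet_point h t \<alpha> = Complex \<alpha> (h \<alpha> t)"

text \<open>The values of \<open>u\<close> on the sheet itself, a null set, are left unspecified.\<close>

definition classical_vortex_sheet ::
    "real \<Rightarrow> (real \<Rightarrow> real \<Rightarrow> real) \<Rightarrow> (real \<Rightarrow> real \<Rightarrow> real) \<Rightarrow> (real \<Rightarrow> complex \<Rightarrow> complex) \<Rightarrow> bool"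
  where
  "classical_vortex_sheet T h \<gamma> u \<longleftrightarrow>
     weak_euler_solution T u \<and>
     (\<forall>t\<in>{0..T}. \<forall>z. z \<notin> range (sheet_point h t) \<longrightarrow>
        cnj (u t z) =
          1 / (4 * of_real pi * \<i>) *
          (LINT \<alpha>:{-pi..pi}|lebesgue. cot ((z - sheet_point h t \<alpha>) / 2) * of_real (\<gamma> \<alpha> t)))"

end

theory Submission
  imports Defs "HOL-Computational_Algebra.Polynomial"
begin

text \<open>
  Regularize the kernel \<open>cot (w / 2)\<close> by adding \<open>e > 0\<close> to its denominator \<open>cosh y - cos x\<close>. The stream function
  of the regularized velocity, cut off away from the sheet, generates a smooth divergence-free test field
  \<open>\<psi>\<close>. The pairing \<open>E = \<integral> u \<bullet> \<psi>\<close> is a symmetric quadratic form in \<open>\<gamma>\<close> with kernel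
  \<open>ln (cosh y - cos x + e)\<close>, hence \<open>\<integral> u \<bullet> \<partial>\<^sub>t \<psi> = E' / 2\<close>, and the weak formulation identifies half of the increment
  of \<open>E\<close> with the time integral of \<open>\<integral> (u \<otimes> u) : \<nabla>\<psi>\<close>.

  The Cauchy--Pompeiu formula on the strip and the addition theorem of the cotangent (Delort's
  symmetrization) turn \<open>\<integral> (u \<otimes> u) : \<nabla>\<psi>\<close> into the double integral over the sheet of
  \<open>cot ((\<zeta>' - \<zeta>) / 2) (\<psi>(\<zeta>') - \<psi>(\<zeta>)) \<gamma> \<gamma>'\<close>. With the regularized kernel in place of the cotangent this would vanish;
  the difference is \<open>O(e\<^sup>1\<^sup>/\<^sup>4)\<close> because on the sheet \<open>\<psi>\<close> has Lipschitz constant \<open>O(e\<^sup>-\<^sup>1\<^sup>/\<^sup>8)\<close>. As \<open>e\<close> tends to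
  \<open>0\<close>, \<open>E\<close> tends to the energy: it does not depend on the height of the cutoff, and vanishing
  circulation keeps the stream function bounded, so the cutoff can be moved to infinity.
\<close>

section \<open>Functions with continuous derivatives of order \<open>k\<close>\<close>

text \<open>The equation of motion of the sheet is never derived; only the weak formulation enters,
  tested with a field made from the solution itself. \<open>u\<close> is no admissible test field:
  it jumps across the sheet and lacks compact support. Regularizing the kernel, rather than
  averaging \<open>u\<close>, keeps the pairings explicit integrals over the sheet; truncating the
  stream function, rather than the velocity, keeps the divergence zero.

  The rate comes from balancing powers of \<open>D = denom w\<close> near the diagonal. Up to
  constants, the increment of \<psi> along the sheet is at most \<open>e^(-1/8) D^(1/2)\<close> and
  the defect of the kernel at most \<open>D^(-1/2) (e/D)^(3/8)\<close>. The half powers cancel and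
  leave \<open>e^(1/4) D^(-3/8)\<close>, where \<open>D^(-3/8)\<close> behaves like the power
  \<open>-3/4\<close> of the parameter difference and is integrable over a line. It is decisive that
  only increments along the sheet occur, because across it the limit velocity jumps. All constants
  come from bounds on the sheet that are uniform in time, so the defect can be integrated over
  time.\<close>

lemma Ck_on_continuous: "Ck_on k S f \<Longrightarrow> continuous_on S f"
proof (induction k)
  case (Suc k)
  then obtain f' where "\<forall>x\<in>S. (f has_derivative f' x) (at x within S)" by auto
  then show ?case
    by (meson continuous_on_eq_continuous_within has_derivative_continuous)
qed auto

lemma Ck_on_SucD: "Ck_on (Suc k) S f \<Longrightarrow> Ck_on k S f"
proof (induction k arbitrary: f)
  case 0
  then show ?case using Ck_on_continuous[OF 0] by simp
next
  case (Suc k)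
  then obtain f' where "\<forall>x\<in>S. (f has_derivative f' x) (at x within S)" "\<forall>v. Ck_on (Suc k) S (\<lambda>x. f' x v)"
    by auto
  then show ?case using Suc.IH by auto
qed

lemma Ck_on_subset: "Ck_on k S f \<Longrightarrow> U \<subseteq> S \<Longrightarrow> Ck_on k U f"
proof (induction k arbitrary: f)
  case 0
  then show ?case by (auto intro: continuous_on_subset)
next
  case (Suc k)
  then obtain f' where "\<forall>x\<in>S. (f has_derivative f' x) (at x within S)" "\<forall>v. Ck_on k S (\<lambda>x. f' x v)"
    by auto
  then show ?case using Suc.IH Suc.prems
    by (auto intro!: exI[of _ f'] intro: has_derivative_subset)
qed

lemma Ck_on_cong: "Ck_on k S f \<Longrightarrow> (\<And>x. x \<in> S \<Longrightarrow> f x = g x) \<Longrightarrow> Ck_on k S g"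
proof (cases k)
  case 0
  assume "Ck_on k S f" "\<And>x. x \<in> S \<Longrightarrow> f x = g x"
  then show ?thesis using 0 continuous_on_eq[of S f g] by simp
next
  case (Suc m)
  assume "Ck_on k S f" and fg: "\<And>x. x \<in> S \<Longrightarrow> f x = g x"
  then obtain f' where f': "\<forall>x\<in>S. (f has_derivative f' x) (at x within S)" "\<forall>v. Ck_on m S (\<lambda>x. f' x v)"
    by (auto simp only: Suc Ck_on.simps)
  have "\<forall>x\<in>S. (g has_derivative f' x) (at x within S)"
  proof
    fix x assume "x \<in> S"
    then show "(g has_derivative f' x) (at x within S)"
      by (rule has_derivative_transform[OF _ fg[symmetric]]) (use f'(1) \<open>x \<in> S\<close> in auto)
  qed
  with f' show ?thesis using Suc by auto
qed

lemma Ck_on_const: "Ck_on k S (\<lambda>x. c)"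
proof (induction k arbitrary: c)
  case (Suc k)
  then show ?case by (auto intro!: exI[of _ "\<lambda>x v. 0"])
qed auto

lemma Ck_on_linear:
  assumes "bounded_linear f" shows "Ck_on k S f"
proof (cases k)
  case 0
  then show ?thesis using assms by (auto intro: linear_continuous_on)
next
  case (Suc m)
  then show ?thesis using assms
    by (auto intro!: exI[of _ "\<lambda>x. f"] Ck_on_const bounded_linear_imp_has_derivative)
qed

lemma Ck_on_add:
  assumes "Ck_on k S f" "Ck_on k S g" shows "Ck_on k S (\<lambda>x. f x + g x)"
  using assms
proof (induction k arbitrary: f g)
  case 0
  then show ?case by (auto intro: continuous_on_add)
next
  case (Suc k)
  then obtain f' g' where "\<forall>x\<in>S. (f has_derivative f' x) (at x within S)" "\<forall>v. Ck_on k S (\<lambda>x. f' x v)"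
    "\<forall>x\<in>S. (g has_derivative g' x) (at x within S)" "\<forall>v. Ck_on k S (\<lambda>x. g' x v)"
    by auto
  then show ?case using Suc.IH
    by (auto intro!: exI[of _ "\<lambda>x v. f' x v + g' x v"] has_derivative_add)
qed

lemma Ck_on_bilinear:
  assumes "bounded_bilinear bop" "Ck_on k S f" "Ck_on k S g"
  shows "Ck_on k S (\<lambda>x. bop (f x) (g x))"
  using assms(2,3)
proof (induction k arbitrary: f g)
  case 0
  then show ?case using bounded_bilinear.continuous_on[OF assms(1)] by auto
next
  case (Suc k)
  then obtain f' g' where f': "\<forall>x\<in>S. (f has_derivative f' x) (at x within S)" "\<forall>v. Ck_on k S (\<lambda>x. f' x v)"
    and g': "\<forall>x\<in>S. (g has_derivative g' x) (at x within S)" "\<forall>v. Ck_on k S (\<lambda>x. g' x v)"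
    by auto
  have "Ck_on k S f" "Ck_on k S g" using Suc.prems Ck_on_SucD by blast+
  with f' g' show ?case using Suc.IH
    by (auto intro: bounded_bilinear.FDERIV[OF assms(1)] intro!: exI[of _ "\<lambda>x v. bop (f x) (g' x v) + bop (f' x v) (g x)"] Ck_on_add)
qed

lemmas Ck_on_mult = Ck_on_bilinear[OF bounded_bilinear_mult]
lemmas Ck_on_scaleR = Ck_on_bilinear[OF bounded_bilinear_scaleR]

lemma Ck_on_linear_compose:
  assumes "bounded_linear L" "Ck_on k S f" shows "Ck_on k S (\<lambda>x. L (f x))"
  using assms(2)
proof (induction k arbitrary: f)
  case 0
  then show ?case using bounded_linear.continuous_on[OF assms(1)] by auto
next
  case (Suc k)
  then obtain f' where f': "\<forall>x\<in>S. (f has_derivative f' x) (at x within S)" "\<forall>v. Ck_on k S (\<lambda>x. f' x v)"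
    by auto
  then show ?case using Suc.IH
    by (auto intro: bounded_linear.has_derivative[OF assms(1)] intro!: exI[of _ "\<lambda>x v. L (f' x v)"])
qed

lemma Ck_on_minus: "Ck_on k S f \<Longrightarrow> Ck_on k S (\<lambda>x. - f x)"
  by (rule Ck_on_linear_compose[OF bounded_linear_minus[OF bounded_linear_ident]])

lemma Ck_on_diff: "Ck_on k S f \<Longrightarrow> Ck_on k S g \<Longrightarrow> Ck_on k S (\<lambda>x. f x - g x)"
  using Ck_on_add[of k S f "\<lambda>x. - g x", OF _ Ck_on_minus[of k S g]] by simp

lemma Ck_on_sum:
  assumes "finite A" "\<And>i. i \<in> A \<Longrightarrow> Ck_on k S (f i)" shows "Ck_on k S (\<lambda>x. \<Sum>i\<in>A. f i x)"
  using assms by (induction A rule: finite_induct) (simp_all add: Ck_on_const Ck_on_add)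

text \<open>\<open>Ck_on\<close> controls derivatives in fixed directions only, but the chain rule
  feeds the varying direction \<open>f' x v\<close> into \<open>g'\<close>. Expanding it in the
  basis leaves finitely many fixed directions with smooth coefficients, to which the induction
  hypothesis applies.\<close>

lemma Ck_on_compose:
  fixes f :: "'a::euclidean_space \<Rightarrow> 'b::euclidean_space" and g :: "'b \<Rightarrow> 'c::real_normed_vector"
  assumes "Ck_on k S f" "Ck_on k U g" "f ` S \<subseteq> U"
  shows "Ck_on k S (\<lambda>x. g (f x))"
  using assms
proof (induction k arbitrary: f g)
  case 0
  then show ?case by (auto intro: continuous_on_compose2)
next
  case (Suc k)
  then obtain f' g' where f': "\<forall>x\<in>S. (f has_derivative f' x) (at x within S)" "\<forall>v. Ck_on k S (\<lambda>x. f' x v)"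
    and g': "\<forall>x\<in>U. (g has_derivative g' x) (at x within U)" "\<forall>v. Ck_on k U (\<lambda>x. g' x v)"
    by auto
  have f: "Ck_on k S f" using Suc.prems(1) by (rule Ck_on_SucD)
  define d where "d x v = (\<Sum>b\<in>Basis. (f' x v \<bullet> b) *\<^sub>R g' (f x) b)" for x v
  have "((\<lambda>x. g (f x)) has_derivative d x) (at x within S)" if "x \<in> S" for x
  proof -
    have fx: "f x \<in> U" using that Suc.prems by auto
    have "((\<lambda>x. g (f x)) has_derivative (\<lambda>v. g' (f x) (f' x v))) (at x within S)"
      using has_derivative_in_compose[of f "f' x" x S g "g' (f x)"] f' g' that fx Suc.prems(3)
      by (blast intro: has_derivative_subset)
    moreover have "g' (f x) (f' x v) = d x v" for v
    proof -
      interpret linear "g' (f x)" using g' fx has_derivative_linear by blast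
      have "g' (f x) (f' x v) = g' (f x) (\<Sum>b\<in>Basis. (f' x v \<bullet> b) *\<^sub>R b)"
        by (simp only: euclidean_representation)
      also have "\<dots> = d x v" unfolding d_def by (simp add: sum scale)
      finally show ?thesis .
    qed
    ultimately show ?thesis by simp
  qed
  moreover have "Ck_on k S (\<lambda>x. d x v)" for v
    unfolding d_def
    by (intro Ck_on_sum finite_Basis Ck_on_scaleR Ck_on_linear_compose[OF bounded_linear_inner_left]
        Suc.IH f) (use f' g' Suc.prems in auto)
  ultimately show ?case by auto
qed

section \<open>Smoothness of elementary functions\<close>

lemma Ck_on_of_deriv:
  fixes f :: "real \<Rightarrow> real"
  assumes "\<And>x. x \<in> S \<Longrightarrow> (f has_real_derivative f' x) (at x within S)" "Ck_on k S f'"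
  shows "Ck_on (Suc k) S f"
  using assms
  by (auto intro!: exI[of _ "\<lambda>x v. f' x * v"] Ck_on_mult Ck_on_const simp: has_field_derivative_def)

lemma Ck_on_inverse: "Ck_on k {0<..} (inverse :: real \<Rightarrow> real)"
proof (induction k)
  case 0
  then show ?case by (auto intro!: continuous_intros)
next
  case (Suc k)
  show ?case
  proof (rule Ck_on_of_deriv)
    show "(inverse has_real_derivative - (inverse x * inverse x)) (at x within {0<..})"
      if "x \<in> {0<..}" for x :: real
      using that by (auto intro!: derivative_eq_intros simp: power2_eq_square)
  qed (intro Ck_on_minus Ck_on_mult Suc)
qed

lemma Ck_on_ln: "Ck_on k {0<..} (ln :: real \<Rightarrow> real)"
proof (cases k)
  case 0
  then show ?thesis by (auto intro!: continuous_intros)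
next
  case (Suc m)
  show ?thesis unfolding Suc
    by (rule Ck_on_of_deriv[OF _ Ck_on_inverse]) (auto intro!: derivative_eq_intros simp: field_simps)
qed

lemma Ck_on_sin_cos: "Ck_on k UNIV (sin :: real \<Rightarrow> real) \<and> Ck_on k UNIV (cos :: real \<Rightarrow> real)"
proof (induction k)
  case 0
  then show ?case by (auto intro!: continuous_intros)
next
  case (Suc k)
  have "Ck_on (Suc k) UNIV (sin :: real \<Rightarrow> real)"
    by (rule Ck_on_of_deriv[of _ _ cos]) (use Suc in auto)
  moreover have "Ck_on (Suc k) UNIV (cos :: real \<Rightarrow> real)"
    by (rule Ck_on_of_deriv[of _ _ "\<lambda>x. - sin x"]) (use Suc Ck_on_minus in \<open>auto intro!: derivative_eq_intros\<close>)
  ultimately show ?case by blast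
qed

lemma Ck_on_sinh_cosh: "Ck_on k UNIV (sinh :: real \<Rightarrow> real) \<and> Ck_on k UNIV (cosh :: real \<Rightarrow> real)"
proof (induction k)
  case 0
  then show ?case by (auto intro!: continuous_intros)
next
  case (Suc k)
  have "Ck_on (Suc k) UNIV (sinh :: real \<Rightarrow> real)"
    by (rule Ck_on_of_deriv[of _ _ cosh]) (use Suc in \<open>auto intro!: derivative_eq_intros\<close>)
  moreover have "Ck_on (Suc k) UNIV (cosh :: real \<Rightarrow> real)"
    by (rule Ck_on_of_deriv[of _ _ sinh]) (use Suc in \<open>auto intro!: derivative_eq_intros\<close>)
  ultimately show ?case by blast
qed

text \<open>The Leibniz rule asks for a derivative that is continuous as an operator-valued map. In
  finite dimension, continuity in each fixed direction suffices, and this is the form in which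
  \<open>Ck_on\<close> provides it.\<close>

lemma has_derivative_integral_param:
  fixes F :: "'a::euclidean_space \<Rightarrow> real \<Rightarrow> 'c::euclidean_space"
  assumes S: "convex S" "p \<in> S"
    and der: "\<And>p s. p \<in> S \<Longrightarrow> s \<in> {a..b} \<Longrightarrow> ((\<lambda>p. F p s) has_derivative d p s) (at p within S)"
    and dc: "\<And>v. continuous_on (S \<times> {a..b}) (\<lambda>(p, s). d p s v)"
    and Fc: "\<And>p. p \<in> S \<Longrightarrow> continuous_on {a..b} (F p)"
  shows "((\<lambda>p. integral {a..b} (F p)) has_derivative (\<lambda>v. integral {a..b} (\<lambda>s. d p s v))) (at p within S)"
proof -
  define fx where "fx p s = Blinfun (d p s)" for p s
  have fx: "blinfun_apply (fx p s) = d p s" if "p \<in> S" "s \<in> {a..b}" for p s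
    unfolding fx_def by (rule bounded_linear_Blinfun_apply) (rule has_derivative_bounded_linear[OF der[OF that]])
  have cont: "continuous_on (S \<times> cbox a b) (\<lambda>(p, s). fx p s)"
  proof (rule continuous_on_blinfun_componentwise)
    fix i :: 'a
    have "continuous_on (S \<times> cbox a b) (\<lambda>(p, s). d p s i)" using dc by simp
    then show "continuous_on (S \<times> cbox a b) (\<lambda>x. blinfun_apply (case x of (p, s) \<Rightarrow> fx p s) i)"
      by (rule continuous_on_eq) (auto simp: fx)
  qed
  have "((\<lambda>p. integral (cbox a b) (F p)) has_derivative integral (cbox a b) (fx p)) (at p within S)"
    by (rule leibniz_rule) (use S der fx Fc cont in \<open>auto intro!: integrable_continuous_real\<close>)
  moreover have "blinfun_apply (integral (cbox a b) (fx p)) v = integral {a..b} (\<lambda>s. d p s v)" for v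
  proof -
    have "fx p integrable_on cbox a b"
    proof (rule integrable_continuous)
      show "continuous_on (cbox a b) (fx p)"
        by (rule continuous_on_compose2[OF cont, of _ "\<lambda>s. (p, s)", simplified])
          (use S in \<open>auto intro!: continuous_intros\<close>)
    qed
    from blinfun_apply_integral[OF this, of v]
    have "blinfun_apply (integral (cbox a b) (fx p)) v = integral {a..b} (\<lambda>s. blinfun_apply (fx p s) v)" by simp
    also have "\<dots> = integral {a..b} (\<lambda>s. d p s v)"
      by (rule integral_cong) (use fx S in auto)
    finally show ?thesis .
  qed
  ultimately show ?thesis
    using has_derivative_eq_rhs[of _ "blinfun_apply (integral (cbox a b) (fx p))"]
    by (auto simp: fun_eq_iff)
qed

text \<open>Differentiating in \<open>p\<close> replaces \<open>F\<close> by its derivative along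
  \<open>(v, 0)\<close>, which has the required form one order lower. Convexity of \<open>S\<close>
  serves the Leibniz rule.\<close>

lemma Ck_on_integral:
  fixes F :: "'a::euclidean_space \<times> real \<Rightarrow> 'c::euclidean_space"
  assumes "convex S" "Ck_on k (S \<times> UNIV) F"
  shows "Ck_on k S (\<lambda>p. integral {a..b} (\<lambda>s. F (p, s)))"
  using assms(2)
proof (induction k arbitrary: F)
  case 0
  have "continuous_on (S \<times> cbox a b) (\<lambda>(x, t). F (x, t))"
    using 0 by (auto intro: continuous_on_subset)
  from integral_continuous_on_param[OF this] show ?case by simp
next
  case (Suc k)
  then obtain F' where F': "\<forall>x\<in>S\<times>UNIV. (F has_derivative F' x) (at x within S \<times> UNIV)"
      "\<forall>v. Ck_on k (S \<times> UNIV) (\<lambda>x. F' x v)"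
    by auto
  have Fc: "continuous_on (S \<times> UNIV) F" using Ck_on_continuous Suc.prems by blast
  have "((\<lambda>p. integral {a..b} (\<lambda>s. F (p, s))) has_derivative
      (\<lambda>v. integral {a..b} (\<lambda>s. F' (p, s) (v, 0)))) (at p within S)" if "p \<in> S" for p
  proof (rule has_derivative_integral_param[OF assms(1) that])
    show "((\<lambda>p. F (p, s)) has_derivative (\<lambda>v. F' (p, s) (v, 0))) (at p within S)" if "p \<in> S" for p s
    proof -
      have "((\<lambda>p. (p, s)) has_derivative (\<lambda>v. (v, 0))) (at p within S)"
        by (auto intro!: derivative_eq_intros)
      moreover have "(F has_derivative F' (p, s)) (at (p, s) within (\<lambda>p. (p, s)) ` S)"
        using F' that by (auto intro: has_derivative_subset)
      ultimately show ?thesis by (rule has_derivative_in_compose)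
    qed
    show "continuous_on (S \<times> {a..b}) (\<lambda>(p, s). F' (p, s) (v, 0))" for v
      by (rule continuous_on_subset[of "S \<times> UNIV"])
        (use Ck_on_continuous[OF F'(2)[rule_format, of "(v,0)"]] in \<open>auto simp: case_prod_beta'\<close>)
    show "continuous_on {a..b} (\<lambda>s. F (p, s))" if "p \<in> S" for p
      by (intro continuous_on_compose2[OF Fc] continuous_intros) (use that in auto)
  qed
  moreover have "Ck_on k S (\<lambda>p. integral {a..b} (\<lambda>s. F' (p, s) (v, 0)))" for v
    by (rule Suc.IH[of "\<lambda>x. F' x (v, 0)"]) (use F' in auto)
  ultimately show ?case
    by (simp only: Ck_on.simps, intro exI[of _ "\<lambda>p v. integral {a..b} (\<lambda>s. F' (p, s) (v, 0))"] conjI) blast+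
qed

lemma smooth_real_derivative:
  fixes f :: "real \<Rightarrow> real"
  assumes "\<And>k. Ck_on k UNIV f"
  shows "(f has_real_derivative deriv f s) (at s)" "Ck_on k UNIV (deriv f)"
proof -
  from assms[of "Suc k"] obtain f' where f': "\<forall>x. (f has_derivative f' x) (at x)" "\<forall>v. Ck_on k UNIV (\<lambda>x. f' x v)"
    unfolding Ck_on.simps by blast
  have *: "(f has_real_derivative f' x 1) (at x)" for x
  proof -
    have "f' x v = f' x 1 * v" for v
      using linear_scale[OF has_derivative_linear[OF f'(1)[rule_format, of x]], of v 1]
      by (simp only: real_scaleR_def mult_1_right mult_1_left mult.commute)
    then have "f' x = (*) (f' x 1)" by (rule ext)
    then show ?thesis using f'(1) by (simp add: has_field_derivative_def)
  qed
  then have "deriv f = (\<lambda>x. f' x 1)" using DERIV_imp_deriv by blast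
  then show "(f has_real_derivative deriv f s) (at s)" "Ck_on k UNIV (deriv f)" using * f' by auto
qed

section \<open>A smooth cutoff\<close>

text \<open>The polynomial makes the class closed under differentiation: \<open>flat 1\<close> is
  the standard function \<open>exp (- (1 / x))\<close> extended by \<open>0\<close>, and each
  derivative only changes \<open>p\<close>.\<close>

definition flat :: "real poly \<Rightarrow> real \<Rightarrow> real" where
  "flat p x = (if 0 < x then poly p (1 / x) * exp (- (1 / x)) else 0)"

text \<open>The additional power \<open>s ^ k\<close> carries the induction over the coefficients:
  it absorbs the factor \<open>s\<close> that \<open>pCons\<close> splits off.\<close>

lemma poly_exp_tendsto_0: "((\<lambda>s::real. s ^ k * poly p s / exp s) \<longlongrightarrow> 0) at_top"
proof (induction p arbitrary: k)
  case (pCons a p)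
  have "((\<lambda>s. a * (s ^ k / exp s) + s ^ Suc k * poly p s / exp s) \<longlongrightarrow> a * 0 + 0) at_top"
    by (intro tendsto_intros tendsto_power_div_exp_0 pCons.IH)
  then show ?case by (simp add: field_simps)
qed auto

text \<open>The factor \<open>[:0, 0, 1:]\<close> is the \<open>1 / x ^ 2\<close> of the inner
  derivative, written as a polynomial in \<open>1 / x\<close>. At the origin the difference quotient
  has one extra factor \<open>1 / h\<close>, which the exponential still beats.\<close>

lemma flat_has_derivative:
  "(flat p has_real_derivative flat ([:0, 0, 1:] * (p - pderiv p)) x) (at x)"
proof (cases x "0::real" rule: linorder_cases)
  case less
  have "((\<lambda>x. 0) has_real_derivative 0) (at x)" by auto
  moreover have "eventually (\<lambda>y. 0 = flat p y) (nhds x)"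
    using eventually_nhds_in_open[of "{..<0}" x] less by (auto elim!: eventually_mono simp: flat_def)
  ultimately have "(flat p has_real_derivative 0) (at x)"
    by (subst DERIV_cong_ev[OF refl _ refl]) (auto elim: eventually_mono)
  then show ?thesis using less by (simp add: flat_def)
next
  case greater
  have "((\<lambda>x. poly p (1 / x) * exp (- (1 / x))) has_real_derivative
     flat ([:0, 0, 1:] * (p - pderiv p)) x) (at x)"
  proof -
    have "((\<lambda>x. 1 / x) has_real_derivative - (1 / x\<^sup>2)) (at x)"
      using greater by (auto intro!: derivative_eq_intros simp: power2_eq_square)
    note d = this DERIV_chain2[OF poly_DERIV[of p] this]
    show ?thesis
      by (rule DERIV_cong[OF DERIV_mult[OF _ DERIV_fun_exp[OF DERIV_minus]], rotated 2])
        (use greater d in \<open>auto simp: flat_def field_simps power2_eq_square\<close>)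
  qed
  moreover have "eventually (\<lambda>y. poly p (1 / y) * exp (- (1 / y)) = flat p y) (nhds x)"
    using eventually_nhds_in_open[of "{0<..}" x] greater by (auto elim!: eventually_mono simp: flat_def)
  ultimately show ?thesis using DERIV_cong_ev[OF refl, of "\<lambda>x. poly p (1 / x) * exp (- (1 / x))" "flat p" x] by simp
next
  case equal
  have "((\<lambda>h. flat p h / h) \<longlongrightarrow> 0) (at_right 0)"
  proof -
    have "((\<lambda>h. (1/h) ^ 1 * poly p (1/h) / exp (1/h)) \<longlongrightarrow> 0) (at_right (0::real))"
      using filterlim_compose[OF poly_exp_tendsto_0[of 1 p] filterlim_inverse_at_top_right]
      by (simp add: inverse_eq_divide)
    moreover have "eventually (\<lambda>h. (1/h) ^ 1 * poly p (1/h) / exp (1/h) = flat p h / h) (at_right (0::real))"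
      using eventually_at_right_less[of "0::real"]
      by eventually_elim (auto simp: flat_def exp_minus field_simps)
    ultimately show ?thesis by (rule Lim_transform_eventually)
  qed
  moreover have "((\<lambda>h. flat p h / h) \<longlongrightarrow> 0) (at_left 0)"
  proof -
    have "eventually (\<lambda>h. 0 = flat p h / h) (at_left (0::real))"
      using eventually_at_left[of "-1" "0::real"] by (auto simp: flat_def intro!: exI[of _ "-1"])
    then show ?thesis by (rule Lim_transform_eventually[OF tendsto_const])
  qed
  ultimately have "((\<lambda>h. flat p h / h) \<longlongrightarrow> 0) (at 0)"
    by (rule filterlim_split_at[rotated])
  then show ?thesis using equal by (simp add: DERIV_def flat_def)
qed

lemma Ck_on_flat: "Ck_on k S (flat p)"
proof -
  have "Ck_on k UNIV (flat p)"
  proof (induction k arbitrary: p)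
    case 0
    have "isCont (flat p) x" for x using DERIV_isCont[OF flat_has_derivative] .
    then show ?case by (simp add: continuous_on_eq_continuous_at)
  next
    case (Suc k)
    show ?case by (rule Ck_on_of_deriv[OF _ Suc]) (rule flat_has_derivative)
  qed
  then show ?thesis by (rule Ck_on_subset) auto
qed

text \<open>A quotient \<open>a / (a + b)\<close>: \<open>a\<close> is positive exactly for
  \<open>|s| < 2\<close> and \<open>b\<close> exactly for \<open>|s| > 1\<close>. These sets cover
  the line, so the denominator never vanishes.\<close>

lemma smooth_cutoff_exists:
  obtains X X' :: "real \<Rightarrow> real" where "\<And>k. Ck_on k UNIV X" "\<And>k. Ck_on k UNIV X'"
    "\<And>s. (X has_real_derivative X' s) (at s)" "\<And>s. \<bar>s\<bar> \<le> 1 \<Longrightarrow> X s = 1" "\<And>s. 2 \<le> \<bar>s\<bar> \<Longrightarrow> X s = 0"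
    "\<And>s. 0 \<le> X s" "\<And>s. X s \<le> 1"
    "\<And>s. \<bar>s\<bar> < 1 \<Longrightarrow> X' s = 0" "\<And>s. 2 < \<bar>s\<bar> \<Longrightarrow> X' s = 0"
proof -
  define a where "a s = flat 1 (4 - s * s)" for s
  define b where "b s = flat 1 (s * s - 1)" for s
  have ka: "Ck_on k UNIV a" for k unfolding a_def
    by (rule Ck_on_compose[OF _ Ck_on_flat[of _ UNIV]]) (intro Ck_on_diff Ck_on_mult Ck_on_const Ck_on_linear[OF bounded_linear_ident] subset_UNIV | simp)+
  have kb: "Ck_on k UNIV b" for k unfolding b_def
    by (rule Ck_on_compose[OF _ Ck_on_flat[of _ UNIV]]) (intro Ck_on_diff Ck_on_mult Ck_on_const Ck_on_linear[OF bounded_linear_ident] subset_UNIV | simp)+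
  have nn: "0 \<le> a s" "0 \<le> b s" for s by (auto simp: a_def b_def flat_def)
  have pos: "0 < a s + b s" for s
  proof (cases "s * s < 4")
    case True
    then have "0 < a s" by (auto simp: a_def flat_def)
    then show ?thesis using nn[of s] by linarith
  next
    case False
    then have "0 < b s" by (auto simp: b_def flat_def)
    then show ?thesis using nn[of s] by linarith
  qed
  define X where "X s = a s * inverse (a s + b s)" for s
  have kX: "Ck_on k UNIV X" for k unfolding X_def
    by (rule Ck_on_mult[OF ka Ck_on_compose[OF Ck_on_add[OF ka kb] Ck_on_inverse]]) (use pos in auto)
  note der = smooth_real_derivative(1)[OF kX] and kX' = smooth_real_derivative(2)[OF kX]
  have X1: "X s = 1" if "\<bar>s\<bar> \<le> 1" for s
  proof -
    have "s * s \<le> 1" using that abs_square_le_1[of s] by (simp add: power2_eq_square)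
    then have "b s = 0" by (auto simp: b_def flat_def)
    then show ?thesis using pos[of s] by (simp add: X_def)
  qed
  have X2: "X s = 0" if "2 \<le> \<bar>s\<bar>" for s
  proof -
    have "2 * 2 \<le> \<bar>s\<bar> * \<bar>s\<bar>" using that by (intro mult_mono) auto
    then show ?thesis by (simp add: X_def a_def flat_def)
  qed
  have "deriv X s = 0" if "\<bar>s\<bar> < 1" for s
  proof -
    have "eventually (\<lambda>y. y \<in> {-1<..<1}) (nhds s)"
      using that by (intro eventually_nhds_in_open) auto
    then have "eventually (\<lambda>y. 1 = X y) (nhds s)"
      by (rule eventually_mono) (auto intro!: X1)
    then have "(X has_real_derivative 0) (at s)"
      by (rule DERIV_cong_ev[OF refl _ refl, THEN iffD1]) (rule DERIV_const)
    then show ?thesis by (rule DERIV_imp_deriv)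
  qed
  moreover have "deriv X s = 0" if "2 < \<bar>s\<bar>" for s
  proof -
    have "eventually (\<lambda>y. y \<in> {y. 2 < \<bar>y\<bar>}) (nhds s)"
      using that by (intro eventually_nhds_in_open) (auto intro!: open_Collect_less continuous_intros)
    then have "eventually (\<lambda>y. 0 = X y) (nhds s)"
      by (rule eventually_mono) (auto intro!: X2)
    then have "(X has_real_derivative 0) (at s)"
      by (rule DERIV_cong_ev[OF refl _ refl, THEN iffD1]) (rule DERIV_const)
    then show ?thesis by (rule DERIV_imp_deriv)
  qed
  moreover have "0 \<le> X s" "X s \<le> 1" for s
    using nn[of s] pos[of s] by (auto simp: X_def field_simps)
  ultimately show thesis using that[of X "deriv X"] kX kX' der X1 X2 by blast
qed

section \<open>Integration over a period strip\<close>

text \<open>Identifies the plane with a product of two real lines, so that Fubini and Tonelli become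
  available in the coordinates \<open>Re\<close> and \<open>Im\<close>.\<close>

lemma lborel_complex:
  "(lborel :: complex measure) = distr (lborel \<Otimes>\<^sub>M lborel) borel (\<lambda>p. Complex (fst p) (snd p))"
proof (rule lborel_eqI)
  have m: "(\<lambda>p. Complex (fst p) (snd p)) \<in> borel_measurable (lborel \<Otimes>\<^sub>M lborel)"
    unfolding lborel_prod Complex_eq by (simp, intro borel_measurable_continuous_onI continuous_intros)
  fix l u :: complex
  assume "\<And>b. b \<in> Basis \<Longrightarrow> l \<bullet> b \<le> u \<bullet> b"
  from this[of 1] this[of \<i>] have lu: "Re l \<le> Re u" "Im l \<le> Im u" by auto
  have "(\<lambda>p. Complex (fst p) (snd p)) -` box l u \<inter> space (lborel \<Otimes>\<^sub>M lborel)
      = {Re l<..<Re u} \<times> {Im l<..<Im u}"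
    by (auto simp: box_def Basis_complex_def space_pair_measure)
  then show "emeasure (distr (lborel \<Otimes>\<^sub>M lborel) borel (\<lambda>p. Complex (fst p) (snd p))) (box l u)
      = ennreal (\<Prod>b\<in>Basis. (u - l) \<bullet> b)"
    using lu by (subst emeasure_distr[OF m])
      (auto simp: lborel.emeasure_pair_measure_Times Basis_complex_def ennreal_mult)
qed simp

lemma measurable_Complex [measurable (raw)]:
  "f \<in> borel_measurable M \<Longrightarrow> g \<in> borel_measurable M \<Longrightarrow> (\<lambda>x. Complex (f x) (g x)) \<in> borel_measurable M"
proof -
  assume f: "f \<in> borel_measurable M" "g \<in> borel_measurable M"
  have "(\<lambda>p. Complex (fst p) (snd p)) \<in> borel_measurable (borel \<Otimes>\<^sub>M borel)"
    unfolding borel_prod Complex_eq by (intro borel_measurable_continuous_onI continuous_intros)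
  from measurable_compose[OF measurable_Pair[OF f] this] show ?thesis by simp
qed

lemma nn_integral_complex:
  assumes [measurable]: "f \<in> borel_measurable borel"
  shows "(\<integral>\<^sup>+z. f z \<partial>lborel) = (\<integral>\<^sup>+x. \<integral>\<^sup>+y. f (Complex x y) \<partial>lborel \<partial>lborel)"
  by (subst lborel_complex) (simp add: nn_integral_distr flip: lborel.nn_integral_fst)

lemma integral_complex:
  fixes f :: "complex \<Rightarrow> 'b::{banach, second_countable_topology}"
  assumes f: "integrable lborel f"
  shows "(\<integral>z. f z \<partial>lborel) = (\<integral>x. \<integral>y. f (Complex x y) \<partial>lborel \<partial>lborel)"
    and "(\<integral>z. f z \<partial>lborel) = (\<integral>y. \<integral>x. f (Complex x y) \<partial>lborel \<partial>lborel)"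
proof -
  have [measurable]: "f \<in> borel_measurable borel" using f by auto
  have i: "integrable (lborel \<Otimes>\<^sub>M lborel) (\<lambda>(x, y). f (Complex x y))"
    using f by (subst (asm) lborel_complex) (simp add: integrable_distr_eq case_prod_beta')
  show 1: "(\<integral>z. f z \<partial>lborel) = (\<integral>x. \<integral>y. f (Complex x y) \<partial>lborel \<partial>lborel)"
    using lborel_pair.integral_fst'[OF i]
    by (subst lborel_complex) (simp add: integral_distr case_prod_beta')
  show "(\<integral>z. f z \<partial>lborel) = (\<integral>y. \<integral>x. f (Complex x y) \<partial>lborel \<partial>lborel)"
    unfolding 1 by (rule lborel_pair.Fubini_integral[OF i, symmetric])
qed

lemma strip_borel [measurable]: "strip \<in> sets borel"
  unfolding strip_def by measurable

lemma set_integrable_strip_continuous: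
  fixes f :: "complex \<Rightarrow> 'b::{banach, second_countable_topology}"
  assumes "continuous_on UNIV f" "\<And>z. R < \<bar>Im z\<bar> \<Longrightarrow> f z = 0"
  shows "set_integrable lborel strip f"
proof -
  let ?B = "cbox (Complex (-pi) (-R)) (Complex pi R)"
  have "set_integrable lborel ?B f" unfolding set_integrable_def
    by (rule borel_integrable_compact) (use assms in \<open>auto intro: continuous_on_subset\<close>)
  then have "set_integrable lborel (strip \<inter> ?B) f"
    by (rule set_integrable_subset) auto
  moreover have "indicator (strip \<inter> ?B) z *\<^sub>R f z = indicator strip z *\<^sub>R f z" for z
    using assms(2)[of z] by (cases "R < \<bar>Im z\<bar>") (auto simp: strip_def cbox_def Basis_complex_def indicator_def)
  ultimately show ?thesis by (simp add: set_integrable_def)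
qed

lemma LBINT_open_interval_eq:
  fixes f :: "real \<Rightarrow> 'b::{banach, second_countable_topology}"
  assumes "f \<in> borel_measurable borel"
  shows "(\<integral>x. indicator {a<..<b} x *\<^sub>R f x \<partial>lborel) = (\<integral>x. indicator {a..b} x *\<^sub>R f x \<partial>lborel)"
proof (rule integral_cong_AE)
  have "AE x in lborel. x \<noteq> a \<and> x \<noteq> b"
    by (intro AE_conjI AE_lborel_singleton)
  then show "AE x in lborel. indicator {a<..<b} x *\<^sub>R f x = indicator {a..b} x *\<^sub>R f x"
    by eventually_elim (auto simp: indicator_def)
qed (use assms in measurable)

text \<open>The region beyond height \<open>R\<close> is open, so around each of its points
  \<open>g\<close> agrees with a constant.\<close>

lemma partials_vanish:
  fixes g gx gy :: "complex \<Rightarrow> 'b::real_normed_vector"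
  assumes g: "\<And>z. (g has_derivative (\<lambda>v. Re v *\<^sub>R gx z + Im v *\<^sub>R gy z)) (at z)"
    and supp: "\<And>z. R < \<bar>Im z\<bar> \<Longrightarrow> g z = 0" and z: "R < \<bar>Im z\<bar>"
  shows "gx z = 0" "gy z = 0"
proof -
  have "((\<lambda>_. 0) has_derivative (\<lambda>v. 0)) (at z)" by simp
  then have "(g has_derivative (\<lambda>v. 0)) (at z)"
    by (rule has_derivative_transform_within_open[where s = "{w. R < \<bar>Im w\<bar>}"])
      (use z supp in \<open>auto intro!: open_Collect_less continuous_intros\<close>)
  from has_derivative_unique[OF this g]
  have "(\<lambda>v. 0) = (\<lambda>v. Re v *\<^sub>R gx z + Im v *\<^sub>R gy z)" .
  from fun_cong[OF this, of 1] fun_cong[OF this, of \<i>] show "gx z = 0" "gy z = 0" by auto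
qed

text \<open>Fubini in both orders: a horizontal derivative integrates to \<open>0\<close> over each
  row by periodicity, a vertical one over each column by compact support.\<close>

lemma strip_divergence_theorem:
  fixes g gx gy :: "complex \<Rightarrow> complex"
  assumes g: "\<And>z. (g has_derivative (\<lambda>v. Re v *\<^sub>R gx z + Im v *\<^sub>R gy z)) (at z)"
    and gx: "continuous_on UNIV gx" and gy: "continuous_on UNIV gy"
    and per: "x_periodic g" and supp: "\<And>z. R < \<bar>Im z\<bar> \<Longrightarrow> g z = 0"
  shows "(LINT z:strip|lborel. gx z) = 0" "(LINT z:strip|lborel. gy z) = 0"
    "set_integrable lborel strip gx" "set_integrable lborel strip gy"
proof -
  note z0 = partials_vanish[OF g supp]
  show si: "set_integrable lborel strip gx" "set_integrable lborel strip gy"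
    using set_integrable_strip_continuous gx gy z0 by blast+
  have cC: "continuous_on S (\<lambda>x. Complex x y)" "continuous_on S (\<lambda>y. Complex x y)" for S x y
    unfolding Complex_eq by (intro continuous_intros)+
  have dx: "((\<lambda>x. g (Complex x y)) has_vector_derivative gx (Complex x y)) (at x within S)" for x y S
  proof -
    have "((\<lambda>x. Complex x y) has_derivative (\<lambda>v. of_real v)) (at x within S)"
      unfolding Complex_eq by (auto intro!: derivative_eq_intros)
    from has_derivative_compose[OF this g] show ?thesis by (simp add: has_vector_derivative_def)
  qed
  have dy: "((\<lambda>y. g (Complex x y)) has_vector_derivative gy (Complex x y)) (at y within S)" for x y S
  proof -
    have "((\<lambda>y. Complex x y) has_derivative (\<lambda>v. \<i> * of_real v)) (at y within S)"
      unfolding Complex_eq by (auto intro!: derivative_eq_intros)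
    from has_derivative_compose[OF this g] show ?thesis by (simp add: has_vector_derivative_def)
  qed
  have innerx: "(\<integral>x. indicator {-pi<..<pi} x *\<^sub>R gx (Complex x y) \<partial>lborel) = 0" for y
  proof -
    have "(\<integral>x. indicator {-pi<..<pi} x *\<^sub>R gx (Complex x y) \<partial>lborel)
        = (\<integral>x. indicator {-pi..pi} x *\<^sub>R gx (Complex x y) \<partial>lborel)"
      by (intro LBINT_open_interval_eq borel_measurable_continuous_onI continuous_on_compose2[OF gx] cC) auto
    also have "\<dots> = g (Complex pi y) - g (Complex (-pi) y)"
      by (intro integral_FTC_atLeastAtMost dx continuous_on_compose2[OF gx] cC) auto
    also have "\<dots> = 0" using per[unfolded x_periodic_def, rule_format, of "Complex (-pi) y"]
      by (simp add: Complex_eq algebra_simps)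
    finally show ?thesis .
  qed
  have "(LINT z:strip|lborel. gx z) = (\<integral>y. \<integral>x. indicator {-pi<..<pi} x *\<^sub>R gx (Complex x y) \<partial>lborel \<partial>lborel)"
    using integral_complex(2)[OF si(1)[unfolded set_integrable_def]]
    by (simp add: set_lebesgue_integral_def strip_def indicator_def)
  then show "(LINT z:strip|lborel. gx z) = 0" by (simp only: innerx integral_zero)
  have innery: "(\<integral>y. indicator {-pi<..<pi} x *\<^sub>R gy (Complex x y) \<partial>lborel) = 0" for x
  proof -
    \<comment> \<open>\<open>R\<close> may be negative, and the support condition speaks only of
      heights strictly beyond \<open>R\<close>.\<close>
    define S where "S = \<bar>R\<bar> + 1"
    have "(\<integral>y. indicator {-pi<..<pi} x *\<^sub>R gy (Complex x y) \<partial>lborel)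
        = indicator {-pi<..<pi} x *\<^sub>R (\<integral>y. gy (Complex x y) \<partial>lborel)" by simp
    also have "(\<integral>y. gy (Complex x y) \<partial>lborel) = (\<integral>y. indicator {-S..S} y *\<^sub>R gy (Complex x y) \<partial>lborel)"
      by (rule Bochner_Integration.integral_cong) (auto simp: indicator_def S_def intro!: z0)
    also have "\<dots> = g (Complex x S) - g (Complex x (-S))"
      by (intro integral_FTC_atLeastAtMost dy continuous_on_compose2[OF gy] cC) (auto simp: S_def)
    also have "\<dots> = 0" using supp by (simp add: S_def)
    finally show ?thesis by simp
  qed
  have "(LINT z:strip|lborel. gy z) = (\<integral>x. \<integral>y. indicator {-pi<..<pi} x *\<^sub>R gy (Complex x y) \<partial>lborel \<partial>lborel)"
    using integral_complex(1)[OF si(2)[unfolded set_integrable_def]]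
    by (simp add: set_lebesgue_integral_def strip_def indicator_def)
  then show "(LINT z:strip|lborel. gy z) = 0" by (simp only: innery integral_zero)
qed

section \<open>The regularized cotangent kernel\<close>

text \<open>This is twice the squared modulus of \<open>sin (w / 2)\<close>, a smooth periodic
  substitute for half the squared distance of \<open>w\<close> from the multiples of
  \<open>2 * pi\<close>.\<close>

definition denom :: "complex \<Rightarrow> real" where
  "denom w = cosh (Im w) - cos (Re w)"

text \<open>
  The vortex blob kernel: \<open>blob 0 w = cot (w / 2)\<close>, and for \<open>e > 0\<close> the conjugate of \<open>blob e\<close> is the
  gradient of \<open>ln (denom w + e)\<close>.
\<close>

definition blob :: "real \<Rightarrow> complex \<Rightarrow> complex" where
  "blob e w = Complex (sin (Re w)) (- sinh (Im w)) / of_real (denom w + e)"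

lemma denom_nonneg: "0 \<le> denom w"
  unfolding denom_def using cos_le_one[of "Re w"] cosh_real_ge_1[of "Im w"] by linarith

lemma continuous_on_denom [continuous_intros]:
  fixes f :: "'a::t2_space \<Rightarrow> complex"
  shows "continuous_on S f \<Longrightarrow> continuous_on S (\<lambda>x. denom (f x))"
  unfolding denom_def by (intro continuous_intros)

lemma denom_measurable [measurable]: "denom \<in> borel_measurable borel"
  by (intro borel_measurable_continuous_onI continuous_intros)

lemma cot_half: "cot (w / 2) = blob 0 w"
proof -
  define A where "A = w / 2"
  have s: "A + cnj A = of_real (Re w)" "A - cnj A = \<i> * of_real (Im w)"
    by (auto simp: A_def complex_eq_iff)
  have S: "sin (\<i> * of_real y) = \<i> * of_real (sinh y)" "cos (\<i> * of_real y) = of_real (cosh y)" for y :: real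
    using sinh_conv_sin[of "of_real y"] cosh_conv_cos[of "of_real y"]
    by (auto simp: complex_eq_iff sinh_field_def cosh_field_def simp flip: exp_of_real)
  have "cos A * sin (cnj A) = (of_real (sin (Re w)) - \<i> * of_real (sinh (Im w))) / 2"
    unfolding cos_times_sin s by (simp add: S flip: sin_of_real)
  then have 1: "cos A * cnj (sin A) = Complex (sin (Re w)) (- sinh (Im w)) / 2"
    by (simp add: cnj_sin Complex_eq)
  have "sin A * sin (cnj A) = (of_real (cosh (Im w)) - of_real (cos (Re w))) / 2"
    unfolding sin_times_sin s by (simp add: S flip: cos_of_real)
  then have 2: "sin A * cnj (sin A) = of_real (denom w) / 2"
    by (simp add: cnj_sin denom_def)
  show ?thesis
  proof (cases "sin A = 0")
    \<comment> \<open>At a pole both sides are \<open>0\<close>, by the convention on division by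
      \<open>0\<close>.\<close>
    case True
    then show ?thesis using 1 2 by (simp add: blob_def cot_def A_def)
  next
    case False
    then have "cot A = (cos A * cnj (sin A)) / (sin A * cnj (sin A))" by (simp add: cot_def)
    then show ?thesis unfolding 1 2 by (simp add: blob_def A_def)
  qed
qed

lemma blob_minus: "blob e (- w) = - blob e w"
  by (simp add: blob_def denom_def complex_eq_iff)

lemma blob_add_2pi: "blob e (w + of_real (2 * pi)) = blob e w" "denom (w + of_real (2 * pi)) = denom w"
  using cos_periodic[of "Re w"] sin_periodic[of "Re w"] by (simp_all add: blob_def denom_def)

text \<open>The sum of the squares of sine and hyperbolic sine is a difference of squares of
  \<open>cosh\<close> and \<open>cos\<close>, with \<open>denom w\<close> as a factor. So the
  numerator carries half a power of \<open>denom\<close>, and the kernel is only as singular as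
  \<open>denom\<close> to the power \<open>- (1/2)\<close>.\<close>

lemma norm_blob_numerator:
  "(norm (Complex (sin (Re w)) (- sinh (Im w))))\<^sup>2 = denom w * (cosh (Im w) + cos (Re w))"
proof -
  have "(norm (Complex (sin (Re w)) (- sinh (Im w))))\<^sup>2 = (sin (Re w))\<^sup>2 + (sinh (Im w))\<^sup>2"
    by (simp add: cmod_def)
  also have "\<dots> = (cosh (Im w))\<^sup>2 - (cos (Re w))\<^sup>2"
    using sin_squared_eq[of "Re w"] cosh_square_eq[of "Im w"] by simp
  finally show ?thesis by (simp add: denom_def power2_eq_square algebra_simps)
qed

lemma norm_blob_numerator_le:
  "norm (Complex (sin (Re w)) (- sinh (Im w))) \<le> sqrt (denom w) * sqrt (2 * cosh (Im w))"
proof -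
  have "cosh (Im w) + cos (Re w) \<le> 2 * cosh (Im w)"
    using cos_le_one[of "Re w"] cosh_real_ge_1[of "Im w"] by linarith
  then have "(norm (Complex (sin (Re w)) (- sinh (Im w))))\<^sup>2 \<le> denom w * (2 * cosh (Im w))"
    unfolding norm_blob_numerator by (rule mult_left_mono[OF _ denom_nonneg])
  from real_le_rsqrt[OF this] show ?thesis by (simp add: real_sqrt_mult)
qed

text \<open>The first bound is uniform in \<open>e\<close> and serves for dominated convergence. The
  last one keeps \<open>e\<close> under the root; negative powers of \<open>e\<close> are extracted
  from it.\<close>

lemma norm_blob_le:
  assumes "0 \<le> e"
  shows "norm (blob e w) \<le> sqrt (2 * cosh (Im w)) * (1 / sqrt (denom w))"
    and "norm (blob e w) \<le> norm (blob 0 w)"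
    and "norm (blob e w) \<le> sqrt (2 * cosh (Im w)) * (1 / sqrt (denom w + e))"
proof -
  note D = denom_nonneg[of w]
  have n: "norm (blob e w) = norm (Complex (sin (Re w)) (- sinh (Im w))) / (denom w + e)"
    if "0 \<le> e" for e
    using D that by (simp add: blob_def norm_divide del: of_real_add)
  have z: "norm (Complex (sin (Re w)) (- sinh (Im w))) = 0" if "denom w = 0"
    using norm_blob_numerator_le[of w] that by simp
  show "norm (blob e w) \<le> norm (blob 0 w)"
  proof (cases "denom w = 0")
    case True
    then show ?thesis using z n[of e] assms by simp
  next
    case False
    then show ?thesis unfolding n[OF assms] n[OF order.refl] using D assms by (intro divide_left_mono) auto
  qed
  have 3: "norm (blob e w) \<le> sqrt (2 * cosh (Im w)) * (1 / sqrt (denom w + e))" if "0 \<le> e" for e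
  proof -
    have ab: "a * b / (a * a) = b * (1 / a)" for a b :: real by (cases "a = 0") auto
    have "norm (blob e w) \<le> sqrt (denom w + e) * sqrt (2 * cosh (Im w)) / (denom w + e)"
      unfolding n[OF that] using D that
      by (intro divide_right_mono order_trans[OF norm_blob_numerator_le] mult_right_mono) auto
    also have "\<dots> = sqrt (2 * cosh (Im w)) * (1 / sqrt (denom w + e))"
      using that D ab[of "sqrt (denom w + e)"] by simp
    finally show ?thesis .
  qed
  show "norm (blob e w) \<le> sqrt (2 * cosh (Im w)) * (1 / sqrt (denom w + e))"
    by (rule 3[OF assms])
  show "norm (blob e w) \<le> sqrt (2 * cosh (Im w)) * (1 / sqrt (denom w))"
    using \<open>norm (blob e w) \<le> norm (blob 0 w)\<close> 3[of 0] by simp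
qed

lemma blob_has_derivative:
  assumes "0 < e"
  shows "(blob e has_derivative (\<lambda>v.
      Re v *\<^sub>R (of_real (cos (Re w) / (denom w + e)) - of_real (sin (Re w) / (denom w + e)) * blob e w)
    + Im v *\<^sub>R (- \<i> * of_real (cosh (Im w) / (denom w + e)) - of_real (sinh (Im w) / (denom w + e)) * blob e w)))
    (at w)"
proof -
  have p: "denom w + e > 0" for w using denom_nonneg[of w] assms by linarith
  have b: "blob e = (\<lambda>w. (of_real (sin (Re w)) - \<i> * of_real (sinh (Im w))) * of_real (inverse (denom w + e)))"
    by (auto simp: blob_def fun_eq_iff Complex_eq divide_inverse simp del: of_real_add)
  have d: "((\<lambda>w. sinh (Im w)) has_derivative (\<lambda>v. Im v * cosh (Im w))) (at w)"
    "((\<lambda>w. cosh (Im w)) has_derivative (\<lambda>v. Im v * sinh (Im w))) (at w)"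
    "((\<lambda>w. sin (Re w)) has_derivative (\<lambda>v. Re v * cos (Re w))) (at w)"
    "((\<lambda>w. cos (Re w)) has_derivative (\<lambda>v. Re v * - sin (Re w))) (at w)"
    by (rule DERIV_compose_FDERIV; auto intro!: derivative_eq_intros)+
  have D: "((\<lambda>w. inverse (denom w + e)) has_derivative
      (\<lambda>v. - (inverse (denom w + e) * (Im v * sinh (Im w) + Re v * sin (Re w)) * inverse (denom w + e)))) (at w)"
    using p[of w] unfolding denom_def by (auto intro!: derivative_eq_intros d)
  have N: "((\<lambda>w. of_real (sin (Re w)) - \<i> * of_real (sinh (Im w))) has_derivative
      (\<lambda>v. of_real (Re v * cos (Re w)) - \<i> * of_real (Im v * cosh (Im w)))) (at w)"
    by (intro has_derivative_diff has_derivative_mult_right has_derivative_of_real d)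
  show ?thesis unfolding b
    by (rule has_derivative_eq_rhs[OF has_derivative_mult[OF N has_derivative_of_real[OF D]]])
      (simp add: fun_eq_iff scaleR_conv_of_real divide_inverse algebra_simps)
qed

lemma blob_cont: "0 < e \<Longrightarrow> continuous_on A f \<Longrightarrow> continuous_on A (\<lambda>x. blob e (f x))" for f :: "'c::t2_space \<Rightarrow> complex"
proof -
  assume e: "0 < e" and f: "continuous_on A f"
  have "continuous_on UNIV (blob e)"
    using has_derivative_continuous[OF blob_has_derivative[OF e]] by (auto intro: continuous_at_imp_continuous_on)
  from continuous_on_compose2[OF this f] show ?thesis by auto
qed

text \<open>The subtraction theorem of the cotangent, solved for the product. For \<open>A\<close>
  and \<open>B\<close> with a fixed difference, a product of two kernels becomes linear in the
  single kernels.\<close>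

lemma cot_mult_cot:
  fixes A B :: complex
  assumes "sin A \<noteq> 0" "sin B \<noteq> 0" "sin (A - B) \<noteq> 0"
  shows "cot A * cot B = cot (A - B) * (cot B - cot A) - 1"
proof -
  have "cot B - cot A = sin (A - B) / (sin A * sin B)"
    using assms by (simp add: cot_def sin_diff field_simps)
  then have "cot (A - B) * (cot B - cot A) = cos (A - B) / (sin A * sin B)"
    using assms by (simp add: cot_def)
  also have "\<dots> = cot A * cot B + 1"
    using assms by (simp add: cot_def cos_diff field_simps)
  finally show ?thesis by simp
qed

text \<open>Jordan's inequality: a concave function lies above its chord, here over
  \<open>[0, pi / 2]\<close>.\<close>

lemma sin_ge_linear:
  assumes "0 \<le> s" "s \<le> pi / 2"
  shows "2 * s / pi \<le> sin s"
proof -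
  have "concave_on {0..pi} sin"
    by (rule f''_le0_imp_concave[where f' = cos and f'' = "\<lambda>x. - sin x"])
      (auto intro!: derivative_eq_intros sin_ge_zero)
  then have "(1 - 2 * s / pi) * sin 0 + (2 * s / pi) * sin (pi / 2) \<le> sin ((1 - 2 * s / pi) *\<^sub>R 0 + (2 * s / pi) *\<^sub>R (pi / 2))"
    by (rule concave_onD) (use assms in \<open>auto simp: field_simps\<close>)
  then show ?thesis by simp
qed

lemma one_minus_cos_ge:
  assumes "\<bar>x\<bar> \<le> pi"
  shows "2 * x\<^sup>2 / pi\<^sup>2 \<le> 1 - cos x"
proof -
  have "\<bar>x\<bar> / pi \<le> sin (\<bar>x\<bar> / 2)" using sin_ge_linear[of "\<bar>x\<bar> / 2"] assms by simp
  then have "(\<bar>x\<bar> / pi)\<^sup>2 \<le> (sin (\<bar>x\<bar> / 2))\<^sup>2" by (intro power_mono) auto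
  moreover have "1 - cos x = 2 * (sin (\<bar>x\<bar> / 2))\<^sup>2"
    using cos_double_sin[of "\<bar>x\<bar> / 2"] by simp
  ultimately show ?thesis by (simp add: power_divide)
qed

lemma cosh_minus_one_ge: "y\<^sup>2 / 4 \<le> cosh y - 1" for y :: real
proof -
  have "y\<^sup>2 / 4 \<le> cosh y - 1" if "0 \<le> y" for y :: real
  proof -
    have "2 + y\<^sup>2 / 2 \<le> exp y + exp (- y)"
      using exp_lower_Taylor_quadratic[OF that] exp_ge_add_one_self[of "- y"] by linarith
    then show ?thesis by (simp add: cosh_field_def field_simps)
  qed
  from this[of "\<bar>y\<bar>"] show ?thesis by simp
qed

text \<open>\<open>denom\<close> is controlled from below by the distance to the nearest multiple of
  \<open>2 * pi\<close>. Real parts from one closed period differ by at most \<open>2 * pi\<close>,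
  so three candidates for this multiple suffice.\<close>

lemma denom_ge:
  assumes "\<bar>Re w\<bar> \<le> 2 * pi"
  obtains k where "k \<in> {0, 2 * pi, - (2 * pi)}" "\<bar>Re w - k\<bar> \<le> pi"
    "(2 / pi\<^sup>2) * ((Re w - k)\<^sup>2 + (Im w)\<^sup>2) \<le> denom w"
proof -
  define k where "k = (if \<bar>Re w\<bar> \<le> pi then 0 else if 0 < Re w then 2 * pi else - (2 * pi))"
  have k: "k \<in> {0, 2 * pi, - (2 * pi)}" "\<bar>Re w - k\<bar> \<le> pi"
    using assms by (auto simp: k_def)
  have "cos (Re w) = cos (Re w - k)"
    using k(1) cos_periodic[of "Re w"] cos_periodic[of "Re w - 2 * pi"] by auto
  moreover have "2 / pi\<^sup>2 * (Im w)\<^sup>2 \<le> cosh (Im w) - 1"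
  proof -
    have "(3::real)\<^sup>2 \<le> pi\<^sup>2" using pi_gt3 by (intro power_mono) auto
    then have "2 / pi\<^sup>2 \<le> 1 / (4::real)" by (simp add: field_simps)
    then have "2 / pi\<^sup>2 * (Im w)\<^sup>2 \<le> 1 / 4 * (Im w)\<^sup>2" by (rule mult_right_mono) simp
    then show ?thesis using cosh_minus_one_ge[of "Im w"] by linarith
  qed
  ultimately have "(2 / pi\<^sup>2) * ((Re w - k)\<^sup>2 + (Im w)\<^sup>2) \<le> denom w"
    using one_minus_cos_ge[OF k(2)] by (simp add: denom_def distrib_left)
  with k show thesis by (rule that)
qed

section \<open>Bounds for the singular kernel\<close>

text \<open>The value \<open>\<infinity>\<close> at the singularity lets the bounds below hold without exceptional points.\<close>

definition sing :: "real \<Rightarrow> real \<Rightarrow> ennreal" where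
  "sing \<theta> s = (if s = 0 then if \<theta> = 0 then 1 else \<infinity> else ennreal (\<bar>s\<bar> powr - \<theta>))"

text \<open>The three shifts are the multiples of \<open>2 * pi\<close> between which
  \<open>denom_ge\<close> chooses; adding them up avoids a case distinction under the
  integral.\<close>

definition sing_periodic :: "real \<Rightarrow> real \<Rightarrow> ennreal" where
  "sing_periodic \<theta> s = sing \<theta> s + sing \<theta> (s - 2 * pi) + sing \<theta> (s + 2 * pi)"

lemma sing_measurable [measurable]: "sing \<theta> \<in> borel_measurable borel"
  unfolding sing_def by measurable

lemma sing_periodic_measurable [measurable]: "sing_periodic \<theta> \<in> borel_measurable borel"
  unfolding sing_periodic_def by measurable

lemma sing_pos: "0 < sing \<theta> s"
  by (auto simp: sing_def)

text \<open>A distance dominates both of its coordinates, so a negative power of it splits into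
  one-dimensional powers. With exponent \<open>0\<close> the factor \<open>sing 0\<close> is
  constantly \<open>1\<close> and that coordinate drops out. The constant \<open>6\<close> bounds a
  power of \<open>pi^2 / 2\<close> with exponent at most \<open>1\<close>, by way of
  \<open>pi^2 \<le> 12\<close>.\<close>

lemma denom_powr_le:
  assumes w: "\<bar>Re w\<bar> \<le> 2 * pi" and ab: "0 \<le> a" "0 \<le> b" "a + b \<le> 2" "0 < a + b"
  shows "ennreal (denom w powr - ((a + b) / 2)) \<le> 6 * (sing_periodic a (Re w) * sing b (Im w))"
proof -
  from denom_ge[OF w] obtain k where k: "k \<in> {0, 2 * pi, - (2 * pi)}"
    and D: "(2 / pi\<^sup>2) * ((Re w - k)\<^sup>2 + (Im w)\<^sup>2) \<le> denom w" by blast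
  have "ennreal (denom w powr - ((a + b) / 2)) \<le> 6 * (sing a (Re w - k) * sing b (Im w))"
  proof (cases "(Re w - k = 0 \<and> a \<noteq> 0) \<or> (Im w = 0 \<and> b \<noteq> 0)")
    case True
    have "sing a (Re w - k) * sing b (Im w) = \<infinity>"
      using True sing_pos[of a "Re w - k"] sing_pos[of b "Im w"]
      by (auto simp: sing_def ennreal_top_mult ennreal_mult_top)
    then show ?thesis by (simp add: ennreal_mult_top)
  next
    case False
    define r where "r = sqrt ((Re w - k)\<^sup>2 + (Im w)\<^sup>2)"
    have r: "r > 0" using False ab by (auto simp: r_def sum_power2_gt_zero_iff)
    have rr: "(2 / pi\<^sup>2) * r\<^sup>2 \<le> denom w" using D by (simp add: r_def)
    have "denom w powr - ((a + b) / 2) \<le> ((2 / pi\<^sup>2) * r\<^sup>2) powr - ((a + b) / 2)"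
      by (rule powr_mono2') (use rr r ab in auto)
    also have "\<dots> = (2 / pi\<^sup>2) powr - ((a + b) / 2) * r powr - (a + b)"
    proof -
      have e: "2 * - ((a + b) / 2) = - (a + b)" by (simp add: field_simps)
      have "r\<^sup>2 = r powr 2" using r by simp
      then have "(r\<^sup>2) powr - ((a + b) / 2) = r powr - (a + b)" by (simp only: powr_powr e)
      then show ?thesis by (subst powr_mult) simp_all
    qed
    also have "\<dots> \<le> 6 * r powr - (a + b)"
    proof (rule mult_right_mono)
      have "pi\<^sup>2 \<le> 12"
      proof -
        have "pi \<le> 31415926535899 / 10 ^ 13" using pi_approx by blast
        also have "\<dots> \<le> (3.2::real)" by simp
        finally have "pi \<le> 3.2" .
        then have "pi * pi \<le> 3.2 * 3.2" by (intro mult_mono) auto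
        then show ?thesis by (simp add: power2_eq_square)
      qed
      then have 6: "pi\<^sup>2 / 2 \<le> 6" by simp
      have 9: "(3::real)\<^sup>2 \<le> pi\<^sup>2" using pi_gt3 by (intro power_mono) auto
      have "(2 / pi\<^sup>2) powr - ((a + b) / 2) = (pi\<^sup>2 / 2) powr ((a + b) / 2)"
        using powr_minus[of "pi\<^sup>2 / 2" "(a + b) / 2"] by (simp add: powr_minus powr_divide)
      also have "\<dots> \<le> (pi\<^sup>2 / 2) powr 1"
        by (rule powr_mono) (use ab 9 in auto)
      also have "\<dots> \<le> 6" using 6 by simp
      finally show "(2 / pi\<^sup>2) powr - ((a + b) / 2) \<le> 6" .
    qed simp
    also have "r powr - (a + b) = r powr - a * r powr - b" using powr_add[of r "- a" "- b"] by simp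
    finally have 1: "ennreal (denom w powr - ((a + b) / 2)) \<le> 6 * (ennreal (r powr - a) * ennreal (r powr - b))"
      by (simp add: ennreal_mult'[symmetric] flip: ennreal_numeral)
    have s: "ennreal (r powr - t) \<le> sing t c" if "\<bar>c\<bar> \<le> r" "0 \<le> t" "\<not> (c = 0 \<and> t \<noteq> 0)" for c t
    proof (cases "c = 0")
      case True
      then show ?thesis using that r by (simp add: sing_def)
    next
      case False
      then show ?thesis using that r by (auto simp: sing_def intro!: ennreal_leI powr_mono2')
    qed
    have "ennreal (r powr - a) \<le> sing a (Re w - k)" "ennreal (r powr - b) \<le> sing b (Im w)"
    proof -
      have "\<bar>Re w - k\<bar> \<le> r" "\<bar>Im w\<bar> \<le> r"
        unfolding r_def by (rule real_le_rsqrt, simp)+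
      then show "ennreal (r powr - a) \<le> sing a (Re w - k)" "ennreal (r powr - b) \<le> sing b (Im w)"
        using s[of "Re w - k" a] s[of "Im w" b] False ab by auto
    qed
    then show ?thesis using 1 by (meson mult_left_mono mult_mono order_trans zero_le)
  qed
  also have "sing a (Re w - k) \<le> sing_periodic a (Re w)"
    using k by (auto simp: sing_periodic_def intro: add_increasing add_increasing2)
  finally show ?thesis by (simp add: mult_left_mono mult_right_mono)
qed

lemma nn_integral_sing_0:
  assumes "0 \<le> \<theta>" "\<theta> < 1" "0 \<le> A"
  shows "(\<integral>\<^sup>+s. indicator {-A..A} s * sing \<theta> s \<partial>lborel) < \<infinity>"
proof -
  define f where "f s = (if s \<in> {0..A} then s powr - \<theta> else 0)" for s
  have [measurable]: "f \<in> borel_measurable borel" unfolding f_def by measurable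
  have "(f has_integral A powr (-\<theta> + 1) / (-\<theta> + 1)) UNIV"
    unfolding f_def by (subst has_integral_restrict_UNIV) (rule has_integral_powr_from_0; use assms in simp)
  then have N: "(\<integral>\<^sup>+s. ennreal (f s) \<partial>lborel) = ennreal (A powr (-\<theta> + 1) / (-\<theta> + 1))"
    by (rule nn_integral_has_integral_lborel[rotated 2]) (auto simp: f_def)
  have "(\<integral>\<^sup>+s. indicator {-A..A} s * sing \<theta> s \<partial>lborel) \<le> (\<integral>\<^sup>+s. ennreal (f s) + ennreal (f (- s)) \<partial>lborel)"
  proof (rule nn_integral_mono_AE)
    show "AE s in lborel. indicator {-A..A} s * sing \<theta> s \<le> ennreal (f s) + ennreal (f (- s))"
      using AE_lborel_singleton[of "0::real"]
    proof eventually_elim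
      case (elim s)
      then show ?case by (cases "s > 0") (auto simp: sing_def f_def indicator_def)
    qed
  qed
  also have "\<dots> = (\<integral>\<^sup>+s. ennreal (f s) \<partial>lborel) + (\<integral>\<^sup>+s. ennreal (f (- s)) \<partial>lborel)"
    by (rule nn_integral_add) auto
  also have "(\<integral>\<^sup>+s. ennreal (f (- s)) \<partial>lborel) = (\<integral>\<^sup>+s. ennreal (f s) \<partial>lborel)"
    using nn_integral_real_affine[of "\<lambda>s. ennreal (f s)" "-1" 0] by simp
  finally show ?thesis using N by (simp add: less_top[symmetric] top_unique)
      (metis ennreal_add_eq_top ennreal_less_top neq_top_trans order_less_le)
qed

text \<open>Moving the centre to the origin at most doubles the interval, which makes the constant
  independent of \<open>c\<close>.\<close>

lemma nn_integral_sing: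
  assumes "0 \<le> \<theta>" "\<theta> < 1" "0 \<le> A"
  shows "\<exists>C\<ge>0. \<forall>c. \<bar>c\<bar> \<le> A \<longrightarrow> (\<integral>\<^sup>+s. indicator {-A..A} s * sing \<theta> (s - c) \<partial>lborel) \<le> ennreal C"
proof -
  from nn_integral_sing_0[OF assms(1,2), of "2 * A"] assms obtain C where C: "0 \<le> C"
    "(\<integral>\<^sup>+s. indicator {-(2*A)..2*A} s * sing \<theta> s \<partial>lborel) = ennreal C"
    by (cases "\<integral>\<^sup>+s. indicator {-(2*A)..2*A} s * sing \<theta> s \<partial>lborel" rule: ennreal_cases) auto
  show ?thesis
  proof (intro exI[of _ C] conjI allI impI)
    fix c assume c: "\<bar>c\<bar> \<le> A"
    have "(\<integral>\<^sup>+s. indicator {-A..A} s * sing \<theta> (s - c) \<partial>lborel)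
        = (\<integral>\<^sup>+s. indicator {-A..A} (c + s) * sing \<theta> s \<partial>lborel)"
      using nn_integral_real_affine[of "\<lambda>s. indicator {-A..A} s * sing \<theta> (s - c)" 1 c] by simp
    also have "\<dots> \<le> (\<integral>\<^sup>+s. indicator {-(2*A)..2*A} s * sing \<theta> s \<partial>lborel)"
      by (rule nn_integral_mono) (use c in \<open>auto simp: indicator_def\<close>)
    finally show "(\<integral>\<^sup>+s. indicator {-A..A} s * sing \<theta> (s - c) \<partial>lborel) \<le> ennreal C" using C by simp
  qed (use C in simp)
qed

lemma nn_integral_sing_periodic:
  assumes "0 \<le> \<theta>" "\<theta> < 1"
  shows "\<exists>C\<ge>0. \<forall>c. \<bar>c\<bar> \<le> pi \<longrightarrow>
    (\<integral>\<^sup>+s. indicator {-pi..pi} s * sing_periodic \<theta> (s - c) \<partial>lborel) \<le> ennreal C \<and>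
    (\<integral>\<^sup>+s. indicator {-pi..pi} s * sing_periodic \<theta> (c - s) \<partial>lborel) \<le> ennreal C"
proof -
  \<comment> \<open>A centre in \<open>[-pi, pi]\<close> shifted by \<open>2 * pi\<close> stays
    within \<open>3 * pi\<close>.\<close>
  obtain C where C: "0 \<le> C" "\<And>c. \<bar>c\<bar> \<le> 3 * pi \<Longrightarrow>
      (\<integral>\<^sup>+s. indicator {-(3*pi)..3*pi} s * sing \<theta> (s - c) \<partial>lborel) \<le> ennreal C"
    using nn_integral_sing[OF assms, of "3 * pi"] by auto
  have 1: "(\<integral>\<^sup>+s. indicator {-pi..pi} s * sing \<theta> (s - c) \<partial>lborel) \<le> ennreal C" if "\<bar>c\<bar> \<le> 3 * pi" for c
    by (rule order_trans[OF nn_integral_mono C(2)[OF that]]) (auto simp: indicator_def)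
  have 2: "(\<integral>\<^sup>+s. indicator {-pi..pi} s * sing_periodic \<theta> (s - c) \<partial>lborel) \<le> ennreal (3 * C)" if "\<bar>c\<bar> \<le> pi" for c
  proof -
    have "(\<integral>\<^sup>+s. indicator {-pi..pi} s * sing_periodic \<theta> (s - c) \<partial>lborel)
       = (\<integral>\<^sup>+s. indicator {-pi..pi} s * sing \<theta> (s - c) \<partial>lborel)
       + (\<integral>\<^sup>+s. indicator {-pi..pi} s * sing \<theta> (s - (c + 2 * pi)) \<partial>lborel)
       + (\<integral>\<^sup>+s. indicator {-pi..pi} s * sing \<theta> (s - (c - 2 * pi)) \<partial>lborel)"
      by (simp add: sing_periodic_def distrib_left nn_integral_add algebra_simps)
    also have "\<dots> \<le> ennreal C + ennreal C + ennreal C"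
      using that by (intro add_mono 1) auto
    also have "\<dots> = ennreal (3 * C)" using C by (simp flip: ennreal_plus)
    finally show ?thesis .
  qed
  have sym: "sing_periodic \<theta> (c - s) = sing_periodic \<theta> (s - c)" for c s
  proof -
    have "sing \<theta> (- x) = sing \<theta> x" for x by (simp add: sing_def)
    from this[of "s - c"] this[of "s - c - 2 * pi"] this[of "s - c + 2 * pi"]
    show ?thesis by (simp add: sing_periodic_def algebra_simps)
  qed
  show ?thesis by (rule exI[of _ "3 * C"]) (use 2 C in \<open>auto simp: sym\<close>)
qed

lemma ennreal_powr_mult: "ennreal (d powr a) * ennreal (d powr b) = ennreal (d powr (a + b))"
  by (simp add: ennreal_mult' powr_add)

text \<open>Closed in the horizontal direction, unlike \<open>strip\<close>, so that it contains the
  sheet points over both end points of a period.\<close>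

definition slab :: "real \<Rightarrow> complex set" where
  "slab R = {z. \<bar>Re z\<bar> \<le> pi \<and> \<bar>Im z\<bar> \<le> R}"

lemma slab_borel [measurable]: "slab R \<in> sets borel"
  unfolding slab_def by measurable

lemma indicator_slab: "(indicator (slab R) (Complex x y) :: 'a::semiring_1) = indicator {-pi..pi} x * indicator {-R..R} y"
  by (auto simp: slab_def indicator_def)

lemma nn_integral_slab_sing:
  assumes "0 \<le> \<theta>" "\<theta> < 1" "0 \<le> \<eta>" "\<eta> < 1" "0 \<le> R"
  shows "\<exists>C\<ge>0. \<forall>a\<in>slab R. (\<integral>\<^sup>+z. indicator (slab R) z * (sing_periodic \<theta> (Re (z - a)) * sing \<eta> (Im (z - a))) \<partial>lborel) \<le> ennreal C"
proof -
  obtain C1 where C1: "0 \<le> C1"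
    "\<And>c. \<bar>c\<bar> \<le> pi \<Longrightarrow> (\<integral>\<^sup>+s. indicator {-pi..pi} s * sing_periodic \<theta> (s - c) \<partial>lborel) \<le> ennreal C1"
    using nn_integral_sing_periodic[OF assms(1,2)] by blast
  obtain C2 where C2: "0 \<le> C2"
    "\<And>c. \<bar>c\<bar> \<le> R \<Longrightarrow> (\<integral>\<^sup>+s. indicator {-R..R} s * sing \<eta> (s - c) \<partial>lborel) \<le> ennreal C2"
    using nn_integral_sing[OF assms(3,4,5)] by blast
  show ?thesis
  proof (intro exI[of _ "C1 * C2"] conjI ballI)
    fix a assume a: "a \<in> slab R"
    have "(\<integral>\<^sup>+z. indicator (slab R) z * (sing_periodic \<theta> (Re (z - a)) * sing \<eta> (Im (z - a))) \<partial>lborel)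
      = (\<integral>\<^sup>+x. \<integral>\<^sup>+y. (indicator {-pi..pi} x * sing_periodic \<theta> (x - Re a)) * (indicator {-R..R} y * sing \<eta> (y - Im a)) \<partial>lborel \<partial>lborel)"
      by (subst nn_integral_complex) (auto simp: indicator_slab mult_ac)
    also have "\<dots> = (\<integral>\<^sup>+x. indicator {-pi..pi} x * sing_periodic \<theta> (x - Re a) \<partial>lborel)
        * (\<integral>\<^sup>+y. indicator {-R..R} y * sing \<eta> (y - Im a) \<partial>lborel)"
      by (simp add: nn_integral_cmult nn_integral_multc)
    also have "\<dots> \<le> ennreal C1 * ennreal C2"
      using a by (intro mult_mono C1 C2) (auto simp: slab_def)
    finally show "(\<integral>\<^sup>+z. indicator (slab R) z * (sing_periodic \<theta> (Re (z - a)) * sing \<eta> (Im (z - a))) \<partial>lborel) \<le> ennreal (C1 * C2)"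
      using C1 C2 by (simp add: ennreal_mult)
  qed (use C1 C2 in auto)
qed

text \<open>In terms of the distance the exponent is \<open>1\<close>, critical for a single
  coordinate. Divided as \<open>3/4 + 1/4\<close> it leaves two powers below \<open>1\<close>, each
  integrable along a line uniformly in the centre.\<close>

lemma denom_integrable:
  assumes "0 \<le> R"
  shows "\<exists>C\<ge>0. \<forall>a\<in>slab R. (\<integral>\<^sup>+z. indicator (slab R) z * ennreal (denom (z - a) powr - (1/2)) \<partial>lborel) \<le> ennreal C"
proof -
  obtain C where C: "0 \<le> C"
    "\<And>a. a \<in> slab R \<Longrightarrow> (\<integral>\<^sup>+z. indicator (slab R) z * (sing_periodic (3/4) (Re (z - a)) * sing (1/4) (Im (z - a))) \<partial>lborel) \<le> ennreal C"
    using nn_integral_slab_sing[of "3/4" "1/4" R] assms by auto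
  show ?thesis
  proof (intro exI[of _ "6 * C"] conjI ballI)
    fix a assume a: "a \<in> slab R"
    have "(\<integral>\<^sup>+z. indicator (slab R) z * ennreal (denom (z - a) powr - (1/2)) \<partial>lborel)
       \<le> (\<integral>\<^sup>+z. 6 * (indicator (slab R) z * (sing_periodic (3/4) (Re (z - a)) * sing (1/4) (Im (z - a)))) \<partial>lborel)"
      using a denom_powr_le[of "z - a" "3/4" "1/4" for z]
      by (intro nn_integral_mono) (auto simp: slab_def indicator_def)
    also have "\<dots> \<le> 6 * ennreal C"
      using C(2)[OF a] by (simp add: nn_integral_cmult mult_left_mono)
    finally show "(\<integral>\<^sup>+z. indicator (slab R) z * ennreal (denom (z - a) powr - (1/2)) \<partial>lborel) \<le> ennreal (6 * C)"
      using C by (simp add: ennreal_mult)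
  qed (use C in auto)
qed

text \<open>\<open>1 / denom\<close> just fails to be integrable in the plane, so the square cannot
  simply be moved under the sheet integral. Instead \<open>- (1/2)\<close> is written as
  \<open>- (3/16) - (5/16)\<close> and Cauchy-Schwarz is applied in the sheet parameter. The first
  factor squared has the power \<open>- (3/8)\<close> and is integrable along the sheet; the second
  one squared has the power \<open>- (5/8)\<close> and is integrable over the plane after an
  exchange of integrals.\<close>

lemma sheet_potential_square_integrable:
  fixes h :: "real \<Rightarrow> real"
  assumes [measurable]: "h \<in> borel_measurable borel" and h: "\<And>\<alpha>. \<bar>h \<alpha>\<bar> \<le> R"
  shows "(\<integral>\<^sup>+z. indicator (slab R) z *
      (\<integral>\<^sup>+\<alpha>. indicator {-pi..pi} \<alpha> * ennreal (denom (z - Complex \<alpha> (h \<alpha>)) powr - (1/2)) \<partial>lborel)\<^sup>2 \<partial>lborel) < \<infinity>"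
proof -
  have R: "0 \<le> R" using h[of 0] by linarith
  obtain C1 where C1: "0 \<le> C1"
    "\<And>c. \<bar>c\<bar> \<le> pi \<Longrightarrow> (\<integral>\<^sup>+s. indicator {-pi..pi} s * sing_periodic (3/4) (c - s) \<partial>lborel) \<le> ennreal C1"
    using nn_integral_sing_periodic[of "3/4"] by auto
  obtain C2 where C2: "0 \<le> C2"
    "\<And>a. a \<in> slab R \<Longrightarrow> (\<integral>\<^sup>+z. indicator (slab R) z * (sing_periodic (3/4) (Re (z - a)) * sing (1/2) (Im (z - a))) \<partial>lborel) \<le> ennreal C2"
    using nn_integral_slab_sing[of "3/4" "1/2" R] R by auto
  let ?D = "\<lambda>z \<alpha>. denom (z - Complex \<alpha> (h \<alpha>))"
  let ?I = "indicator {-pi..pi} :: real \<Rightarrow> ennreal"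
  have pt: "indicator (slab R) z * (\<integral>\<^sup>+\<alpha>. ?I \<alpha> * ennreal (?D z \<alpha> powr - (1/2)) \<partial>lborel)\<^sup>2
    \<le> 36 * ennreal C1 * (\<integral>\<^sup>+\<alpha>. ?I \<alpha> * (indicator (slab R) z *
        (sing_periodic (3/4) (Re (z - Complex \<alpha> (h \<alpha>))) * sing (1/2) (Im (z - Complex \<alpha> (h \<alpha>))))) \<partial>lborel)" for z
  proof (cases "z \<in> slab R")
    case True
    have "(\<integral>\<^sup>+\<alpha>. ?I \<alpha> * ennreal (?D z \<alpha> powr - (1/2)) \<partial>lborel)\<^sup>2
      = (\<integral>\<^sup>+\<alpha>. (?I \<alpha> * ennreal (?D z \<alpha> powr - (3/16))) * (?I \<alpha> * ennreal (?D z \<alpha> powr - (5/16))) \<partial>lborel)\<^sup>2"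
    proof -
      have "?I \<alpha> * ennreal (?D z \<alpha> powr - (1/2))
          = (?I \<alpha> * ennreal (?D z \<alpha> powr - (3/16))) * (?I \<alpha> * ennreal (?D z \<alpha> powr - (5/16)))" for \<alpha>
        using ennreal_powr_mult[of "?D z \<alpha>" "- (3/16)" "- (5/16)"] by (cases "\<alpha> \<in> {-pi..pi}") simp_all
      then show ?thesis by (simp only:)
    qed
    also have "\<dots> \<le> (\<integral>\<^sup>+\<alpha>. (?I \<alpha> * ennreal (?D z \<alpha> powr - (3/16)))\<^sup>2 \<partial>lborel)
        * (\<integral>\<^sup>+\<alpha>. (?I \<alpha> * ennreal (?D z \<alpha> powr - (5/16)))\<^sup>2 \<partial>lborel)"
      by (rule Cauchy_Schwarz_nn_integral) auto
    also have "\<dots> \<le> (6 * ennreal C1) * (6 * (\<integral>\<^sup>+\<alpha>. ?I \<alpha> *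
        (sing_periodic (3/4) (Re (z - Complex \<alpha> (h \<alpha>))) * sing (1/2) (Im (z - Complex \<alpha> (h \<alpha>)))) \<partial>lborel))"
    proof (rule mult_mono)
      have "(\<integral>\<^sup>+\<alpha>. (?I \<alpha> * ennreal (?D z \<alpha> powr - (3/16)))\<^sup>2 \<partial>lborel)
          \<le> (\<integral>\<^sup>+\<alpha>. 6 * (?I \<alpha> * sing_periodic (3/4) (Re z - \<alpha>)) \<partial>lborel)"
      proof (rule nn_integral_mono)
        fix \<alpha>
        show "(?I \<alpha> * ennreal (?D z \<alpha> powr - (3/16)))\<^sup>2 \<le> 6 * (?I \<alpha> * sing_periodic (3/4) (Re z - \<alpha>))"
        proof (cases "\<alpha> \<in> {-pi..pi}")
          case \<alpha>: True
          \<comment> \<open>The vertical exponent is \<open>0\<close>, so that the bound along the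
            sheet does not depend on its shape.\<close>
          have D: "ennreal (?D z \<alpha> powr - ((3/4 + 0) / 2)) \<le> 6 * (sing_periodic (3/4) (Re (z - Complex \<alpha> (h \<alpha>))) * sing 0 (Im (z - Complex \<alpha> (h \<alpha>))))"
            using True \<alpha> by (intro denom_powr_le) (auto simp: slab_def)
          have "(ennreal (?D z \<alpha> powr - (3/16)))\<^sup>2 = ennreal (?D z \<alpha> powr - (3/8))"
            by (simp only: power2_eq_square ennreal_powr_mult) simp
          moreover have "sing 0 s = 1" for s by (simp add: sing_def)
          ultimately show ?thesis using D \<alpha> by simp
        qed auto
      qed
      also have "\<dots> \<le> 6 * ennreal C1"
        using C1(2)[of "Re z"] True by (simp add: nn_integral_cmult mult_left_mono slab_def)
      finally show "(\<integral>\<^sup>+\<alpha>. (?I \<alpha> * ennreal (?D z \<alpha> powr - (3/16)))\<^sup>2 \<partial>lborel) \<le> 6 * ennreal C1" .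
      have "(\<integral>\<^sup>+\<alpha>. (?I \<alpha> * ennreal (?D z \<alpha> powr - (5/16)))\<^sup>2 \<partial>lborel) \<le> (\<integral>\<^sup>+\<alpha>. 6 * (?I \<alpha> *
        (sing_periodic (3/4) (Re (z - Complex \<alpha> (h \<alpha>))) * sing (1/2) (Im (z - Complex \<alpha> (h \<alpha>))))) \<partial>lborel)"
      proof (rule nn_integral_mono)
        fix \<alpha>
        show "(?I \<alpha> * ennreal (?D z \<alpha> powr - (5/16)))\<^sup>2 \<le> 6 * (?I \<alpha> *
          (sing_periodic (3/4) (Re (z - Complex \<alpha> (h \<alpha>))) * sing (1/2) (Im (z - Complex \<alpha> (h \<alpha>)))))"
        proof (cases "\<alpha> \<in> {-pi..pi}")
          case \<alpha>: True
          have D: "ennreal (?D z \<alpha> powr - ((3/4 + 1/2) / 2)) \<le> 6 * (sing_periodic (3/4) (Re (z - Complex \<alpha> (h \<alpha>))) * sing (1/2) (Im (z - Complex \<alpha> (h \<alpha>))))"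
            using True \<alpha> by (intro denom_powr_le) (auto simp: slab_def)
          have "(ennreal (?D z \<alpha> powr - (5/16)))\<^sup>2 = ennreal (?D z \<alpha> powr - (5/8))"
            by (simp only: power2_eq_square ennreal_powr_mult) simp
          then show ?thesis using D \<alpha> by simp
        qed auto
      qed
      then show "(\<integral>\<^sup>+\<alpha>. (?I \<alpha> * ennreal (?D z \<alpha> powr - (5/16)))\<^sup>2 \<partial>lborel) \<le> 6 * (\<integral>\<^sup>+\<alpha>. ?I \<alpha> *
        (sing_periodic (3/4) (Re (z - Complex \<alpha> (h \<alpha>))) * sing (1/2) (Im (z - Complex \<alpha> (h \<alpha>)))) \<partial>lborel)"
        by (simp add: nn_integral_cmult)
    qed auto
    also have "\<dots> = (6 * 6) * (ennreal C1 * (\<integral>\<^sup>+\<alpha>. ?I \<alpha> *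
        (sing_periodic (3/4) (Re (z - Complex \<alpha> (h \<alpha>))) * sing (1/2) (Im (z - Complex \<alpha> (h \<alpha>)))) \<partial>lborel))"
      by (simp only: mult_ac)
    also have "(6 * 6 :: ennreal) = 36" by simp
    finally show ?thesis using True by (simp add: mult.assoc)
  qed auto
  have "(\<integral>\<^sup>+z. indicator (slab R) z * (\<integral>\<^sup>+\<alpha>. ?I \<alpha> * ennreal (?D z \<alpha> powr - (1/2)) \<partial>lborel)\<^sup>2 \<partial>lborel)
    \<le> (\<integral>\<^sup>+z. 36 * ennreal C1 * (\<integral>\<^sup>+\<alpha>. ?I \<alpha> * (indicator (slab R) z *
        (sing_periodic (3/4) (Re (z - Complex \<alpha> (h \<alpha>))) * sing (1/2) (Im (z - Complex \<alpha> (h \<alpha>))))) \<partial>lborel) \<partial>lborel)"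
    by (rule nn_integral_mono) (rule pt)
  also have "\<dots> = 36 * ennreal C1 * (\<integral>\<^sup>+z. \<integral>\<^sup>+\<alpha>. ?I \<alpha> * (indicator (slab R) z *
        (sing_periodic (3/4) (Re (z - Complex \<alpha> (h \<alpha>))) * sing (1/2) (Im (z - Complex \<alpha> (h \<alpha>))))) \<partial>lborel \<partial>lborel)"
    by (rule nn_integral_cmult) measurable
  also have "(\<integral>\<^sup>+z. \<integral>\<^sup>+\<alpha>. ?I \<alpha> * (indicator (slab R) z *
        (sing_periodic (3/4) (Re (z - Complex \<alpha> (h \<alpha>))) * sing (1/2) (Im (z - Complex \<alpha> (h \<alpha>))))) \<partial>lborel \<partial>lborel)
    = (\<integral>\<^sup>+\<alpha>. \<integral>\<^sup>+z. ?I \<alpha> * (indicator (slab R) z *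
        (sing_periodic (3/4) (Re (z - Complex \<alpha> (h \<alpha>))) * sing (1/2) (Im (z - Complex \<alpha> (h \<alpha>))))) \<partial>lborel \<partial>lborel)"
    by (rule lborel_pair.Fubini'[symmetric]) measurable
  also have "\<dots> \<le> (\<integral>\<^sup>+\<alpha>. ?I \<alpha> * ennreal C2 \<partial>lborel)"
  proof (rule nn_integral_mono)
    fix \<alpha>
    show "(\<integral>\<^sup>+z. ?I \<alpha> * (indicator (slab R) z *
        (sing_periodic (3/4) (Re (z - Complex \<alpha> (h \<alpha>))) * sing (1/2) (Im (z - Complex \<alpha> (h \<alpha>))))) \<partial>lborel) \<le> ?I \<alpha> * ennreal C2"
      using C2(2)[of "Complex \<alpha> (h \<alpha>)"] h[of \<alpha>] by (auto simp: nn_integral_cmult slab_def indicator_def)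
  qed
  also have "\<dots> = ennreal (2 * pi * C2)"
    using C2 by (simp add: nn_integral_multc ennreal_mult)
  finally have "(\<integral>\<^sup>+z. indicator (slab R) z * (\<integral>\<^sup>+\<alpha>. ?I \<alpha> * ennreal (?D z \<alpha> powr - (1/2)) \<partial>lborel)\<^sup>2 \<partial>lborel)
      \<le> 36 * ennreal C1 * ennreal (2 * pi * C2)" by (simp add: mult_left_mono)
  also have "\<dots> < \<infinity>" by (simp add: ennreal_mult_less_top)
  finally show ?thesis .
qed

section \<open>The Cauchy--Pompeiu formula on the strip\<close>

lemma blob_measurable [measurable]: "blob e \<in> borel_measurable borel"
proof -
  have [measurable]: "(\<lambda>w::complex. sinh (Im w)) \<in> borel_measurable borel"
    "(\<lambda>w. complex_of_real (denom w + e)) \<in> borel_measurable borel"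
    by (intro borel_measurable_continuous_onI continuous_intros)+
  show ?thesis unfolding blob_def by measurable
qed

lemma blob_cnj: "blob e (cnj w) = cnj (blob e w)"
  by (simp add: blob_def denom_def complex_cnj)

lemma powr_minus_half: "0 \<le> d \<Longrightarrow> d powr - (1/2) = 1 / sqrt d" for d :: real
  by (simp only: powr_minus powr_half_sqrt inverse_eq_divide)

lemma integrable_denom:
  assumes "0 \<le> R" "a \<in> slab R"
  shows "integrable lborel (\<lambda>z. indicator (slab R) z * (1 / sqrt (denom (z - a))))"
proof (rule integrableI_nonneg)
  obtain C where C: "(\<integral>\<^sup>+z. indicator (slab R) z * ennreal (denom (z - a) powr - (1/2)) \<partial>lborel) \<le> ennreal C"
    using denom_integrable[OF assms(1)] assms(2) by blast
  have "(\<integral>\<^sup>+z. ennreal (indicator (slab R) z * (1 / sqrt (denom (z - a)))) \<partial>lborel)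
     = (\<integral>\<^sup>+z. indicator (slab R) z * ennreal (denom (z - a) powr - (1/2)) \<partial>lborel)"
    by (rule nn_integral_cong) (simp add: powr_minus_half denom_nonneg indicator_def)
  then show "(\<integral>\<^sup>+z. ennreal (indicator (slab R) z * (1 / sqrt (denom (z - a)))) \<partial>lborel) < \<infinity>"
    using C by (simp add: le_less_trans)
  show "AE z in lborel. 0 \<le> indicator (slab R) z * (1 / sqrt (denom (z - a)))"
    by (simp add: denom_nonneg)
qed measurable

lemma cot_conv_exp:
  fixes w :: complex
  shows "cot (w / 2) = \<i> * (exp (\<i> * w) + 1) / (exp (\<i> * w) - 1)"
proof -
  define E where "E = exp (\<i> * (w / 2))"
  have E: "E \<noteq> 0" "exp (\<i> * w) = E * E" "exp (- (\<i> * (w / 2))) = inverse E"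
    by (auto simp: E_def exp_minus simp flip: exp_add)
  have "cot (w / 2) = ((E + inverse E) / 2) / ((E - inverse E) / (2 * \<i>))"
    unfolding cot_def sin_exp_eq cos_exp_eq E(3) by (simp add: E_def)
  also have "\<dots> = \<i> * ((E + inverse E) / (E - inverse E))"
  proof -
    have "(a / 2) / (b / (2 * \<i>)) = \<i> * (a / b)" for a b :: complex
      by (cases "b = 0") (simp_all add: field_simps)
    then show ?thesis .
  qed
  also have "(E + inverse E) / (E - inverse E) = (E * (E + inverse E)) / (E * (E - inverse E))"
    using E(1) by simp
  also have "\<dots> = (E * E + 1) / (E * E - 1)" using E(1) by (simp add: algebra_simps)
  finally show ?thesis using E(2) by simp
qed

text \<open>Above the pole \<open>cot (w / 2)\<close> has the primitive \<open>F\<close>. Its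
  logarithm stays on the principal branch and is periodic, so only the linear term changes over a
  period. Below the pole the value follows by conjugation.\<close>

lemma cot_row_integral:
  assumes "y \<noteq> Im a"
  shows "(\<integral>x. indicator {-pi..pi} x *\<^sub>R blob 0 (Complex x y - a) \<partial>lborel) = - (2 * pi * \<i> * sgn (y - Im a))"
proof -
  have pos: "(\<integral>x. indicator {-pi..pi} x *\<^sub>R blob 0 (Complex x y - a) \<partial>lborel) = - (2 * pi * \<i>)"
    if y: "y > Im a" for y a
  proof -
    define F where "F w = - \<i> * w + 2 * Ln (1 - exp (\<i> * w))" for w
    have F: "(F has_field_derivative blob 0 w) (at w)" if "Im w > 0" for w
    proof -
      have "norm (exp (\<i> * w)) < 1" using that by simp
      then have "Re (exp (\<i> * w)) < 1" using complex_Re_le_cmod[of "exp (\<i> * w)"] by linarith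
      then have *: "1 - exp (\<i> * w) \<notin> \<real>\<^sub>\<le>\<^sub>0" "exp (\<i> * w) \<noteq> 1"
        by (auto simp: complex_nonpos_Reals_iff)
      have d: "((\<lambda>w. 1 - exp (\<i> * w)) has_field_derivative - (\<i> * exp (\<i> * w))) (at w)"
        by (auto intro!: derivative_eq_intros)
      have "((\<lambda>w. Ln (1 - exp (\<i> * w))) has_field_derivative inverse (1 - exp (\<i> * w)) * - (\<i> * exp (\<i> * w))) (at w)"
        by (rule DERIV_chain2[OF has_field_derivative_Ln[OF *(1)] d])
      then have "(F has_field_derivative - \<i> + 2 * (inverse (1 - exp (\<i> * w)) * - (\<i> * exp (\<i> * w)))) (at w)"
        unfolding F_def by (intro DERIV_add DERIV_cmult) (auto intro!: derivative_eq_intros)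
      moreover have "- \<i> + 2 * (inverse (1 - E) * - (\<i> * E)) = \<i> * (E + 1) / (E - 1)" if "E \<noteq> 1" for E
        using that by (simp add: field_simps)
      ultimately show ?thesis unfolding cot_half[symmetric] cot_conv_exp using *(2) by simp
    qed
    have d: "((\<lambda>x. F (Complex x y - a)) has_vector_derivative blob 0 (Complex x y - a)) (at x within S)" for x S
    proof -
      have "((\<lambda>x. Complex x y - a) has_vector_derivative 1) (at x within S)"
        unfolding Complex_eq by (auto intro!: derivative_eq_intros)
      from field_vector_diff_chain_within[OF this DERIV_subset[OF F]] y show ?thesis
        by (simp add: o_def)
    qed
    have c: "continuous_on {-pi..pi} (\<lambda>x. blob 0 (Complex x y - a))"
    proof -
      have "0 < (y - Im a)\<^sup>2 / 4" using y by simp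
      then have "denom (Complex x y - a) \<noteq> 0" for x
        using cosh_minus_one_ge[of "y - Im a"] cos_le_one[of "x - Re a"]
        unfolding denom_def by (simp only: minus_complex.sel complex.sel)
      then show ?thesis unfolding blob_def
        by (auto simp: Complex_eq intro!: continuous_intros simp del: of_real_add)
    qed
    have "(\<integral>x. indicator {-pi..pi} x *\<^sub>R blob 0 (Complex x y - a) \<partial>lborel)
        = F (Complex pi y - a) - F (Complex (-pi) y - a)"
      by (intro integral_FTC_atLeastAtMost d c) auto
    also have "exp (\<i> * (Complex pi y - a)) = exp (\<i> * (Complex (-pi) y - a))"
    proof -
      have "\<i> * (Complex pi y - a) = \<i> * (Complex (-pi) y - a) + of_real (2 * pi) * \<i>"
        by (simp add: complex_eq_iff)
      then show ?thesis by (simp only: exp_add exp_two_pi_i' exp_two_pi_i mult_1_right of_real_mult of_real_numeral)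
    qed
    then have "F (Complex pi y - a) - F (Complex (-pi) y - a) = - (2 * pi * \<i>)"
      by (simp add: F_def) (simp add: complex_eq_iff)
    finally show ?thesis .
  qed
  show ?thesis
  proof (cases "y > Im a")
    case True
    then show ?thesis using pos by simp
  next
    case False
    have c: "blob 0 (Complex x (- y) - cnj a) = cnj (blob 0 (Complex x y - a))" for x
    proof -
      have "Complex x (- y) - cnj a = cnj (Complex x y - a)" by (simp add: complex_eq_iff)
      then show ?thesis by (simp only: blob_cnj)
    qed
    have "(\<integral>x. indicator {-pi..pi} x *\<^sub>R blob 0 (Complex x (- y) - cnj a) \<partial>lborel) = - (2 * pi * \<i>)"
      by (rule pos) (use False assms in simp)
    moreover have "(\<integral>x. indicator {-pi..pi} x *\<^sub>R blob 0 (Complex x (- y) - cnj a) \<partial>lborel)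
       = cnj (\<integral>x. indicator {-pi..pi} x *\<^sub>R blob 0 (Complex x y - a) \<partial>lborel)"
      unfolding Bochner_Integration.integral_cnj[symmetric] by (rule Bochner_Integration.integral_cong) (auto simp: c)
    ultimately have "cnj (\<integral>x. indicator {-pi..pi} x *\<^sub>R blob 0 (Complex x y - a) \<partial>lborel) = - (2 * pi * \<i>)"
      by simp
    then have "(\<integral>x. indicator {-pi..pi} x *\<^sub>R blob 0 (Complex x y - a) \<partial>lborel) = cnj (- (2 * pi * \<i>))"
      by (metis complex_cnj_cnj)
    then show ?thesis using False assms by (simp add: sgn_if)
  qed
qed

text \<open>A Lipschitz bound, applied to the translate of \<open>z\<close> nearest to
  \<open>a\<close>: that distance is at most a multiple of the root of
  \<open>denom (z - a)\<close>.\<close>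

lemma vanishing_le_sqrt_denom:
  fixes \<psi> px py :: "complex \<Rightarrow> complex"
  assumes d: "\<And>z. (\<psi> has_derivative (\<lambda>v. Re v *\<^sub>R px z + Im v *\<^sub>R py z)) (at z)"
    and c: "continuous_on UNIV px" "continuous_on UNIV py"
    and per: "x_periodic \<psi>" and R: "\<bar>Im a\<bar> \<le> R" "\<bar>Re a\<bar> \<le> pi" and a: "\<psi> a = 0"
  shows "\<exists>L. \<forall>z\<in>slab R. norm (\<psi> z) \<le> L * sqrt (denom (z - a))"
proof -
  \<comment> \<open>Wide enough for the translates of \<open>slab R\<close> by \<open>2 * pi\<close>
    in either direction.\<close>
  define Q where "Q = cbox (Complex (-(4*pi)) (-R)) (Complex (4*pi) R)"
  have Q: "w \<in> Q \<longleftrightarrow> \<bar>Re w\<bar> \<le> 4 * pi \<and> \<bar>Im w\<bar> \<le> R" for w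
    by (auto simp: Q_def in_cbox_complex_iff)
  have "compact ((\<lambda>z. norm (px z) + norm (py z)) ` Q)"
    unfolding Q_def by (intro compact_continuous_image continuous_intros continuous_on_subset[OF c(1)]
        continuous_on_subset[OF c(2)] compact_cbox) auto
  then have "bounded ((\<lambda>z. norm (px z) + norm (py z)) ` Q)" by (rule compact_imp_bounded)
  then obtain B where "\<forall>x\<in>(\<lambda>z. norm (px z) + norm (py z)) ` Q. norm x \<le> B"
    unfolding bounded_iff by blast
  then have B: "norm (px z) + norm (py z) \<le> B" if "z \<in> Q" for z using that by auto
  have lip: "norm (\<psi> z - \<psi> w) \<le> B * norm (z - w)" if "z \<in> Q" "w \<in> Q" for z w
  proof (rule differentiable_bound[where S = Q])
    show "convex Q" unfolding Q_def by (rule convex_box)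
    show "(\<psi> has_derivative (\<lambda>v. Re v *\<^sub>R px z + Im v *\<^sub>R py z)) (at z within Q)" for z
      by (rule has_derivative_at_withinI[OF d])
    show "onorm (\<lambda>v. Re v *\<^sub>R px z + Im v *\<^sub>R py z) \<le> B" if "z \<in> Q" for z
    proof (rule onorm_le)
      fix v
      have "norm (Re v *\<^sub>R px z + Im v *\<^sub>R py z) \<le> \<bar>Re v\<bar> * norm (px z) + \<bar>Im v\<bar> * norm (py z)"
        by (rule order_trans[OF norm_triangle_ineq]) simp
      also have "\<dots> \<le> norm v * norm (px z) + norm v * norm (py z)"
        by (intro add_mono mult_right_mono abs_Re_le_cmod abs_Im_le_cmod) auto
      also have "\<dots> \<le> B * norm v" using mult_right_mono[OF B[OF that], of "norm v"] by (simp add: algebra_simps)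
      finally show "norm (Re v *\<^sub>R px z + Im v *\<^sub>R py z) \<le> B * norm v" .
    qed
  qed (use that in auto)
  have B0: "0 \<le> B"
  proof -
    have "a \<in> Q" using R pi_ge_zero by (simp add: Q)
    from B[OF this] show ?thesis using norm_ge_zero[of "px a"] norm_ge_zero[of "py a"] by linarith
  qed
  show ?thesis
  proof (intro exI ballI)
    fix z assume z: "z \<in> slab R"
    then have "\<bar>Re (z - a)\<bar> \<le> 2 * pi" using R by (auto simp: slab_def)
    from denom_ge[OF this] obtain k where k: "k \<in> {0, 2 * pi, - (2 * pi)}"
      and D: "(2 / pi\<^sup>2) * ((Re (z - a) - k)\<^sup>2 + (Im (z - a))\<^sup>2) \<le> denom (z - a)" by blast
    have "\<psi> (z - of_real k) = \<psi> z"
      using k per[unfolded x_periodic_def, rule_format, of z]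
        per[unfolded x_periodic_def, rule_format, of "z - of_real (2 * pi)"] by auto
    moreover have "z - of_real k \<in> Q" "a \<in> Q" using z R k by (auto simp: Q slab_def)
    ultimately have "norm (\<psi> z) \<le> B * norm (z - of_real k - a)"
      using lip[of "z - of_real k" a] a by simp
    also have "norm (z - of_real k - a) \<le> pi * sqrt (denom (z - a))"
    proof -
      have "(norm (z - of_real k - a))\<^sup>2 = (Re (z - a) - k)\<^sup>2 + (Im (z - a))\<^sup>2"
        by (simp add: cmod_power2 algebra_simps)
      also have "\<dots> \<le> pi\<^sup>2 * denom (z - a)"
      proof -
        have "(Re (z - a) - k)\<^sup>2 + (Im (z - a))\<^sup>2 \<le> (pi\<^sup>2 / 2) * denom (z - a)"
          using mult_left_mono[OF D, of "pi\<^sup>2 / 2"] by simp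
        also have "\<dots> \<le> pi\<^sup>2 * denom (z - a)" using denom_nonneg[of "z - a"] by (intro mult_right_mono) auto
        finally show ?thesis .
      qed
      finally show ?thesis using real_le_rsqrt by (fastforce simp: real_sqrt_mult)
    qed
    finally show "norm (\<psi> z) \<le> (B * pi) * sqrt (denom (z - a))"
      using B0 by (simp add: mult_left_mono mult.assoc)
  qed
qed

text \<open>Integration by parts moves the derivative onto the regularized kernel, where it produces
  the peak \<open>J e\<close>. As \<psi> vanishes at the centre of the peak like the root of
  \<open>denom\<close>, the product is dominated by a multiple of the integrable
  \<open>1 / sqrt (denom (z - a))\<close> and tends to \<open>0\<close> pointwise; the mass of the
  peak never has to be computed.\<close>

lemma cauchy_pompeiu_vanishing:
  fixes \<psi> px py :: "complex \<Rightarrow> complex"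
  assumes d: "\<And>z. (\<psi> has_derivative (\<lambda>v. Re v *\<^sub>R px z + Im v *\<^sub>R py z)) (at z)"
    and c: "continuous_on UNIV px" "continuous_on UNIV py"
    and per: "x_periodic \<psi>" and supp: "\<And>z. R < \<bar>Im z\<bar> \<Longrightarrow> \<psi> z = 0"
    and R: "\<bar>Im a\<bar> \<le> R" "\<bar>Re a\<bar> \<le> pi" and a: "\<psi> a = 0"
  shows "(LINT z:strip|lborel. blob 0 (z - a) * (px z + \<i> * py z)) = 0"
proof -
  have aR: "a \<in> slab R" "0 \<le> R" using R by (auto simp: slab_def)
  have cpsi: "continuous_on UNIV \<psi>" using d has_derivative_continuous continuous_on_eq_continuous_within
    by (metis UNIV_I)
  have [measurable]: "px \<in> borel_measurable borel" "py \<in> borel_measurable borel" "\<psi> \<in> borel_measurable borel"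
    using c cpsi by (auto intro: borel_measurable_continuous_onI)
  obtain L where L: "\<And>z. z \<in> slab R \<Longrightarrow> norm (\<psi> z) \<le> L * sqrt (denom (z - a))"
    using vanishing_le_sqrt_denom[OF d c per R a] by blast
  have "compact ((\<lambda>z. norm (px z + \<i> * py z)) ` cbox (Complex (-pi) (-R)) (Complex pi R))"
    by (intro compact_continuous_image continuous_intros continuous_on_subset[OF c(1)]
        continuous_on_subset[OF c(2)] compact_cbox) auto
  then have "bounded ((\<lambda>z. norm (px z + \<i> * py z)) ` cbox (Complex (-pi) (-R)) (Complex pi R))"
    by (rule compact_imp_bounded)
  then obtain B where "\<forall>x\<in>(\<lambda>z. norm (px z + \<i> * py z)) ` cbox (Complex (-pi) (-R)) (Complex pi R). norm x \<le> B"
    unfolding bounded_iff by blast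
  then have B: "norm (px z + \<i> * py z) \<le> B" if "z \<in> slab R" for z
  proof -
    have "z \<in> cbox (Complex (-pi) (-R)) (Complex pi R)"
      using that by (simp add: slab_def in_cbox_complex_iff abs_le_iff)
    then show ?thesis using \<open>\<forall>x\<in>_. norm x \<le> B\<close> by simp
  qed
  \<comment> \<open>The derivative \<open>\<partial>\<^sub>x + \<i> * \<partial>\<^sub>y\<close> of
    \<open>blob e\<close>. For \<open>blob 0\<close>, holomorphic off its poles, it is
    \<open>0\<close> there; hence the factor \<open>e\<close>.\<close>
  define J where "J e w = e * (cos (Re w) + cosh (Im w)) / (denom w + e)\<^sup>2" for e :: real and w
  have id: "(LINT z:strip|lborel. blob e (z - a) * (px z + \<i> * py z)) = - (LINT z:strip|lborel. of_real (J e (z - a)) * \<psi> z)"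
    if e: "0 < e" for e
  proof -
    define bx where "bx w = of_real (cos (Re w) / (denom w + e)) - of_real (sin (Re w) / (denom w + e)) * blob e w" for w
    define byy where "byy w = - \<i> * of_real (cosh (Im w) / (denom w + e)) - of_real (sinh (Im w) / (denom w + e)) * blob e w" for w
    have p: "denom w + e \<noteq> 0" for w using denom_nonneg[of w] e by linarith
    have bc: "continuous_on UNIV (\<lambda>z. blob e (z - a))" "continuous_on UNIV (\<lambda>z. bx (z - a))" "continuous_on UNIV (\<lambda>z. byy (z - a))"
      unfolding bx_def byy_def blob_def using p
      by (auto simp: Complex_eq intro!: continuous_intros simp del: of_real_add)
    have bd: "((\<lambda>z. blob e (z - a)) has_derivative (\<lambda>v. Re v *\<^sub>R bx (z - a) + Im v *\<^sub>R byy (z - a))) (at z)" for z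
    proof -
      have "((\<lambda>z. z - a) has_derivative (\<lambda>v. v)) (at z)" by (auto intro!: derivative_eq_intros)
      from has_derivative_compose[OF this blob_has_derivative[OF e]] show ?thesis by (simp add: bx_def byy_def)
    qed
    define gx where "gx z = bx (z - a) * \<psi> z + blob e (z - a) * px z" for z
    define gy where "gy z = byy (z - a) * \<psi> z + blob e (z - a) * py z" for z
    have g: "((\<lambda>z. blob e (z - a) * \<psi> z) has_derivative (\<lambda>v. Re v *\<^sub>R gx z + Im v *\<^sub>R gy z)) (at z)" for z
      by (rule has_derivative_eq_rhs[OF has_derivative_mult[OF bd d]]) (auto simp: gx_def gy_def scaleR_conv_of_real algebra_simps)
    have gc: "continuous_on UNIV gx" "continuous_on UNIV gy"
      unfolding gx_def gy_def by (intro continuous_intros bc c cpsi)+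
    have gp: "x_periodic (\<lambda>z. blob e (z - a) * \<psi> z)"
      using per blob_add_2pi(1)[of e "z - a" for z] by (simp add: x_periodic_def algebra_simps)
    have gs: "blob e (z - a) * \<psi> z = 0" if "R < \<bar>Im z\<bar>" for z using supp that by simp
    note dt = strip_divergence_theorem[OF g gc gp gs]
    have J: "bx w + \<i> * byy w = of_real (J e w)" for w
    proof -
      have "bx w + \<i> * byy w = of_real ((cos (Re w) + cosh (Im w)) / (denom w + e))
        - (of_real (sin (Re w)) + \<i> * of_real (sinh (Im w))) * (of_real (sin (Re w)) - \<i> * of_real (sinh (Im w))) / (of_real (denom w + e) * of_real (denom w + e))"
        using p[of w] by (simp add: bx_def byy_def blob_def Complex_eq divide_simps del: of_real_add) (simp add: algebra_simps)
      also have "(of_real (sin (Re w)) + \<i> * of_real (sinh (Im w))) * (of_real (sin (Re w)) - \<i> * of_real (sinh (Im w)))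
          = complex_of_real (denom w * (cosh (Im w) + cos (Re w)))"
      proof -
        have "(sin (Re w))\<^sup>2 + (sinh (Im w))\<^sup>2 = denom w * (cosh (Im w) + cos (Re w))"
          using norm_blob_numerator[of w] by (simp add: cmod_power2)
        then show ?thesis by (simp add: complex_eq_iff power2_eq_square)
      qed
      also have "of_real ((cos (Re w) + cosh (Im w)) / (denom w + e)) - of_real (denom w * (cosh (Im w) + cos (Re w))) / (of_real (denom w + e) * of_real (denom w + e))
          = complex_of_real ((cos (Re w) + cosh (Im w)) / (denom w + e) - denom w * (cosh (Im w) + cos (Re w)) / ((denom w + e) * (denom w + e)))"
        by simp
      also have "(cos (Re w) + cosh (Im w)) / (denom w + e) - denom w * (cosh (Im w) + cos (Re w)) / ((denom w + e) * (denom w + e)) = J e w"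
        using p[of w] by (simp add: J_def divide_simps power2_eq_square) (simp add: algebra_simps)
      finally show ?thesis .
    qed
    have i: "set_integrable lborel strip (\<lambda>z. blob e (z - a) * (px z + \<i> * py z))"
      by (rule set_integrable_strip_continuous[where R = R])
        (use partials_vanish[OF d supp] in \<open>auto intro!: continuous_intros bc c\<close>)
    have "0 = (LINT z:strip|lborel. gx z) + \<i> * (LINT z:strip|lborel. gy z)" using dt by simp
    also have "\<dots> = (LINT z:strip|lborel. gx z + \<i> * gy z)"
      using dt by (simp add: set_integral_add)
    also have "(\<lambda>z. gx z + \<i> * gy z) = (\<lambda>z. of_real (J e (z - a)) * \<psi> z + blob e (z - a) * (px z + \<i> * py z))"
      by (auto simp: gx_def gy_def algebra_simps fun_eq_iff simp flip: J)
    also have "(LINT z:strip|lborel. of_real (J e (z - a)) * \<psi> z + blob e (z - a) * (px z + \<i> * py z))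
       = (LINT z:strip|lborel. of_real (J e (z - a)) * \<psi> z) + (LINT z:strip|lborel. blob e (z - a) * (px z + \<i> * py z))"
    proof (rule set_integral_add(2)[OF _ i])
      have "set_integrable lborel strip (\<lambda>z. (gx z + \<i> * gy z) - blob e (z - a) * (px z + \<i> * py z))"
        using dt(3,4) i by (intro set_integral_diff set_integral_add) auto
      moreover have "(\<lambda>z. (gx z + \<i> * gy z) - blob e (z - a) * (px z + \<i> * py z)) = (\<lambda>z. of_real (J e (z - a)) * \<psi> z)"
        by (auto simp: gx_def gy_def algebra_simps fun_eq_iff simp flip: J)
      ultimately show "set_integrable lborel strip (\<lambda>z. of_real (J e (z - a)) * \<psi> z)" by simp
    qed
    finally show ?thesis by (simp add: add_eq_0_iff)
  qed
  define e where "e n = inverse (real (Suc n))" for n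
  have e: "0 < e n" for n by (simp add: e_def)
  have e0: "e \<longlonglongrightarrow> 0" unfolding e_def by (rule LIMSEQ_inverse_real_of_nat)
  define C where "C = cosh (2 * R)"
  have ch: "cosh (Im (z - a)) \<le> C" if "z \<in> slab R" for z
  proof -
    have "cosh \<bar>Im (z - a)\<bar> \<le> cosh (2 * R)"
      using that R by (subst cosh_real_nonneg_le_iff) (auto simp: slab_def)
    then show ?thesis by (simp add: C_def)
  qed
  have strip_slab: "z \<in> slab R" if "z \<in> strip" "\<not> R < \<bar>Im z\<bar>" for z
    using that by (auto simp: slab_def strip_def)
  note wint = integrable_denom[OF aR(2,1)]
  have lim: "(\<lambda>n. LINT z:strip|lborel. blob (e n) (z - a) * (px z + \<i> * py z))
      \<longlonglongrightarrow> (LINT z:strip|lborel. blob 0 (z - a) * (px z + \<i> * py z))"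
    unfolding set_lebesgue_integral_def
  proof (rule integral_dominated_convergence)
    show "integrable lborel (\<lambda>z. (sqrt (2 * C) * B) * (indicator (slab R) z * (1 / sqrt (denom (z - a)))))"
      using wint by (rule integrable_mult_right)
    show "AE z in lborel. (\<lambda>n. indicator strip z *\<^sub>R (blob (e n) (z - a) * (px z + \<i> * py z)))
        \<longlonglongrightarrow> indicator strip z *\<^sub>R (blob 0 (z - a) * (px z + \<i> * py z))"
    proof (rule AE_I2)
      fix z
      have "(\<lambda>n. blob (e n) (z - a)) \<longlonglongrightarrow> blob 0 (z - a)"
      proof (cases "denom (z - a) = 0")
        case True
        then have "Complex (sin (Re (z - a))) (- sinh (Im (z - a))) = 0"
          using norm_blob_numerator_le[of "z - a"] by simp
        then show ?thesis by (simp add: blob_def)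
      next
        case False
        then show ?thesis unfolding blob_def using e0
          by (intro tendsto_intros) auto
      qed
      then show "(\<lambda>n. indicator strip z *\<^sub>R (blob (e n) (z - a) * (px z + \<i> * py z)))
        \<longlonglongrightarrow> indicator strip z *\<^sub>R (blob 0 (z - a) * (px z + \<i> * py z))"
        by (intro tendsto_intros)
    qed
    show "AE z in lborel. norm (indicator strip z *\<^sub>R (blob (e n) (z - a) * (px z + \<i> * py z)))
        \<le> (sqrt (2 * C) * B) * (indicator (slab R) z * (1 / sqrt (denom (z - a))))" for n
    proof (rule AE_I2)
      fix z
      show "norm (indicator strip z *\<^sub>R (blob (e n) (z - a) * (px z + \<i> * py z)))
        \<le> (sqrt (2 * C) * B) * (indicator (slab R) z * (1 / sqrt (denom (z - a))))"
      proof (cases "z \<in> strip \<and> \<not> R < \<bar>Im z\<bar>")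
        case True
        then have zs: "z \<in> slab R" using strip_slab by blast
        have "norm (blob (e n) (z - a)) \<le> sqrt (2 * cosh (Im (z - a))) * (1 / sqrt (denom (z - a)))"
          using norm_blob_le(1)[of "e n" "z - a"] e[of n] by simp
        also have "\<dots> \<le> sqrt (2 * C) * (1 / sqrt (denom (z - a)))"
          using ch[OF zs] denom_nonneg by (intro mult_right_mono) auto
        finally have "norm (blob (e n) (z - a)) * norm (px z + \<i> * py z) \<le> sqrt (2 * C) * (1 / sqrt (denom (z - a))) * B"
          using B[OF zs] denom_nonneg by (intro mult_mono) (auto intro!: mult_nonneg_nonneg simp: C_def)
        then show ?thesis using True zs by (simp add: norm_mult mult_ac)
      next
        case False
        then have n: "norm (indicator strip z *\<^sub>R (blob (e n) (z - a) * (px z + \<i> * py z))) = 0"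
          using partials_vanish[OF d supp] by auto
        have "0 \<le> B"
          using order_trans[OF norm_ge_zero B[OF aR(1)]] .
        then show ?thesis unfolding n using denom_nonneg[of "z - a"]
          by (intro mult_nonneg_nonneg) (auto simp: C_def)
      qed
    qed
  qed auto
  have "(\<lambda>n. LINT z:strip|lborel. of_real (J (e n) (z - a)) * \<psi> z) \<longlonglongrightarrow> (LINT z:strip|lborel. (0::complex))"
    unfolding set_lebesgue_integral_def
  proof (rule integral_dominated_convergence)
    show "integrable lborel (\<lambda>z. (2 * C * \<bar>L\<bar>) * (indicator (slab R) z * (1 / sqrt (denom (z - a)))))"
      using wint by (rule integrable_mult_right)
    show "(\<lambda>z. indicator strip z *\<^sub>R (complex_of_real (J (e n) (z - a)) * \<psi> z)) \<in> borel_measurable lborel" for n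
    proof -
      have "denom w + e n \<noteq> 0" for w using denom_nonneg[of w] e[of n] by linarith
      then have [measurable]: "J (e n) \<in> borel_measurable borel"
        unfolding J_def by (intro borel_measurable_continuous_onI continuous_intros) auto
      show ?thesis by measurable
    qed
    have J0: "0 \<le> J (e n) w" for n w
    proof -
      have "0 \<le> cos (Re w) + cosh (Im w)"
        using cosh_real_ge_1[of "Im w"] cos_ge_minus_one[of "Re w"] by linarith
      then show ?thesis using less_imp_le[OF e[of n]] unfolding J_def
        by (intro divide_nonneg_nonneg mult_nonneg_nonneg) auto
    qed
    show "AE z in lborel. (\<lambda>n. indicator strip z *\<^sub>R (complex_of_real (J (e n) (z - a)) * \<psi> z)) \<longlonglongrightarrow> indicator strip z *\<^sub>R 0"
    proof (rule AE_I2)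
      fix z
      show "(\<lambda>n. indicator strip z *\<^sub>R (complex_of_real (J (e n) (z - a)) * \<psi> z)) \<longlonglongrightarrow> indicator strip z *\<^sub>R 0"
      proof (cases "z \<in> slab R \<and> denom (z - a) \<noteq> 0")
        case True
        have "(\<lambda>n. J (e n) (z - a)) \<longlonglongrightarrow> 0 * (cos (Re (z - a)) + cosh (Im (z - a))) / (denom (z - a) + 0)\<^sup>2"
          unfolding J_def by (intro tendsto_intros e0) (use True in auto)
        then have "(\<lambda>n. indicator strip z *\<^sub>R (complex_of_real (J (e n) (z - a)) * \<psi> z)) \<longlonglongrightarrow> indicator strip z *\<^sub>R (of_real 0 * \<psi> z)"
          by (intro tendsto_intros) simp
        then show ?thesis by simp
      next
        case False
        \<comment> \<open>At a pole \<open>J\<close> grows without bound, but there \<open>L\<close>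
          forces \<open>\<psi> z = 0\<close>; outside the slab the indicator or the support
          condition gives \<open>0\<close>.\<close>
        then have "indicator strip z *\<^sub>R \<psi> z = 0"
          using L[of z] strip_slab[of z] supp[of z] by (auto simp: indicator_def)
        then have "indicator strip z *\<^sub>R (complex_of_real (J (e n) (z - a)) * \<psi> z) = 0" for n
          by (metis mult_scaleR_right mult_zero_right)
        then show ?thesis by (simp only: scaleR_zero_right tendsto_const)
      qed
    qed
    show "AE z in lborel. norm (indicator strip z *\<^sub>R (complex_of_real (J (e n) (z - a)) * \<psi> z))
        \<le> (2 * C * \<bar>L\<bar>) * (indicator (slab R) z * (1 / sqrt (denom (z - a))))" for n
    proof (rule AE_I2)
      fix z
      show "norm (indicator strip z *\<^sub>R (complex_of_real (J (e n) (z - a)) * \<psi> z))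
        \<le> (2 * C * \<bar>L\<bar>) * (indicator (slab R) z * (1 / sqrt (denom (z - a))))"
      proof (cases "z \<in> strip \<and> \<not> R < \<bar>Im z\<bar>")
        case True
        then have zs: "z \<in> slab R" using strip_slab by blast
        define D where "D = denom (z - a)"
        have D: "0 \<le> D" by (simp add: D_def denom_nonneg)
        have "J (e n) (z - a) \<le> e n * (2 * C) / (D + e n)\<^sup>2"
        proof -
          have "cos (Re (z - a)) + cosh (Im (z - a)) \<le> 2 * C"
            using ch[OF zs] cos_le_one[of "Re (z - a)"] cosh_real_ge_1[of "Im (z - a)"] by linarith
          then show ?thesis unfolding J_def D_def using less_imp_le[OF e[of n]]
            by (intro divide_right_mono mult_left_mono) simp_all
        qed
        moreover have "norm (\<psi> z) \<le> \<bar>L\<bar> * sqrt D"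
          unfolding D_def by (rule order_trans[OF L[OF zs]], rule mult_right_mono) (auto simp: denom_nonneg)
        ultimately have "J (e n) (z - a) * norm (\<psi> z) \<le> (e n * (2 * C) / (D + e n)\<^sup>2) * (\<bar>L\<bar> * sqrt D)"
          using J0 by (intro mult_mono) (auto simp: C_def intro!: divide_nonneg_nonneg mult_nonneg_nonneg less_imp_le[OF e])
        also have "\<dots> = (2 * C * \<bar>L\<bar>) * (e n * sqrt D / (D + e n)\<^sup>2)" by simp
        also have "\<dots> \<le> (2 * C * \<bar>L\<bar>) * (1 / sqrt D)"
        proof (rule mult_left_mono)
          show "e n * sqrt D / (D + e n)\<^sup>2 \<le> 1 / sqrt D"
          proof (cases "D = 0")
            case False
            have "e n * D \<le> (D + e n)\<^sup>2" using D e[of n] by (simp add: power2_eq_square algebra_simps)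
            then have "e n * sqrt D * sqrt D \<le> (D + e n)\<^sup>2" using D by (simp add: mult.assoc)
            then show ?thesis using D False e[of n] by (simp add: divide_simps)
          qed simp
        qed (simp add: C_def)
        finally show ?thesis using True zs J0 by (simp add: norm_mult D_def)
      next
        case False
        then have n: "norm (indicator strip z *\<^sub>R (complex_of_real (J (e n) (z - a)) * \<psi> z)) = 0"
          using supp by auto
        show ?thesis unfolding n using denom_nonneg[of "z - a"]
          by (intro mult_nonneg_nonneg) (auto simp: C_def)
      qed
    qed
  qed auto
  then have "(\<lambda>n. - (LINT z:strip|lborel. of_real (J (e n) (z - a)) * \<psi> z)) \<longlonglongrightarrow> - (LINT z:strip|lborel. (0::complex))"
    by (rule tendsto_minus)
  from LIMSEQ_unique[OF lim[unfolded id[OF e]] this] show ?thesis by simp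
qed

text \<open>Either side of \<open>b\<close> contributes \<open>- X b\<close>: the sign change of
  \<open>sgn\<close> prevents the two parts from cancelling.\<close>

lemma cutoff_integral:
  fixes X X' :: "real \<Rightarrow> real"
  assumes X: "\<And>s. (X has_real_derivative X' s) (at s)" and c: "continuous_on UNIV X'"
    and supp: "\<And>s. S < \<bar>s\<bar> \<Longrightarrow> X s = 0" "\<And>s. S < \<bar>s\<bar> \<Longrightarrow> X' s = 0" and b: "X b = 1"
  shows "(\<integral>y. X' y * sgn (y - b) \<partial>lborel) = - 2"
proof -
  define Q where "Q = \<bar>S\<bar> + \<bar>b\<bar> + 1"
  have cs: "continuous_on A X'" for A using c by (rule continuous_on_subset) auto
  have d: "(X has_vector_derivative X' s) (at s within A)" for s A
    using X[of s] by (auto simp: has_real_derivative_iff_has_vector_derivative intro: has_vector_derivative_at_within)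
  have i: "integrable lborel (\<lambda>y. indicator {u..v} y *\<^sub>R X' y)" for u v
    by (intro borel_integrable_compact compact_Icc cs)
  have "(\<integral>y. X' y * sgn (y - b) \<partial>lborel)
      = (\<integral>y. indicator {b..Q} y *\<^sub>R X' y - indicator {-Q..b} y *\<^sub>R X' y \<partial>lborel)"
  proof (rule integral_cong_AE)
    show "AE y in lborel. X' y * sgn (y - b) = indicator {b..Q} y *\<^sub>R X' y - indicator {-Q..b} y *\<^sub>R X' y"
      using AE_lborel_singleton[of b]
    proof eventually_elim
      case (elim y)
      show ?case
      proof (cases "S < \<bar>y\<bar>")
        case True
        then show ?thesis using supp by simp
      next
        case False
        then have "-Q \<le> y" "y \<le> Q" by (auto simp: Q_def)
        then show ?thesis using elim by (auto simp: indicator_def sgn_if)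
      qed
    qed
    have [measurable]: "X' \<in> borel_measurable borel" using c by (rule borel_measurable_continuous_onI)
    show "(\<lambda>y. X' y * sgn (y - b)) \<in> borel_measurable lborel"
      "(\<lambda>y. indicator {b..Q} y *\<^sub>R X' y - indicator {-Q..b} y *\<^sub>R X' y) \<in> borel_measurable lborel"
      unfolding sgn_if by measurable
  qed
  also have "\<dots> = (X Q - X b) - (X b - X (- Q))"
  proof -
    have "(\<integral>y. indicator {b..Q} y *\<^sub>R X' y \<partial>lborel) = X Q - X b"
      by (intro integral_FTC_atLeastAtMost d cs) (auto simp: Q_def)
    moreover have "(\<integral>y. indicator {-Q..b} y *\<^sub>R X' y \<partial>lborel) = X b - X (- Q)"
      by (intro integral_FTC_atLeastAtMost d cs) (auto simp: Q_def)
    ultimately show ?thesis using i by simp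
  qed
  also have "\<dots> = - 2"
    using supp(1)[of Q] supp(1)[of "- Q"] b by (simp add: Q_def)
  finally show ?thesis .
qed

text \<open>
  The general case is reduced to a function vanishing at \<open>a\<close> by subtracting a multiple of a cutoff
  in \<open>Im z\<close>, for which the integral is computed row by row.
\<close>

theorem cauchy_pompeiu_strip:
  fixes \<psi> px py :: "complex \<Rightarrow> complex"
  assumes d: "\<And>z. (\<psi> has_derivative (\<lambda>v. Re v *\<^sub>R px z + Im v *\<^sub>R py z)) (at z)"
    and c: "continuous_on UNIV px" "continuous_on UNIV py"
    and per: "x_periodic \<psi>" and supp: "\<And>z. R < \<bar>Im z\<bar> \<Longrightarrow> \<psi> z = 0"
    and R: "\<bar>Re a\<bar> \<le> pi"
  shows "(LINT z:strip|lborel. blob 0 (z - a) * (px z + \<i> * py z)) = - 4 * pi * \<psi> a"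
    and "set_integrable lborel strip (\<lambda>z. blob 0 (z - a) * (px z + \<i> * py z))"
proof -
  obtain X X' :: "real \<Rightarrow> real" where X: "\<And>k. Ck_on k UNIV X'"
    "\<And>s. (X has_real_derivative X' s) (at s)" "\<And>s. \<bar>s\<bar> \<le> 1 \<Longrightarrow> X s = 1" "\<And>s. 2 \<le> \<bar>s\<bar> \<Longrightarrow> X s = 0"
    "\<And>s. 2 < \<bar>s\<bar> \<Longrightarrow> X' s = 0"
    using smooth_cutoff_exists by metis
  \<comment> \<open>The scale that puts the height of \<open>a\<close> into the region where the
    cutoff is \<open>1\<close>.\<close>
  define S where "S = \<bar>Im a\<bar> + 1"
  have S: "0 < S" by (simp add: S_def)
  define r where "r y = X (y / S)" for y
  define r' where "r' y = X' (y / S) / S" for y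
  have r: "(r has_real_derivative r' y) (at y)" for y
  proof -
    have "((\<lambda>y. y / S) has_real_derivative (1 / S)) (at y)" using S by (auto intro!: derivative_eq_intros)
    from DERIV_chain2[OF X(2) this] show ?thesis by (simp add: r_def[abs_def] r'_def)
  qed
  have rc: "continuous_on UNIV r'"
  proof -
    have S0: "S \<noteq> 0" using S by simp
    show ?thesis unfolding r'_def
      by (intro continuous_intros continuous_on_compose2[OF Ck_on_continuous[OF X(1)[of 0]]]) (use S0 in auto)
  qed
  have ra: "r (Im a) = 1" unfolding r_def using S by (intro X(3)) (auto simp: S_def)
  have rs: "r y = 0" "r' y = 0" if "2 * S < \<bar>y\<bar>" for y
    using that S X(4)[of "y / S"] X(5)[of "y / S"] by (auto simp: r_def r'_def field_simps)
  define Q where "Q = max (max R (2 * S)) \<bar>Im a\<bar>"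
  define \<phi> where "\<phi> z = \<psi> z - of_real (r (Im z)) * \<psi> a" for z
  define qy where "qy z = py z - of_real (r' (Im z)) * \<psi> a" for z
  have rd: "((\<lambda>z. r (Im z)) has_derivative (\<lambda>v. Im v * r' (Im z))) (at z)" for z
    by (rule DERIV_compose_FDERIV[OF r]) (auto intro!: derivative_eq_intros)
  have \<phi>d: "(\<phi> has_derivative (\<lambda>v. Re v *\<^sub>R px z + Im v *\<^sub>R qy z)) (at z)" for z
    unfolding \<phi>_def
    by (rule has_derivative_eq_rhs[OF has_derivative_diff[OF d has_derivative_mult_left[OF has_derivative_of_real[OF rd]]]])
      (auto simp: qy_def fun_eq_iff scaleR_conv_of_real algebra_simps)
  have rcI: "continuous_on UNIV (\<lambda>z. r' (Im z))"
    by (intro continuous_on_compose2[OF rc] continuous_intros) auto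
  have qc: "continuous_on UNIV qy"
    unfolding qy_def by (intro continuous_intros c rcI)
  have z: "(LINT z:strip|lborel. blob 0 (z - a) * (px z + \<i> * qy z)) = 0"
    by (rule cauchy_pompeiu_vanishing[OF \<phi>d c(1) qc, where R = Q])
      (use per R in \<open>auto simp: \<phi>_def x_periodic_def supp rs ra Q_def\<close>)
  have int: "set_integrable lborel strip (\<lambda>z. blob 0 (z - a) * f z)"
    if f: "continuous_on UNIV f" "\<And>z. Q < \<bar>Im z\<bar> \<Longrightarrow> f z = 0" for f
  proof -
    have aQ: "a \<in> slab Q" "0 \<le> Q" using R by (auto simp: slab_def Q_def)
    have "compact (cbox (Complex (-pi) (-Q)) (Complex pi Q))" by simp
    then have "bounded (f ` cbox (Complex (-pi) (-Q)) (Complex pi Q))"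
      by (intro compact_imp_bounded compact_continuous_image continuous_on_subset[OF f(1)]) auto
    then obtain B where "\<forall>x\<in>f ` cbox (Complex (-pi) (-Q)) (Complex pi Q). norm x \<le> B"
      unfolding bounded_iff by blast
    then have B: "norm (f z) \<le> B" if "z \<in> slab Q" for z
    proof -
      have "z \<in> cbox (Complex (-pi) (-Q)) (Complex pi Q)"
        using that by (simp add: slab_def in_cbox_complex_iff abs_le_iff)
      then show ?thesis using \<open>\<forall>x\<in>_. norm x \<le> B\<close> by simp
    qed
    have B0: "0 \<le> B" using order_trans[OF norm_ge_zero B[OF aQ(1)]] .
    have [measurable]: "f \<in> borel_measurable borel" using f(1) by (rule borel_measurable_continuous_onI)
    show ?thesis unfolding set_integrable_def
    proof (rule Bochner_Integration.integrable_bound)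
      show "integrable lborel (\<lambda>z. (sqrt (2 * cosh (2 * Q)) * B) * (indicator (slab Q) z * (1 / sqrt (denom (z - a)))))"
        by (intro integrable_mult_right integrable_denom aQ)
      show "AE z in lborel. norm (indicator strip z *\<^sub>R (blob 0 (z - a) * f z))
        \<le> norm ((sqrt (2 * cosh (2 * Q)) * B) * (indicator (slab Q) z * (1 / sqrt (denom (z - a)))))"
      proof (rule AE_I2)
        fix z
        show "norm (indicator strip z *\<^sub>R (blob 0 (z - a) * f z))
        \<le> norm ((sqrt (2 * cosh (2 * Q)) * B) * (indicator (slab Q) z * (1 / sqrt (denom (z - a)))))"
        proof (cases "z \<in> strip \<and> \<not> Q < \<bar>Im z\<bar>")
          case True
          then have zs: "z \<in> slab Q" by (auto simp: slab_def strip_def)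
          have "cosh \<bar>Im (z - a)\<bar> \<le> cosh (2 * Q)"
            using zs aQ by (subst cosh_real_nonneg_le_iff) (auto simp: slab_def)
          then have ch: "cosh (Im (z - a)) \<le> cosh (2 * Q)" by (simp only: cosh_real_abs)
          have "norm (blob 0 (z - a)) \<le> sqrt (2 * cosh (Im (z - a))) * (1 / sqrt (denom (z - a)))"
            using norm_blob_le(1)[of 0 "z - a"] by simp
          also have "\<dots> \<le> sqrt (2 * cosh (2 * Q)) * (1 / sqrt (denom (z - a)))"
            using ch denom_nonneg[of "z - a"] by (intro mult_right_mono) (simp_all only: real_sqrt_le_iff, simp_all)
          finally have "norm (blob 0 (z - a)) * norm (f z) \<le> sqrt (2 * cosh (2 * Q)) * (1 / sqrt (denom (z - a))) * B"
            by (rule mult_mono[OF _ B[OF zs]]) (simp_all add: denom_nonneg)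
          then show ?thesis using True zs B0 by (simp add: norm_mult mult_ac denom_nonneg)
        next
          case False
          then have n: "norm (indicator strip z *\<^sub>R (blob 0 (z - a) * f z)) = 0" using f(2) by auto
          show ?thesis unfolding n by simp
        qed
      qed
    qed measurable
  qed
  show "set_integrable lborel strip (\<lambda>z. blob 0 (z - a) * (px z + \<i> * py z))"
    by (rule int) (use partials_vanish[OF d supp] in \<open>auto intro!: continuous_intros c simp: Q_def\<close>)
  have i1: "set_integrable lborel strip (\<lambda>z. blob 0 (z - a) * (px z + \<i> * qy z))"
    by (rule int) (use partials_vanish[OF d supp] rs in \<open>auto intro!: continuous_intros c rcI simp: Q_def qy_def\<close>)
  have i2: "set_integrable lborel strip (\<lambda>z. blob 0 (z - a) * (\<i> * \<psi> a * of_real (r' (Im z))))"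
    by (rule int) (use rs in \<open>auto intro!: continuous_intros rcI simp: Q_def\<close>)
  have "(LINT z:strip|lborel. blob 0 (z - a) * (px z + \<i> * py z))
      = (LINT z:strip|lborel. blob 0 (z - a) * (px z + \<i> * qy z) + blob 0 (z - a) * (\<i> * \<psi> a * of_real (r' (Im z))))"
    by (simp add: qy_def algebra_simps)
  also have "\<dots> = (LINT z:strip|lborel. blob 0 (z - a) * (\<i> * \<psi> a * of_real (r' (Im z))))"
    using set_integral_add(2)[OF i1 i2] z by simp
  also have "\<dots> = (\<integral>y. \<integral>x. indicator strip (Complex x y) *\<^sub>R (blob 0 (Complex x y - a) * (\<i> * \<psi> a * of_real (r' y))) \<partial>lborel \<partial>lborel)"
    using integral_complex(2)[OF i2[unfolded set_integrable_def]] by (simp add: set_lebesgue_integral_def)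
  \<comment> \<open>A row gives \<open>- (2 * pi * \<i> * sgn (y - Im a))\<close> times
    \<open>\<i> * \<psi> a * r' y\<close>. The integral over the rows then contributes
    \<open>- 2\<close>, whence the constant \<open>- 4 * pi\<close>.\<close>
  also have "\<dots> = (\<integral>y. (2 * pi * \<psi> a) * of_real (r' y * sgn (y - Im a)) \<partial>lborel)"
  proof (rule integral_cong_AE)
    show "AE y in lborel. (\<integral>x. indicator strip (Complex x y) *\<^sub>R (blob 0 (Complex x y - a) * (\<i> * \<psi> a * of_real (r' y))) \<partial>lborel)
       = (2 * pi * \<psi> a) * of_real (r' y * sgn (y - Im a))"
      using AE_lborel_singleton[of "Im a"]
    proof eventually_elim
      case (elim y)
      have "(\<integral>x. indicator strip (Complex x y) *\<^sub>R (blob 0 (Complex x y - a) * (\<i> * \<psi> a * of_real (r' y))) \<partial>lborel)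
         = (\<integral>x. (indicator {-pi<..<pi} x *\<^sub>R blob 0 (Complex x y - a)) * (\<i> * \<psi> a * of_real (r' y)) \<partial>lborel)"
        by (rule Bochner_Integration.integral_cong) (auto simp: strip_def indicator_def)
      also have "\<dots> = (\<integral>x. indicator {-pi<..<pi} x *\<^sub>R blob 0 (Complex x y - a) \<partial>lborel) * (\<i> * \<psi> a * of_real (r' y))"
        by (rule integral_mult_left_zero)
      also have "(\<integral>x. indicator {-pi<..<pi} x *\<^sub>R blob 0 (Complex x y - a) \<partial>lborel)
          = (\<integral>x. indicator {-pi..pi} x *\<^sub>R blob 0 (Complex x y - a) \<partial>lborel)"
        by (rule LBINT_open_interval_eq) measurable
      also have "\<dots> = - (2 * pi * \<i> * sgn (y - Im a))" by (rule cot_row_integral[OF elim])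
      finally show ?case by (simp add: complex_eq_iff)
    qed
    have [measurable]: "r' \<in> borel_measurable borel" using rc by (rule borel_measurable_continuous_onI)
    show "(\<lambda>y. (2 * pi * \<psi> a) * complex_of_real (r' y * sgn (y - Im a))) \<in> borel_measurable lborel"
      unfolding sgn_if by measurable
    show "(\<lambda>y. \<integral>x. indicator strip (Complex x y) *\<^sub>R (blob 0 (Complex x y - a) * (\<i> * \<psi> a * of_real (r' y))) \<partial>lborel) \<in> borel_measurable lborel"
      by measurable
  qed
  also have "\<dots> = (2 * pi * \<psi> a) * of_real (\<integral>y. r' y * sgn (y - Im a) \<partial>lborel)"
    by (simp only: integral_mult_right_zero integral_complex_of_real)
  also have "(\<integral>y. r' y * sgn (y - Im a) \<partial>lborel) = - 2"
    by (rule cutoff_integral[OF r rc, of "2 * S"]) (use rs ra in auto)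
  finally show "(LINT z:strip|lborel. blob 0 (z - a) * (px z + \<i> * py z)) = - 4 * pi * \<psi> a" by simp
qed

section \<open>The nonlinearity of a vortex sheet\<close>

text \<open>Polymorphic in the values of \<open>F\<close>, so that velocity, stream function and
  their derivatives in space and time are all instances, for suitable kernels and weights.\<close>

definition sheet_conv :: "(real \<Rightarrow> real) \<Rightarrow> (real \<Rightarrow> real) \<Rightarrow> (complex \<Rightarrow> 'b::{banach,second_countable_topology}) \<Rightarrow> complex \<Rightarrow> 'b" where
  "sheet_conv h g F z = (LINT \<alpha>:{-pi..pi}|lborel. g \<alpha> *\<^sub>R F (z - Complex \<alpha> (h \<alpha>)))"

text \<open>A vertical line meets the graph in a single point, so Tonelli gives measure
  \<open>0\<close>.\<close>

lemma AE_off_graph: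
  assumes [measurable]: "h \<in> borel_measurable borel"
  shows "AE z in lborel. Im z \<noteq> h (Re z)"
proof -
  have "(\<integral>\<^sup>+z. indicator {z. Im z = h (Re z)} z \<partial>lborel)
      = (\<integral>\<^sup>+x. \<integral>\<^sup>+y. indicator {h x} y \<partial>lborel \<partial>lborel)"
  proof -
    have "(indicator {z. Im z = h (Re z)} (Complex x y) :: ennreal) = indicator {h x} y" for x y
      by (simp add: indicator_def)
    then show ?thesis by (subst nn_integral_complex) simp_all
  qed
  also have "\<dots> = 0" by simp
  finally have "{z. Im z = h (Re z)} \<in> null_sets lborel" by (auto simp: null_sets_def)
  then show ?thesis by (rule AE_I'[of "{z. Im z = h (Re z)}"]) auto
qed

lemma denom_eq_0: "denom w = 0 \<longleftrightarrow> sin (w / 2) = 0"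
proof -
  have "sin (w / 2) * cnj (sin (w / 2)) = of_real (denom w) / 2"
  proof -
    have s: "w / 2 + cnj (w / 2) = of_real (Re w)" "w / 2 - cnj (w / 2) = \<i> * of_real (Im w)"
      by (auto simp: complex_eq_iff)
    have "cos (\<i> * of_real (Im w)) = of_real (cosh (Im w))"
      using cosh_conv_cos[of "of_real (Im w)"] by (simp add: cosh_field_def flip: exp_of_real)
    then have "sin (w / 2) * sin (cnj (w / 2)) = (of_real (cosh (Im w)) - of_real (cos (Re w))) / 2"
      unfolding sin_times_sin s by (simp flip: cos_of_real)
    then show ?thesis by (simp add: cnj_sin denom_def)
  qed
  then show ?thesis by (metis complex_cnj_zero_iff div_0 divide_eq_0_iff mult_eq_0_iff of_real_eq_0_iff zero_neq_numeral)
qed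

lemma blob_product:
  assumes "denom (z - a) \<noteq> 0" "denom (z - b) \<noteq> 0" "denom (b - a) \<noteq> 0"
  shows "blob 0 (z - a) * blob 0 (z - b) = blob 0 (b - a) * (blob 0 (z - b) - blob 0 (z - a)) - 1"
proof -
  have e: "(z - a) / 2 - (z - b) / 2 = (b - a) / 2" by (simp add: field_simps)
  show ?thesis
    using cot_mult_cot[of "(z - a) / 2" "(z - b) / 2"] assms
    unfolding e cot_half denom_eq_0 by blast
qed

lemma denom_pos:
  assumes "\<bar>Re w\<bar> < 2 * pi" "w \<noteq> 0"
  shows "0 < denom w"
proof -
  have "denom w \<noteq> 0"
  proof
    assume "denom w = 0"
    then have "cosh (Im w) = cos (Re w)" by (simp add: denom_def)
    then have "cosh (Im w) = 1" "cos (Re w) = 1"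
      using cosh_real_ge_1[of "Im w"] cos_le_one[of "Re w"] by linarith+
    then have "Im w = 0" by simp
    moreover obtain n :: int where n: "Re w = of_int n * 2 * pi"
      using \<open>cos (Re w) = 1\<close> cos_one_2pi_int by auto
    have "n = 0"
    proof (rule ccontr)
      assume "n \<noteq> 0"
      then have "1 \<le> \<bar>n\<bar>" by simp
      then have "1 * (2 * pi) \<le> \<bar>real_of_int n\<bar> * (2 * pi)" by (intro mult_right_mono) auto
      then show False using assms(1) n by (simp add: abs_mult)
    qed
    ultimately show False using assms(2) n by (simp add: complex_eq_iff)
  qed
  then show ?thesis using denom_nonneg[of w] by linarith
qed

text \<open>A sheet frozen at one instant. \<open>R\<close> and \<open>G\<close> are parameters and
  not suprema, so that the same values can serve all times.\<close>

locale sheet =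
  fixes h g :: "real \<Rightarrow> real" and R G :: real
  assumes h_cont: "continuous_on UNIV h" and g_cont: "continuous_on UNIV g"
    and h_per: "h (\<alpha> + 2 * pi) = h \<alpha>" and g_per: "g (\<alpha> + 2 * pi) = g \<alpha>"
    and h_le: "\<bar>h \<alpha>\<bar> \<le> R" and g_le: "\<bar>g \<alpha>\<bar> \<le> G"
begin

definition zeta :: "real \<Rightarrow> complex" where "zeta \<alpha> = Complex \<alpha> (h \<alpha>)"

abbreviation I :: "real set" where "I \<equiv> {-pi..pi}"

lemma h_meas [measurable]: "h \<in> borel_measurable borel"
  using h_cont by (rule borel_measurable_continuous_onI)

lemma g_meas [measurable]: "g \<in> borel_measurable borel"
  using g_cont by (rule borel_measurable_continuous_onI)

lemma zeta_meas [measurable]: "zeta \<in> borel_measurable borel"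
  unfolding zeta_def by measurable

lemma zeta_cont: "continuous_on S zeta"
  unfolding zeta_def Complex_eq by (intro continuous_intros continuous_on_subset[OF h_cont]) auto

lemma R_nonneg: "0 \<le> R" using h_le[of 0] by linarith

lemma G_nonneg: "0 \<le> G" using g_le[of 0] by linarith

lemma zeta_slab: "\<alpha> \<in> I \<Longrightarrow> R \<le> S \<Longrightarrow> zeta \<alpha> \<in> slab S"
  using h_le[of \<alpha>] by (auto simp: zeta_def slab_def)

text \<open>On a slab of bounded height this is, up to a constant, one majorant for all kernels
  \<open>blob e\<close> with \<open>0 \<le> e\<close>.\<close>

definition kern :: "complex \<Rightarrow> real \<Rightarrow> real" where
  "kern z \<alpha> = indicator I \<alpha> * (1 / sqrt (denom (z - zeta \<alpha>)))"

lemma kern_nonneg: "0 \<le> kern z \<alpha>" by (simp add: kern_def denom_nonneg)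

lemma strip_diff: "z \<in> strip \<Longrightarrow> \<alpha> \<in> I \<Longrightarrow> \<bar>Re (z - zeta \<alpha>)\<bar> < 2 * pi"
  by (auto simp: strip_def zeta_def abs_less_iff)

lemma kern_meas1 [measurable]: "kern z \<in> borel_measurable borel"
  unfolding kern_def by measurable

lemma kern_meas [measurable]: "(\<lambda>p. kern (fst p) (snd p)) \<in> borel_measurable (lborel \<Otimes>\<^sub>M lborel)"
  unfolding kern_def by measurable

lemma kern_integrable:
  assumes S: "R \<le> S"
  shows "integrable (lborel \<Otimes>\<^sub>M lborel) (\<lambda>(z, \<alpha>). indicator (slab S) z * kern z \<alpha>)"
proof (rule integrableI_nonneg)
  have S0: "0 \<le> S" using S R_nonneg by linarith
  obtain C where C: "0 \<le> C" "\<And>a. a \<in> slab S \<Longrightarrow> (\<integral>\<^sup>+z. indicator (slab S) z * ennreal (denom (z - a) powr - (1/2)) \<partial>lborel) \<le> ennreal C"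
    using denom_integrable[OF S0] by blast
  have "(\<integral>\<^sup>+p. ennreal (case p of (z, \<alpha>) \<Rightarrow> indicator (slab S) z * kern z \<alpha>) \<partial>(lborel \<Otimes>\<^sub>M lborel))
     = (\<integral>\<^sup>+\<alpha>. \<integral>\<^sup>+z. ennreal (indicator (slab S) z * kern z \<alpha>) \<partial>lborel \<partial>lborel)"
    by (subst lborel_pair.nn_integral_snd[symmetric]) (auto simp: case_prod_beta')
  also have "\<dots> \<le> (\<integral>\<^sup>+\<alpha>. indicator I \<alpha> * ennreal C \<partial>lborel)"
  proof (rule nn_integral_mono)
    fix \<alpha> :: real
    show "(\<integral>\<^sup>+z. ennreal (indicator (slab S) z * kern z \<alpha>) \<partial>lborel) \<le> indicator I \<alpha> * ennreal C"
    proof (cases "\<alpha> \<in> I")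
      case True
      have "(\<integral>\<^sup>+z. ennreal (indicator (slab S) z * kern z \<alpha>) \<partial>lborel)
          = (\<integral>\<^sup>+z. indicator (slab S) z * ennreal (denom (z - zeta \<alpha>) powr - (1/2)) \<partial>lborel)"
        using True by (intro nn_integral_cong) (simp add: kern_def powr_minus_half denom_nonneg indicator_def)
      then show ?thesis using C(2)[OF zeta_slab[OF True S]] True by simp
    qed (simp add: kern_def)
  qed
  also have "\<dots> < \<infinity>" by (simp add: nn_integral_multc ennreal_mult_less_top)
  finally show "(\<integral>\<^sup>+p. ennreal (case p of (z, \<alpha>) \<Rightarrow> indicator (slab S) z * kern z \<alpha>) \<partial>(lborel \<Otimes>\<^sub>M lborel)) < \<infinity>" .
qed (auto simp: kern_nonneg case_prod_beta')

lemma kern_nn_integral: "(\<integral>\<^sup>+\<alpha>. ennreal (kern z \<alpha>) \<partial>lborel)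
   = (\<integral>\<^sup>+\<alpha>. indicator {-pi..pi} \<alpha> * ennreal (denom (z - Complex \<alpha> (h \<alpha>)) powr - (1/2)) \<partial>lborel)"
  by (rule nn_integral_cong) (simp add: kern_def zeta_def powr_minus_half denom_nonneg indicator_def)

lemma kern_square_finite:
  assumes S: "R \<le> S"
  shows "(\<integral>\<^sup>+z. indicator (slab S) z * (\<integral>\<^sup>+\<alpha>. ennreal (kern z \<alpha>) \<partial>lborel)\<^sup>2 \<partial>lborel) < \<infinity>"
  unfolding kern_nn_integral
  by (rule sheet_potential_square_integrable[OF h_meas]) (use h_le S order_trans in blast)

text \<open>By Tonelli this is the squared potential of \<open>kern_square_finite\<close>. It
  licenses the exchange of the integral over the plane with the double integral over the sheet in
  the quadratic term.\<close>

lemma kern_kern_integrable: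
  assumes S: "R \<le> S"
  shows "integrable (lborel \<Otimes>\<^sub>M (lborel :: (real \<times> real) measure))
    (\<lambda>(z, p). indicator (slab S) z * (kern z (fst p) * kern z (snd p)))"
proof (rule integrableI_nonneg)
  have "(\<integral>\<^sup>+q. ennreal (case q of (z, p) \<Rightarrow> indicator (slab S) z * (kern z (fst p) * kern z (snd p)))
       \<partial>(lborel \<Otimes>\<^sub>M (lborel :: (real \<times> real) measure)))
     = (\<integral>\<^sup>+z. \<integral>\<^sup>+p. ennreal (indicator (slab S) z * (kern z (fst p) * kern z (snd p))) \<partial>lborel \<partial>lborel)"
    by (subst lborel.nn_integral_fst[symmetric]) (auto simp: case_prod_beta' lborel_prod[symmetric] kern_def)
  also have "\<dots> = (\<integral>\<^sup>+z. indicator (slab S) z * (\<integral>\<^sup>+\<alpha>. ennreal (kern z \<alpha>) \<partial>lborel)\<^sup>2 \<partial>lborel)"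
  proof (rule nn_integral_cong)
    fix z
    have "(\<integral>\<^sup>+p. ennreal (indicator (slab S) z * (kern z (fst p) * kern z (snd p))) \<partial>(lborel :: (real \<times> real) measure))
      = (\<integral>\<^sup>+\<alpha>. \<integral>\<^sup>+\<beta>. indicator (slab S) z * (ennreal (kern z \<alpha>) * ennreal (kern z \<beta>)) \<partial>lborel \<partial>lborel)"
    proof -
      have pw: "ennreal (indicator (slab S) z * (a * b)) = indicator (slab S) z * (ennreal a * ennreal b)"
        if "0 \<le> a" for a b
        using that by (cases "z \<in> slab S") (simp_all add: ennreal_mult')
      show ?thesis unfolding lborel_prod[symmetric]
        by (subst lborel.nn_integral_fst[symmetric]) (simp_all add: pw kern_nonneg)
    qed
    also have "\<dots> = indicator (slab S) z * (\<integral>\<^sup>+\<alpha>. ennreal (kern z \<alpha>) \<partial>lborel)\<^sup>2"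
      by (simp add: nn_integral_cmult nn_integral_multc power2_eq_square kern_def)
    finally show "(\<integral>\<^sup>+p. ennreal (indicator (slab S) z * (kern z (fst p) * kern z (snd p))) \<partial>(lborel :: (real \<times> real) measure))
      = indicator (slab S) z * (\<integral>\<^sup>+\<alpha>. ennreal (kern z \<alpha>) \<partial>lborel)\<^sup>2" .
  qed
  also note kern_square_finite[OF S]
  finally show "(\<integral>\<^sup>+q. ennreal (case q of (z, p) \<Rightarrow> indicator (slab S) z * (kern z (fst p) * kern z (snd p)))
       \<partial>(lborel \<Otimes>\<^sub>M (lborel :: (real \<times> real) measure))) < \<infinity>" .
  show "(\<lambda>(z, p). indicator (slab S) z * (kern z (fst p) * kern z (snd p)))
     \<in> borel_measurable (lborel \<Otimes>\<^sub>M (lborel :: (real \<times> real) measure))"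
    unfolding lborel_prod[symmetric] kern_def by measurable
qed (auto simp: kern_nonneg case_prod_beta' intro!: mult_nonneg_nonneg)

lemma norm_blob_le_kern:
  assumes "z \<in> slab S" "R \<le> S" "0 \<le> e"
  shows "norm (indicator I \<alpha> *\<^sub>R (g \<alpha> *\<^sub>R blob e (z - zeta \<alpha>))) \<le> (G * sqrt (2 * cosh (2 * S))) * kern z \<alpha>"
proof (cases "\<alpha> \<in> I")
  case True
  have "cosh \<bar>Im (z - zeta \<alpha>)\<bar> \<le> cosh (2 * S)"
    using assms h_le[of \<alpha>] by (subst cosh_real_nonneg_le_iff) (auto simp: slab_def zeta_def)
  then have ch: "cosh (Im (z - zeta \<alpha>)) \<le> cosh (2 * S)" by (simp only: cosh_real_abs)
  have "norm (blob e (z - zeta \<alpha>)) \<le> sqrt (2 * cosh (Im (z - zeta \<alpha>))) * (1 / sqrt (denom (z - zeta \<alpha>)))"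
    by (rule norm_blob_le(1)[OF assms(3)])
  also have "\<dots> \<le> sqrt (2 * cosh (2 * S)) * (1 / sqrt (denom (z - zeta \<alpha>)))"
    using ch denom_nonneg[of "z - zeta \<alpha>"] by (intro mult_right_mono) (simp_all only: real_sqrt_le_iff, simp_all)
  finally have "\<bar>g \<alpha>\<bar> * norm (blob e (z - zeta \<alpha>)) \<le> G * (sqrt (2 * cosh (2 * S)) * (1 / sqrt (denom (z - zeta \<alpha>))))"
    by (intro mult_mono g_le) (auto simp: G_nonneg)
  then show ?thesis using True by (simp add: kern_def mult_ac)
qed (simp add: kern_def)

lemma linear_integrable:
  fixes \<Theta> :: "complex \<Rightarrow> complex"
  assumes \<Theta>[measurable]: "\<Theta> \<in> borel_measurable borel" and B: "\<And>z. norm (\<Theta> z) \<le> B"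
    and supp: "\<And>z. S < \<bar>Im z\<bar> \<Longrightarrow> \<Theta> z = 0" and S: "R \<le> S"
  shows "integrable (lborel \<Otimes>\<^sub>M lborel) (\<lambda>(z, \<alpha>). (indicator strip z *\<^sub>R \<Theta> z) * (indicator I \<alpha> *\<^sub>R (g \<alpha> *\<^sub>R blob 0 (z - zeta \<alpha>))))"
proof (rule Bochner_Integration.integrable_bound)
  show "integrable (lborel \<Otimes>\<^sub>M lborel) (\<lambda>q. (B * (G * sqrt (2 * cosh (2 * S)))) * (case q of (z, \<alpha>) \<Rightarrow> indicator (slab S) z * kern z \<alpha>))"
    by (rule integrable_mult_right[OF kern_integrable[OF S]])
  show "AE q in lborel \<Otimes>\<^sub>M lborel. norm (case q of (z, \<alpha>) \<Rightarrow> (indicator strip z *\<^sub>R \<Theta> z) * (indicator I \<alpha> *\<^sub>R (g \<alpha> *\<^sub>R blob 0 (z - zeta \<alpha>))))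
    \<le> norm ((B * (G * sqrt (2 * cosh (2 * S)))) * (case q of (z, \<alpha>) \<Rightarrow> indicator (slab S) z * kern z \<alpha>))"
  proof (rule AE_I2, clarify)
    fix z \<alpha>
    show "norm ((indicator strip z *\<^sub>R \<Theta> z) * (indicator I \<alpha> *\<^sub>R (g \<alpha> *\<^sub>R blob 0 (z - zeta \<alpha>))))
     \<le> norm ((B * (G * sqrt (2 * cosh (2 * S)))) * (indicator (slab S) z * kern z \<alpha>))"
    proof (cases "z \<in> strip \<and> \<not> S < \<bar>Im z\<bar>")
      case True
      then have zs: "z \<in> slab S" by (auto simp: slab_def strip_def)
      have "norm (\<Theta> z) * norm (indicator I \<alpha> *\<^sub>R (g \<alpha> *\<^sub>R blob 0 (z - zeta \<alpha>))) \<le> B * ((G * sqrt (2 * cosh (2 * S))) * kern z \<alpha>)"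
        by (intro mult_mono B norm_blob_le_kern zs S order_trans[OF norm_ge_zero B]) auto
      then show ?thesis using True zs by (simp only: norm_mult) (simp add: mult_ac abs_of_nonneg[OF kern_nonneg] order_trans[OF norm_ge_zero B] G_nonneg)
    next
      case False
      then have n: "norm ((indicator strip z *\<^sub>R \<Theta> z) * (indicator I \<alpha> *\<^sub>R (g \<alpha> *\<^sub>R blob 0 (z - zeta \<alpha>)))) = 0"
        using supp by auto
      show ?thesis unfolding n by simp
    qed
  qed
qed measurable

lemma sheet_conv_zeta: "sheet_conv h g F z = (\<integral>\<alpha>. indicator I \<alpha> *\<^sub>R (g \<alpha> *\<^sub>R F (z - zeta \<alpha>)) \<partial>lborel)"
  by (simp add: sheet_conv_def set_lebesgue_integral_def zeta_def)

lemma bounded_continuous_slab: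
  fixes f :: "complex \<Rightarrow> complex"
  assumes "continuous_on UNIV f" "\<And>z. S < \<bar>Im z\<bar> \<Longrightarrow> f z = 0"
  shows "\<exists>B. \<forall>z. norm (indicator (slab S) z *\<^sub>R f z) \<le> B"
proof -
  have "compact (cbox (Complex (-pi) (-S)) (Complex pi S))" by simp
  then have "bounded (f ` cbox (Complex (-pi) (-S)) (Complex pi S))"
    by (intro compact_imp_bounded compact_continuous_image continuous_on_subset[OF assms(1)]) auto
  then obtain B where B: "\<forall>x\<in>f ` cbox (Complex (-pi) (-S)) (Complex pi S). norm x \<le> B"
    unfolding bounded_iff by blast
  have "norm (indicator (slab S) z *\<^sub>R f z) \<le> \<bar>B\<bar>" for z
  proof (cases "z \<in> slab S")
    case True
    then have "z \<in> cbox (Complex (-pi) (-S)) (Complex pi S)"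
      by (simp add: slab_def in_cbox_complex_iff abs_le_iff)
    then show ?thesis using B True by fastforce
  qed simp
  then show ?thesis by blast
qed

end

locale sheet_test = sheet +
  fixes \<psi> px py :: "complex \<Rightarrow> complex" and S :: real
  assumes d: "\<And>z. (\<psi> has_derivative (\<lambda>v. Re v *\<^sub>R px z + Im v *\<^sub>R py z)) (at z)"
    and c: "continuous_on UNIV px" "continuous_on UNIV py"
    and per: "x_periodic \<psi>" and supp: "\<And>z. S < \<bar>Im z\<bar> \<Longrightarrow> \<psi> z = 0" and S: "R \<le> S"
begin

text \<open>Twice the Wirtinger derivative with respect to the conjugate variable, the density in
  the Cauchy--Pompeiu formula.\<close>

definition \<Theta> :: "complex \<Rightarrow> complex" where "\<Theta> z = px z + \<i> * py z"

text \<open>Indistinguishable from \<Theta> on the strip, but bounded on the whole plane by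
  compactness alone.\<close>

definition \<Theta>' :: "complex \<Rightarrow> complex" where "\<Theta>' z = indicator (slab S) z *\<^sub>R \<Theta> z"

lemma \<Theta>_cont: "continuous_on UNIV \<Theta>"
  unfolding \<Theta>_def by (intro continuous_intros c)

lemma \<psi>_cont: "continuous_on A \<psi>"
  using has_derivative_continuous[OF d] by (auto intro: continuous_at_imp_continuous_on)

lemma \<Theta>_meas [measurable]: "\<Theta> \<in> borel_measurable borel" "\<Theta>' \<in> borel_measurable borel"
  unfolding \<Theta>'_def using borel_measurable_continuous_onI[OF \<Theta>_cont] by measurable

lemma \<Theta>_supp: "S < \<bar>Im z\<bar> \<Longrightarrow> \<Theta> z = 0"
  using partials_vanish[OF d supp] by (simp add: \<Theta>_def)

lemma \<Theta>'_eq: "indicator strip z *\<^sub>R \<Theta>' z = indicator strip z *\<^sub>R \<Theta> z"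
  using \<Theta>_supp[of z] by (cases "S < \<bar>Im z\<bar>") (auto simp: \<Theta>'_def slab_def strip_def indicator_def)

lemma \<Theta>'_bounded: "\<exists>B. \<forall>z. norm (\<Theta>' z) \<le> B"
  using bounded_continuous_slab[OF \<Theta>_cont \<Theta>_supp] unfolding \<Theta>'_def by blast

lemma \<Theta>'_supp: "S < \<bar>Im z\<bar> \<Longrightarrow> \<Theta>' z = 0"
  by (simp add: \<Theta>'_def \<Theta>_supp)

text \<open>The vanishing mean is what removes the constant \<open>- 1\<close> of the cotangent
  addition theorem from the quadratic term.\<close>

lemma \<Theta>_integral_0:
  "(\<integral>z. indicator strip z *\<^sub>R \<Theta> z \<partial>lborel) = 0" "integrable lborel (\<lambda>z. indicator strip z *\<^sub>R \<Theta> z)"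
proof -
  have "(LINT z:strip|lborel. px z) = 0" "(LINT z:strip|lborel. py z) = 0"
    "set_integrable lborel strip px" "set_integrable lborel strip py"
    by (rule strip_divergence_theorem[OF d c per], rule supp, assumption)+
  note D = this[unfolded set_lebesgue_integral_def set_integrable_def]
  have e: "(\<lambda>z. indicator strip z *\<^sub>R \<Theta> z) = (\<lambda>z. indicator strip z *\<^sub>R px z + \<i> * (indicator strip z *\<^sub>R py z))"
    by (simp add: \<Theta>_def scaleR_conv_of_real algebra_simps fun_eq_iff)
  show "(\<integral>z. indicator strip z *\<^sub>R \<Theta> z \<partial>lborel) = 0" "integrable lborel (\<lambda>z. indicator strip z *\<^sub>R \<Theta> z)"
    unfolding e using D by (simp_all only: Bochner_Integration.integral_add Bochner_Integration.integrable_add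
        integral_mult_right_zero integrable_mult_right mult_zero_right add_0_left)
qed

lemma cauchy_pompeiu_sheet:
  assumes "\<alpha> \<in> I"
  shows "(\<integral>z. (indicator strip z *\<^sub>R \<Theta>' z) * blob 0 (z - zeta \<alpha>) \<partial>lborel) = - 4 * pi * \<psi> (zeta \<alpha>)"
    "integrable lborel (\<lambda>z. (indicator strip z *\<^sub>R \<Theta>' z) * blob 0 (z - zeta \<alpha>))"
proof -
  have "\<bar>Re (zeta \<alpha>)\<bar> \<le> pi" using assms by (auto simp: zeta_def)
  note cauchy_pompeiu_strip[OF d c per supp this]
  then show "(\<integral>z. (indicator strip z *\<^sub>R \<Theta>' z) * blob 0 (z - zeta \<alpha>) \<partial>lborel) = - 4 * pi * \<psi> (zeta \<alpha>)"
    "integrable lborel (\<lambda>z. (indicator strip z *\<^sub>R \<Theta>' z) * blob 0 (z - zeta \<alpha>))"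
    unfolding \<Theta>'_eq by (auto simp: set_lebesgue_integral_def set_integrable_def \<Theta>_def mult.commute)
qed

text \<open>After Fubini the integral over the plane is evaluated by Cauchy--Pompeiu at each point
  of the sheet.\<close>

lemma linear_identity:
  "(LINT z:strip|lborel. sheet_conv h g (blob 0) z * \<Theta> z) = - 4 * pi * (LINT \<alpha>:I|lborel. g \<alpha> *\<^sub>R \<psi> (zeta \<alpha>))"
proof -
  obtain B where B: "\<And>z. norm (\<Theta>' z) \<le> B" using \<Theta>'_bounded by blast
  have "(LINT z:strip|lborel. sheet_conv h g (blob 0) z * \<Theta> z)
     = (\<integral>z. \<integral>\<alpha>. (indicator strip z *\<^sub>R \<Theta>' z) * (indicator I \<alpha> *\<^sub>R (g \<alpha> *\<^sub>R blob 0 (z - zeta \<alpha>))) \<partial>lborel \<partial>lborel)"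
    unfolding integral_mult_right_zero \<Theta>'_eq by (simp add: sheet_conv_zeta set_lebesgue_integral_def mult.commute)
  also have "\<dots> = (\<integral>\<alpha>. \<integral>z. (indicator strip z *\<^sub>R \<Theta>' z) * (indicator I \<alpha> *\<^sub>R (g \<alpha> *\<^sub>R blob 0 (z - zeta \<alpha>))) \<partial>lborel \<partial>lborel)"
    by (rule lborel_pair.Fubini_integral[OF linear_integrable[OF \<Theta>_meas(2) B \<Theta>'_supp S], symmetric])
  also have "\<dots> = (\<integral>\<alpha>. - 4 * pi * (indicator I \<alpha> *\<^sub>R (g \<alpha> *\<^sub>R \<psi> (zeta \<alpha>))) \<partial>lborel)"
  proof (rule Bochner_Integration.integral_cong[OF refl])
    fix \<alpha>
    have e: "(\<integral>z. (indicator strip z *\<^sub>R \<Theta>' z) * (indicator I \<alpha> *\<^sub>R (g \<alpha> *\<^sub>R blob 0 (z - zeta \<alpha>))) \<partial>lborel)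
       = indicator I \<alpha> *\<^sub>R (g \<alpha> *\<^sub>R (\<integral>z. (indicator strip z *\<^sub>R \<Theta>' z) * blob 0 (z - zeta \<alpha>) \<partial>lborel))"
      by (simp only: mult_scaleR_right integral_scaleR_right)
    show "(\<integral>z. (indicator strip z *\<^sub>R \<Theta>' z) * (indicator I \<alpha> *\<^sub>R (g \<alpha> *\<^sub>R blob 0 (z - zeta \<alpha>))) \<partial>lborel)
      = - 4 * pi * (indicator I \<alpha> *\<^sub>R (g \<alpha> *\<^sub>R \<psi> (zeta \<alpha>)))"
    proof (cases "\<alpha> \<in> I")
      case True
      show ?thesis unfolding e cauchy_pompeiu_sheet(1)[OF True] by (simp add: scaleR_conv_of_real)
    qed simp
  qed
  also have "\<dots> = - 4 * pi * (LINT \<alpha>:I|lborel. g \<alpha> *\<^sub>R \<psi> (zeta \<alpha>))"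
    by (simp only: integral_mult_right_zero set_lebesgue_integral_def)
  finally show ?thesis .
qed

lemma quadratic_integrable:
  "integrable (lborel \<Otimes>\<^sub>M (lborel :: (real \<times> real) measure))
    (\<lambda>(z, p). (indicator strip z *\<^sub>R \<Theta>' z) * ((indicator I (fst p) *\<^sub>R (g (fst p) *\<^sub>R blob 0 (z - zeta (fst p))))
        * (indicator I (snd p) *\<^sub>R (g (snd p) *\<^sub>R blob 0 (z - zeta (snd p))))))"
proof -
  obtain B where B: "\<And>z. norm (\<Theta>' z) \<le> B" using \<Theta>'_bounded by blast
  have B0: "0 \<le> B" using order_trans[OF norm_ge_zero B] .
  let ?K = "G * sqrt (2 * cosh (2 * S))"
  let ?b = "\<lambda>z \<alpha>. indicator I \<alpha> *\<^sub>R (g \<alpha> *\<^sub>R blob 0 (z - zeta \<alpha>))"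
  have K0: "0 \<le> ?K" by (simp add: G_nonneg)
  show ?thesis
  proof (rule Bochner_Integration.integrable_bound)
    show "integrable (lborel \<Otimes>\<^sub>M (lborel :: (real \<times> real) measure))
      (\<lambda>q. (B * (?K * ?K)) * (case q of (z, p) \<Rightarrow> indicator (slab S) z * (kern z (fst p) * kern z (snd p))))"
      by (rule integrable_mult_right[OF kern_kern_integrable[OF S]])
    show "AE q in lborel \<Otimes>\<^sub>M (lborel :: (real \<times> real) measure).
       norm (case q of (z, p) \<Rightarrow> (indicator strip z *\<^sub>R \<Theta>' z) * (?b z (fst p) * ?b z (snd p)))
      \<le> norm ((B * (?K * ?K)) * (case q of (z, p) \<Rightarrow> indicator (slab S) z * (kern z (fst p) * kern z (snd p))))"
    proof (rule AE_I2, clarify)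
      fix z and \<alpha> \<beta> :: real
      have "norm ((indicator strip z *\<^sub>R \<Theta>' z) * (?b z \<alpha> * ?b z \<beta>)) \<le> (B * (?K * ?K)) * (indicator (slab S) z * (kern z \<alpha> * kern z \<beta>))"
      proof (cases "z \<in> strip \<and> \<not> S < \<bar>Im z\<bar>")
        case True
        then have zs: "z \<in> slab S" by (auto simp: slab_def strip_def)
        have "norm (\<Theta>' z) * (norm (?b z \<alpha>) * norm (?b z \<beta>)) \<le> B * ((?K * kern z \<alpha>) * (?K * kern z \<beta>))"
          by (intro mult_mono B norm_blob_le_kern zs S B0 mult_nonneg_nonneg K0 kern_nonneg norm_ge_zero order.refl)
        then show ?thesis using True zs by (simp only: norm_mult) (simp add: mult_ac)
      next
        case False
        then have n: "norm ((indicator strip z *\<^sub>R \<Theta>' z) * (?b z \<alpha> * ?b z \<beta>)) = 0"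
          using \<Theta>'_supp by auto
        show ?thesis unfolding n by (intro mult_nonneg_nonneg B0 K0 kern_nonneg) auto
      qed
      also have "\<dots> \<le> norm ((B * (?K * ?K)) * (indicator (slab S) z * (kern z \<alpha> * kern z \<beta>)))" by simp
      finally show "norm ((indicator strip z *\<^sub>R \<Theta>' z) * (?b z (fst (\<alpha>, \<beta>)) * ?b z (snd (\<alpha>, \<beta>))))
        \<le> norm ((B * (?K * ?K)) * (indicator (slab S) z * (kern z (fst (\<alpha>, \<beta>)) * kern z (snd (\<alpha>, \<beta>)))))" by simp
    qed
    show "(\<lambda>(z, p). (indicator strip z *\<^sub>R \<Theta>' z) * (?b z (fst p) * ?b z (snd p))) \<in> borel_measurable (lborel \<Otimes>\<^sub>M (lborel :: (real \<times> real) measure))"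
      unfolding lborel_prod[symmetric] by measurable
  qed
qed

definition interaction :: "real \<times> real \<Rightarrow> complex" where
  "interaction p = (indicator I (fst p) * indicator I (snd p) * g (fst p) * g (snd p)) *\<^sub>R
     (blob 0 (zeta (snd p) - zeta (fst p)) * (\<psi> (zeta (snd p)) - \<psi> (zeta (fst p))))"

text \<open>Off the graph the integrand is continuous in the sheet parameter, hence integrable, and
  the square of the integral is a double integral.\<close>

lemma sheet_conv_square_AE:
  "AE z in lborel. indicator strip z *\<^sub>R ((sheet_conv h g (blob 0) z)\<^sup>2 * \<Theta> z)
      = (\<integral>p. (indicator strip z *\<^sub>R \<Theta>' z) * ((indicator I (fst p) *\<^sub>R (g (fst p) *\<^sub>R blob 0 (z - zeta (fst p)))) * (indicator I (snd p) *\<^sub>R (g (snd p) *\<^sub>R blob 0 (z - zeta (snd p))))) \<partial>(lborel :: (real \<times> real) measure))"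
proof -
  let ?b = "\<lambda>z \<alpha>. indicator I \<alpha> *\<^sub>R (g \<alpha> *\<^sub>R blob 0 (z - zeta \<alpha>))"
  have prod: "(\<integral>p. ?b z (fst p) * ?b z (snd p) \<partial>(lborel :: (real \<times> real) measure)) = (sheet_conv h g (blob 0) z)\<^sup>2"
    if z: "z \<in> strip" "Im z \<noteq> h (Re z)" for z
  proof -
    have dn: "denom (z - zeta \<alpha>) \<noteq> 0" if "\<alpha> \<in> I" for \<alpha>
    proof -
      have "z \<noteq> zeta \<alpha>" using z by (auto simp: zeta_def)
      then show ?thesis using denom_pos[OF strip_diff[OF z(1) that]] by auto
    qed
    have "continuous_on I (\<lambda>\<alpha>. g \<alpha> *\<^sub>R blob 0 (z - zeta \<alpha>))"
      unfolding blob_def using dn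
      by (auto simp: Complex_eq intro!: continuous_intros zeta_cont continuous_on_subset[OF g_cont])
    then have i: "integrable lborel (?b z)"
      by (intro borel_integrable_compact) auto
    have "(\<integral>p. ?b z (fst p) * ?b z (snd p) \<partial>(lborel :: (real \<times> real) measure))
       = (\<integral>\<alpha>. \<integral>\<beta>. ?b z \<alpha> * ?b z \<beta> \<partial>lborel \<partial>lborel)"
    proof -
      have "integrable (lborel \<Otimes>\<^sub>M lborel) (\<lambda>p. ?b z (fst p) * ?b z (snd p))"
      proof (rule lborel_pair.Fubini_integrable)
        show "integrable lborel (\<lambda>\<alpha>. \<integral>\<beta>. norm (?b z (fst (\<alpha>, \<beta>)) * ?b z (snd (\<alpha>, \<beta>))) \<partial>lborel)"
          using integrable_norm[OF i] by (simp only: fst_conv snd_conv norm_mult integral_mult_right_zero integrable_mult_left)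
        show "AE \<alpha> in lborel. integrable lborel (\<lambda>\<beta>. ?b z (fst (\<alpha>, \<beta>)) * ?b z (snd (\<alpha>, \<beta>)))"
          using i by (intro AE_I2) (simp only: fst_conv snd_conv integrable_mult_right)
      qed measurable
      from lborel_pair.integral_fst'[OF this] show ?thesis by (simp only: lborel_prod fst_conv snd_conv)
    qed
    also have "\<dots> = (sheet_conv h g (blob 0) z)\<^sup>2"
      by (simp only: integral_mult_right_zero integral_mult_left_zero sheet_conv_zeta power2_eq_square)
    finally show ?thesis .
  qed
  show ?thesis
      using AE_off_graph[OF h_meas]
    proof eventually_elim
      case (elim z)
      show ?case
      proof (cases "z \<in> strip")
        case True
        then show ?thesis unfolding integral_mult_right_zero prod[OF True elim] \<Theta>'_eq by (simp add: mult.commute)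
      qed simp
    qed
qed

lemma quadratic_integrable_strip: "integrable lborel (\<lambda>z. indicator strip z *\<^sub>R ((sheet_conv h g (blob 0) z)\<^sup>2 * \<Theta> z))"
proof -
  have "integrable lborel (\<lambda>z. \<integral>p. (indicator strip z *\<^sub>R \<Theta>' z) * ((indicator I (fst p) *\<^sub>R (g (fst p) *\<^sub>R blob 0 (z - zeta (fst p)))) * (indicator I (snd p) *\<^sub>R (g (snd p) *\<^sub>R blob 0 (z - zeta (snd p))))) \<partial>(lborel :: (real \<times> real) measure))"
    using lborel_pair.integrable_fst'[OF quadratic_integrable] by simp
  then show ?thesis
    by (rule integrable_cong_AE_imp) (use sheet_conv_square_AE in \<open>auto simp: sheet_conv_zeta\<close>)
qed

text \<open>
  Delort's symmetrization: the product of two kernels is, by the addition theorem of the cotangent, a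
  difference of single kernels up to a constant, and the constant does not contribute.
\<close>

lemma quadratic_identity:
  "(LINT z:strip|lborel. (sheet_conv h g (blob 0) z)\<^sup>2 * \<Theta> z) = - 4 * pi * (\<integral>p. interaction p \<partial>lborel)"
proof -
  let ?b = "\<lambda>z \<alpha>. indicator I \<alpha> *\<^sub>R (g \<alpha> *\<^sub>R blob 0 (z - zeta \<alpha>))"
  have "(LINT z:strip|lborel. (sheet_conv h g (blob 0) z)\<^sup>2 * \<Theta> z)
     = (\<integral>z. \<integral>p. (indicator strip z *\<^sub>R \<Theta>' z) * (?b z (fst p) * ?b z (snd p)) \<partial>(lborel :: (real \<times> real) measure) \<partial>lborel)"
    unfolding set_lebesgue_integral_def
  proof (rule integral_cong_AE)
    show "AE z in lborel. indicator strip z *\<^sub>R ((sheet_conv h g (blob 0) z)\<^sup>2 * \<Theta> z)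
      = (\<integral>p. (indicator strip z *\<^sub>R \<Theta>' z) * (?b z (fst p) * ?b z (snd p)) \<partial>(lborel :: (real \<times> real) measure))"
      by (rule sheet_conv_square_AE)
    show "(\<lambda>z. indicator strip z *\<^sub>R ((sheet_conv h g (blob 0) z)\<^sup>2 * \<Theta> z)) \<in> borel_measurable lborel"
      unfolding sheet_conv_zeta by measurable
    show "(\<lambda>z. \<integral>p. (indicator strip z *\<^sub>R \<Theta>' z) * (?b z (fst p) * ?b z (snd p)) \<partial>(lborel :: (real \<times> real) measure)) \<in> borel_measurable lborel"
      unfolding lborel_prod[symmetric] by measurable
  qed
  also have "\<dots> = (\<integral>p. \<integral>z. (indicator strip z *\<^sub>R \<Theta>' z) * (?b z (fst p) * ?b z (snd p)) \<partial>lborel \<partial>(lborel :: (real \<times> real) measure))"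
    by (rule lborel_pair.Fubini_integral[OF quadratic_integrable, symmetric])
  also have "\<dots> = (\<integral>p. - 4 * pi * interaction p \<partial>lborel)"
  proof (rule integral_cong_AE)
    \<comment> \<open>Besides the diagonal, the end points of the period are excluded: the sheet
      points over \<open>- pi\<close> and \<open>pi\<close> are translates of each other, so
      \<open>denom\<close> of their difference is \<open>0\<close>.\<close>
    have ae: "AE p in (lborel :: (real \<times> real) measure). fst p \<noteq> snd p \<and> \<bar>fst p\<bar> \<noteq> pi"
    proof -
      have "AE p in lborel \<Otimes>\<^sub>M lborel. fst p \<noteq> (snd p :: real) \<and> \<bar>fst p\<bar> \<noteq> pi"
      proof (rule lborel_pair.AE_pair_measure)
        show "{p \<in> space (lborel \<Otimes>\<^sub>M lborel). fst p \<noteq> (snd p :: real) \<and> \<bar>fst p\<bar> \<noteq> pi} \<in> sets (lborel \<Otimes>\<^sub>M lborel)"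
          by measurable
        show "AE x in lborel. AE y in lborel. fst (x, y) \<noteq> (snd (x, y) :: real) \<and> \<bar>fst (x, y)\<bar> \<noteq> pi"
          using AE_lborel_singleton[of pi] AE_lborel_singleton[of "- pi"]
        proof eventually_elim
          case (elim x)
          show ?case using AE_lborel_singleton[of x] by eventually_elim (use elim in auto)
        qed
      qed
      then show ?thesis unfolding lborel_prod .
    qed
    show "AE p in (lborel :: (real \<times> real) measure). (\<integral>z. (indicator strip z *\<^sub>R \<Theta>' z) * (?b z (fst p) * ?b z (snd p)) \<partial>lborel) = - 4 * pi * interaction p"
      using ae
    proof eventually_elim
      case (elim p)
      obtain \<alpha> \<beta> where p: "p = (\<alpha>, \<beta>)" by (cases p)
      show ?case
      proof (cases "\<alpha> \<in> I \<and> \<beta> \<in> I")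
        case False
        then have "(indicator strip z *\<^sub>R \<Theta>' z) * (?b z (fst p) * ?b z (snd p)) = 0" for z by (auto simp: p)
        then show ?thesis using False by (simp only: integral_zero) (auto simp: p interaction_def)
      next
        case True
        let ?a = "zeta \<alpha>" and ?c = "zeta \<beta>" and ?t = "\<lambda>z. indicator strip z *\<^sub>R \<Theta>' z"
        have ab: "denom (?c - ?a) \<noteq> 0"
        proof -
          have "\<alpha> \<noteq> pi" "\<alpha> \<noteq> - pi" "?c - ?a \<noteq> 0" using elim by (auto simp: p zeta_def complex_eq_iff)
          moreover have "-pi \<le> \<alpha>" "\<alpha> \<le> pi" "-pi \<le> \<beta>" "\<beta> \<le> pi" using True by auto
          ultimately have "\<bar>\<beta> - \<alpha>\<bar> < 2 * pi" unfolding abs_less_iff by linarith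
          then show ?thesis using denom_pos[of "?c - ?a"] \<open>?c - ?a \<noteq> 0\<close> by (auto simp: zeta_def)
        qed
        have t: "(\<integral>z. ?t z \<partial>lborel) = 0" "integrable lborel ?t"
          unfolding \<Theta>'_eq using \<Theta>_integral_0 by simp_all
        note A = cauchy_pompeiu_sheet[of \<alpha>, OF conjunct1[OF True]] and C = cauchy_pompeiu_sheet[of \<beta>, OF conjunct2[OF True]]
        have "(\<integral>z. ?t z * (blob 0 (z - ?a) * blob 0 (z - ?c)) \<partial>lborel)
          = (\<integral>z. blob 0 (?c - ?a) * (?t z * blob 0 (z - ?c) - ?t z * blob 0 (z - ?a)) - ?t z \<partial>lborel)"
        proof (rule integral_cong_AE)
          show "AE z in lborel. ?t z * (blob 0 (z - ?a) * blob 0 (z - ?c))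
             = blob 0 (?c - ?a) * (?t z * blob 0 (z - ?c) - ?t z * blob 0 (z - ?a)) - ?t z"
            using AE_lborel_singleton[of ?a] AE_lborel_singleton[of ?c]
          proof eventually_elim
            case (elim z)
            show ?case
            proof (cases "z \<in> strip")
              case zs: True
              have "denom (z - ?a) \<noteq> 0" "denom (z - ?c) \<noteq> 0"
                using denom_pos[OF strip_diff[OF zs, of \<alpha>]] denom_pos[OF strip_diff[OF zs, of \<beta>]] elim True by auto
              from blob_product[OF this ab] show ?thesis by (simp only:) (simp add: algebra_simps)
            qed simp
          qed
        qed measurable
        \<comment> \<open>The coefficient that is singular on the diagonal now multiplies a
          difference of values of \<psi>, which compensates the singularity.\<close>
        also have "\<dots> = blob 0 (?c - ?a) * (- 4 * pi * \<psi> ?c - - 4 * pi * \<psi> ?a) - 0"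
          using A C t by (simp only: Bochner_Integration.integral_diff integral_mult_right_zero integrable_mult_right Bochner_Integration.integrable_diff)
        finally have "(\<integral>z. ?t z * (blob 0 (z - ?a) * blob 0 (z - ?c)) \<partial>lborel) = - 4 * pi * (blob 0 (?c - ?a) * (\<psi> ?c - \<psi> ?a))"
          by (simp add: algebra_simps)
        then have "(\<integral>z. (g \<alpha> * g \<beta>) *\<^sub>R (?t z * (blob 0 (z - ?a) * blob 0 (z - ?c))) \<partial>lborel) = (g \<alpha> * g \<beta>) *\<^sub>R (- 4 * pi * (blob 0 (?c - ?a) * (\<psi> ?c - \<psi> ?a)))"
          by (simp only: integral_scaleR_right)
        then show ?thesis using True by (simp add: p interaction_def scaleR_conv_of_real mult_ac)
      qed
    qed
    show "(\<lambda>p. \<integral>z. (indicator strip z *\<^sub>R \<Theta>' z) * (?b z (fst p) * ?b z (snd p)) \<partial>lborel) \<in> borel_measurable (lborel :: (real \<times> real) measure)"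
      unfolding lborel_prod[symmetric] by measurable
    have [measurable]: "\<psi> \<in> borel_measurable borel" using \<psi>_cont by (rule borel_measurable_continuous_onI)
    show "(\<lambda>p. - 4 * pi * interaction p) \<in> borel_measurable (lborel :: (real \<times> real) measure)"
      unfolding lborel_prod[symmetric] interaction_def by measurable
  qed
  also have "\<dots> = - 4 * pi * (\<integral>p. interaction p \<partial>lborel)"
    by (rule integral_mult_right_zero)
  finally show ?thesis .
qed

end

section \<open>The defect of the regularization\<close>

text \<open>With a primitive \<open>A\<close> the integral is \<open>A (x + pi) - A (x - pi)\<close>
  as a function of the shift, and the derivative of this function vanishes by periodicity.\<close>

lemma LBINT_periodic_shift:
  fixes F :: "real \<Rightarrow> complex"
  assumes F: "continuous_on UNIV F" and per: "\<And>x. F (x + 2 * pi) = F x"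
  shows "(LINT s:{-pi..pi}|lborel. F (c + s)) = (LINT s:{-pi..pi}|lborel. F s)"
proof -
  define N where "N = \<bar>c\<bar> + pi"
  have cF: "continuous_on A F" for A using F by (rule continuous_on_subset) auto
  obtain A where A: "\<And>x. x \<in> {-N..N} \<Longrightarrow> (A has_vector_derivative F x) (at x within {-N..N})"
    using antiderivative_continuous[OF cF] by metis
  define k where "k x = A (x + pi) - A (x - pi)" for x
  have kI: "(LINT s:{-pi..pi}|lborel. F (x + s)) = k x" if "\<bar>x\<bar> \<le> \<bar>c\<bar>" for x
  proof -
    have "((\<lambda>s. A (x + s)) has_vector_derivative F (x + s)) (at s within {-pi..pi})" if s: "-pi \<le> s" "s \<le> pi" for s
    proof -
      have xs: "x + s \<in> {-N..N}" using s \<open>\<bar>x\<bar> \<le> \<bar>c\<bar>\<close> by (auto simp: N_def)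
      have "(A has_vector_derivative F (x + s)) (at (x + s) within (\<lambda>s. x + s) ` {-pi..pi})"
        by (rule has_vector_derivative_within_subset[OF A[OF xs]])
          (use \<open>\<bar>x\<bar> \<le> \<bar>c\<bar>\<close> in \<open>auto simp: N_def\<close>)
      moreover have "((\<lambda>s. x + s) has_vector_derivative 1) (at s within {-pi..pi})"
        by (auto intro!: derivative_eq_intros)
      ultimately show ?thesis using vector_diff_chain_within[of "\<lambda>s. x + s" 1 s "{-pi..pi}" A "F (x + s)"]
        by (simp add: o_def)
    qed
    then have "(\<integral>s. indicator {-pi..pi} s *\<^sub>R F (x + s) \<partial>lborel) = A (x + pi) - A (x + - pi)"
      by (intro integral_FTC_atLeastAtMost continuous_on_compose2[OF F] continuous_intros) auto
    then show ?thesis by (simp add: set_lebesgue_integral_def k_def)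
  qed
  have "\<exists>K. \<forall>x\<in>{-\<bar>c\<bar>..\<bar>c\<bar>}. k x = K"
  proof -
    have "(k has_vector_derivative 0) (at x within {-\<bar>c\<bar>..\<bar>c\<bar>})" if x: "x \<in> {-\<bar>c\<bar>..\<bar>c\<bar>}" for x
    proof -
      have sh: "((\<lambda>x. A (x + t)) has_vector_derivative F (x + t)) (at x within {-\<bar>c\<bar>..\<bar>c\<bar>})" if "\<bar>t\<bar> \<le> pi" for t
      proof -
        have "(A has_vector_derivative F (x + t)) (at (x + t) within (\<lambda>s. s + t) ` {-\<bar>c\<bar>..\<bar>c\<bar>})"
          by (rule has_vector_derivative_within_subset[OF A]) (use x that in \<open>auto simp: N_def\<close>)
        moreover have "((\<lambda>s. s + t) has_vector_derivative 1) (at x within {-\<bar>c\<bar>..\<bar>c\<bar>})"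
          by (auto intro!: derivative_eq_intros)
        ultimately show ?thesis using vector_diff_chain_within[of "\<lambda>s. s + t" 1 x _ A "F (x + t)"]
          by (simp add: o_def)
      qed
      have "(k has_vector_derivative F (x + pi) - F (x - pi)) (at x within {-\<bar>c\<bar>..\<bar>c\<bar>})"
        unfolding k_def using sh[of pi] sh[of "- pi"] by (auto intro!: derivative_eq_intros)
      moreover have "F (x + pi) - F (x - pi) = 0" using per[of "x - pi"] by (simp add: algebra_simps)
      ultimately show ?thesis by (simp only:)
    qed
    then show ?thesis using has_vector_derivative_zero_constant[of "{-\<bar>c\<bar>..\<bar>c\<bar>}" k]
      by (metis convex_real_interval(5))
  qed
  then obtain K where "\<forall>x\<in>{-\<bar>c\<bar>..\<bar>c\<bar>}. k x = K" ..
  moreover have "c \<in> {-\<bar>c\<bar>..\<bar>c\<bar>}" "0 \<in> {-\<bar>c\<bar>..\<bar>c\<bar>}"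
    by (simp_all add: minus_le_iff abs_ge_minus_self)
  ultimately have "k c = K" "k 0 = K" by blast+
  then show ?thesis using kI[of c] kI[of 0] by simp
qed

section \<open>Estimates for the regularized kernel along the sheet\<close>

lemma norm_set_integral_le:
  fixes F :: "real \<Rightarrow> complex"
  assumes F: "continuous_on UNIV F" and B: "0 \<le> B" "\<And>s. s \<in> {-pi..pi} \<Longrightarrow> s \<noteq> 0 \<Longrightarrow> norm (F s) \<le> B * \<bar>s\<bar> powr - (3/4)"
    and C: "(\<integral>\<^sup>+s. indicator {-pi..pi} s * sing_periodic (3/4) (s - 0) \<partial>lborel) \<le> ennreal C" "0 \<le> C"
  shows "norm (LINT s:{-pi..pi}|lborel. F s) \<le> B * C"
proof -
  have i: "integrable lborel (\<lambda>s. indicator {-pi..pi} s *\<^sub>R F s)"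
    by (intro borel_integrable_compact continuous_on_subset[OF F]) auto
  have "ennreal (norm (LINT s:{-pi..pi}|lborel. F s)) \<le> (\<integral>\<^sup>+s. ennreal (norm (indicator {-pi..pi} s *\<^sub>R F s)) \<partial>lborel)"
    unfolding set_lebesgue_integral_def by (rule integral_norm_bound_ennreal[OF i])
  also have "\<dots> \<le> (\<integral>\<^sup>+s. ennreal B * (indicator {-pi..pi} s * sing_periodic (3/4) (s - 0)) \<partial>lborel)"
  proof (rule nn_integral_mono_AE)
    show "AE s in lborel. ennreal (norm (indicator {-pi..pi} s *\<^sub>R F s)) \<le> ennreal B * (indicator {-pi..pi} s * sing_periodic (3/4) (s - 0))"
      using AE_lborel_singleton[of "0::real"]
    proof eventually_elim
      case (elim s)
      show ?case
      proof (cases "s \<in> {-pi..pi}")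
        case True
        have "ennreal (norm (F s)) \<le> ennreal B * sing (3/4) s"
          using B(2)[OF True elim] B(1) elim by (simp add: sing_def ennreal_mult'[symmetric])
        also have "\<dots> \<le> ennreal B * sing_periodic (3/4) s"
          by (intro mult_left_mono) (auto simp: sing_periodic_def add_increasing2)
        finally show ?thesis using True by simp
      qed simp
    qed
  qed
  also have "\<dots> = ennreal B * (\<integral>\<^sup>+s. indicator {-pi..pi} s * sing_periodic (3/4) (s - 0) \<partial>lborel)"
    by (rule nn_integral_cmult) measurable
  also have "\<dots> \<le> ennreal B * ennreal C" by (rule mult_left_mono[OF C(1)]) simp
  finally show ?thesis using B C by (simp add: ennreal_mult[symmetric])
qed

lemma two_over_pi_sq_powr: "((2 / pi\<^sup>2) * s\<^sup>2) powr - (3/8) \<le> 6 * \<bar>s\<bar> powr - (3/4)"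
proof (cases "s = 0")
  case False
  have pi6: "1 \<le> pi\<^sup>2 / 2" "pi\<^sup>2 / 2 \<le> 6"
  proof -
    have "pi \<le> 31415926535899 / 10 ^ 13" using pi_approx by blast
    also have "\<dots> \<le> (3.2::real)" by simp
    finally have "pi * pi \<le> 3.2 * 3.2" by (intro mult_mono) auto
    then show "pi\<^sup>2 / 2 \<le> 6" by (simp add: power2_eq_square)
    have "(3::real)\<^sup>2 \<le> pi\<^sup>2" using pi_gt3 by (intro power_mono) auto
    then show "1 \<le> pi\<^sup>2 / 2" by simp
  qed
  have "s\<^sup>2 = \<bar>s\<bar> powr 2" using False by simp
  then have sq: "(s\<^sup>2) powr - (3/8) = \<bar>s\<bar> powr - (3/4)"
    using powr_powr[of "\<bar>s\<bar>" 2 "- (3/8)"] by simp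
  have "((2 / pi\<^sup>2) * s\<^sup>2) powr - (3/8) = (2 / pi\<^sup>2) powr - (3/8) * \<bar>s\<bar> powr - (3/4)"
    unfolding sq[symmetric] by (rule powr_mult)
  also have "(2 / pi\<^sup>2) powr - (3/8) = (pi\<^sup>2 / 2) powr (3/8)"
    using powr_minus[of "pi\<^sup>2 / 2" "3/8"] by (simp add: powr_minus powr_divide)
  finally have "((2 / pi\<^sup>2) * s\<^sup>2) powr - (3/8) = (pi\<^sup>2 / 2) powr (3/8) * \<bar>s\<bar> powr - (3/4)" .
  also have "\<dots> \<le> (pi\<^sup>2 / 2) powr 1 * \<bar>s\<bar> powr - (3/4)"
    by (intro mult_right_mono powr_mono pi6) auto
  also have "\<dots> \<le> 6 * \<bar>s\<bar> powr - (3/4)"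
    using pi6 by (intro mult_right_mono) auto
  finally show ?thesis .
qed simp

text \<open>The power \<open>- (1/2)\<close> is divided into \<open>- (3/8)\<close>, charged to
  \<open>s\<close> so that the singularity stays integrable, and \<open>- (1/8)\<close>, charged to
  \<open>e\<close>.\<close>

lemma inverse_sqrt_le:
  assumes e: "0 < e" and D: "(2 / pi\<^sup>2) * s\<^sup>2 \<le> D" and s: "s \<noteq> 0"
  shows "1 / sqrt (D + e) \<le> 6 * \<bar>s\<bar> powr - (3/4) * e powr - (1/8)"
proof -
  have p: "0 < (2 / pi\<^sup>2) * s\<^sup>2" using s by simp
  then have X: "0 < D + e" "0 < D" using D e by linarith+
  have ex: "- (3/8) + - (1/8) = - (1/2 :: real)" by simp
  have "1 / sqrt (D + e) = (D + e) powr - (1/2)" using X by (intro powr_minus_half[symmetric]) simp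
  also have "\<dots> = (D + e) powr - (3/8) * (D + e) powr - (1/8)" by (simp only: powr_add[symmetric] ex)
  also have "\<dots> \<le> ((2 / pi\<^sup>2) * s\<^sup>2) powr - (3/8) * e powr - (1/8)"
    using p X D e by (intro mult_mono powr_mono2') auto
  also have "\<dots> \<le> 6 * \<bar>s\<bar> powr - (3/4) * e powr - (1/8)"
    by (intro mult_right_mono two_over_pi_sq_powr) auto
  finally show ?thesis .
qed

text \<open>The vertical derivative of the kernel has two terms over \<open>denom + e\<close>: one
  is at most \<open>cosh Y\<close>, the other at most \<open>2 * cosh Y\<close>, because the
  hyperbolic sine supplies the half power of \<open>denom\<close> that the kernel lacks. Along the
  vertical segment \<open>denom\<close> never drops below \<open>1 - cos x\<close>, so one
  \<open>d\<close> serves for all of it.\<close>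

lemma blob_vertical_lipschitz:
  assumes e: "0 < e" and y: "\<bar>y1\<bar> \<le> Y" "\<bar>y2\<bar> \<le> Y" and d: "0 \<le> d" "d \<le> 1 - cos x"
  shows "norm (blob e (Complex x y1) - blob e (Complex x y2)) \<le> 3 * cosh Y / (d + e) * \<bar>y1 - y2\<bar>"
proof -
  define b where "b y = - \<i> * of_real (cosh y / (denom (Complex x y) + e)) - of_real (sinh y / (denom (Complex x y) + e)) * blob e (Complex x y)" for y
  have "norm (blob e (Complex x y1) - blob e (Complex x y2)) \<le> 3 * cosh Y / (d + e) * norm (y1 - y2)"
  proof (rule differentiable_bound[where S = "{-Y..Y}" and f = "\<lambda>y. blob e (Complex x y)"])
    show "((\<lambda>y. blob e (Complex x y)) has_derivative (\<lambda>v. v *\<^sub>R b y)) (at y within {-Y..Y})" for y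
    proof -
      have "((\<lambda>y. Complex x y) has_derivative (\<lambda>v. \<i> * of_real v)) (at y within {-Y..Y})"
        unfolding Complex_eq by (auto intro!: derivative_eq_intros)
      from has_derivative_compose[OF this blob_has_derivative[OF e]] show ?thesis by (simp add: b_def)
    qed
    fix y assume "y \<in> {-Y..Y}"
    then have "cosh \<bar>y\<bar> \<le> cosh Y" by (subst cosh_real_nonneg_le_iff) auto
    then have ch: "cosh y \<le> cosh Y" by (simp only: cosh_real_abs)
    let ?D = "denom (Complex x y)"
    have D: "d \<le> ?D" "0 \<le> ?D"
      using d cosh_real_ge_1[of y] denom_nonneg by (auto simp: denom_def)
    have sh: "\<bar>sinh y\<bar> \<le> sqrt ?D * sqrt (2 * cosh y)"
      using norm_blob_numerator_le[of "Complex x y"] abs_Im_le_cmod[of "Complex (sin x) (- sinh y)"] by simp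
    have "\<bar>sinh y\<bar> * norm (blob e (Complex x y)) \<le> (sqrt ?D * sqrt (2 * cosh y)) * (sqrt (2 * cosh y) * (1 / sqrt (?D + e)))"
      using norm_blob_le(3)[of e "Complex x y"] e D by (intro mult_mono sh) auto
    also have "\<dots> = (2 * cosh y) * (sqrt ?D / sqrt (?D + e))" by simp
    also have "\<dots> \<le> (2 * cosh Y) * 1"
      using ch D e by (intro mult_mono) auto
    finally have s: "\<bar>sinh y\<bar> * norm (blob e (Complex x y)) \<le> 2 * cosh Y" by simp
    have "norm (b y) \<le> norm (\<i> * complex_of_real (cosh y / (?D + e))) + norm (complex_of_real (sinh y / (?D + e)) * blob e (Complex x y))"
      unfolding b_def by (rule order_trans[OF norm_triangle_ineq4]) simp
    also have "\<dots> = (cosh y + \<bar>sinh y\<bar> * norm (blob e (Complex x y))) / (?D + e)"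
      using D e by (simp add: norm_mult norm_divide add_divide_distrib del: of_real_divide of_real_add)
    also have "\<dots> \<le> (3 * cosh Y) / (?D + e)"
      using s ch D e by (intro divide_right_mono) auto
    also have "\<dots> \<le> 3 * cosh Y / (d + e)"
      using D d e by (intro divide_left_mono) auto
    finally have nb: "norm (b y) \<le> 3 * cosh Y / (d + e)" .
    show "onorm (\<lambda>v. v *\<^sub>R b y) \<le> 3 * cosh Y / (d + e)"
      by (rule onorm_le) (use mult_left_mono[OF nb, of "\<bar>_\<bar>"] in \<open>simp add: mult.commute\<close>)
  qed (use y in auto)
  then show ?thesis by simp
qed

text \<open>The defect estimate works with Lipschitz constants of slope and density.
  \<open>C0\<close> depends on no sheet; carrying it as a parameter lets all times share one
  value.\<close>

locale sheet_reg = sheet +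
  fixes h' :: "real \<Rightarrow> real" and M C0 :: real
  assumes h_der: "(h has_real_derivative h' \<alpha>) (at \<alpha>)"
    and h'_lip: "\<bar>h' \<alpha> - h' \<beta>\<bar> \<le> M * \<bar>\<alpha> - \<beta>\<bar>"
    and g_lip: "\<bar>g \<alpha> - g \<beta>\<bar> \<le> M * \<bar>\<alpha> - \<beta>\<bar>"
    and C0: "0 \<le> C0" "\<And>c. \<bar>c\<bar> \<le> pi \<Longrightarrow> (\<integral>\<^sup>+s. indicator {-pi..pi} s * sing_periodic (3/4) (s - c) \<partial>lborel) \<le> ennreal C0"
begin

lemma M_nonneg: "0 \<le> M" using h'_lip[of 0 1] by simp

text \<open>The first summand is the variation of the kernel, with \<open>54 = 3 * 18\<close> and
  the \<open>3\<close> of \<open>blob_vertical_lipschitz\<close>; the second is the variation of the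
  density, with the \<open>6\<close> of \<open>inverse_sqrt_le\<close>. \<open>C0\<close> bounds the
  integral of the remaining power \<open>- (3/4)\<close>.\<close>

definition LC :: real where
  "LC = (54 * G * M * cosh (2 * R) + 6 * M * sqrt (2 * cosh (2 * R))) * C0"

lemma zeta_shift: "zeta (\<beta> + 2 * pi) = zeta \<beta> + of_real (2 * pi)"
  by (simp add: zeta_def h_per complex_eq_iff)

text \<open>The mean value theorem for \<open>h x - h (x + s)\<close> as a function of
  \<open>x\<close>, whose slope is at most \<open>M * |s|\<close>. The extra factor
  \<open>|s|\<close> tames the derivative of the kernel, which may be as large as the inverse square
  of \<open>s\<close>.\<close>

lemma second_difference:
  "\<bar>(h \<alpha> - h (\<alpha> + s)) - (h \<beta> - h (\<beta> + s))\<bar> \<le> M * \<bar>s\<bar> * \<bar>\<alpha> - \<beta>\<bar>"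
proof -
  have "norm ((h \<alpha> - h (\<alpha> + s)) - (h \<beta> - h (\<beta> + s))) \<le> (M * \<bar>s\<bar>) * norm (\<alpha> - \<beta>)"
  proof (rule differentiable_bound[where S = UNIV and f = "\<lambda>x. h x - h (x + s)"])
    show "((\<lambda>x. h x - h (x + s)) has_derivative (\<lambda>v. (h' x - h' (x + s)) * v)) (at x within UNIV)" for x
    proof -
      have "((\<lambda>x. h (x + s)) has_real_derivative h' (x + s) * 1) (at x)"
        by (rule DERIV_chain2[OF h_der]) (auto intro!: derivative_eq_intros)
      from DERIV_diff[OF h_der this] show ?thesis by (simp add: has_field_derivative_def)
    qed
    show "onorm (\<lambda>v. (h' x - h' (x + s)) * v) \<le> M * \<bar>s\<bar>" for x
    proof (rule onorm_le)
      fix v show "norm ((h' x - h' (x + s)) * v) \<le> M * \<bar>s\<bar> * norm v"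
        using mult_right_mono[OF h'_lip[of x "x + s"], of "\<bar>v\<bar>"] by (simp add: abs_mult)
    qed
  qed auto
  then show ?thesis by simp
qed

definition P :: "real \<Rightarrow> real \<Rightarrow> complex" where "P e \<alpha> = sheet_conv h g (blob e) (zeta \<alpha>)"

text \<open>Periodicity allows the period to be centred at \<alpha>. The singularity then sits at
  \<open>s = 0\<close> for every \<alpha>, and values of \<open>P e\<close> at different points can
  be subtracted under the integral.\<close>

lemma P_shifted:
  assumes e: "0 < e"
  shows "P e \<alpha> = (LINT s:I|lborel. g (\<alpha> + s) *\<^sub>R blob e (zeta \<alpha> - zeta (\<alpha> + s)))"
proof -
  have "(LINT s:I|lborel. g (\<alpha> + s) *\<^sub>R blob e (zeta \<alpha> - zeta (\<alpha> + s))) = (LINT s:I|lborel. g s *\<^sub>R blob e (zeta \<alpha> - zeta s))"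
  proof (rule LBINT_periodic_shift[of "\<lambda>s. g s *\<^sub>R blob e (zeta \<alpha> - zeta s)"])
    show "continuous_on UNIV (\<lambda>s. g s *\<^sub>R blob e (zeta \<alpha> - zeta s))"
      by (intro continuous_intros blob_cont[OF e] g_cont zeta_cont)
    show "g (x + 2 * pi) *\<^sub>R blob e (zeta \<alpha> - zeta (x + 2 * pi)) = g x *\<^sub>R blob e (zeta \<alpha> - zeta x)" for x
    proof -
      have "zeta \<alpha> - zeta x = (zeta \<alpha> - zeta (x + 2 * pi)) + of_real (2 * pi)" by (simp add: zeta_shift)
      then show ?thesis by (simp only: blob_add_2pi g_per)
    qed
  qed
  then show ?thesis by (simp add: P_def sheet_conv_def zeta_def)
qed

text \<open>After centring, the kernel arguments for \<alpha> and \<beta> share the real part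
  \<open>- s\<close>, so only a vertical displacement has to be estimated. Its factor
  \<open>|s|\<close> against the derivative of the kernel is of order
  \<open>|s| / (s^2 + e)\<close>, at most a multiple of
  \<open>|s| powr - (3/4) * e powr - (1/8)\<close>.\<close>

lemma P_lipschitz:
  assumes e: "0 < e"
  shows "norm (P e \<alpha> - P e \<beta>) \<le> LC * e powr - (1/8) * \<bar>\<alpha> - \<beta>\<bar>"
proof -
  let ?w = "\<lambda>\<alpha> s. zeta \<alpha> - zeta (\<alpha> + s)"
  let ?F = "\<lambda>\<alpha> s. g (\<alpha> + s) *\<^sub>R blob e (?w \<alpha> s)"
  have cF: "continuous_on UNIV (?F \<alpha>)" for \<alpha>
    by (intro continuous_intros blob_cont[OF e] continuous_on_compose2[OF g_cont] continuous_on_compose2[OF zeta_cont[of UNIV]]) auto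
  have i: "set_integrable lborel I (?F \<alpha>)" for \<alpha>
    unfolding set_integrable_def by (intro borel_integrable_compact continuous_on_subset[OF cF]) auto
  let ?B = "(54 * G * M * cosh (2 * R) + 6 * M * sqrt (2 * cosh (2 * R))) * (e powr - (1/8) * \<bar>\<alpha> - \<beta>\<bar>)"
  have "norm (LINT s:I|lborel. ?F \<alpha> s - ?F \<beta> s) \<le> ?B * C0"
  proof (rule norm_set_integral_le)
    show "continuous_on UNIV (\<lambda>s. ?F \<alpha> s - ?F \<beta> s)" by (intro continuous_intros cF)
    show "0 \<le> ?B" using G_nonneg M_nonneg by (intro mult_nonneg_nonneg add_nonneg_nonneg) auto
    show "(\<integral>\<^sup>+s. indicator I s * sing_periodic (3/4) (s - 0) \<partial>lborel) \<le> ennreal C0" by (rule C0(2)) simp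
    show "0 \<le> C0" by (rule C0(1))
    fix s assume s: "s \<in> I" "s \<noteq> 0"
    define Z where "Z = \<bar>s\<bar> powr - (3/4) * e powr - (1/8)"
    have w: "?w \<alpha> s = Complex (- s) (h \<alpha> - h (\<alpha> + s))" for \<alpha> by (simp add: zeta_def complex_eq_iff)
    have h2: "\<bar>h \<alpha> - h (\<alpha> + s)\<bar> \<le> 2 * R" for \<alpha> using h_le[of \<alpha>] h_le[of "\<alpha> + s"] by linarith
    have d: "(2 / pi\<^sup>2) * s\<^sup>2 \<le> 1 - cos (- s)" using one_minus_cos_ge[of s] s by (simp add: abs_le_iff)
    have dD: "(2 / pi\<^sup>2) * s\<^sup>2 \<le> denom (?w \<alpha> s)" for \<alpha>
      using d cosh_real_ge_1[of "h \<alpha> - h (\<alpha> + s)"] by (simp add: w denom_def)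
    have Z0: "0 \<le> Z" by (simp add: Z_def)
    let ?d = "(2 / pi\<^sup>2) * s\<^sup>2"
    have "norm (blob e (?w \<alpha> s) - blob e (?w \<beta> s)) \<le> 3 * cosh (2 * R) / (?d + e) * \<bar>(h \<alpha> - h (\<alpha> + s)) - (h \<beta> - h (\<beta> + s))\<bar>"
      unfolding w by (rule blob_vertical_lipschitz[OF e h2 h2 _ d]) simp
    also have "\<dots> \<le> 3 * cosh (2 * R) / (?d + e) * (M * \<bar>s\<bar> * \<bar>\<alpha> - \<beta>\<bar>)"
      using e by (intro mult_left_mono second_difference) auto
    also have "\<dots> = 3 * cosh (2 * R) * M * \<bar>\<alpha> - \<beta>\<bar> * (\<bar>s\<bar> / (?d + e))" by simp
    \<comment> \<open>From \<open>pi^2 \<le> 16\<close> follows \<open>s^2 \<le> 9 * ?d\<close>; the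
      root gives the factor \<open>3\<close>, and \<open>inverse_sqrt_le\<close> the remaining
      \<open>6\<close>.\<close>
    also have "\<bar>s\<bar> / (?d + e) \<le> 18 * Z"
    proof -
      have "s\<^sup>2 \<le> 9 * (?d + e)"
      proof -
        have "pi\<^sup>2 \<le> 16" using pi_less_4 power_mono[of pi 4 2] by simp
        then have "s\<^sup>2 * pi\<^sup>2 \<le> s\<^sup>2 * 18" by (intro mult_left_mono) auto
        then have "s\<^sup>2 \<le> 9 * ?d" by (simp add: field_simps)
        then show ?thesis using e by simp
      qed
      then have "\<bar>s\<bar> \<le> 3 * sqrt (?d + e)"
        using real_sqrt_le_mono[of "s\<^sup>2" "9 * (?d + e)"] by (simp only: real_sqrt_abs real_sqrt_mult) simp
      then have "\<bar>s\<bar> / (?d + e) \<le> 3 * sqrt (?d + e) / (?d + e)" using e by (intro divide_right_mono) auto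
      also have "\<dots> = 3 * (1 / sqrt (?d + e))"
      proof -
        have "a / (a * a) = 1 / a" for a :: real by (cases "a = 0") auto
        from this[of "sqrt (?d + e)"] e show ?thesis by simp
      qed
      also have "\<dots> \<le> 3 * (6 * \<bar>s\<bar> powr - (3/4) * e powr - (1/8))"
        by (rule mult_left_mono[OF inverse_sqrt_le[OF e order.refl s(2)]]) simp
      finally show ?thesis by (simp add: Z_def)
    qed
    finally have 1: "norm (blob e (?w \<alpha> s) - blob e (?w \<beta> s)) \<le> 3 * cosh (2 * R) * M * \<bar>\<alpha> - \<beta>\<bar> * (18 * Z)"
      using M_nonneg by (simp add: mult_left_mono)
    have 2: "norm (blob e (?w \<beta> s)) \<le> sqrt (2 * cosh (2 * R)) * (6 * Z)"
    proof -
      have "cosh \<bar>h \<beta> - h (\<beta> + s)\<bar> \<le> cosh (2 * R)"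
        using h2 R_nonneg by (subst cosh_real_nonneg_le_iff) auto
      then have ch: "cosh (h \<beta> - h (\<beta> + s)) \<le> cosh (2 * R)" by (simp only: cosh_real_abs)
      have "norm (blob e (?w \<beta> s)) \<le> sqrt (2 * cosh (Im (?w \<beta> s))) * (1 / sqrt (denom (?w \<beta> s) + e))"
        by (rule norm_blob_le(3)) (use e in simp)
      also have "\<dots> \<le> sqrt (2 * cosh (2 * R)) * (6 * \<bar>s\<bar> powr - (3/4) * e powr - (1/8))"
        using ch e denom_nonneg by (intro mult_mono inverse_sqrt_le[OF e dD s(2)]) (simp_all add: w)
      finally show ?thesis by (simp add: Z_def mult.assoc)
    qed
    have "?F \<alpha> s - ?F \<beta> s = g (\<alpha> + s) *\<^sub>R (blob e (?w \<alpha> s) - blob e (?w \<beta> s)) + (g (\<alpha> + s) - g (\<beta> + s)) *\<^sub>R blob e (?w \<beta> s)"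
      by (simp add: algebra_simps)
    also have "norm \<dots> \<le> \<bar>g (\<alpha> + s)\<bar> * norm (blob e (?w \<alpha> s) - blob e (?w \<beta> s)) + \<bar>g (\<alpha> + s) - g (\<beta> + s)\<bar> * norm (blob e (?w \<beta> s))"
      by (rule order_trans[OF norm_triangle_ineq]) simp
    also have "\<dots> \<le> G * (3 * cosh (2 * R) * M * \<bar>\<alpha> - \<beta>\<bar> * (18 * Z)) + (M * \<bar>\<alpha> - \<beta>\<bar>) * (sqrt (2 * cosh (2 * R)) * (6 * Z))"
      using g_lip[of "\<alpha> + s" "\<beta> + s"] M_nonneg Z0 by (intro add_mono mult_mono g_le 1 2) (auto simp: G_nonneg)
    also have "\<dots> = ?B * \<bar>s\<bar> powr - (3/4)" by (simp add: Z_def algebra_simps)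
    finally show "norm (?F \<alpha> s - ?F \<beta> s) \<le> ?B * \<bar>s\<bar> powr - (3/4)" .
  qed
  also have "(LINT s:I|lborel. ?F \<alpha> s - ?F \<beta> s) = P e \<alpha> - P e \<beta>"
    unfolding P_shifted[OF e] by (rule set_integral_diff(2)[OF i i])
  also have "?B * C0 = LC * e powr - (1/8) * \<bar>\<alpha> - \<beta>\<bar>" by (simp add: LC_def mult_ac)
  finally show ?thesis .
qed

lemma P_periodic:
  assumes "k \<in> {0, 2 * pi, - (2 * pi)}"
  shows "P e (\<alpha> - k) = P e \<alpha>"
proof -
  have z: "zeta (\<alpha> - k) = zeta \<alpha> - of_real k"
    using assms zeta_shift[of \<alpha>] zeta_shift[of "\<alpha> - 2 * pi"] by auto
  have "blob e (zeta \<alpha> - of_real k - w) = blob e (zeta \<alpha> - w)" for w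
    using assms blob_add_2pi(1)[of e "zeta \<alpha> - w"] blob_add_2pi(1)[of e "zeta \<alpha> - w - of_real (2 * pi)"]
    by (auto simp: algebra_simps)
  then show ?thesis unfolding P_def sheet_conv_zeta z by simp
qed

end

text \<open>\<open>\<psi>_sheet\<close> ties the test field to the regularization on the sheet, the
  only place where the interaction evaluates it.\<close>

locale sheet_reg_test = sheet_reg + sheet_test +
  fixes e :: real
  assumes e: "0 < e"
    and \<psi>_sheet: "\<And>\<alpha>. \<psi> (zeta \<alpha>) = \<i> / (4 * pi) * cnj (P e \<alpha>)"
begin

text \<open>\<open>i1a - i1b\<close> is the interaction with the regularized kernel and
  \<open>i2\<close> the defect. The two halves can be separated because the regularized kernel is
  continuous; with \<open>blob 0\<close> they would in general not be integrable one by one.\<close>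

definition i1a :: "real \<times> real \<Rightarrow> complex" where
  "i1a p = (indicator I (fst p) * indicator I (snd p) * g (fst p) * g (snd p)) *\<^sub>R
     (blob e (zeta (snd p) - zeta (fst p)) * \<psi> (zeta (snd p)))"

definition i1b :: "real \<times> real \<Rightarrow> complex" where
  "i1b p = (indicator I (fst p) * indicator I (snd p) * g (fst p) * g (snd p)) *\<^sub>R
     (blob e (zeta (snd p) - zeta (fst p)) * \<psi> (zeta (fst p)))"

definition i2 :: "real \<times> real \<Rightarrow> complex" where
  "i2 p = (indicator I (fst p) * indicator I (snd p) * g (fst p) * g (snd p)) *\<^sub>R
     ((blob 0 (zeta (snd p) - zeta (fst p)) - blob e (zeta (snd p) - zeta (fst p))) * (\<psi> (zeta (snd p)) - \<psi> (zeta (fst p))))"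

lemma interaction_split: "interaction p = i1a p - i1b p + i2 p"
  by (simp add: interaction_def i1a_def i1b_def i2_def algebra_simps)

lemma square_integrable_continuous:
  fixes f :: "real \<times> real \<Rightarrow> complex"
  assumes "continuous_on UNIV f"
  shows "integrable lborel (\<lambda>p. (indicator I (fst p) * indicator I (snd p)) *\<^sub>R f p)"
proof -
  have "integrable lborel (\<lambda>p. indicator (cbox (-pi, -pi) (pi, pi)) p *\<^sub>R f p)"
    by (intro borel_integrable_compact continuous_on_subset[OF assms]) auto
  moreover have "indicator (cbox (-pi, -pi) (pi, pi)) p = (indicator I (fst p) * indicator I (snd p) :: real)" for p
    by (cases p) (auto simp: indicator_def)
  ultimately show ?thesis by simp
qed

lemma cont_parts: "continuous_on A (\<lambda>p. g (fst p))" "continuous_on A (\<lambda>p. g (snd p))"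
  "continuous_on A (\<lambda>p. zeta (fst p))" "continuous_on A (\<lambda>p. zeta (snd p))"
  "continuous_on A (\<lambda>p. \<psi> (zeta (fst p)))" "continuous_on A (\<lambda>p. \<psi> (zeta (snd p)))"
  for A :: "(real \<times> real) set"
  by (auto intro!: continuous_on_compose2[OF g_cont] continuous_on_compose2[OF zeta_cont[of UNIV]]
      continuous_on_compose2[OF \<psi>_cont[of UNIV]] continuous_intros)

lemma i1_integrable: "integrable lborel i1a" "integrable lborel i1b"
proof -
  have eq: "i1a = (\<lambda>p. (indicator I (fst p) * indicator I (snd p)) *\<^sub>R ((g (fst p) * g (snd p)) *\<^sub>R (blob e (zeta (snd p) - zeta (fst p)) * \<psi> (zeta (snd p)))))"
    "i1b = (\<lambda>p. (indicator I (fst p) * indicator I (snd p)) *\<^sub>R ((g (fst p) * g (snd p)) *\<^sub>R (blob e (zeta (snd p) - zeta (fst p)) * \<psi> (zeta (fst p)))))"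
    by (auto simp: i1a_def i1b_def fun_eq_iff)
  show "integrable lborel i1a" "integrable lborel i1b"
    unfolding eq by (intro square_integrable_continuous continuous_intros cont_parts blob_cont[OF e])+
qed

text \<open>
  On the sheet \<open>\<psi>\<close> is \<open>\<i> / (4 \<pi>)\<close> times the conjugate of the kernel integral \<open>P e\<close>, so integrating out one
  variable leaves a purely imaginary multiple of the square of its modulus.
\<close>

lemma Re_i1: "Re (\<integral>p. i1a p \<partial>lborel) = 0" "Re (\<integral>p. i1b p \<partial>lborel) = 0"
proof -
  have P: "(\<integral>\<beta>. indicator I \<beta> *\<^sub>R (g \<beta> *\<^sub>R blob e (zeta \<alpha> - zeta \<beta>)) \<partial>lborel) = P e \<alpha>" for \<alpha>
    by (simp add: P_def sheet_conv_zeta)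
  have sq: "\<psi> (zeta \<alpha>) * P e \<alpha> = \<i> * of_real ((norm (P e \<alpha>))\<^sup>2 / (4 * pi))" for \<alpha>
    using complex_norm_square[of "P e \<alpha>"] by (simp add: \<psi>_sheet mult_ac)
  have "(\<integral>p. i1a p \<partial>lborel) = (\<integral>\<beta>. \<integral>\<alpha>. i1a (\<alpha>, \<beta>) \<partial>lborel \<partial>lborel)"
    using lborel_pair.integral_snd[of "\<lambda>\<alpha> \<beta>. i1a (\<alpha>, \<beta>)"] i1_integrable(1) by (simp add: lborel_prod case_prod_beta')
  also have "\<dots> = (\<integral>\<beta>. \<i> * of_real (indicator I \<beta> * g \<beta> * ((norm (P e \<beta>))\<^sup>2 / (4 * pi))) \<partial>lborel)"
  proof (rule Bochner_Integration.integral_cong[OF refl])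
    fix \<beta>
    have "(\<integral>\<alpha>. i1a (\<alpha>, \<beta>) \<partial>lborel) = (\<integral>\<alpha>. (indicator I \<beta> * g \<beta>) *\<^sub>R (\<psi> (zeta \<beta>) * (indicator I \<alpha> *\<^sub>R (g \<alpha> *\<^sub>R blob e (zeta \<beta> - zeta \<alpha>)))) \<partial>lborel)"
      by (rule Bochner_Integration.integral_cong) (simp_all add: i1a_def mult_ac)
    also have "\<dots> = (indicator I \<beta> * g \<beta>) *\<^sub>R (\<psi> (zeta \<beta>) * P e \<beta>)"
      by (simp only: integral_scaleR_right integral_mult_right_zero P)
    finally show "(\<integral>\<alpha>. i1a (\<alpha>, \<beta>) \<partial>lborel) = \<i> * of_real (indicator I \<beta> * g \<beta> * ((norm (P e \<beta>))\<^sup>2 / (4 * pi)))"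
      unfolding sq by (simp add: scaleR_conv_of_real mult_ac)
  qed
  also have "Re \<dots> = 0"
    by (simp only: integral_mult_right_zero integral_complex_of_real) simp
  finally show "Re (\<integral>p. i1a p \<partial>lborel) = 0" .
  have "(\<integral>p. i1b p \<partial>lborel) = (\<integral>\<alpha>. \<integral>\<beta>. i1b (\<alpha>, \<beta>) \<partial>lborel \<partial>lborel)"
    using lborel_pair.integral_fst[of "\<lambda>\<alpha> \<beta>. i1b (\<alpha>, \<beta>)"] i1_integrable(2) by (simp add: lborel_prod case_prod_beta')
  also have "\<dots> = (\<integral>\<alpha>. \<i> * of_real (- (indicator I \<alpha> * g \<alpha> * ((norm (P e \<alpha>))\<^sup>2 / (4 * pi)))) \<partial>lborel)"
  proof (rule Bochner_Integration.integral_cong[OF refl])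
    fix \<alpha>
    have "(\<integral>\<beta>. i1b (\<alpha>, \<beta>) \<partial>lborel) = (\<integral>\<beta>. (- (indicator I \<alpha> * g \<alpha>)) *\<^sub>R (\<psi> (zeta \<alpha>) * (indicator I \<beta> *\<^sub>R (g \<beta> *\<^sub>R blob e (zeta \<alpha> - zeta \<beta>)))) \<partial>lborel)"
    proof (rule Bochner_Integration.integral_cong[OF refl])
      fix \<beta>
      have "blob e (zeta \<beta> - zeta \<alpha>) = - blob e (zeta \<alpha> - zeta \<beta>)"
        using blob_minus[of e "zeta \<alpha> - zeta \<beta>"] by simp
      then show "i1b (\<alpha>, \<beta>) = (- (indicator I \<alpha> * g \<alpha>)) *\<^sub>R (\<psi> (zeta \<alpha>) * (indicator I \<beta> *\<^sub>R (g \<beta> *\<^sub>R blob e (zeta \<alpha> - zeta \<beta>))))"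
        by (simp add: i1b_def mult_ac)
    qed
    also have "\<dots> = (- (indicator I \<alpha> * g \<alpha>)) *\<^sub>R (\<psi> (zeta \<alpha>) * P e \<alpha>)"
      by (simp only: integral_scaleR_right integral_mult_right_zero P)
    finally show "(\<integral>\<beta>. i1b (\<alpha>, \<beta>) \<partial>lborel) = \<i> * of_real (- (indicator I \<alpha> * g \<alpha> * ((norm (P e \<alpha>))\<^sup>2 / (4 * pi))))"
      unfolding sq by (simp add: scaleR_conv_of_real mult_ac)
  qed
  also have "Re \<dots> = 0"
    by (simp only: integral_mult_right_zero integral_complex_of_real) simp
  finally show "Re (\<integral>p. i1b p \<partial>lborel) = 0" .
qed

definition K :: real where "K = G\<^sup>2 * sqrt (2 * cosh (2 * R)) * LC"

lemma K_nonneg: "0 \<le> K"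
  unfolding K_def LC_def using G_nonneg M_nonneg C0 by (intro mult_nonneg_nonneg add_nonneg_nonneg) auto

text \<open>Three factors meet: the bounded densities, the defect of the kernel and the increment of
  the test field. The half powers of \<open>D\<close> in the last two cancel, which leaves
  \<open>D\<close> to the power \<open>- (3/8)\<close>.\<close>

lemma i2_le:
  "ennreal (norm (i2 (\<alpha>, \<beta>))) \<le> ennreal (6 * K * e powr (1/4)) * (indicator I \<alpha> * (indicator I \<beta> * sing_periodic (3/4) (\<beta> - \<alpha>)))"
proof (cases "\<alpha> \<in> I \<and> \<beta> \<in> I")
  case True
  define w where "w = zeta \<beta> - zeta \<alpha>"
  have Rw: "\<bar>Re w\<bar> \<le> 2 * pi" using True by (auto simp: w_def zeta_def)
  define D where "D = denom w"
  have D0: "0 \<le> D" by (simp add: D_def denom_nonneg)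
  have main: "norm (i2 (\<alpha>, \<beta>)) \<le> K * e powr (1/4) * D powr - (3/8)"
  proof (cases "D = 0")
    case True
    \<comment> \<open>The two points coincide modulo the period: the numerator is \<open>0\<close>,
      hence both kernels are, and \<open>i2\<close> vanishes.\<close>
    have "Complex (sin (Re w)) (- sinh (Im w)) = 0"
      using norm_blob_numerator_le[of w] True by (simp add: D_def)
    then show ?thesis using K_nonneg by (simp add: i2_def blob_def flip: w_def)
  next
    case False
    then have D: "0 < D" using D0 by simp
    from denom_ge[OF Rw] obtain k where k: "k \<in> {0, 2 * pi, - (2 * pi)}"
      and kD: "(2 / pi\<^sup>2) * ((Re w - k)\<^sup>2 + (Im w)\<^sup>2) \<le> D" unfolding D_def by blast
    \<comment> \<open>Parameters near opposite ends of the period are close modulo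
      \<open>2 * pi\<close>; the shift by \<open>k\<close> does not change \<open>P e\<close>. The
      factor \<open>3\<close> comes from \<open>pi^2 / 2 \<le> 9\<close>.\<close>
    have dist: "\<bar>\<beta> - k - \<alpha>\<bar> \<le> 3 * sqrt D"
    proof -
      have "pi\<^sup>2 \<le> 16" using pi_less_4 power_mono[of pi 4 2] by simp
      then have p: "pi\<^sup>2 / 2 * D \<le> 9 * D" using D0 by (intro mult_right_mono) auto
      have "(\<beta> - k - \<alpha>)\<^sup>2 \<le> (Re w - k)\<^sup>2 + (Im w)\<^sup>2" by (simp add: w_def zeta_def algebra_simps)
      also have "\<dots> \<le> pi\<^sup>2 / 2 * D" using mult_left_mono[OF kD, of "pi\<^sup>2 / 2"] by simp
      also note p
      finally have "sqrt ((\<beta> - k - \<alpha>)\<^sup>2) \<le> sqrt (9 * D)" by (rule real_sqrt_le_mono)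
      then show ?thesis by (simp only: real_sqrt_abs real_sqrt_mult) simp
    qed
    have "norm (\<psi> (zeta \<beta>) - \<psi> (zeta \<alpha>)) = norm (P e \<beta> - P e \<alpha>) / (4 * pi)"
    proof -
      have "\<psi> (zeta \<beta>) - \<psi> (zeta \<alpha>) = \<i> / (4 * pi) * cnj (P e \<beta> - P e \<alpha>)"
        by (simp add: \<psi>_sheet algebra_simps)
      then show ?thesis by (simp only: norm_mult complex_mod_cnj norm_divide) simp
    qed
    also have "\<dots> \<le> norm (P e \<beta> - P e \<alpha>) / 3"
      using pi_gt3 by (intro divide_left_mono) auto
    also have "P e \<beta> - P e \<alpha> = P e (\<beta> - k) - P e \<alpha>" by (simp add: P_periodic[OF k])
    also have "norm (P e (\<beta> - k) - P e \<alpha>) / 3 \<le> LC * e powr - (1/8) * \<bar>\<beta> - k - \<alpha>\<bar> / 3"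
      by (intro divide_right_mono P_lipschitz[OF e]) auto
    also have "\<dots> \<le> LC * e powr - (1/8) * (3 * sqrt D) / 3"
    proof -
      have "0 \<le> LC" unfolding LC_def using G_nonneg M_nonneg C0 by (intro mult_nonneg_nonneg add_nonneg_nonneg) auto
      then show ?thesis using dist by (intro divide_right_mono mult_left_mono mult_nonneg_nonneg) auto
    qed
    finally have A: "norm (\<psi> (zeta \<beta>) - \<psi> (zeta \<alpha>)) \<le> LC * e powr - (1/8) * sqrt D" by simp
    have B: "norm (blob 0 w - blob e w) \<le> sqrt (2 * cosh (2 * R)) * (1 / sqrt D) * (e powr (3/8) * D powr - (3/8))"
    proof -
      have De: "complex_of_real (D + e) \<noteq> 0" "complex_of_real D \<noteq> 0" using D e by (auto simp del: of_real_add)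
      have "blob 0 w - blob e w = blob 0 w * of_real (e / (D + e))"
        using De by (simp add: blob_def D_def[symmetric] divide_simps del: of_real_add) (simp add: algebra_simps)
      then have n: "norm (blob 0 w - blob e w) = norm (blob 0 w) * (e / (D + e))"
        using D e by (simp add: norm_mult del: of_real_divide of_real_add)
      have 1: "norm (blob 0 w) \<le> sqrt (2 * cosh (2 * R)) * (1 / sqrt D)"
      proof -
        have "\<bar>Im w\<bar> \<le> 2 * R" using h_le[of \<alpha>] h_le[of \<beta>] by (simp add: w_def zeta_def)
        then have "cosh \<bar>Im w\<bar> \<le> cosh (2 * R)" using R_nonneg by (subst cosh_real_nonneg_le_iff) auto
        then have ch: "cosh (Im w) \<le> cosh (2 * R)" by (simp only: cosh_real_abs)
        have "norm (blob 0 w) \<le> sqrt (2 * cosh (Im w)) * (1 / sqrt D)"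
          using norm_blob_le(1)[of 0 w] by (simp add: D_def)
        also have "\<dots> \<le> sqrt (2 * cosh (2 * R)) * (1 / sqrt D)"
          using ch D by (intro mult_right_mono) auto
        finally show ?thesis .
      qed
      \<comment> \<open>An interpolation between the trivial bounds \<open>1\<close> and
        \<open>e / D\<close>. A larger exponent than \<open>3/8\<close> would improve the rate but
        worsen the singularity.\<close>
      have 2: "e / (D + e) \<le> e powr (3/8) * D powr - (3/8)"
      proof -
        have ex: "(5/8::real) + 3/8 = 1" "(3/8::real) + 5/8 = 1" by simp_all
        have "e / (D + e) = (e powr (3/8) * e powr (5/8)) * ((D + e) powr - (3/8) * (D + e) powr - (5/8))"
        proof -
          have m: "- (3/8) + - (5/8) = (- 1 :: real)" by simp
          have "(D + e) powr - (3/8) * (D + e) powr - (5/8) = (D + e) powr - 1"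
            unfolding m[symmetric] by (rule powr_add[symmetric])
          also have "\<dots> = 1 / (D + e)" by (rule powr_neg_one) (use D e in simp)
          finally have "(D + e) powr - (3/8) * (D + e) powr - (5/8) = 1 / (D + e)" .
          moreover have "e powr (3/8) * e powr (5/8) = e powr 1"
            unfolding ex(2)[symmetric] by (rule powr_add[symmetric])
          ultimately show ?thesis using e by simp
        qed
        also have "\<dots> \<le> (e powr (3/8) * e powr (5/8)) * (D powr - (3/8) * e powr - (5/8))"
          using D e by (intro mult_left_mono mult_mono powr_mono2') auto
        also have "\<dots> = e powr (3/8) * D powr - (3/8) * (e powr (5/8) * e powr - (5/8))" by simp
        also have "e powr (5/8) * e powr - (5/8) = 1"
          using e powr_add[of e "5/8" "- (5/8)"] by simp
        finally show ?thesis by simp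
      qed
      show ?thesis unfolding n using D e by (intro mult_mono 1 2) auto
    qed
    have "norm (i2 (\<alpha>, \<beta>)) = (\<bar>g \<alpha>\<bar> * \<bar>g \<beta>\<bar>) * (norm (blob 0 w - blob e w) * norm (\<psi> (zeta \<beta>) - \<psi> (zeta \<alpha>)))"
      using \<open>\<alpha> \<in> I \<and> \<beta> \<in> I\<close> by (simp add: i2_def norm_mult abs_mult w_def)
    also have "\<dots> \<le> (G * G) * ((sqrt (2 * cosh (2 * R)) * (1 / sqrt D) * (e powr (3/8) * D powr - (3/8))) * (LC * e powr - (1/8) * sqrt D))"
      using D0 by (intro mult_mono A B g_le mult_nonneg_nonneg) (auto simp: G_nonneg)
    also have "\<dots> = K * (e powr (3/8) * e powr - (1/8)) * D powr - (3/8)"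
      using D by (simp add: K_def power2_eq_square)
    also have "e powr (3/8) * e powr - (1/8) = e powr (1/4)"
      using powr_add[of e "3/8" "- (1/8)"] by simp
    finally show ?thesis .
  qed
  have "ennreal (D powr - ((3/4 + 0) / 2)) \<le> 6 * (sing_periodic (3/4) (Re w) * sing 0 (Im w))"
    unfolding D_def by (rule denom_powr_le[OF Rw]) auto
  moreover have "sing 0 s = 1" for s by (simp add: sing_def)
  ultimately have S: "ennreal (D powr - (3/8)) \<le> 6 * sing_periodic (3/4) (\<beta> - \<alpha>)" by (simp add: w_def zeta_def)
  have "ennreal (norm (i2 (\<alpha>, \<beta>))) \<le> ennreal (K * e powr (1/4)) * ennreal (D powr - (3/8))"
    using main K_nonneg by (simp add: ennreal_mult[symmetric])
  also have "\<dots> \<le> ennreal (K * e powr (1/4)) * (6 * sing_periodic (3/4) (\<beta> - \<alpha>))"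
    by (rule mult_left_mono[OF S]) simp
  also have "\<dots> = ennreal (6 * K * e powr (1/4)) * sing_periodic (3/4) (\<beta> - \<alpha>)"
    using K_nonneg by (simp add: ennreal_mult mult_ac)
  finally show ?thesis using True by simp
qed (auto simp: i2_def)

lemma i2_nn_integral: "(\<integral>\<^sup>+p. ennreal (norm (i2 p)) \<partial>lborel) \<le> ennreal (6 * K * e powr (1/4) * (2 * pi * C0))"
proof -
  have "(\<integral>\<^sup>+p. ennreal (norm (i2 p)) \<partial>lborel)
     \<le> (\<integral>\<^sup>+p. ennreal (6 * K * e powr (1/4)) * (indicator I (fst p) * (indicator I (snd p) * sing_periodic (3/4) (snd p - fst p))) \<partial>lborel)"
    by (rule nn_integral_mono) (use i2_le in auto)
  also have "\<dots> = (\<integral>\<^sup>+\<alpha>. \<integral>\<^sup>+\<beta>. ennreal (6 * K * e powr (1/4)) * (indicator I \<alpha> * (indicator I \<beta> * sing_periodic (3/4) (\<beta> - \<alpha>))) \<partial>lborel \<partial>lborel)"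
    unfolding lborel_prod[symmetric] by (subst lborel.nn_integral_fst[symmetric]) simp_all
  also have "\<dots> = (\<integral>\<^sup>+\<alpha>. ennreal (6 * K * e powr (1/4)) * (indicator I \<alpha> * (\<integral>\<^sup>+\<beta>. indicator I \<beta> * sing_periodic (3/4) (\<beta> - \<alpha>) \<partial>lborel)) \<partial>lborel)"
    by (simp add: nn_integral_cmult)
  also have "\<dots> \<le> (\<integral>\<^sup>+\<alpha>. ennreal (6 * K * e powr (1/4)) * (indicator I \<alpha> * ennreal C0) \<partial>lborel)"
  proof (rule nn_integral_mono)
    fix \<alpha>
    show "ennreal (6 * K * e powr (1/4)) * (indicator I \<alpha> * (\<integral>\<^sup>+\<beta>. indicator I \<beta> * sing_periodic (3/4) (\<beta> - \<alpha>) \<partial>lborel))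
      \<le> ennreal (6 * K * e powr (1/4)) * (indicator I \<alpha> * ennreal C0)"
      using C0(2)[of \<alpha>] by (cases "\<alpha> \<in> I") (auto intro!: mult_left_mono simp: abs_le_iff)
  qed
  also have "\<dots> = ennreal (6 * K * e powr (1/4)) * (ennreal (2 * pi) * ennreal C0)"
    by (simp add: nn_integral_cmult nn_integral_multc)
  also have "\<dots> = ennreal (6 * K * e powr (1/4)) * ennreal (2 * pi * C0)"
    using C0 by (subst ennreal_mult[symmetric]) simp_all
  also have "\<dots> = ennreal (6 * K * e powr (1/4) * (2 * pi * C0))"
    using K_nonneg C0 by (intro ennreal_mult[symmetric]) simp_all
  finally show ?thesis .
qed

text \<open>Only the real part enters the weak formulation, and to it the two regularized halves
  contribute nothing; the estimate is that of \<open>i2\<close>.\<close>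

theorem interaction_bound: "\<bar>Re (\<integral>p. interaction p \<partial>lborel)\<bar> \<le> 6 * K * e powr (1/4) * (2 * pi * C0)"
proof -
  have [measurable]: "\<psi> \<in> borel_measurable borel" using \<psi>_cont by (rule borel_measurable_continuous_onI)
  have m: "i2 \<in> borel_measurable lborel"
    unfolding lborel_prod[symmetric] i2_def by measurable
  have fin: "(\<integral>\<^sup>+p. ennreal (norm (i2 p)) \<partial>lborel) < \<infinity>"
    using i2_nn_integral by (rule order_le_less_trans) simp
  have i: "integrable lborel i2" by (rule integrableI_bounded[OF m fin])
  have "(\<integral>p. interaction p \<partial>lborel) = (\<integral>p. i1a p \<partial>lborel) - (\<integral>p. i1b p \<partial>lborel) + (\<integral>p. i2 p \<partial>lborel)"
    unfolding interaction_split using i i1_integrable by simp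
  then have "Re (\<integral>p. interaction p \<partial>lborel) = Re (\<integral>p. i2 p \<partial>lborel)" using Re_i1 by simp
  also have "\<bar>\<dots>\<bar> \<le> norm (\<integral>p. i2 p \<partial>lborel)" by (rule abs_Re_le_cmod)
  also have "\<dots> \<le> 6 * K * e powr (1/4) * (2 * pi * C0)"
  proof -
    have "ennreal (norm (\<integral>p. i2 p \<partial>lborel)) \<le> ennreal (6 * K * e powr (1/4) * (2 * pi * C0))"
      by (rule order_trans[OF integral_norm_bound_ennreal[OF i] i2_nn_integral])
    then show ?thesis using K_nonneg C0 by simp
  qed
  finally show ?thesis .
qed

end

section \<open>Stream functions and test fields\<close>

text \<open>For \<open>e = 0\<close> this is, up to an additive constant, \<open>4 * pi\<close>
  times the Green function of the Laplacian on the periodic strip; \<open>e\<close> removes its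
  logarithmic poles.\<close>

definition lnk :: "real \<Rightarrow> complex \<Rightarrow> real" where
  "lnk e w = ln (denom w + e)"

definition blob_x :: "real \<Rightarrow> complex \<Rightarrow> complex" where
  "blob_x e w = of_real (cos (Re w) / (denom w + e)) - of_real (sin (Re w) / (denom w + e)) * blob e w"

definition blob_y :: "real \<Rightarrow> complex \<Rightarrow> complex" where
  "blob_y e w = - \<i> * of_real (cosh (Im w) / (denom w + e)) - of_real (sinh (Im w) / (denom w + e)) * blob e w"

lemma has_derivative_divide_const:
  "(f has_derivative f') F \<Longrightarrow> ((\<lambda>x. f x / c) has_derivative (\<lambda>x. f' x / c)) F" for c :: "'b::real_normed_field"
  by (rule bounded_linear.has_derivative[OF bounded_linear_divide])

lemma cnj_measurable [measurable]: "cnj \<in> borel_measurable borel"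
  by (intro borel_measurable_continuous_onI continuous_intros)

lemma denom_add_pos: "0 < e \<Longrightarrow> 0 < denom w + e"
  using denom_nonneg[of w] by linarith

lemma blob_sel: "Re (blob e w) = sin (Re w) / (denom w + e)" "Im (blob e w) = - sinh (Im w) / (denom w + e)"
  by (simp_all add: blob_def del: of_real_add)

lemma blob_der: "0 < e \<Longrightarrow> (blob e has_derivative (\<lambda>v. Re v *\<^sub>R blob_x e w + Im v *\<^sub>R blob_y e w)) (at w)"
  unfolding blob_x_def blob_y_def by (rule blob_has_derivative)

lemma blob_continuous: "0 < e \<Longrightarrow> continuous_on A (blob e)"
  by (rule blob_cont[OF _ continuous_on_id])

lemma blob_xy_continuous:
  assumes "0 < e" shows "continuous_on A (blob_x e)" "continuous_on A (blob_y e)"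
proof -
  have p: "denom w + e \<noteq> 0" for w using denom_add_pos[OF assms, of w] by simp
  show "continuous_on A (blob_x e)" "continuous_on A (blob_y e)"
    unfolding blob_x_def blob_y_def by (intro continuous_intros blob_continuous[OF assms] ballI p)+
qed

lemma denom_has_derivative: "(denom has_derivative (\<lambda>v. Re v * sin (Re w) + Im v * sinh (Im w))) (at w)"
proof -
  have "((\<lambda>w. cosh (Im w)) has_derivative (\<lambda>v. Im v * sinh (Im w))) (at w)"
    "((\<lambda>w. cos (Re w)) has_derivative (\<lambda>v. Re v * - sin (Re w))) (at w)"
    by (rule DERIV_compose_FDERIV; auto intro!: derivative_eq_intros)+
  from has_derivative_diff[OF this] show ?thesis
    unfolding denom_def[abs_def] by (simp add: algebra_simps)
qed

lemma lnk_der: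
  assumes "0 < e"
  shows "(lnk e has_derivative (\<lambda>v. Re v *\<^sub>R Re (blob e w) + Im v *\<^sub>R (- Im (blob e w)))) (at w)"
proof -
  have "((\<lambda>w. denom w + e) has_derivative (\<lambda>v. Re v * sin (Re w) + Im v * sinh (Im w))) (at w)"
    using has_derivative_add[OF denom_has_derivative[of w] has_derivative_const[of e]] by simp
  from DERIV_compose_FDERIV[OF DERIV_ln[OF denom_add_pos[OF assms]] this] show ?thesis
    unfolding lnk_def[abs_def] by (simp add: blob_sel divide_inverse algebra_simps)
qed

lemma lnk_continuous: "0 < e \<Longrightarrow> continuous_on A (lnk e)"
  using has_derivative_continuous[OF lnk_der] by (auto intro: continuous_at_imp_continuous_on)

lemma lnk_sym: "lnk e (- w) = lnk e w" and lnk_add_2pi: "lnk e (w + of_real (2 * pi)) = lnk e w"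
  unfolding lnk_def blob_add_2pi by (simp_all add: denom_def)

text \<open>Equality of the mixed second derivatives of \<open>lnk e\<close>, whose gradient is the
  conjugate of \<open>blob e\<close>. It makes the perpendicular gradient divergence-free.\<close>

lemma blob_symmetry: "Re (blob_y e w) = - Im (blob_x e w)"
  by (simp add: blob_x_def blob_y_def blob_sel del: of_real_add)

text \<open>\<open>- Im (blob e w)\<close> is the vertical derivative of \<open>lnk e\<close>, the
  one that a vertical motion of the sheet produces. By \<open>blob_symmetry\<close> its gradient is
  expressed through \<open>blob_y\<close> alone.\<close>

lemma minus_Im_blob_der:
  assumes "0 < e"
  shows "((\<lambda>w. - Im (blob e w)) has_derivative (\<lambda>v. Re v *\<^sub>R Re (blob_y e w) + Im v *\<^sub>R (- Im (blob_y e w)))) (at w)"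
proof -
  have "((\<lambda>w. - Im (blob e w)) has_derivative (\<lambda>v. - Im (Re v *\<^sub>R blob_x e w + Im v *\<^sub>R blob_y e w))) (at w)"
    by (intro has_derivative_minus has_derivative_Im blob_der assms)
  then show ?thesis by (simp add: blob_symmetry algebra_simps)
qed

section \<open>Regularity of kernels integrated over the sheet\<close>

lemma sheet_conv_HK:
  fixes F :: "complex \<Rightarrow> 'b::euclidean_space"
  assumes "continuous_on UNIV h" "continuous_on UNIV g" "continuous_on UNIV F"
  shows "sheet_conv h g F z = integral {-pi..pi} (\<lambda>\<alpha>. g \<alpha> *\<^sub>R F (z - Complex \<alpha> (h \<alpha>)))"
proof -
  have "continuous_on {-pi..pi} (\<lambda>\<alpha>. g \<alpha> *\<^sub>R F (z - Complex \<alpha> (h \<alpha>)))"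
    unfolding Complex_eq
    by (intro continuous_intros continuous_on_compose2[OF assms(3)] continuous_on_compose2[OF assms(2)] continuous_on_compose2[OF assms(1)]) auto
  then have "set_integrable lborel {-pi..pi} (\<lambda>\<alpha>. g \<alpha> *\<^sub>R F (z - Complex \<alpha> (h \<alpha>)))"
    by (rule borel_integrable_atLeastAtMost')
  then show ?thesis unfolding sheet_conv_def by (rule set_borel_integral_eq_integral)
qed

lemma continuous_sheet_integrand:
  fixes F :: "complex \<Rightarrow> 'b::euclidean_space"
  assumes "continuous_on UNIV h" "continuous_on UNIV g" "continuous_on UNIV F"
  shows "continuous_on A (\<lambda>(z, \<alpha>). g \<alpha> *\<^sub>R F (z - Complex \<alpha> (h \<alpha>)))"
  unfolding Complex_eq case_prod_beta'
  by (intro continuous_intros continuous_on_compose2[OF assms(3)] continuous_on_compose2[OF assms(2)] continuous_on_compose2[OF assms(1)]) auto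

lemma sheet_conv_continuous:
  fixes F :: "complex \<Rightarrow> 'b::euclidean_space"
  assumes c: "continuous_on UNIV h" "continuous_on UNIV g" "continuous_on UNIV F"
  shows "continuous_on A (sheet_conv h g F)"
proof -
  have "continuous_on A (\<lambda>z. integral (cbox (-pi) pi) (\<lambda>\<alpha>. g \<alpha> *\<^sub>R F (z - Complex \<alpha> (h \<alpha>))))"
    by (rule integral_continuous_on_param) (rule continuous_sheet_integrand[OF c])
  then show ?thesis by (simp add: sheet_conv_HK[OF c, abs_def])
qed

lemma sheet_conv_has_derivative:
  fixes F Fx Fy :: "complex \<Rightarrow> 'b::euclidean_space"
  assumes c: "continuous_on UNIV h" "continuous_on UNIV g"
    and F: "\<And>w. (F has_derivative (\<lambda>v. Re v *\<^sub>R Fx w + Im v *\<^sub>R Fy w)) (at w)"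
    and Fc: "continuous_on UNIV Fx" "continuous_on UNIV Fy"
  shows "(sheet_conv h g F has_derivative (\<lambda>v. Re v *\<^sub>R sheet_conv h g Fx z + Im v *\<^sub>R sheet_conv h g Fy z)) (at z)"
proof -
  have F0: "continuous_on UNIV F"
    using has_derivative_continuous[OF F] by (auto intro: continuous_at_imp_continuous_on)
  let ?z = "\<lambda>z \<alpha>. z - Complex \<alpha> (h \<alpha>)"
  let ?d = "\<lambda>z \<alpha> v. g \<alpha> *\<^sub>R (Re v *\<^sub>R Fx (?z z \<alpha>) + Im v *\<^sub>R Fy (?z z \<alpha>))"
  have "((\<lambda>z. integral {-pi..pi} (\<lambda>\<alpha>. g \<alpha> *\<^sub>R F (?z z \<alpha>))) has_derivative (\<lambda>v. integral {-pi..pi} (\<lambda>\<alpha>. ?d z \<alpha> v))) (at z within UNIV)"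
  proof (rule has_derivative_integral_param)
    show "((\<lambda>z. g \<alpha> *\<^sub>R F (?z z \<alpha>)) has_derivative ?d z \<alpha>) (at z within UNIV)" for z \<alpha>
    proof -
      have "((\<lambda>z. ?z z \<alpha>) has_derivative (\<lambda>v. v)) (at z)" by (auto intro!: derivative_eq_intros)
      from has_derivative_compose[OF this F] show ?thesis by (intro has_derivative_scaleR_right) simp
    qed
    show "continuous_on (UNIV \<times> {-pi..pi}) (\<lambda>(z, \<alpha>). ?d z \<alpha> v)" for v
      using continuous_on_add[OF continuous_on_scaleR[OF continuous_on_const[of _ "Re v"] continuous_sheet_integrand[OF c Fc(1)]]
          continuous_on_scaleR[OF continuous_on_const[of _ "Im v"] continuous_sheet_integrand[OF c Fc(2)]], of "UNIV \<times> {-pi..pi}"]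
      by (simp add: case_prod_beta' scaleR_add_right mult.commute)
    show "continuous_on {-pi..pi} (\<lambda>\<alpha>. g \<alpha> *\<^sub>R F (?z z \<alpha>))" for z
      unfolding Complex_eq
      by (intro continuous_intros continuous_on_compose2[OF F0] continuous_on_compose2[OF c(1)] continuous_on_compose2[OF c(2)]) auto
  qed auto
  moreover have "integral {-pi..pi} (\<lambda>\<alpha>. ?d z \<alpha> v) = Re v *\<^sub>R sheet_conv h g Fx z + Im v *\<^sub>R sheet_conv h g Fy z" for v
  proof -
    have i: "(\<lambda>\<alpha>. g \<alpha> *\<^sub>R G (?z z \<alpha>)) integrable_on {-pi..pi}" if "continuous_on UNIV G" for G :: "complex \<Rightarrow> 'b"
      unfolding Complex_eq
      by (intro integrable_continuous_real continuous_intros continuous_on_compose2[OF that] continuous_on_compose2[OF c(1)] continuous_on_compose2[OF c(2)]) auto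
    have "integral {-pi..pi} (\<lambda>\<alpha>. ?d z \<alpha> v)
        = integral {-pi..pi} (\<lambda>\<alpha>. Re v *\<^sub>R (g \<alpha> *\<^sub>R Fx (?z z \<alpha>)) + Im v *\<^sub>R (g \<alpha> *\<^sub>R Fy (?z z \<alpha>)))"
      by (simp add: scaleR_add_right mult.commute)
    also have "\<dots> = Re v *\<^sub>R integral {-pi..pi} (\<lambda>\<alpha>. g \<alpha> *\<^sub>R Fx (?z z \<alpha>)) + Im v *\<^sub>R integral {-pi..pi} (\<lambda>\<alpha>. g \<alpha> *\<^sub>R Fy (?z z \<alpha>))"
      by (simp only: Henstock_Kurzweil_Integration.integral_add[OF integrable_cmul[OF i[OF Fc(1)]] integrable_cmul[OF i[OF Fc(2)]]]
          Henstock_Kurzweil_Integration.integral_cmul)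
    finally show ?thesis by (simp add: sheet_conv_HK[OF c] Fc)
  qed
  ultimately show ?thesis
    by (simp add: sheet_conv_HK[OF c F0, abs_def])
qed

lemma sheet_conv_periodic:
  assumes "\<And>w. F (w + of_real (2 * pi)) = F w"
  shows "sheet_conv h g F (z + of_real (2 * pi)) = sheet_conv h g F z"
proof -
  have "F (z + of_real (2 * pi) - w) = F (z - w)" for w
    using assms[of "z - w"] by (simp add: algebra_simps)
  then show ?thesis by (simp add: sheet_conv_def)
qed

lemma Re_sheet_conv:
  assumes c: "continuous_on UNIV h" "continuous_on UNIV g" "continuous_on UNIV F"
  shows "Re (sheet_conv h g F z) = sheet_conv h g (\<lambda>w. Re (F w)) z"
    "- Im (sheet_conv h g F z) = sheet_conv h g (\<lambda>w. - Im (F w)) z"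
proof -
  have "continuous_on {-pi..pi} (\<lambda>\<alpha>. g \<alpha> *\<^sub>R F (z - Complex \<alpha> (h \<alpha>)))"
    unfolding Complex_eq
    by (intro continuous_intros continuous_on_compose2[OF c(3)] continuous_on_compose2[OF c(2)] continuous_on_compose2[OF c(1)]) auto
  then have i: "integrable lborel (\<lambda>\<alpha>. indicator {-pi..pi} \<alpha> *\<^sub>R (g \<alpha> *\<^sub>R F (z - Complex \<alpha> (h \<alpha>))))"
    using borel_integrable_atLeastAtMost' unfolding set_integrable_def by blast
  show "Re (sheet_conv h g F z) = sheet_conv h g (\<lambda>w. Re (F w)) z"
    unfolding sheet_conv_def set_lebesgue_integral_def using integral_Re[OF i] by (simp add: mult.assoc)
  show "- Im (sheet_conv h g F z) = sheet_conv h g (\<lambda>w. - Im (F w)) z"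
    unfolding sheet_conv_def set_lebesgue_integral_def using integral_Im[OF i] by (simp add: mult.assoc)
qed

text \<open>After scaling by \<open>N\<close> the transition takes place for heights between
  \<open>N\<close> and \<open>2 * N\<close>, so each derivative of the cutoff gains a factor
  \<open>1 / N\<close>.\<close>

locale cutoff =
  fixes X X' X'' :: "real \<Rightarrow> real" and N :: real
  assumes X_der: "(X has_real_derivative X' s) (at s)" and X'_der: "(X' has_real_derivative X'' s) (at s)"
    and X''_cont: "continuous_on UNIV X''" and N: "0 < N"
    and X_1: "\<bar>s\<bar> \<le> 1 \<Longrightarrow> X s = 1" and X_0: "2 \<le> \<bar>s\<bar> \<Longrightarrow> X s = 0"
    and X'_0: "\<bar>s\<bar> < 1 \<Longrightarrow> X' s = 0" "2 < \<bar>s\<bar> \<Longrightarrow> X' s = 0"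
begin

definition c :: "complex \<Rightarrow> real" where "c z = X (Im z / N)"
definition c1 :: "complex \<Rightarrow> real" where "c1 z = X' (Im z / N) / N"
definition c2 :: "complex \<Rightarrow> real" where "c2 z = X'' (Im z / N) / N / N"

lemma Im_scaled: "((\<lambda>z. Im z / N) has_derivative (\<lambda>v. Im v / N)) (at z)"
  using N by (auto intro!: derivative_eq_intros)

lemma c_der: "(c has_derivative (\<lambda>v. Im v * c1 z)) (at z)"
  using DERIV_compose_FDERIV[OF X_der Im_scaled] by (simp add: c_def[abs_def] c1_def)

lemma c1_der: "(c1 has_derivative (\<lambda>v. Im v * c2 z)) (at z)"
  using has_derivative_divide_const[OF DERIV_compose_FDERIV[OF X'_der Im_scaled], of N]
  by (simp add: c1_def[abs_def] c2_def)

lemma c_cont: "continuous_on A c" "continuous_on A c1" "continuous_on A c2"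
proof -
  show "continuous_on A c" "continuous_on A c1"
    using has_derivative_continuous[OF c_der] has_derivative_continuous[OF c1_der]
    by (auto intro: continuous_at_imp_continuous_on)
  have N0: "N \<noteq> 0" using N by simp
  show "continuous_on A c2" unfolding c2_def
    by (intro continuous_intros continuous_on_compose2[OF X''_cont]) (use N0 in auto)
qed

lemma c_far: "2 * N < \<bar>Im z\<bar> \<Longrightarrow> c z = 0" "2 * N < \<bar>Im z\<bar> \<Longrightarrow> c1 z = 0"
proof -
  assume "2 * N < \<bar>Im z\<bar>"
  then have "2 < \<bar>Im z / N\<bar>" using N by (simp add: field_simps)
  then show "c z = 0" "c1 z = 0" using X_0[of "Im z / N"] X'_0(2)[of "Im z / N"] by (auto simp: c_def c1_def)
qed

lemma c_near: "\<bar>Im z\<bar> < N \<Longrightarrow> c z = 1" "\<bar>Im z\<bar> < N \<Longrightarrow> c1 z = 0"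
proof -
  assume "\<bar>Im z\<bar> < N"
  then have "\<bar>Im z / N\<bar> < 1" using N by (simp add: field_simps)
  then show "c z = 1" "c1 z = 0" using X_1[of "Im z / N"] X'_0(1)[of "Im z / N"] by (auto simp: c_def c1_def)
qed

lemma c_periodic: "c (z + of_real (2 * pi)) = c z" "c1 (z + of_real (2 * pi)) = c1 z"
  by (simp_all add: c_def c1_def)

end

section \<open>Velocity and stream function of a sheet\<close>

context sheet
begin

text \<open>The Biot--Savart law gives the conjugate velocity; the prefactor is the conjugate of its
  constant \<open>1 / (4 * pi * \<i>)\<close>.\<close>

definition vel :: "complex \<Rightarrow> complex" where
  "vel z = \<i> / (4 * pi) * cnj (sheet_conv h g (blob 0) z)"

text \<open>In contrast to \<open>vel\<close>, the functions \<open>V\<close> and \<open>\<Psi>\<close> do not include the factor \<open>1 / (4 \<pi>)\<close>.\<close>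

definition V :: "real \<Rightarrow> complex \<Rightarrow> complex" where "V e = sheet_conv h g (blob e)"
definition \<Psi> :: "real \<Rightarrow> complex \<Rightarrow> real" where "\<Psi> e = sheet_conv h g (lnk e)"

lemma vel_meas [measurable]: "vel \<in> borel_measurable borel"
  unfolding vel_def[abs_def] sheet_conv_zeta by measurable

lemma V_der: "0 < e \<Longrightarrow> (V e has_derivative (\<lambda>v. Re v *\<^sub>R sheet_conv h g (blob_x e) z + Im v *\<^sub>R sheet_conv h g (blob_y e) z)) (at z)"
  unfolding V_def by (rule sheet_conv_has_derivative[OF h_cont g_cont blob_der blob_xy_continuous])

lemma \<Psi>_der: "0 < e \<Longrightarrow> (\<Psi> e has_derivative (\<lambda>v. Re v * Re (V e z) + Im v * - Im (V e z))) (at z)"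
proof -
  assume e: "0 < e"
  have "(sheet_conv h g (lnk e) has_derivative (\<lambda>v. Re v *\<^sub>R sheet_conv h g (\<lambda>w. Re (blob e w)) z + Im v *\<^sub>R sheet_conv h g (\<lambda>w. - Im (blob e w)) z)) (at z)"
    by (rule sheet_conv_has_derivative[OF h_cont g_cont lnk_der[OF e]]) (intro continuous_intros blob_continuous[OF e])+
  then show ?thesis unfolding \<Psi>_def V_def Re_sheet_conv[OF h_cont g_cont blob_continuous[OF e]] by simp
qed

end

locale sheet_cutoff = sheet + cutoff +
  assumes RN: "R < N"
begin

lemma RN': "R \<le> 2 * N" using RN N by linarith

lemma zeta_near: "c (zeta \<alpha>) = 1" "c1 (zeta \<alpha>) = 0"
  using c_near[of "zeta \<alpha>"] h_le[of \<alpha>] RN by (auto simp: zeta_def)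

text \<open>The real part of \<open>linear_identity\<close> for a real test function. In effect, the
  vorticity of \<open>vel\<close> is the measure on the sheet with density \<open>g\<close>.\<close>

lemma stream_test:
  fixes \<phi> \<phi>x \<phi>y :: "complex \<Rightarrow> real"
  assumes d: "\<And>z. (\<phi> has_derivative (\<lambda>v. Re v * \<phi>x z + Im v * \<phi>y z)) (at z)"
    and cont: "continuous_on UNIV \<phi>x" "continuous_on UNIV \<phi>y"
    and per: "x_periodic \<phi>" and supp: "\<And>z. 2 * N < \<bar>Im z\<bar> \<Longrightarrow> \<phi> z = 0"
  shows "(LINT z:strip|lborel. vel z \<bullet> Complex (- \<phi>y z) (\<phi>x z)) = - (LINT \<alpha>:I|lborel. g \<alpha> * \<phi> (zeta \<alpha>))"
proof -
  interpret t: sheet_test h g R G "\<lambda>z. of_real (\<phi> z)" "\<lambda>z. of_real (\<phi>x z)" "\<lambda>z. of_real (\<phi>y z)" "2 * N"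
  proof
    show "((\<lambda>z. complex_of_real (\<phi> z)) has_derivative (\<lambda>v. Re v *\<^sub>R complex_of_real (\<phi>x z) + Im v *\<^sub>R complex_of_real (\<phi>y z))) (at z)" for z
      using has_derivative_of_real[OF d[of z]] by (simp add: scaleR_conv_of_real)
    show "x_periodic (\<lambda>z. complex_of_real (\<phi> z))" using per by (simp add: x_periodic_def)
  qed (use supp RN' in \<open>auto intro!: continuous_intros cont\<close>)
  have "vel z \<bullet> Complex (- \<phi>y z) (\<phi>x z) = Re (sheet_conv h g (blob 0) z * t.\<Theta> z) / (4 * pi)" for z
    by (simp add: vel_def t.\<Theta>_def inner_complex_def algebra_simps add_divide_distrib diff_divide_distrib)
  then have "(LINT z:strip|lborel. vel z \<bullet> Complex (- \<phi>y z) (\<phi>x z))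
      = (LINT z:strip|lborel. Re (sheet_conv h g (blob 0) z * t.\<Theta> z)) / (4 * pi)"
    by (simp add: set_lebesgue_integral_def)
  also have "(LINT z:strip|lborel. Re (sheet_conv h g (blob 0) z * t.\<Theta> z)) = Re (LINT z:strip|lborel. sheet_conv h g (blob 0) z * t.\<Theta> z)"
  proof -
    obtain B where B: "\<And>z. norm (t.\<Theta>' z) \<le> B" using t.\<Theta>'_bounded by blast
    have "integrable lborel (\<lambda>z. \<integral>\<alpha>. (indicator strip z *\<^sub>R t.\<Theta>' z) * (indicator I \<alpha> *\<^sub>R (g \<alpha> *\<^sub>R blob 0 (z - zeta \<alpha>))) \<partial>lborel)"
      using lborel_pair.integrable_fst'[OF linear_integrable[OF t.\<Theta>_meas(2) B t.\<Theta>'_supp RN']] by simp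
    then have "integrable lborel (\<lambda>z. indicator strip z *\<^sub>R (sheet_conv h g (blob 0) z * t.\<Theta> z))"
      unfolding integral_mult_right_zero t.\<Theta>'_eq by (simp add: sheet_conv_zeta mult.commute)
    from integral_Re[OF this] show ?thesis by (simp add: set_lebesgue_integral_def)
  qed
  also have "\<dots> = - (4 * pi) * Re (LINT \<alpha>:I|lborel. of_real (g \<alpha> * \<phi> (zeta \<alpha>)))"
    by (simp add: t.linear_identity scaleR_conv_of_real)
  also have "(LINT \<alpha>:I|lborel. complex_of_real (g \<alpha> * \<phi> (zeta \<alpha>))) = of_real (LINT \<alpha>:I|lborel. g \<alpha> * \<phi> (zeta \<alpha>))"
    by (rule set_integral_complex_of_real)
  finally show ?thesis by simp
qed

text \<open>The perpendicular gradient of the truncated stream function \<open>c \<Psi> / (4 \<pi>)\<close>.\<close>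

definition psi :: "real \<Rightarrow> complex \<Rightarrow> complex" where
  "psi e z = (of_real (c z) * (\<i> * cnj (V e z)) - of_real (c1 z * \<Psi> e z)) / (4 * pi)"

definition psi_x :: "real \<Rightarrow> complex \<Rightarrow> complex" where
  "psi_x e z = (of_real (c z) * (\<i> * cnj (sheet_conv h g (blob_x e) z)) - of_real (c1 z * Re (V e z))) / (4 * pi)"

definition psi_y :: "real \<Rightarrow> complex \<Rightarrow> complex" where
  "psi_y e z = (of_real (c1 z) * (\<i> * cnj (V e z)) + of_real (c z) * (\<i> * cnj (sheet_conv h g (blob_y e) z))
     - of_real (c2 z * \<Psi> e z + c1 z * - Im (V e z))) / (4 * pi)"

lemma psi_der:
  assumes e: "0 < e"
  shows "(psi e has_derivative (\<lambda>v. Re v *\<^sub>R psi_x e z + Im v *\<^sub>R psi_y e z)) (at z)"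
proof -
  have 1: "((\<lambda>z. complex_of_real (c z) * (\<i> * cnj (V e z))) has_derivative (\<lambda>v. of_real (c z) * (\<i> * cnj (Re v *\<^sub>R sheet_conv h g (blob_x e) z + Im v *\<^sub>R sheet_conv h g (blob_y e) z))
     + of_real (Im v * c1 z) * (\<i> * cnj (V e z)))) (at z)"
    by (intro has_derivative_mult has_derivative_of_real c_der has_derivative_mult_right has_derivative_cnj V_der e)
  have 2: "((\<lambda>z. complex_of_real (c1 z * \<Psi> e z)) has_derivative (\<lambda>v. of_real (c1 z * (Re v * Re (V e z) + Im v * - Im (V e z)) + Im v * c2 z * \<Psi> e z))) (at z)"
    by (intro has_derivative_mult has_derivative_of_real c1_der \<Psi>_der e)
  show ?thesis unfolding psi_def[abs_def]
    by (rule has_derivative_eq_rhs[OF has_derivative_divide_const[OF has_derivative_diff[OF 1 2]]])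
      (simp add: fun_eq_iff psi_x_def psi_y_def scaleR_conv_of_real add_divide_distrib diff_divide_distrib algebra_simps)
qed

lemma psi_xy_cont:
  assumes e: "0 < e" shows "continuous_on UNIV (psi_x e)" "continuous_on UNIV (psi_y e)"
  unfolding psi_x_def[abs_def] psi_y_def[abs_def] V_def \<Psi>_def
  by (auto intro!: continuous_intros c_cont sheet_conv_continuous h_cont g_cont blob_xy_continuous[OF e] blob_continuous[OF e] lnk_continuous[OF e])

lemma psi_periodic: "x_periodic (psi e)"
  unfolding x_periodic_def psi_def V_def \<Psi>_def
  using sheet_conv_periodic[of "blob e", OF blob_add_2pi(1)] sheet_conv_periodic[of "lnk e", OF lnk_add_2pi]
  by (simp only: c_periodic simp_thms)

lemma psi_far: "2 * N < \<bar>Im z\<bar> \<Longrightarrow> psi e z = 0"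
  by (simp add: psi_def c_far)

lemma psi_div:
  assumes e: "0 < e" shows "Re (psi_x e z) + Im (psi_y e z) = 0"
proof -
  have "Im (sheet_conv h g (blob_x e) z) + Re (sheet_conv h g (blob_y e) z) = 0"
    using Re_sheet_conv(1)[OF h_cont g_cont blob_xy_continuous(2)[OF e], of z]
      Re_sheet_conv(2)[OF h_cont g_cont blob_xy_continuous(1)[OF e], of z]
    by (simp add: blob_symmetry)
  then have "c z * Im (sheet_conv h g (blob_x e) z) + c z * Re (sheet_conv h g (blob_y e) z) = 0"
    by (simp flip: distrib_left)
  then show ?thesis
    by (simp add: psi_x_def psi_y_def flip: add_divide_distrib)
qed

lemma psi_sheet: "psi e (zeta \<alpha>) = \<i> / (4 * pi) * cnj (V e (zeta \<alpha>))"
  by (simp add: psi_def zeta_near)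

text \<open>By \<open>stream_test\<close> the pairing sees the cutoff on the sheet only, where it is
  \<open>1\<close>. The value is therefore independent of \<open>N\<close>.\<close>

lemma psi_pairing:
  assumes e: "0 < e"
  shows "(LINT z:strip|lborel. vel z \<bullet> psi e z) = - (LINT \<alpha>:I|lborel. g \<alpha> * \<Psi> e (zeta \<alpha>)) / (4 * pi)"
proof -
  define \<phi> where "\<phi> z = c z * \<Psi> e z / (4 * pi)" for z
  have "(LINT z:strip|lborel. vel z \<bullet> Complex (- ((Im 1 * 0 + c1 z * \<Psi> e z + c z * - Im (V e z)) / (4 * pi))) (c z * Re (V e z) / (4 * pi)))
      = - (LINT \<alpha>:I|lborel. g \<alpha> * \<phi> (zeta \<alpha>))"
  proof (rule stream_test)
    show "(\<phi> has_derivative (\<lambda>v. Re v * (c z * Re (V e z) / (4 * pi)) + Im v * ((Im 1 * 0 + c1 z * \<Psi> e z + c z * - Im (V e z)) / (4 * pi)))) (at z)" for z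
      unfolding \<phi>_def[abs_def]
      by (rule has_derivative_eq_rhs[OF has_derivative_divide_const[OF has_derivative_mult[OF c_der \<Psi>_der[OF e]]]])
        (simp add: fun_eq_iff add_divide_distrib diff_divide_distrib algebra_simps)
    show "x_periodic \<phi>"
      unfolding x_periodic_def \<phi>_def \<Psi>_def using sheet_conv_periodic[of "lnk e", OF lnk_add_2pi]
      by (simp only: c_periodic simp_thms)
  qed (auto simp: \<phi>_def c_far V_def \<Psi>_def intro!: continuous_intros c_cont sheet_conv_continuous h_cont g_cont blob_continuous[OF e] lnk_continuous[OF e])
  moreover have "Complex (- ((Im 1 * 0 + c1 z * \<Psi> e z + c z * - Im (V e z)) / (4 * pi))) (c z * Re (V e z) / (4 * pi)) = psi e z" for z
    by (simp add: psi_def complex_eq_iff diff_divide_distrib add_divide_distrib)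
  ultimately show ?thesis by (simp add: \<phi>_def zeta_near set_lebesgue_integral_def)
qed

end

locale sheet_reg_cutoff = sheet_reg + sheet_cutoff
begin

text \<open>The gradient of a divergence-free field meets \<open>v \<otimes> v\<close> only through
  its trace-free symmetric part, two real numbers that \<open>t.\<Theta>\<close> combines into a
  complex one. The integrand is thus a multiple of the real part of the squared kernel integral
  times \<open>t.\<Theta>\<close>, and \<open>quadratic_identity\<close> turns it into the
  interaction.\<close>

lemma nonlinear_bound:
  assumes e: "0 < e"
  shows "\<bar>LINT z:strip|lborel. (\<Sum>i\<in>Basis. \<Sum>j\<in>Basis. (vel z \<bullet> i) * (vel z \<bullet> j) * ((Re j *\<^sub>R psi_x e z + Im j *\<^sub>R psi_y e z) \<bullet> i))\<bar>
     \<le> G\<^sup>2 * sqrt (2 * cosh (2 * R)) * LC * C0 * 2 * e powr (1/4)"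
proof -
  interpret t: sheet_reg_test h g R G h' M C0 "psi e" "psi_x e" "psi_y e" "2 * N" e
    by unfold_locales (use e psi_der psi_xy_cont psi_periodic psi_far RN' psi_sheet in \<open>auto simp: P_def V_def\<close>)
  let ?q = "\<lambda>z. (sheet_conv h g (blob 0) z)\<^sup>2 * t.\<Theta> z"
  have "(\<Sum>i\<in>Basis. \<Sum>j\<in>Basis. (vel z \<bullet> i) * (vel z \<bullet> j) * ((Re j *\<^sub>R psi_x e z + Im j *\<^sub>R psi_y e z) \<bullet> i))
      = (- 1 / (32 * pi\<^sup>2)) * Re (?q z)" for z
  proof -
    define f where "f = sheet_conv h g (blob 0) z"
    have v: "Re (vel z) = Im f / (4 * pi)" "Im (vel z) = Re f / (4 * pi)" by (simp_all add: vel_def f_def)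
    have dv: "Im (psi_y e z) = - Re (psi_x e z)" using psi_div[OF e, of z] by simp
    have "(\<Sum>i\<in>Basis. \<Sum>j\<in>Basis. (vel z \<bullet> i) * (vel z \<bullet> j) * ((Re j *\<^sub>R psi_x e z + Im j *\<^sub>R psi_y e z) \<bullet> i))
      = Re (vel z) * Re (vel z) * Re (psi_x e z) + Re (vel z) * Im (vel z) * (Re (psi_y e z) + Im (psi_x e z)) + Im (vel z) * Im (vel z) * Im (psi_y e z)"
      by (simp add: Basis_complex_def inner_complex_def algebra_simps)
    also have "\<dots> = ((Im f * Im f - Re f * Re f) * Re (psi_x e z) + Re f * Im f * (Re (psi_y e z) + Im (psi_x e z))) / (16 * pi\<^sup>2)"
      unfolding v dv by (simp add: power2_eq_square add_divide_distrib diff_divide_distrib algebra_simps)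
    also have "\<dots> = - Re (f\<^sup>2 * t.\<Theta> z) / (32 * pi\<^sup>2)"
      by (simp add: t.\<Theta>_def dv power2_eq_square field_simps)
    also have "\<dots> = (- 1 / (32 * pi\<^sup>2)) * Re (f\<^sup>2 * t.\<Theta> z)"
    proof -
      have "- x / a = (- 1 / a) * x" for x a :: real by simp
      then show ?thesis .
    qed
    finally show ?thesis by (simp only: f_def)
  qed
  then have "(LINT z:strip|lborel. (\<Sum>i\<in>Basis. \<Sum>j\<in>Basis. (vel z \<bullet> i) * (vel z \<bullet> j) * ((Re j *\<^sub>R psi_x e z + Im j *\<^sub>R psi_y e z) \<bullet> i)))
      = (- 1 / (32 * pi\<^sup>2)) * (LINT z:strip|lborel. Re (?q z))"
    by (simp only: set_integral_mult_right)
  also have "(LINT z:strip|lborel. Re (?q z)) = (\<integral>z. Re (indicator strip z *\<^sub>R ?q z) \<partial>lborel)"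
    by (simp only: set_lebesgue_integral_def scaleR_complex.sel real_scaleR_def)
  also have "\<dots> = Re (LINT z:strip|lborel. ?q z)"
    unfolding set_lebesgue_integral_def by (rule integral_Re[OF t.quadratic_integrable_strip])
  also have "\<dots> = - 4 * pi * Re (\<integral>p. t.interaction p \<partial>lborel)"
    unfolding t.quadratic_identity by simp
  finally have eq: "(LINT z:strip|lborel. (\<Sum>i\<in>Basis. \<Sum>j\<in>Basis. (vel z \<bullet> i) * (vel z \<bullet> j) * ((Re j *\<^sub>R psi_x e z + Im j *\<^sub>R psi_y e z) \<bullet> i)))
      = Re (\<integral>p. t.interaction p \<partial>lborel) / (8 * pi)"
    by (simp add: power2_eq_square)
  have "\<bar>Re (\<integral>p. t.interaction p \<partial>lborel)\<bar> \<le> 6 * (G\<^sup>2 * sqrt (2 * cosh (2 * R)) * LC) * e powr (1/4) * (2 * pi * C0)"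
    using t.interaction_bound by (simp add: t.K_def)
  then have "\<bar>Re (\<integral>p. t.interaction p \<partial>lborel)\<bar> / (8 * pi) \<le> 6 * (G\<^sup>2 * sqrt (2 * cosh (2 * R)) * LC) * e powr (1/4) * (2 * pi * C0) / (8 * pi)"
    by (rule divide_right_mono) simp
  also have "\<dots> = 3/2 * (G\<^sup>2 * sqrt (2 * cosh (2 * R)) * LC * C0 * e powr (1/4))" by simp
  also have "\<dots> \<le> 2 * (G\<^sup>2 * sqrt (2 * cosh (2 * R)) * LC * C0 * e powr (1/4))"
  proof (rule mult_right_mono)
    have "0 \<le> LC" unfolding LC_def using G_nonneg M_nonneg C0 by (intro mult_nonneg_nonneg add_nonneg_nonneg) auto
    then show "0 \<le> G\<^sup>2 * sqrt (2 * cosh (2 * R)) * LC * C0 * e powr (1/4)"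
      using C0 by (intro mult_nonneg_nonneg) auto
  qed simp
  finally show ?thesis unfolding eq by (simp add: mult_ac)
qed

end

section \<open>The energy as a limit\<close>

text \<open>As \<open>exp a \<ge> 5/2\<close>, the subtracted \<open>1\<close> is at most
  \<open>7/16\<close> of \<open>exp a\<close>, and \<open>1/2 - 7/16 = 1/16\<close>.\<close>

lemma exp_le_cosh:
  fixes a :: real
  assumes "1 \<le> a" shows "exp a / 16 \<le> cosh a - 1"
proof -
  have "1 + 1 + 1\<^sup>2 / 2 \<le> exp (1::real)" by (rule exp_lower_Taylor_quadratic) simp
  then have "5 / 2 \<le> exp (1::real)" by simp
  also have "\<dots> \<le> exp a" using assms by simp
  finally have "5 / 2 \<le> exp a" .
  then show ?thesis
    by (simp add: cosh_field_def field_simps) (use exp_gt_zero[of "- a"] in linarith)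
qed

text \<open>At such heights \<open>denom w + e\<close> lies between \<open>exp |Im w| / 16\<close>
  and \<open>16 * exp |Im w|\<close>; a common factor on both sides makes the bound for the
  logarithm symmetric.\<close>

lemma lnk_bound:
  assumes y: "1 \<le> \<bar>Im w\<bar>" and e: "0 \<le> e" "e \<le> 1"
  shows "\<bar>lnk e w - \<bar>Im w\<bar>\<bar> \<le> ln 16" "0 < denom w"
proof -
  let ?a = "\<bar>Im w\<bar>"
  have c: "cosh (Im w) = cosh ?a" by simp
  have "exp ?a / 16 \<le> cosh ?a - 1" by (rule exp_le_cosh[OF y])
  then have lo: "exp ?a / 16 \<le> denom w"
    unfolding denom_def c using cos_le_one[of "Re w"] by linarith
  then show D: "0 < denom w" using exp_gt_zero[of ?a] by linarith
  have "cosh ?a \<le> exp ?a" using sinh_real_nonneg_iff[of ?a] cosh_plus_sinh[of ?a] by linarith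
  moreover have "1 \<le> exp ?a" by simp
  ultimately have hi: "denom w + e \<le> 16 * exp ?a"
    unfolding denom_def c using cos_ge_minus_one[of "Re w"] e by linarith
  have "ln (denom w + e) \<le> ln (16 * exp ?a)" using hi D e by simp
  then have 1: "lnk e w \<le> ln 16 + ?a" by (simp add: lnk_def ln_mult)
  have "ln (exp ?a / 16) \<le> ln (denom w + e)" using lo D e by simp
  then have 2: "?a - ln 16 \<le> lnk e w" by (simp add: lnk_def ln_div)
  show "\<bar>lnk e w - ?a\<bar> \<le> ln 16" unfolding abs_le_iff using 1 2 by linarith
qed

lemma lnk_measurable [measurable]: "lnk e \<in> borel_measurable borel"
  unfolding lnk_def[abs_def] by measurable

section \<open>Bounds and limits off the sheet\<close>

context sheet
begin

lemma sheet_conv_bound: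
  assumes "\<And>\<alpha>. \<alpha> \<in> I \<Longrightarrow> norm (F (z - zeta \<alpha>)) \<le> B" "0 \<le> B"
  shows "norm (sheet_conv h g F z) \<le> 2 * pi * G * B"
proof (cases "integrable lborel (\<lambda>\<alpha>. indicator I \<alpha> *\<^sub>R (g \<alpha> *\<^sub>R F (z - zeta \<alpha>)))")
  case True
  have "norm (sheet_conv h g F z) \<le> (\<integral>\<alpha>. norm (indicator I \<alpha> *\<^sub>R (g \<alpha> *\<^sub>R F (z - zeta \<alpha>))) \<partial>lborel)"
    unfolding sheet_conv_zeta by (rule integral_norm_bound)
  also have "\<dots> \<le> (\<integral>\<alpha>. indicator I \<alpha> *\<^sub>R (G * B) \<partial>lborel)"
  proof (rule integral_mono)
    show "integrable lborel (\<lambda>\<alpha>. norm (indicator I \<alpha> *\<^sub>R (g \<alpha> *\<^sub>R F (z - zeta \<alpha>))))"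
      using True by (rule integrable_norm)
    show "integrable lborel (\<lambda>\<alpha>. indicator I \<alpha> *\<^sub>R (G * B))"
      by (intro borel_integrable_compact) auto
    show "norm (indicator I \<alpha> *\<^sub>R (g \<alpha> *\<^sub>R F (z - zeta \<alpha>))) \<le> indicator I \<alpha> *\<^sub>R (G * B)" for \<alpha>
    proof (cases "\<alpha> \<in> I")
      case True
      have "\<bar>g \<alpha>\<bar> * norm (F (z - zeta \<alpha>)) \<le> G * B"
        by (intro mult_mono g_le assms True) (auto simp: G_nonneg)
      then show ?thesis using True by simp
    qed simp
  qed
  also have "\<dots> = 2 * pi * G * B" by simp
  finally show ?thesis .
next
  \<comment> \<open>A non-integrable integrand has integral \<open>0\<close> by convention, and the
    bound is trivial.\<close>
  case False
  then have "sheet_conv h g F z = 0" unfolding sheet_conv_zeta by (rule not_integrable_integral_eq)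
  then show ?thesis using assms(2) G_nonneg by simp
qed

lemma kern_integral_square_integrable:
  assumes S: "R \<le> S"
  shows "integrable lborel (\<lambda>z. indicator (slab S) z * (\<integral>\<alpha>. kern z \<alpha> \<partial>lborel)\<^sup>2)"
proof (rule integrableI_nonneg)
  have le: "ennreal (\<integral>\<alpha>. kern z \<alpha> \<partial>lborel) \<le> (\<integral>\<^sup>+\<alpha>. ennreal (kern z \<alpha>) \<partial>lborel)" for z
  proof (cases "integrable lborel (kern z)")
    case True
    then show ?thesis by (simp add: nn_integral_eq_integral kern_nonneg)
  qed (simp add: not_integrable_integral_eq)
  have "(\<integral>\<^sup>+z. ennreal (indicator (slab S) z * (\<integral>\<alpha>. kern z \<alpha> \<partial>lborel)\<^sup>2) \<partial>lborel)
     \<le> (\<integral>\<^sup>+z. indicator (slab S) z * (\<integral>\<^sup>+\<alpha>. ennreal (kern z \<alpha>) \<partial>lborel)\<^sup>2 \<partial>lborel)"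
  proof (rule nn_integral_mono)
    fix z
    have "ennreal ((\<integral>\<alpha>. kern z \<alpha> \<partial>lborel)\<^sup>2) \<le> (\<integral>\<^sup>+\<alpha>. ennreal (kern z \<alpha>) \<partial>lborel)\<^sup>2"
      using power_mono[OF le, of z 2] by (simp add: ennreal_power kern_nonneg Bochner_Integration.integral_nonneg)
    then show "ennreal (indicator (slab S) z * (\<integral>\<alpha>. kern z \<alpha> \<partial>lborel)\<^sup>2) \<le> indicator (slab S) z * (\<integral>\<^sup>+\<alpha>. ennreal (kern z \<alpha>) \<partial>lborel)\<^sup>2"
      by (cases "z \<in> slab S") simp_all
  qed
  also note kern_square_finite[OF S]
  finally show "(\<integral>\<^sup>+z. ennreal (indicator (slab S) z * (\<integral>\<alpha>. kern z \<alpha> \<partial>lborel)\<^sup>2) \<partial>lborel) < \<infinity>" .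
  show "(\<lambda>z. indicator (slab S) z * (\<integral>\<alpha>. kern z \<alpha> \<partial>lborel)\<^sup>2) \<in> borel_measurable lborel"
    unfolding kern_def by measurable
qed auto

lemma kern_integrable_off_sheet:
  assumes z: "z \<in> strip" "Im z \<noteq> h (Re z)"
  shows "integrable lborel (kern z)"
proof -
  have "denom (z - zeta \<alpha>) \<noteq> 0" if "\<alpha> \<in> I" for \<alpha>
  proof -
    have "z \<noteq> zeta \<alpha>" using z by (auto simp: zeta_def)
    then show ?thesis using denom_pos[OF strip_diff[OF z(1) that]] by auto
  qed
  then have "continuous_on I (\<lambda>\<alpha>. 1 / sqrt (denom (z - zeta \<alpha>)))"
    by (intro continuous_intros zeta_cont) auto
  from borel_integrable_compact[OF _ this] show ?thesis by (simp add: kern_def[abs_def])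
qed

lemma norm_V_le:
  assumes z: "z \<in> strip" "Im z \<noteq> h (Re z)" "z \<in> slab S" and S: "R \<le> S" and e: "0 \<le> e"
  shows "norm (sheet_conv h g (blob e) z) \<le> G * sqrt (2 * cosh (2 * S)) * (\<integral>\<alpha>. kern z \<alpha> \<partial>lborel)"
proof -
  have i: "integrable lborel (\<lambda>\<alpha>. (G * sqrt (2 * cosh (2 * S))) * kern z \<alpha>)"
    by (intro integrable_mult_right kern_integrable_off_sheet z)
  have b: "norm (indicator I \<alpha> *\<^sub>R (g \<alpha> *\<^sub>R blob e (z - zeta \<alpha>))) \<le> (G * sqrt (2 * cosh (2 * S))) * kern z \<alpha>" for \<alpha>
    by (rule norm_blob_le_kern[OF z(3) S e])
  have "norm (sheet_conv h g (blob e) z) \<le> (\<integral>\<alpha>. norm (indicator I \<alpha> *\<^sub>R (g \<alpha> *\<^sub>R blob e (z - zeta \<alpha>))) \<partial>lborel)"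
    unfolding sheet_conv_zeta by (rule integral_norm_bound)
  also have "\<dots> \<le> (\<integral>\<alpha>. (G * sqrt (2 * cosh (2 * S))) * kern z \<alpha> \<partial>lborel)"
  proof (rule integral_mono[OF _ i b])
    show "integrable lborel (\<lambda>\<alpha>. norm (indicator I \<alpha> *\<^sub>R (g \<alpha> *\<^sub>R blob e (z - zeta \<alpha>))))"
      by (rule Bochner_Integration.integrable_bound[OF i]) (use b in \<open>auto intro: order_trans[OF _ abs_ge_self]\<close>)
  qed
  finally show ?thesis by simp
qed

lemma V_tendsto:
  assumes z: "z \<in> strip" "Im z \<noteq> h (Re z)" and e: "\<And>n. 0 < e n" "e \<longlonglongrightarrow> 0"
  shows "(\<lambda>n. sheet_conv h g (blob (e n)) z) \<longlonglongrightarrow> sheet_conv h g (blob 0) z"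
  unfolding sheet_conv_zeta
proof (rule integral_dominated_convergence)
  define S where "S = max R \<bar>Im z\<bar>"
  have zs: "z \<in> slab S" "R \<le> S" using z(1) by (auto simp: S_def slab_def strip_def)
  show "integrable lborel (\<lambda>\<alpha>. (G * sqrt (2 * cosh (2 * S))) * kern z \<alpha>)"
    by (intro integrable_mult_right kern_integrable_off_sheet z)
  show "AE \<alpha> in lborel. norm (indicator I \<alpha> *\<^sub>R (g \<alpha> *\<^sub>R blob (e n) (z - zeta \<alpha>))) \<le> (G * sqrt (2 * cosh (2 * S))) * kern z \<alpha>" for n
    by (intro AE_I2 norm_blob_le_kern zs less_imp_le[OF e(1)])
  show "AE \<alpha> in lborel. (\<lambda>n. indicator I \<alpha> *\<^sub>R (g \<alpha> *\<^sub>R blob (e n) (z - zeta \<alpha>))) \<longlonglongrightarrow> indicator I \<alpha> *\<^sub>R (g \<alpha> *\<^sub>R blob 0 (z - zeta \<alpha>))"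
  proof (rule AE_I2)
    fix \<alpha>
    show "(\<lambda>n. indicator I \<alpha> *\<^sub>R (g \<alpha> *\<^sub>R blob (e n) (z - zeta \<alpha>))) \<longlonglongrightarrow> indicator I \<alpha> *\<^sub>R (g \<alpha> *\<^sub>R blob 0 (z - zeta \<alpha>))"
    proof (cases "\<alpha> \<in> I")
      case True
      have "z \<noteq> zeta \<alpha>" using z by (auto simp: zeta_def)
      then have "denom (z - zeta \<alpha>) \<noteq> 0" using denom_pos[OF strip_diff[OF z(1) True]] by auto
      then show ?thesis unfolding blob_def using e(2) by (intro tendsto_intros) auto
    qed simp
  qed
qed measurable

text \<open>Stated away from the sheet, because \<open>\<Psi>\<close> enters the test field with the
  factor \<open>c1\<close>, which vanishes near the sheet. At these heights the logarithm has no
  singularity and is bounded uniformly in \<open>e\<close>.\<close>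

lemma \<Psi>_tendsto:
  assumes z: "R + 1 \<le> \<bar>Im z\<bar>" and e: "\<And>n. 0 < e n" "\<And>n. e n \<le> 1" "e \<longlonglongrightarrow> 0"
  shows "(\<lambda>n. \<Psi> (e n) z) \<longlonglongrightarrow> \<Psi> 0 z"
  unfolding \<Psi>_def sheet_conv_zeta
proof (rule integral_dominated_convergence)
  have y: "1 \<le> \<bar>Im (z - zeta \<alpha>)\<bar>" "\<bar>Im (z - zeta \<alpha>)\<bar> \<le> \<bar>Im z\<bar> + R" for \<alpha>
    using z h_le[of \<alpha>] by (auto simp: zeta_def)
  show "integrable lborel (\<lambda>\<alpha>. indicator I \<alpha> *\<^sub>R (G * (\<bar>Im z\<bar> + R + ln 16)))"
    by (intro borel_integrable_compact) auto
  show "AE \<alpha> in lborel. norm (indicator I \<alpha> *\<^sub>R (g \<alpha> *\<^sub>R lnk (e n) (z - zeta \<alpha>))) \<le> indicator I \<alpha> *\<^sub>R (G * (\<bar>Im z\<bar> + R + ln 16))" for n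
  proof (rule AE_I2)
    fix \<alpha>
    have "\<bar>lnk (e n) (z - zeta \<alpha>)\<bar> \<le> \<bar>Im z\<bar> + R + ln 16"
      using lnk_bound(1)[OF y(1)[of \<alpha>] less_imp_le[OF e(1)] e(2), of n] y(2)[of \<alpha>] by linarith
    then have "\<bar>g \<alpha>\<bar> * \<bar>lnk (e n) (z - zeta \<alpha>)\<bar> \<le> G * (\<bar>Im z\<bar> + R + ln 16)"
      by (intro mult_mono g_le) (auto simp: G_nonneg)
    then show "norm (indicator I \<alpha> *\<^sub>R (g \<alpha> *\<^sub>R lnk (e n) (z - zeta \<alpha>))) \<le> indicator I \<alpha> *\<^sub>R (G * (\<bar>Im z\<bar> + R + ln 16))"
      by (simp add: indicator_def abs_mult)
  qed
  show "AE \<alpha> in lborel. (\<lambda>n. indicator I \<alpha> *\<^sub>R (g \<alpha> *\<^sub>R lnk (e n) (z - zeta \<alpha>))) \<longlonglongrightarrow> indicator I \<alpha> *\<^sub>R (g \<alpha> *\<^sub>R lnk 0 (z - zeta \<alpha>))"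
  proof (rule AE_I2)
    fix \<alpha>
    have "0 < denom (z - zeta \<alpha>)" by (rule lnk_bound(2)[OF y(1), of 0]) auto
    then have "(\<lambda>n. lnk (e n) (z - zeta \<alpha>)) \<longlonglongrightarrow> lnk 0 (z - zeta \<alpha>)"
      unfolding lnk_def using e(3) by (intro tendsto_intros) auto
    then show "(\<lambda>n. indicator I \<alpha> *\<^sub>R (g \<alpha> *\<^sub>R lnk (e n) (z - zeta \<alpha>))) \<longlonglongrightarrow> indicator I \<alpha> *\<^sub>R (g \<alpha> *\<^sub>R lnk 0 (z - zeta \<alpha>))"
      by (intro tendsto_intros)
  qed
qed measurable

lemma \<Psi>_bound:
  assumes z: "R + 1 \<le> \<bar>Im z\<bar>" and e: "0 \<le> e" "e \<le> 1"
  shows "\<bar>\<Psi> e z\<bar> \<le> 2 * pi * G * (\<bar>Im z\<bar> + R + ln 16)"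
proof -
  have "norm (\<Psi> e z) \<le> 2 * pi * G * (\<bar>Im z\<bar> + R + ln 16)"
    unfolding \<Psi>_def
  proof (rule sheet_conv_bound)
    fix \<alpha>
    have y: "1 \<le> \<bar>Im (z - zeta \<alpha>)\<bar>" "\<bar>Im (z - zeta \<alpha>)\<bar> \<le> \<bar>Im z\<bar> + R"
      using z h_le[of \<alpha>] by (auto simp: zeta_def)
    show "norm (lnk e (z - zeta \<alpha>)) \<le> \<bar>Im z\<bar> + R + ln 16"
      using lnk_bound(1)[OF y(1) e] y(2) by simp
  qed (use R_nonneg in simp)
  then show ?thesis by simp
qed

end

locale sheet_energy = sheet +
  assumes vel_L2: "integrable lborel (\<lambda>z. indicator strip z *\<^sub>R (norm (vel z))\<^sup>2)"
    and circulation: "(LINT \<alpha>:I|lborel. g \<alpha>) = 0"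
begin

text \<open>Vanishing circulation cancels the linear growth of the logarithmic kernel at infinity.\<close>

lemma \<Psi>_bound_uniform:
  assumes z: "R + 1 \<le> \<bar>Im z\<bar>"
  shows "\<bar>\<Psi> 0 z\<bar> \<le> 2 * pi * G * (R + ln 16)"
proof -
  have ig: "integrable lborel (\<lambda>\<alpha>. indicator I \<alpha> *\<^sub>R g \<alpha>)"
    by (intro borel_integrable_compact continuous_on_subset[OF g_cont]) auto
  have y: "1 \<le> \<bar>Im (z - zeta \<alpha>)\<bar>" "\<bar>\<bar>Im (z - zeta \<alpha>)\<bar> - \<bar>Im z\<bar>\<bar> \<le> R" for \<alpha>
    using z h_le[of \<alpha>] by (auto simp: zeta_def)
  have "sheet_conv h g (\<lambda>w. lnk 0 w - \<bar>Im z\<bar>) z = \<Psi> 0 z - \<bar>Im z\<bar> * (LINT \<alpha>:I|lborel. g \<alpha>)"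
  proof -
    have "continuous_on I (\<lambda>\<alpha>. g \<alpha> *\<^sub>R lnk 0 (z - zeta \<alpha>))"
    proof -
      have "denom (z - zeta \<alpha>) + 0 \<noteq> 0" for \<alpha> using lnk_bound(2)[OF y(1)[of \<alpha>], of 0] by simp
      then show ?thesis unfolding lnk_def
        by (intro continuous_intros zeta_cont continuous_on_subset[OF g_cont]) auto
    qed
    then have i: "integrable lborel (\<lambda>\<alpha>. indicator I \<alpha> *\<^sub>R (g \<alpha> *\<^sub>R lnk 0 (z - zeta \<alpha>)))"
      by (intro borel_integrable_compact) auto
    have "sheet_conv h g (\<lambda>w. lnk 0 w - \<bar>Im z\<bar>) z
       = (\<integral>\<alpha>. indicator I \<alpha> *\<^sub>R (g \<alpha> *\<^sub>R lnk 0 (z - zeta \<alpha>)) - \<bar>Im z\<bar> * (indicator I \<alpha> *\<^sub>R g \<alpha>) \<partial>lborel)"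
      unfolding sheet_conv_zeta by (rule Bochner_Integration.integral_cong) (simp_all add: algebra_simps)
    also have "\<dots> = (\<integral>\<alpha>. indicator I \<alpha> *\<^sub>R (g \<alpha> *\<^sub>R lnk 0 (z - zeta \<alpha>)) \<partial>lborel) - \<bar>Im z\<bar> * (\<integral>\<alpha>. indicator I \<alpha> *\<^sub>R g \<alpha> \<partial>lborel)"
      using i ig by (simp only: Bochner_Integration.integral_diff integral_mult_right_zero integrable_mult_right)
    finally show ?thesis by (simp only: \<Psi>_def sheet_conv_zeta set_lebesgue_integral_def)
  qed
  then have "\<Psi> 0 z = sheet_conv h g (\<lambda>w. lnk 0 w - \<bar>Im z\<bar>) z" by (simp add: circulation)
  also have "norm \<dots> \<le> 2 * pi * G * (R + ln 16)"
  proof (rule sheet_conv_bound)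
    fix \<alpha>
    show "norm (lnk 0 (z - zeta \<alpha>) - \<bar>Im z\<bar>) \<le> R + ln 16"
      using lnk_bound(1)[OF y(1)[of \<alpha>], of 0] y(2)[of \<alpha>] by simp
  qed (use R_nonneg in simp)
  finally show ?thesis by simp
qed

end

locale sheet_energy_cutoff = sheet_energy + sheet_cutoff +
  fixes B1 :: real
  assumes RN1: "R + 1 \<le> N" and X_le: "\<And>s. \<bar>X s\<bar> \<le> 1" and X'_le: "\<And>s. \<bar>X' s\<bar> \<le> B1"
begin

lemma B1_nonneg: "0 \<le> B1" using X'_le[of 0] by linarith

lemma c_le: "\<bar>c z\<bar> \<le> 1" "\<bar>c1 z\<bar> \<le> B1 / N"
  using X_le X'_le N by (auto simp: c_def c1_def divide_right_mono)

text \<open>The limit of \<open>psi e\<close> off the sheet. It generally jumps across the sheet and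
  is no test field, which is why the limit is taken in the pairing and not in the weak
  formulation.\<close>

definition psi0 :: "complex \<Rightarrow> complex" where
  "psi0 z = of_real (c z) * vel z - of_real (c1 z * \<Psi> 0 z) / (4 * pi)"

lemma c_meas [measurable]: "c \<in> borel_measurable borel" "c1 \<in> borel_measurable borel"
  using c_cont by (auto intro: borel_measurable_continuous_onI)

text \<open>\<open>vel\<close> is merely square integrable, so \<open>psi e\<close> needs a square
  integrable majorant that is uniform in \<open>e\<close>. It is built from the potential
  \<open>k\<close> of the kernel's modulus, and the product is split by
  \<open>x * y \<le> x^2 + y^2\<close>.\<close>

lemma psi_tendsto:
  assumes e: "\<And>n. 0 < e n" "\<And>n. e n \<le> 1" "e \<longlonglongrightarrow> 0"
  shows "(\<lambda>n. LINT z:strip|lborel. vel z \<bullet> psi (e n) z) \<longlonglongrightarrow> (LINT z:strip|lborel. vel z \<bullet> psi0 z)"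
proof -
  define k where "k z = (\<integral>\<alpha>. kern z \<alpha> \<partial>lborel)" for z
  define A where "A = G * sqrt (2 * cosh (2 * (2 * N)))"
  define B where "B = B1 / N * (2 * pi * G * (2 * N + R + ln 16))"
  have B0: "0 \<le> B" using B1_nonneg N G_nonneg R_nonneg unfolding B_def by (intro mult_nonneg_nonneg) auto
  have k0: "0 \<le> k z" for z by (simp add: k_def kern_nonneg)
  have A0: "0 \<le> A" by (simp add: A_def G_nonneg)
  have far: "R + 1 \<le> \<bar>Im z\<bar>" if "c1 z \<noteq> 0" for z
    using c_near(2)[of z] that RN1 by linarith
  show ?thesis
    unfolding set_lebesgue_integral_def
  proof (rule integral_dominated_convergence)
    show "integrable lborel (\<lambda>z. indicator strip z *\<^sub>R (norm (vel z))\<^sup>2 + (2 * A\<^sup>2 * (indicator (slab (2 * N)) z * (k z)\<^sup>2) + 2 * B\<^sup>2 * indicator (slab (2 * N)) z))"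
    proof (intro Bochner_Integration.integrable_add vel_L2 integrable_mult_right)
      show "integrable lborel (\<lambda>z. indicator (slab (2 * N)) z * (k z)\<^sup>2)"
        unfolding k_def by (rule kern_integral_square_integrable[OF RN'])
      have "slab (2 * N) = cbox (Complex (-pi) (-(2*N))) (Complex pi (2*N))"
        by (auto simp: slab_def in_cbox_complex_iff abs_le_iff)
      then show "integrable lborel (indicator (slab (2 * N)) :: complex \<Rightarrow> real)"
        by (simp add: emeasure_lborel_cbox_eq)
    qed
    show "(\<lambda>z. indicator strip z *\<^sub>R (vel z \<bullet> psi (e n) z)) \<in> borel_measurable lborel" for n
      unfolding psi_def V_def \<Psi>_def sheet_conv_zeta by measurable
    show "(\<lambda>z. indicator strip z *\<^sub>R (vel z \<bullet> psi0 z)) \<in> borel_measurable lborel"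
      unfolding psi0_def \<Psi>_def sheet_conv_zeta by measurable
    show "AE z in lborel. (\<lambda>n. indicator strip z *\<^sub>R (vel z \<bullet> psi (e n) z)) \<longlonglongrightarrow> indicator strip z *\<^sub>R (vel z \<bullet> psi0 z)"
      using AE_off_graph[OF h_meas]
    proof eventually_elim
      case (elim z)
      show ?case
      proof (cases "z \<in> strip")
        case True
        have 1: "(\<lambda>n. V (e n) z) \<longlonglongrightarrow> sheet_conv h g (blob 0) z"
          unfolding V_def by (rule V_tendsto[OF True elim e(1,3)])
        have 2: "(\<lambda>n. c1 z * \<Psi> (e n) z) \<longlonglongrightarrow> c1 z * \<Psi> 0 z"
        proof (cases "c1 z = 0")
          case False
          then show ?thesis by (intro tendsto_intros \<Psi>_tendsto far e)
        qed simp
        have "(\<lambda>n. psi (e n) z) \<longlonglongrightarrow> (of_real (c z) * (\<i> * cnj (sheet_conv h g (blob 0) z)) - of_real (c1 z * \<Psi> 0 z)) / (4 * pi)"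
          unfolding psi_def by (intro tendsto_intros 1 2) auto
        also have "(of_real (c z) * (\<i> * cnj (sheet_conv h g (blob 0) z)) - of_real (c1 z * \<Psi> 0 z)) / (4 * pi) = psi0 z"
          by (simp add: psi0_def vel_def diff_divide_distrib)
        finally show ?thesis by (intro tendsto_intros)
      qed simp
    qed
    show "AE z in lborel. norm (indicator strip z *\<^sub>R (vel z \<bullet> psi (e n) z))
      \<le> indicator strip z *\<^sub>R (norm (vel z))\<^sup>2 + (2 * A\<^sup>2 * (indicator (slab (2 * N)) z * (k z)\<^sup>2) + 2 * B\<^sup>2 * indicator (slab (2 * N)) z)" for n
      using AE_off_graph[OF h_meas]
    proof eventually_elim
      case (elim z)
      show ?case
      proof (cases "z \<in> strip \<and> \<not> 2 * N < \<bar>Im z\<bar>")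
        case True
        then have zs: "z \<in> slab (2 * N)" by (auto simp: slab_def strip_def)
        have 1: "norm (V (e n) z) \<le> A * k z"
          unfolding V_def A_def k_def using norm_V_le[OF _ elim zs RN' less_imp_le[OF e(1)]] True by simp
        have 2: "\<bar>c1 z * \<Psi> (e n) z\<bar> \<le> B"
        proof (cases "c1 z = 0")
          case False
          have "\<bar>\<Psi> (e n) z\<bar> \<le> 2 * pi * G * (\<bar>Im z\<bar> + R + ln 16)"
            by (rule \<Psi>_bound[OF far[OF False] less_imp_le[OF e(1)] e(2)])
          also have "\<dots> \<le> 2 * pi * G * (2 * N + R + ln 16)"
            using True G_nonneg by (intro mult_left_mono) auto
          finally have "\<bar>c1 z\<bar> * \<bar>\<Psi> (e n) z\<bar> \<le> B"
            unfolding B_def using B1_nonneg N by (intro mult_mono c_le) auto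
          then show ?thesis by (simp add: abs_mult)
        qed (use B0 in simp)
        have "norm (of_real (c z) * (\<i> * cnj (V (e n) z)) - of_real (c1 z * \<Psi> (e n) z)) \<le> A * k z + B"
        proof -
          have "norm (of_real (c z) * (\<i> * cnj (V (e n) z)) - of_real (c1 z * \<Psi> (e n) z))
             \<le> \<bar>c z\<bar> * norm (V (e n) z) + \<bar>c1 z * \<Psi> (e n) z\<bar>"
            by (rule order_trans[OF norm_triangle_ineq4]) (simp add: norm_mult del: of_real_mult)
          also have "\<dots> \<le> 1 * (A * k z) + B"
            by (intro add_mono mult_mono c_le 1 2) auto
          finally show ?thesis by simp
        qed
        then have "norm (psi (e n) z) \<le> (A * k z + B) / (4 * pi)"
          unfolding psi_def by (simp add: norm_divide divide_right_mono)
        also have "\<dots> \<le> (A * k z + B) / 1"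
          using pi_gt3 A0 k0 B0 by (intro divide_left_mono) auto
        finally have n: "norm (psi (e n) z) \<le> A * k z + B" by simp
        have "\<bar>vel z \<bullet> psi (e n) z\<bar> \<le> norm (vel z) * norm (psi (e n) z)" by (rule Cauchy_Schwarz_ineq2)
        also have "\<dots> \<le> norm (vel z) * (A * k z + B)" by (intro mult_left_mono n) simp
        also have "\<dots> \<le> (norm (vel z))\<^sup>2 + (A * k z + B)\<^sup>2"
        proof -
          have "x * y \<le> x\<^sup>2 + y\<^sup>2" for x y :: real
            using sum_squares_bound[of x y] zero_le_power2[of x] zero_le_power2[of y] by linarith
          then show ?thesis .
        qed
        also have "(A * k z + B)\<^sup>2 \<le> 2 * A\<^sup>2 * (k z)\<^sup>2 + 2 * B\<^sup>2"
          using zero_le_power2[of "A * k z - B"] by (simp add: power2_diff power2_sum power_mult_distrib)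
        finally show ?thesis using True zs by simp
      next
        case False
        then have n: "norm (indicator strip z *\<^sub>R (vel z \<bullet> psi (e n) z)) = 0" using psi_far by auto
        show ?thesis unfolding n by (intro add_nonneg_nonneg mult_nonneg_nonneg scaleR_nonneg_nonneg) auto
      qed
    qed
  qed
qed

text \<open>The error is the term with \<open>c1\<close>, of size \<open>1 / N\<close> on a region
  of area at most \<open>8 * pi * N\<close>, where \<open>vel\<close> is controlled in mean square
  only. Young's inequality with the weight \<open>sqrt N\<close> balances the two contributions at
  \<open>1 / sqrt N\<close>. The bound on \<open>\<Psi> 0\<close> must not grow with the height,
  which is what vanishing circulation provides.\<close>

lemma psi0_error:
  "\<bar>(LINT z:strip|lborel. vel z \<bullet> psi0 z) - (LINT z:strip|lborel. c z * (norm (vel z))\<^sup>2)\<bar>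
     \<le> B1 * (pi * G * (R + ln 16)) * (((LINT z:strip|lborel. (norm (vel z))\<^sup>2) + 8 * pi) / sqrt N)"
proof -
  define CP where "CP = 2 * pi * G * (R + ln 16)"
  have CP0: "0 \<le> CP" using G_nonneg R_nonneg by (simp add: CP_def)
  have far: "R + 1 \<le> \<bar>Im z\<bar>" if "c1 z \<noteq> 0" for z
    using c_near(2)[of z] that RN1 by linarith
  let ?w = "\<lambda>z. (B1 / N * CP / 2) * (sqrt N * (indicator strip z *\<^sub>R (norm (vel z))\<^sup>2) + (1 / sqrt N) * indicator (slab (2 * N)) z)"
  have isl: "integrable lborel (indicator (slab (2 * N)) :: complex \<Rightarrow> real)"
    and msl: "(\<integral>z. indicator (slab (2 * N)) z \<partial>lborel) = 8 * pi * N"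
  proof -
    have "slab (2 * N) = cbox (Complex (-pi) (-(2*N))) (Complex pi (2*N))"
      by (auto simp: slab_def in_cbox_complex_iff abs_le_iff)
    then show "integrable lborel (indicator (slab (2 * N)) :: complex \<Rightarrow> real)"
      "(\<integral>z. indicator (slab (2 * N)) z \<partial>lborel) = 8 * pi * N"
      using N by (simp_all add: emeasure_lborel_cbox_eq measure_lborel_cbox_eq Basis_complex_def)
  qed
  have iw: "integrable lborel ?w"
    by (intro integrable_mult_right Bochner_Integration.integrable_add vel_L2 isl)
  have ic: "integrable lborel (\<lambda>z. indicator strip z *\<^sub>R (c z * (norm (vel z))\<^sup>2))"
    by (rule Bochner_Integration.integrable_bound[OF vel_L2])
      (use c_le(1) in \<open>auto intro!: AE_I2 mult_right_mono mult_left_le_one_le simp: indicator_def abs_mult\<close>)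
  let ?r = "\<lambda>z. indicator strip z *\<^sub>R (c1 z * \<Psi> 0 z * Re (vel z) / (4 * pi))"
  have rw: "norm (?r z) \<le> ?w z" for z
  proof (cases "z \<in> strip \<and> c1 z \<noteq> 0")
    case True
    then have zs: "z \<in> slab (2 * N)" using c_far(2)[of z] by (fastforce simp: slab_def strip_def)
    have sN: "sqrt N > 0" using N by simp
    have "\<bar>Re (vel z)\<bar> \<le> norm (vel z)" by (rule abs_Re_le_cmod)
    also have "\<dots> \<le> (sqrt N * (norm (vel z))\<^sup>2 + 1 / sqrt N) / 2"
    proof -
      have "0 \<le> (sqrt N * norm (vel z) - 1)\<^sup>2 / sqrt N" using sN by simp
      also have "\<dots> = sqrt N * (norm (vel z))\<^sup>2 - 2 * norm (vel z) + 1 / sqrt N"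
        using sN by (simp add: power2_eq_square field_simps)
      finally show ?thesis by simp
    qed
    finally have v: "\<bar>Re (vel z)\<bar> \<le> (sqrt N * (norm (vel z))\<^sup>2 + 1 / sqrt N) / 2" .
    have "\<bar>c1 z\<bar> * \<bar>\<Psi> 0 z\<bar> * \<bar>Re (vel z)\<bar> \<le> B1 / N * CP * ((sqrt N * (norm (vel z))\<^sup>2 + 1 / sqrt N) / 2)"
      using True B1_nonneg N CP0 by (intro mult_mono v c_le mult_nonneg_nonneg) (auto simp: CP_def intro!: \<Psi>_bound_uniform far)
    moreover have "\<bar>c1 z\<bar> * \<bar>\<Psi> 0 z\<bar> * \<bar>Re (vel z)\<bar> / (4 * pi) \<le> \<bar>c1 z\<bar> * \<bar>\<Psi> 0 z\<bar> * \<bar>Re (vel z)\<bar> / 1"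
      using pi_gt3 by (intro divide_left_mono) auto
    ultimately show ?thesis using True zs by (simp add: abs_mult)
  next
    case False
    then have n: "norm (?r z) = 0" by auto
    show ?thesis unfolding n using B1_nonneg N CP0 by (intro mult_nonneg_nonneg add_nonneg_nonneg) auto
  qed
  have ir: "integrable lborel ?r"
  proof (rule Bochner_Integration.integrable_bound[OF iw])
    show "?r \<in> borel_measurable lborel" unfolding \<Psi>_def sheet_conv_zeta by measurable
    show "AE z in lborel. norm (?r z) \<le> norm (?w z)"
      by (intro AE_I2 order_trans[OF rw]) (simp only: real_norm_def abs_ge_self)
  qed
  have pt: "vel z \<bullet> psi0 z = c z * (norm (vel z))\<^sup>2 - c1 z * \<Psi> 0 z * Re (vel z) / (4 * pi)" for z
    unfolding psi0_def inner_complex_def cmod_power2 by (simp add: power2_eq_square algebra_simps)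
  have "(LINT z:strip|lborel. vel z \<bullet> psi0 z) = (\<integral>z. indicator strip z *\<^sub>R (c z * (norm (vel z))\<^sup>2) - ?r z \<partial>lborel)"
    unfolding set_lebesgue_integral_def
    by (rule Bochner_Integration.integral_cong)
      (simp_all only: pt scaleR_diff_right)
  also have "\<dots> = (LINT z:strip|lborel. c z * (norm (vel z))\<^sup>2) - (\<integral>z. ?r z \<partial>lborel)"
    using ic ir by (simp only: Bochner_Integration.integral_diff set_lebesgue_integral_def)
  finally have "\<bar>(LINT z:strip|lborel. vel z \<bullet> psi0 z) - (LINT z:strip|lborel. c z * (norm (vel z))\<^sup>2)\<bar> = \<bar>\<integral>z. ?r z \<partial>lborel\<bar>" by simp
  also have "\<dots> \<le> (\<integral>z. norm (?r z) \<partial>lborel)" using integral_norm_bound[of lborel ?r] by simp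
  also have "\<dots> \<le> (\<integral>z. ?w z \<partial>lborel)"
    by (rule integral_mono[OF integrable_norm[OF ir] iw rw])
  also have "\<dots> = (B1 / N * CP / 2) * (sqrt N * (LINT z:strip|lborel. (norm (vel z))\<^sup>2) + (1 / sqrt N) * (8 * pi * N))"
    using vel_L2 isl msl by (simp only: integral_mult_right_zero Bochner_Integration.integral_add integrable_mult_right set_lebesgue_integral_def)
  also have "\<dots> = B1 * (CP / 2) * (((LINT z:strip|lborel. (norm (vel z))\<^sup>2) + 8 * pi) / sqrt N)"
  proof -
    have "N = sqrt N * sqrt N" "sqrt N > 0" using N by simp_all
    then show ?thesis by (simp add: field_simps)
  qed
  finally have "\<bar>(LINT z:strip|lborel. vel z \<bullet> psi0 z) - (LINT z:strip|lborel. c z * (norm (vel z))\<^sup>2)\<bar>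
     \<le> B1 * (CP / 2) * (((LINT z:strip|lborel. (norm (vel z))\<^sup>2) + 8 * pi) / sqrt N)" .
  then show ?thesis by (simp add: CP_def)
qed

end

section \<open>Removal of the cutoff\<close>

context sheet_energy
begin

theorem energy_limit:
  "(\<lambda>n. - (LINT \<alpha>:I|lborel. g \<alpha> * \<Psi> (inverse (real (Suc n))) (zeta \<alpha>)) / (4 * pi))
     \<longlonglongrightarrow> (LINT z:strip|lborel. (norm (vel z))\<^sup>2)"
proof -
  define e where "e n = inverse (real (Suc n))" for n
  have e: "0 < e n" "e n \<le> 1" "e \<longlonglongrightarrow> 0" for n
    using LIMSEQ_inverse_real_of_nat by (auto simp: e_def[abs_def] field_simps)
  define E where "E n = - (LINT \<alpha>:I|lborel. g \<alpha> * \<Psi> (e n) (zeta \<alpha>)) / (4 * pi)" for n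
  define W where "W = (LINT z:strip|lborel. (norm (vel z))\<^sup>2)"
  obtain X X' :: "real \<Rightarrow> real" where X: "\<And>k. Ck_on k UNIV X" "\<And>k. Ck_on k UNIV X'"
    "\<And>s. (X has_real_derivative X' s) (at s)" "\<And>s. \<bar>s\<bar> \<le> 1 \<Longrightarrow> X s = 1" "\<And>s. 2 \<le> \<bar>s\<bar> \<Longrightarrow> X s = 0"
    "\<And>s. 0 \<le> X s" "\<And>s. X s \<le> 1"
    "\<And>s. \<bar>s\<bar> < 1 \<Longrightarrow> X' s = 0" "\<And>s. 2 < \<bar>s\<bar> \<Longrightarrow> X' s = 0"
    using smooth_cutoff_exists by metis
  note X2 = smooth_real_derivative[of X', OF X(2)]
  have "compact (X' ` {-2..2})"
    by (intro compact_continuous_image continuous_on_subset[OF Ck_on_continuous[OF X(2)[of 0]]]) auto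
  then have "bounded (X' ` {-2..2})" by (rule compact_imp_bounded)
  then obtain B where B: "\<forall>x\<in>X' ` {-2..2}. norm x \<le> B" unfolding bounded_iff by blast
  have X'_le: "\<bar>X' s\<bar> \<le> \<bar>B\<bar>" for s
  proof (cases "2 < \<bar>s\<bar>")
    case False
    then have "s \<in> {-2..2}" by (auto simp: abs_le_iff)
    then have "norm (X' s) \<le> B" using B by blast
    then show ?thesis by simp
  qed (simp add: X(9))
  define N where "N n = real n + R + 1" for n
  have N: "0 < N n" "R < N n" "R + 1 \<le> N n" for n using R_nonneg by (auto simp: N_def)
  interpret c: sheet_energy_cutoff h g R G X X' "deriv X'" "N n" "\<bar>B\<bar>" for n
    by unfold_locales (use X X2 X'_le N Ck_on_continuous[OF X2(2)[of 0]] in \<open>auto simp: abs_le_iff intro: order_trans[of _ 0]\<close>)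
  define K where "K = \<bar>B\<bar> * (pi * G * (R + ln 16)) * (W + 8 * pi)"
  define A where "A n = (LINT z:strip|lborel. c.c n z * (norm (vel z))\<^sup>2)" for n
  \<comment> \<open>\<open>E\<close> involves no cutoff, so the limits for all heights coincide, and
    their common value can be found by letting the height grow.\<close>
  have lim: "E \<longlonglongrightarrow> (LINT z:strip|lborel. vel z \<bullet> c.psi0 n z)" for n
    using c.psi_tendsto[OF e(1,2,3), of n] unfolding c.psi_pairing[OF e(1)] by (simp add: E_def[abs_def])
  then have const: "(LINT z:strip|lborel. vel z \<bullet> c.psi0 n z) = (LINT z:strip|lborel. vel z \<bullet> c.psi0 0 z)" for n
    using LIMSEQ_unique by blast
  define L where "L = (LINT z:strip|lborel. vel z \<bullet> c.psi0 0 z)"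
  have err: "\<bar>L - A n\<bar> \<le> K / sqrt (N n)" for n
    using c.psi0_error[of n] const[of n] by (simp add: L_def A_def K_def W_def)
  have Ninf: "filterlim N at_top sequentially"
    unfolding N_def add.assoc
    using filterlim_tendsto_add_at_top[OF tendsto_const[of "R + 1"] filterlim_real_sequentially] by (simp add: add.commute)
  have "(\<lambda>n. K / sqrt (N n)) \<longlonglongrightarrow> 0"
    by (intro real_tendsto_divide_at_top[OF tendsto_const] filterlim_compose[OF sqrt_at_top Ninf])
  then have "(\<lambda>n. L - A n) \<longlonglongrightarrow> 0"
    by (rule Lim_null_comparison[rotated]) (use err in auto)
  then have 1: "A \<longlonglongrightarrow> L"
    using tendsto_diff[OF tendsto_const[of L]] by fastforce
  have 2: "A \<longlonglongrightarrow> W"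
    unfolding A_def[abs_def] W_def set_lebesgue_integral_def
  proof (rule integral_dominated_convergence[OF _ _ vel_L2])
    show "AE z in lborel. (\<lambda>n. indicator strip z *\<^sub>R (c.c n z * (norm (vel z))\<^sup>2)) \<longlonglongrightarrow> indicator strip z *\<^sub>R (norm (vel z))\<^sup>2"
    proof (rule AE_I2)
      fix z
      have "eventually (\<lambda>n. \<bar>Im z\<bar> < N n) sequentially"
        using Ninf unfolding filterlim_at_top_dense by blast
      then have "eventually (\<lambda>n. indicator strip z *\<^sub>R (norm (vel z))\<^sup>2 = indicator strip z *\<^sub>R (c.c n z * (norm (vel z))\<^sup>2)) sequentially"
        by eventually_elim (simp add: c.c_near)
      then show "(\<lambda>n. indicator strip z *\<^sub>R (c.c n z * (norm (vel z))\<^sup>2)) \<longlonglongrightarrow> indicator strip z *\<^sub>R (norm (vel z))\<^sup>2"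
        by (rule Lim_transform_eventually[OF tendsto_const])
    qed
    show "AE z in lborel. norm (indicator strip z *\<^sub>R (c.c n z * (norm (vel z))\<^sup>2)) \<le> indicator strip z *\<^sub>R (norm (vel z))\<^sup>2" for n
      using c.c_le(1) by (auto simp: indicator_def abs_mult intro!: mult_left_le_one_le)
  qed measurable
  have "E \<longlonglongrightarrow> W" using lim[of 0] LIMSEQ_unique[OF 1 2] by (simp add: L_def)
  then show ?thesis by (simp add: E_def[abs_def] W_def e_def)
qed

end

section \<open>Moving sheets\<close>

lemma periodic_bounded:
  fixes F :: "real \<times> real \<Rightarrow> real"
  assumes F: "continuous_on ({0..T} \<times> UNIV) F"
    and per: "\<And>t \<alpha>. t \<in> {0..T} \<Longrightarrow> F (t, \<alpha> + 2 * pi) = F (t, \<alpha>)"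
  shows "\<exists>B. \<forall>t\<in>{0..T}. \<forall>\<alpha>. \<bar>F (t, \<alpha>)\<bar> \<le> B"
proof -
  have "compact (F ` ({0..T} \<times> {0..2 * pi}))"
    by (intro compact_continuous_image continuous_on_subset[OF F] compact_Times) auto
  then have "bounded (F ` ({0..T} \<times> {0..2 * pi}))" by (rule compact_imp_bounded)
  then obtain B where B: "\<forall>x\<in>F ` ({0..T} \<times> {0..2 * pi}). norm x \<le> B" unfolding bounded_iff by blast
  have "\<bar>F (t, \<alpha>)\<bar> \<le> B" if t: "t \<in> {0..T}" for t \<alpha>
  proof -
    interpret periodic_fun_simple "\<lambda>\<alpha>. F (t, \<alpha>)" "2 * pi"
      by standard (use per[OF t] in simp)
    define n where "n = \<lfloor>\<alpha> / (2 * pi)\<rfloor>"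
    define \<beta> where "\<beta> = \<alpha> - of_int n * (2 * pi)"
    have "of_int n \<le> \<alpha> / (2 * pi)" "\<alpha> / (2 * pi) \<le> of_int n + 1" by (auto simp: n_def)
    then have "of_int n * (2 * pi) \<le> \<alpha>" "\<alpha> \<le> (of_int n + 1) * (2 * pi)"
      by (simp_all add: pos_le_divide_eq pos_divide_le_eq)
    then have "\<beta> \<in> {0..2 * pi}" by (simp add: \<beta>_def algebra_simps)
    then have "norm (F (t, \<beta>)) \<le> B" using B t by blast
    moreover have "F (t, \<alpha>) = F (t, \<beta>)" using plus_of_int[of \<beta> n] by (simp add: \<beta>_def)
    ultimately show ?thesis by simp
  qed
  then show ?thesis by blast
qed

text \<open>A spatial slice of the domain is a full line and gives two-sided derivatives; a slice in
  time is the closed interval and gives one-sided ones at its ends.\<close>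

lemma slice_derivatives:
  fixes F :: "real \<times> real \<Rightarrow> real"
  assumes F: "\<forall>x\<in>{0..T} \<times> UNIV. (F has_derivative F' x) (at x within {0..T} \<times> UNIV)" and t: "t \<in> {0..T}"
  shows "((\<lambda>\<alpha>. F (t, \<alpha>)) has_real_derivative F' (t, \<alpha>) (0, 1)) (at \<alpha>)"
    and "((\<lambda>t. F (t, \<alpha>)) has_real_derivative F' (t, \<alpha>) (1, 0)) (at t within {0..T})"
proof -
  have Fd: "(F has_derivative F' (t, \<alpha>)) (at (t, \<alpha>) within {0..T} \<times> UNIV)" using F t by auto
  interpret linear "F' (t, \<alpha>)" using Fd by (rule has_derivative_linear)
  have "((\<lambda>\<alpha>. (t, \<alpha>)) has_derivative (\<lambda>v. (0, v))) (at \<alpha> within UNIV)"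
    by (auto intro!: derivative_eq_intros)
  moreover have "(F has_derivative F' (t, \<alpha>)) (at (t, \<alpha>) within range (Pair t))"
    by (rule has_derivative_subset[OF Fd]) (use t in auto)
  ultimately have "((\<lambda>\<alpha>. F (t, \<alpha>)) has_derivative (\<lambda>v. F' (t, \<alpha>) (0, v))) (at \<alpha>)"
    by (rule has_derivative_in_compose[where g = F and f = "Pair t" and g' = "F' (t, \<alpha>)" and f' = "Pair 0"])
  moreover have "(\<lambda>v. F' (t, \<alpha>) (0, v)) = (*) (F' (t, \<alpha>) (0, 1))"
    by (rule ext, subst mult.commute, unfold real_scaleR_def[symmetric] scale[symmetric]) simp
  ultimately show "((\<lambda>\<alpha>. F (t, \<alpha>)) has_real_derivative F' (t, \<alpha>) (0, 1)) (at \<alpha>)"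
    unfolding has_field_derivative_def by simp
  have "((\<lambda>t. (t, \<alpha>)) has_derivative (\<lambda>v. (v, 0))) (at t within {0..T})"
    by (auto intro!: derivative_eq_intros)
  moreover have "(F has_derivative F' (t, \<alpha>)) (at (t, \<alpha>) within (\<lambda>t. (t, \<alpha>)) ` {0..T})"
    by (rule has_derivative_subset[OF Fd]) auto
  ultimately have "((\<lambda>t. F (t, \<alpha>)) has_derivative (\<lambda>v. F' (t, \<alpha>) (v, 0))) (at t within {0..T})"
    by (rule has_derivative_in_compose[where g = F and f = "\<lambda>t. (t, \<alpha>)" and g' = "F' (t, \<alpha>)" and f' = "\<lambda>v. (v, 0)"])
  moreover have "(\<lambda>v. F' (t, \<alpha>) (v, 0)) = (*) (F' (t, \<alpha>) (1, 0))"
    by (rule ext, subst mult.commute, unfold real_scaleR_def[symmetric] scale[symmetric]) simp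
  ultimately show "((\<lambda>t. F (t, \<alpha>)) has_real_derivative F' (t, \<alpha>) (1, 0)) (at t within {0..T})"
    unfolding has_field_derivative_def by simp
qed

lemma periodic_derivative:
  fixes f f' :: "real \<Rightarrow> real"
  assumes d: "\<And>x. (f has_real_derivative f' x) (at x)" and per: "\<And>x. f (x + p) = f x"
  shows "f' (x + p) = f' x"
proof -
  have "((\<lambda>x. f (x + p)) has_real_derivative f' (x + p) * 1) (at x)"
    by (rule DERIV_chain2[OF d]) (auto intro!: derivative_eq_intros)
  then show ?thesis using d[of x] DERIV_unique by (simp add: per) blast
qed

lemma lipschitz_of_derivative_bound:
  fixes f f' :: "real \<Rightarrow> real"
  assumes "\<And>x. (f has_real_derivative f' x) (at x)" "\<And>x. \<bar>f' x\<bar> \<le> B"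
  shows "\<bar>f x - f y\<bar> \<le> B * \<bar>x - y\<bar>"
  using field_differentiable_bound[of UNIV f f' B x y] assms by auto

text \<open>Condenses smoothness to two derivatives in space and one in time. Periodicity reduces
  the bounds in space to a compact set, and a single \<open>B\<close> collects them for all
  times.\<close>

lemma smooth_sheet_function:
  fixes f :: "real \<Rightarrow> real \<Rightarrow> real"
  assumes sm: "smooth_on ({0..T} \<times> UNIV) (\<lambda>(t, \<alpha>). f \<alpha> t)"
    and per: "\<And>t \<alpha>. t \<in> {0..T} \<Longrightarrow> f (\<alpha> + 2 * pi) t = f \<alpha> t"
  shows "\<exists>f1 ft B. continuous_on ({0..T} \<times> UNIV) (\<lambda>(t, \<alpha>). f \<alpha> t) \<and> continuous_on ({0..T} \<times> UNIV) (\<lambda>(t, \<alpha>). ft \<alpha> t) \<and>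
    (\<forall>t\<in>{0..T}. \<forall>\<alpha>. ((\<lambda>\<alpha>. f \<alpha> t) has_real_derivative f1 \<alpha> t) (at \<alpha>) \<and>
      ((\<lambda>t. f \<alpha> t) has_real_derivative ft \<alpha> t) (at t within {0..T}) \<and> \<bar>f \<alpha> t\<bar> \<le> B \<and>
      (\<forall>\<beta>. \<bar>f \<alpha> t - f \<beta> t\<bar> \<le> B * \<bar>\<alpha> - \<beta>\<bar> \<and> \<bar>f1 \<alpha> t - f1 \<beta> t\<bar> \<le> B * \<bar>\<alpha> - \<beta>\<bar>))"
proof -
  let ?F = "\<lambda>(t, \<alpha>). f \<alpha> t" and ?S = "{0..T} \<times> (UNIV :: real set)"
  have "Ck_on (Suc (Suc 0)) ?S ?F" using sm by (simp only: smooth_on_def)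
  then obtain F' where F': "\<forall>x\<in>?S. (?F has_derivative F' x) (at x within ?S)" "\<forall>v. Ck_on (Suc 0) ?S (\<lambda>x. F' x v)"
    unfolding Ck_on.simps(2)[of "Suc 0"] by blast
  from F'(2)[rule_format, of "(0,1)"] obtain F'' where F'': "\<forall>x\<in>?S. ((\<lambda>x. F' x (0, 1)) has_derivative F'' x) (at x within ?S)"
    "\<forall>v. Ck_on 0 ?S (\<lambda>x. F'' x v)" unfolding Ck_on.simps(2)[of 0] by blast
  have c: "continuous_on ?S ?F" using sm Ck_on_continuous[of 0] unfolding smooth_on_def by blast
  have c1: "continuous_on ?S (\<lambda>x. F' x v)" for v using F'(2) Ck_on_continuous by blast
  have c2: "continuous_on ?S (\<lambda>x. F'' x v)" for v using F''(2) unfolding Ck_on.simps by blast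
  note d1 = slice_derivatives[OF F'(1), unfolded case_prod_conv] and d2 = slice_derivatives(1)[OF F''(1)]
  have p1: "F' (t, \<alpha> + 2 * pi) (0, 1) = F' (t, \<alpha>) (0, 1)" if "t \<in> {0..T}" for t \<alpha>
    using periodic_derivative[OF d1(1)[OF that] per[OF that]] .
  have p2: "F'' (t, \<alpha> + 2 * pi) (0, 1) = F'' (t, \<alpha>) (0, 1)" if "t \<in> {0..T}" for t \<alpha>
    using periodic_derivative[OF d2[OF that] p1[OF that]] .
  obtain B0 where B0: "\<forall>t\<in>{0..T}. \<forall>\<alpha>. \<bar>f \<alpha> t\<bar> \<le> B0"
    using periodic_bounded[OF c] per by auto
  obtain B1 where B1: "\<forall>t\<in>{0..T}. \<forall>\<alpha>. \<bar>F' (t, \<alpha>) (0, 1)\<bar> \<le> B1"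
    using periodic_bounded[OF c1 p1] by auto
  obtain B2 where B2: "\<forall>t\<in>{0..T}. \<forall>\<alpha>. \<bar>F'' (t, \<alpha>) (0, 1)\<bar> \<le> B2"
    using periodic_bounded[OF c2 p2] by auto
  define B where "B = max B0 (max B1 B2)"
  show ?thesis
  proof (intro exI conjI ballI allI)
    show "continuous_on ?S ?F" by (rule c)
    show "continuous_on ?S (\<lambda>(t, \<alpha>). F' (t, \<alpha>) (1, 0))" using c1[of "(1,0)"] by (simp add: case_prod_beta')
    fix t \<alpha> \<beta> assume t: "t \<in> {0..T}"
    show "((\<lambda>\<alpha>. f \<alpha> t) has_real_derivative F' (t, \<alpha>) (0, 1)) (at \<alpha>)"
      "(f \<alpha> has_real_derivative F' (t, \<alpha>) (1, 0)) (at t within {0..T})"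
      using d1[OF t] by auto
    show "\<bar>f \<alpha> t\<bar> \<le> B" using B0 t by (auto simp: B_def intro: le_max_iff_disj[THEN iffD2])
    show "\<bar>f \<alpha> t - f \<beta> t\<bar> \<le> B * \<bar>\<alpha> - \<beta>\<bar>"
      by (rule lipschitz_of_derivative_bound[OF d1(1)[OF t]]) (use B1 t in \<open>auto simp: B_def le_max_iff_disj\<close>)
    show "\<bar>F' (t, \<alpha>) (0, 1) - F' (t, \<beta>) (0, 1)\<bar> \<le> B * \<bar>\<alpha> - \<beta>\<bar>"
      by (rule lipschitz_of_derivative_bound[OF d2[OF t]]) (use B2 t in \<open>auto simp: B_def le_max_iff_disj\<close>)
  qed
qed

section \<open>Smoothness of the kernels and transfer between measures\<close>

lemma Ck_on_denom_add: "Ck_on k UNIV (\<lambda>w. denom w + e)"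
  unfolding denom_def
  by (intro Ck_on_diff Ck_on_add Ck_on_const Ck_on_compose[OF Ck_on_linear[OF bounded_linear_Im] conjunct2[OF Ck_on_sinh_cosh]]
      Ck_on_compose[OF Ck_on_linear[OF bounded_linear_Re] conjunct2[OF Ck_on_sin_cos]] subset_UNIV)

lemma Ck_on_lnk: "0 < e \<Longrightarrow> Ck_on k UNIV (lnk e)"
  unfolding lnk_def[abs_def]
  by (rule Ck_on_compose[OF Ck_on_denom_add Ck_on_ln]) (auto simp: denom_add_pos)

lemma Ck_on_blob:
  assumes "0 < e" shows "Ck_on k UNIV (blob e)"
proof -
  have i: "Ck_on k UNIV (\<lambda>w. inverse (denom w + e))"
    by (rule Ck_on_compose[OF Ck_on_denom_add Ck_on_inverse]) (use denom_add_pos[OF assms] in auto)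
  have b: "blob e = (\<lambda>w. of_real (sin (Re w) * inverse (denom w + e)) - \<i> * of_real (sinh (Im w) * inverse (denom w + e)))"
    by (auto simp: blob_def fun_eq_iff Complex_eq divide_inverse algebra_simps simp del: of_real_add)
  show ?thesis unfolding b
    by (intro Ck_on_diff Ck_on_linear_compose[OF bounded_linear_of_real] Ck_on_linear_compose[OF bounded_linear_mult_right] Ck_on_mult i
        Ck_on_compose[OF Ck_on_linear[OF bounded_linear_Im] conjunct1[OF Ck_on_sinh_cosh]]
        Ck_on_compose[OF Ck_on_linear[OF bounded_linear_Re] conjunct1[OF Ck_on_sin_cos]] subset_UNIV)
qed

text \<open>\<open>u\<close> is Lebesgue measurable only after multiplication by the indicator of
  the strip. Since \<open>H 0 z = 0\<close>, the indicator can be moved into the first argument of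
  \<open>H\<close>, where this measurability applies.\<close>

lemma strip_transfer:
  fixes H :: "complex \<Rightarrow> complex \<Rightarrow> real"
  assumes u: "set_borel_measurable lebesgue strip u" and ae: "AE z in lborel. u z = v z"
    and v[measurable]: "v \<in> borel_measurable borel"
    and H: "continuous_on UNIV (\<lambda>p. H (fst p) (snd p))" and H0: "\<And>z. H 0 z = 0"
  shows "(LINT z:strip|lebesgue. H (u z) z) = (LINT z:strip|lborel. H (v z) z)"
    and "set_integrable lebesgue strip (\<lambda>z. H (u z) z) \<longleftrightarrow> integrable lborel (\<lambda>z. indicator strip z *\<^sub>R H (v z) z)"
proof -
  have Hm: "(\<lambda>p. H (fst p) (snd p)) \<in> borel_measurable (borel \<Otimes>\<^sub>M borel)"
    unfolding borel_prod using H by (rule borel_measurable_continuous_onI)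
  have iH: "indicator strip z *\<^sub>R H w z = H (indicator strip z *\<^sub>R w) z" for w z
    by (simp add: indicator_def H0)
  have "(\<lambda>z. (indicator strip z *\<^sub>R u z, z)) \<in> lebesgue \<rightarrow>\<^sub>M borel \<Otimes>\<^sub>M borel"
    using u unfolding set_borel_measurable_def by (intro measurable_Pair) (auto intro: measurable_completion)
  from measurable_compose[OF this Hm] have m1: "(\<lambda>z. indicator strip z *\<^sub>R H (u z) z) \<in> borel_measurable lebesgue"
    unfolding iH by simp
  have "(\<lambda>z. (indicator strip z *\<^sub>R v z, z)) \<in> lborel \<rightarrow>\<^sub>M borel \<Otimes>\<^sub>M borel" by measurable
  from measurable_compose[OF this Hm] have m2: "(\<lambda>z. indicator strip z *\<^sub>R H (v z) z) \<in> borel_measurable lborel"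
    unfolding iH by simp
  have m3: "(\<lambda>z. indicator strip z *\<^sub>R H (v z) z) \<in> borel_measurable lebesgue"
    using m2 by (rule measurable_completion)
  have a: "AE z in lebesgue. indicator strip z *\<^sub>R H (u z) z = indicator strip z *\<^sub>R H (v z) z"
    using AE_completion[OF ae] by eventually_elim simp
  show "(LINT z:strip|lebesgue. H (u z) z) = (LINT z:strip|lborel. H (v z) z)"
    unfolding set_lebesgue_integral_def integral_completion[OF m2, symmetric] by (rule integral_cong_AE[OF m1 m3 a])
  show "set_integrable lebesgue strip (\<lambda>z. H (u z) z) \<longleftrightarrow> integrable lborel (\<lambda>z. indicator strip z *\<^sub>R H (v z) z)"
    unfolding set_integrable_def integrable_completion[OF m2, symmetric] by (rule integrable_cong_AE[OF m1 m3 a])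
qed

lemma set_lebesgue_eq_lborel:
  fixes f :: "real \<Rightarrow> 'b::{banach, second_countable_topology}"
  assumes [measurable]: "f \<in> borel_measurable borel"
  shows "(LINT x:{a..b}|lebesgue. f x) = (LINT x:{a..b}|lborel. f x)"
  unfolding set_lebesgue_integral_def by (rule integral_completion) measurable

text \<open>A non-integrable \<open>f\<close> is covered as well, its integral being
  \<open>0\<close> by convention; measurability of the nonlinear term in time thus never has to be
  established.\<close>

lemma set_integral_bound_interval:
  fixes f :: "real \<Rightarrow> real"
  assumes f: "\<And>s. s \<in> {0..t} \<Longrightarrow> \<bar>f s\<bar> \<le> C" and t: "0 \<le> t" and C: "0 \<le> C"
  shows "\<bar>LINT s:{0..t}|lebesgue. f s\<bar> \<le> C * t"
proof (cases "integrable lebesgue (\<lambda>s. indicator {0..t} s *\<^sub>R f s)")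
  case True
  have i: "integrable lebesgue (\<lambda>s. C * indicator {0..t} s)"
    using t by (intro integrable_mult_right integrable_real_indicator) auto
  have "\<bar>LINT s:{0..t}|lebesgue. f s\<bar> \<le> (\<integral>s. norm (indicator {0..t} s *\<^sub>R f s) \<partial>lebesgue)"
    unfolding set_lebesgue_integral_def real_norm_def[symmetric] by (rule integral_norm_bound)
  also have "\<dots> \<le> (\<integral>s. C * indicator {0..t} s \<partial>lebesgue)"
    by (rule integral_mono[OF integrable_norm[OF True] i]) (use f C in \<open>auto simp: indicator_def\<close>)
  also have "\<dots> = C * t" using t by simp
  finally show ?thesis .
next
  case False
  then show ?thesis using t C unfolding set_lebesgue_integral_def by (simp add: not_integrable_integral_eq)
qed

text \<open>\<open>R\<close>, \<open>G\<close>, \<open>M\<close> and \<open>C0\<close> are fixed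
  before the time \<open>t\<close>; this uniformity allows the defect to be integrated over
  time.\<close>

locale moving_sheet =
  fixes T :: real and h \<gamma> h1 ht \<gamma>t :: "real \<Rightarrow> real \<Rightarrow> real" and R G M C0 :: real
  assumes T: "0 < T"
    and reg: "t \<in> {0..T} \<Longrightarrow> sheet_reg (\<lambda>\<alpha>. h \<alpha> t) (\<lambda>\<alpha>. \<gamma> \<alpha> t) R G (\<lambda>\<alpha>. h1 \<alpha> t) M C0"
    and h_time: "t \<in> {0..T} \<Longrightarrow> ((\<lambda>t. h \<alpha> t) has_real_derivative ht \<alpha> t) (at t within {0..T})"
    and \<gamma>_time: "t \<in> {0..T} \<Longrightarrow> ((\<lambda>t. \<gamma> \<alpha> t) has_real_derivative \<gamma>t \<alpha> t) (at t within {0..T})"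
    and cont: "continuous_on ({0..T} \<times> UNIV) (\<lambda>(t, \<alpha>). h \<alpha> t)" "continuous_on ({0..T} \<times> UNIV) (\<lambda>(t, \<alpha>). \<gamma> \<alpha> t)"
      "continuous_on ({0..T} \<times> UNIV) (\<lambda>(t, \<alpha>). ht \<alpha> t)" "continuous_on ({0..T} \<times> UNIV) (\<lambda>(t, \<alpha>). \<gamma>t \<alpha> t)"
begin

abbreviation I :: "real set" where "I \<equiv> {-pi..pi}"

definition zeta :: "real \<Rightarrow> real \<Rightarrow> complex" where "zeta t \<alpha> = Complex \<alpha> (h \<alpha> t)"

lemma cont_comp:
  assumes "continuous_on A a" "continuous_on A b" "\<And>x. x \<in> A \<Longrightarrow> a x \<in> {0..T}"
  shows "continuous_on A (\<lambda>x. h (b x) (a x))" "continuous_on A (\<lambda>x. \<gamma> (b x) (a x))"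
    "continuous_on A (\<lambda>x. ht (b x) (a x))" "continuous_on A (\<lambda>x. \<gamma>t (b x) (a x))" "continuous_on A (\<lambda>x. zeta (a x) (b x))"
proof -
  have ab: "continuous_on A (\<lambda>x. (a x, b x))" "(\<lambda>x. (a x, b x)) ` A \<subseteq> {0..T} \<times> UNIV"
    using assms by (auto intro!: continuous_intros)
  show h: "continuous_on A (\<lambda>x. h (b x) (a x))" and "continuous_on A (\<lambda>x. \<gamma> (b x) (a x))"
    "continuous_on A (\<lambda>x. ht (b x) (a x))" "continuous_on A (\<lambda>x. \<gamma>t (b x) (a x))"
    using continuous_on_compose2[OF cont(1) ab] continuous_on_compose2[OF cont(2) ab]
      continuous_on_compose2[OF cont(3) ab] continuous_on_compose2[OF cont(4) ab] by simp_all
  show "continuous_on A (\<lambda>x. zeta (a x) (b x))"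
    unfolding zeta_def Complex_eq by (intro continuous_intros h assms)
qed

lemma cont_space:
  assumes "t \<in> {0..T}"
  shows "continuous_on A (\<lambda>\<alpha>. h \<alpha> t)" "continuous_on A (\<lambda>\<alpha>. \<gamma> \<alpha> t)" "continuous_on A (\<lambda>\<alpha>. ht \<alpha> t)" "continuous_on A (\<lambda>\<alpha>. \<gamma>t \<alpha> t)"
  using cont_comp[of A "\<lambda>_. t" "\<lambda>\<alpha>. \<alpha>"] assms by (auto intro!: continuous_intros)

lemma zeta_time:
  assumes "t \<in> {0..T}"
  shows "((\<lambda>t. z - zeta t \<alpha>) has_derivative (\<lambda>v. - (\<i> * of_real (v * ht \<alpha> t)))) (at t within {0..T})"
proof -
  have "((\<lambda>t. h \<alpha> t) has_derivative (\<lambda>v. v * ht \<alpha> t)) (at t within {0..T})"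
    by (rule has_derivative_eq_rhs[OF h_time[OF assms, unfolded has_field_derivative_def]]) (simp add: fun_eq_iff)
  from has_derivative_diff[OF has_derivative_const has_derivative_add[OF has_derivative_const has_derivative_mult_right[OF has_derivative_of_real[OF this], of \<i>]]]
  show ?thesis unfolding zeta_def Complex_eq by simp
qed

text \<open>A graph moves only vertically, so the motion of the sheet enters through
  \<open>Fy\<close>, weighted with density and vertical speed, and the change of the density through
  \<open>\<gamma>t\<close>.\<close>

lemma sheet_conv_time:
  fixes F Fx Fy :: "complex \<Rightarrow> 'b::euclidean_space"
  assumes t: "t \<in> {0..T}"
    and F: "\<And>w. (F has_derivative (\<lambda>v. Re v *\<^sub>R Fx w + Im v *\<^sub>R Fy w)) (at w)"
    and Fc: "continuous_on UNIV Fy"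
  shows "((\<lambda>t. sheet_conv (\<lambda>\<alpha>. h \<alpha> t) (\<lambda>\<alpha>. \<gamma> \<alpha> t) F z) has_vector_derivative
     sheet_conv (\<lambda>\<alpha>. h \<alpha> t) (\<lambda>\<alpha>. \<gamma>t \<alpha> t) F z + sheet_conv (\<lambda>\<alpha>. h \<alpha> t) (\<lambda>\<alpha>. - (\<gamma> \<alpha> t * ht \<alpha> t)) Fy z) (at t within {0..T})"
proof -
  have F0: "continuous_on UNIV F"
    using has_derivative_continuous[OF F] by (auto intro: continuous_at_imp_continuous_on)
  let ?q = "\<lambda>t \<alpha>. \<gamma> \<alpha> t *\<^sub>R F (z - zeta t \<alpha>)"
  let ?q' = "\<lambda>t \<alpha>. \<gamma>t \<alpha> t *\<^sub>R F (z - zeta t \<alpha>) + (- (\<gamma> \<alpha> t * ht \<alpha> t)) *\<^sub>R Fy (z - zeta t \<alpha>)"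
  have der: "((\<lambda>t. integral I (?q t)) has_derivative (\<lambda>v. integral I (\<lambda>\<alpha>. v *\<^sub>R ?q' t \<alpha>))) (at t within {0..T})"
  proof (rule has_derivative_integral_param[OF _ t])
    show "((\<lambda>t. ?q t \<alpha>) has_derivative (\<lambda>v. v *\<^sub>R ?q' t \<alpha>)) (at t within {0..T})" if t: "t \<in> {0..T}" for t \<alpha>
    proof -
      have 1: "((\<lambda>t. F (z - zeta t \<alpha>)) has_derivative (\<lambda>v. (- (v * ht \<alpha> t)) *\<^sub>R Fy (z - zeta t \<alpha>))) (at t within {0..T})"
        using has_derivative_compose[OF zeta_time[OF t] F] by simp
      have 2: "((\<lambda>t. \<gamma> \<alpha> t) has_derivative (\<lambda>v. v * \<gamma>t \<alpha> t)) (at t within {0..T})"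
        by (rule has_derivative_eq_rhs[OF \<gamma>_time[OF t, unfolded has_field_derivative_def]]) (simp add: fun_eq_iff)
      show ?thesis
        by (rule has_derivative_eq_rhs[OF has_derivative_scaleR[OF 2 1]])
          (auto simp: fun_eq_iff scaleR_add_right algebra_simps)
    qed
    show "continuous_on ({0..T} \<times> I) (\<lambda>(t, \<alpha>). v *\<^sub>R ?q' t \<alpha>)" for v
      unfolding case_prod_beta'
      by (intro continuous_intros cont_comp continuous_on_compose2[OF F0] continuous_on_compose2[OF Fc]) auto
    show "continuous_on I (?q t)" if "t \<in> {0..T}" for t
      by (intro continuous_intros cont_comp continuous_on_compose2[OF F0] cont_space) (use that in auto)
  qed simp
  have HK: "sheet_conv (\<lambda>\<alpha>. h \<alpha> t) (\<lambda>\<alpha>. \<gamma> \<alpha> t) F z = integral I (?q t)" if "t \<in> {0..T}" for t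
    unfolding zeta_def by (rule sheet_conv_HK[OF cont_space(1)[OF that] cont_space(2)[OF that] F0])
  have e: "integral I (?q' t) = sheet_conv (\<lambda>\<alpha>. h \<alpha> t) (\<lambda>\<alpha>. \<gamma>t \<alpha> t) F z + sheet_conv (\<lambda>\<alpha>. h \<alpha> t) (\<lambda>\<alpha>. - (\<gamma> \<alpha> t * ht \<alpha> t)) Fy z"
  proof -
    have c: "continuous_on UNIV (\<lambda>\<alpha>. - (\<gamma> \<alpha> t * ht \<alpha> t))" by (intro continuous_intros cont_space t)
    have i: "(\<lambda>\<alpha>. \<gamma>t \<alpha> t *\<^sub>R F (z - zeta t \<alpha>)) integrable_on I" "(\<lambda>\<alpha>. (- (\<gamma> \<alpha> t * ht \<alpha> t)) *\<^sub>R Fy (z - zeta t \<alpha>)) integrable_on I"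
      by (intro integrable_continuous_real continuous_intros cont_comp continuous_on_compose2[OF F0] continuous_on_compose2[OF Fc] cont_space t; use t in auto)+
    show ?thesis
      unfolding Henstock_Kurzweil_Integration.integral_add[OF i] sheet_conv_HK[OF cont_space(1)[OF t] cont_space(4)[OF t] F0]
        sheet_conv_HK[OF cont_space(1)[OF t] c Fc] by (simp add: zeta_def)
  qed
  have "((\<lambda>t. sheet_conv (\<lambda>\<alpha>. h \<alpha> t) (\<lambda>\<alpha>. \<gamma> \<alpha> t) F z) has_derivative (\<lambda>v. integral I (\<lambda>\<alpha>. v *\<^sub>R ?q' t \<alpha>))) (at t within {0..T})"
    by (rule has_derivative_transform[OF t _ der]) (rule HK)
  then show ?thesis unfolding has_vector_derivative_def e[symmetric] by simp
qed

text \<open>The regularized energy, written over the sheet alone as in \<open>psi_pairing\<close>;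
  no cutoff occurs in it.\<close>

definition Et :: "real \<Rightarrow> real \<Rightarrow> real" where
  "Et e t = - (LINT \<alpha>:I|lborel. \<gamma> \<alpha> t * sheet.\<Psi> (\<lambda>\<alpha>. h \<alpha> t) (\<lambda>\<alpha>. \<gamma> \<alpha> t) e (zeta t \<alpha>)) / (4 * pi)"

text \<open>The time derivative of the stream function at a fixed point of the plane, in the form
  given by \<open>sheet_conv_time\<close>; \<open>Vt\<close> is the same for
  \<open>V\<close>.\<close>

definition \<Psi>t :: "real \<Rightarrow> real \<Rightarrow> complex \<Rightarrow> real" where
  "\<Psi>t e t z = sheet_conv (\<lambda>\<alpha>. h \<alpha> t) (\<lambda>\<alpha>. \<gamma>t \<alpha> t) (lnk e) z
     + sheet_conv (\<lambda>\<alpha>. h \<alpha> t) (\<lambda>\<alpha>. - (\<gamma> \<alpha> t * ht \<alpha> t)) (\<lambda>w. - Im (blob e w)) z"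

definition Vt :: "real \<Rightarrow> real \<Rightarrow> complex \<Rightarrow> complex" where
  "Vt e t z = sheet_conv (\<lambda>\<alpha>. h \<alpha> t) (\<lambda>\<alpha>. \<gamma>t \<alpha> t) (blob e) z
     + sheet_conv (\<lambda>\<alpha>. h \<alpha> t) (\<lambda>\<alpha>. - (\<gamma> \<alpha> t * ht \<alpha> t)) (blob_y e) z"

lemma \<Psi>t_der:
  assumes t: "t \<in> {0..T}" and e: "0 < e"
  shows "(\<Psi>t e t has_derivative (\<lambda>v. Re v * Re (Vt e t z) + Im v * - Im (Vt e t z))) (at z)"
proof -
  have c: "continuous_on UNIV (\<lambda>\<alpha>. - (\<gamma> \<alpha> t * ht \<alpha> t))" by (intro continuous_intros cont_space t)
  note b = blob_continuous[OF e] blob_xy_continuous(2)[OF e]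
  have 1: "(sheet_conv (\<lambda>\<alpha>. h \<alpha> t) (\<lambda>\<alpha>. \<gamma>t \<alpha> t) (lnk e) has_derivative (\<lambda>v. Re v *\<^sub>R sheet_conv (\<lambda>\<alpha>. h \<alpha> t) (\<lambda>\<alpha>. \<gamma>t \<alpha> t) (\<lambda>w. Re (blob e w)) z
      + Im v *\<^sub>R sheet_conv (\<lambda>\<alpha>. h \<alpha> t) (\<lambda>\<alpha>. \<gamma>t \<alpha> t) (\<lambda>w. - Im (blob e w)) z)) (at z)"
    by (rule sheet_conv_has_derivative[OF cont_space(1)[OF t] cont_space(4)[OF t] lnk_der[OF e]]) (intro continuous_intros b)+
  have 2: "(sheet_conv (\<lambda>\<alpha>. h \<alpha> t) (\<lambda>\<alpha>. - (\<gamma> \<alpha> t * ht \<alpha> t)) (\<lambda>w. - Im (blob e w)) has_derivative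
     (\<lambda>v. Re v *\<^sub>R sheet_conv (\<lambda>\<alpha>. h \<alpha> t) (\<lambda>\<alpha>. - (\<gamma> \<alpha> t * ht \<alpha> t)) (\<lambda>w. Re (blob_y e w)) z
      + Im v *\<^sub>R sheet_conv (\<lambda>\<alpha>. h \<alpha> t) (\<lambda>\<alpha>. - (\<gamma> \<alpha> t * ht \<alpha> t)) (\<lambda>w. - Im (blob_y e w)) z)) (at z)"
    by (rule sheet_conv_has_derivative[OF cont_space(1)[OF t] c minus_Im_blob_der[OF e]]) (intro continuous_intros b)+
  show ?thesis unfolding \<Psi>t_def[abs_def] Vt_def
    by (rule has_derivative_eq_rhs[OF has_derivative_add[OF 1 2]])
      (simp add: fun_eq_iff algebra_simps
        Re_sheet_conv(1)[OF cont_space(1)[OF t] cont_space(4)[OF t] b(1), symmetric] Re_sheet_conv(2)[OF cont_space(1)[OF t] cont_space(4)[OF t] b(1), symmetric]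
        Re_sheet_conv(1)[OF cont_space(1)[OF t] c b(2), symmetric] Re_sheet_conv(2)[OF cont_space(1)[OF t] c b(2), symmetric])
qed

lemma Vt_cont:
  assumes t: "t \<in> {0..T}" and e: "0 < e"
  shows "continuous_on A (Vt e t)"
proof -
  have c: "continuous_on UNIV (\<lambda>\<alpha>. - (\<gamma> \<alpha> t * ht \<alpha> t))" by (intro continuous_intros cont_space t)
  show ?thesis unfolding Vt_def[abs_def]
    by (intro continuous_intros sheet_conv_continuous[OF cont_space(1)[OF t] cont_space(4)[OF t] blob_continuous[OF e]]
        sheet_conv_continuous[OF cont_space(1)[OF t] c blob_xy_continuous(2)[OF e]])
qed

lemma minus_Im_blob_minus: "- Im (blob e (- w)) = - (- Im (blob e w))"
  by (simp add: blob_minus)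

text \<open>
  \<open>Et\<close> is a quadratic form with a symmetric kernel, so differentiating one of its two factors gives half
  of its derivative.
\<close>

lemma Et_derivative:
  assumes e: "0 < e"
  shows "\<exists>E'. continuous_on {0..T} E' \<and> (\<forall>t\<in>{0..T}. (Et e has_real_derivative E' t) (at t within {0..T}) \<and>
     - (LINT \<alpha>:I|lborel. \<gamma> \<alpha> t * \<Psi>t e t (zeta t \<alpha>)) / (4 * pi) = E' t / 2)"
proof -
  define L where "L t \<alpha> \<beta> = lnk e (zeta t \<alpha> - zeta t \<beta>)" for t \<alpha> \<beta>
  define D where "D t \<alpha> \<beta> = - Im (blob e (zeta t \<alpha> - zeta t \<beta>))" for t \<alpha> \<beta>
  define q where "q t \<alpha> \<beta> = \<gamma> \<alpha> t * (\<gamma> \<beta> t * L t \<alpha> \<beta>)" for t \<alpha> \<beta>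
  \<comment> \<open>The part of the derivative that is due to density and position at \<beta>. As
    \<open>L\<close> is symmetric and \<open>D\<close> antisymmetric, the part due to \<alpha> is
    \<open>a t \<beta> \<alpha>\<close>.\<close>
  define a where "a t \<alpha> \<beta> = \<gamma> \<alpha> t * (\<gamma>t \<beta> t * L t \<alpha> \<beta> + - (\<gamma> \<beta> t * ht \<beta> t) * D t \<alpha> \<beta>)" for t \<alpha> \<beta>
  define F where "F t = integral I (\<lambda>\<alpha>. integral I (q t \<alpha>))" for t
  define F' where "F' t = integral I (\<lambda>\<alpha>. integral I (\<lambda>\<beta>. a t \<alpha> \<beta> + a t \<beta> \<alpha>))" for t
  have Lc: "continuous_on A (\<lambda>x. L (u x) (v x) (w x))" "continuous_on A (\<lambda>x. D (u x) (v x) (w x))"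
    if "continuous_on A u" "continuous_on A v" "continuous_on A w" "\<And>x. x \<in> A \<Longrightarrow> u x \<in> {0..T}"
    for A :: "'c::t2_space set" and u v w
    unfolding L_def D_def
    by (intro continuous_intros continuous_on_compose2[OF lnk_continuous[OF e, of UNIV]] continuous_on_compose2[OF blob_continuous[OF e, of UNIV]] cont_comp that; simp)+
  have ac: "continuous_on A (\<lambda>x. a (u x) (v x) (w x))" "continuous_on A (\<lambda>x. q (u x) (v x) (w x))"
    if "continuous_on A u" "continuous_on A v" "continuous_on A w" "\<And>x. x \<in> A \<Longrightarrow> u x \<in> {0..T}"
    for A :: "'c::t2_space set" and u v w
    unfolding a_def q_def by (intro continuous_intros Lc cont_comp that; simp add: that)+
  have L_der: "((\<lambda>t. L t \<alpha> \<beta>) has_derivative (\<lambda>v. v * ((ht \<alpha> t - ht \<beta> t) * D t \<alpha> \<beta>))) (at t within {0..T})"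
    if t: "t \<in> {0..T}" for t \<alpha> \<beta>
  proof -
    have "((\<lambda>t. zeta t \<alpha> - zeta t \<beta>) has_derivative (\<lambda>v. \<i> * of_real (v * (ht \<alpha> t - ht \<beta> t)))) (at t within {0..T})"
      using has_derivative_diff[OF zeta_time[OF t, of 0 \<beta>] zeta_time[OF t, of 0 \<alpha>]] by (simp add: algebra_simps)
    from has_derivative_compose[OF this lnk_der[OF e]] show ?thesis
      by (simp add: L_def D_def mult_ac)
  qed
  have \<gamma>_der: "((\<lambda>t. \<gamma> \<alpha> t) has_derivative (\<lambda>v. v * \<gamma>t \<alpha> t)) (at t within {0..T})" if "t \<in> {0..T}" for t \<alpha>
    by (rule has_derivative_eq_rhs[OF \<gamma>_time[OF that, unfolded has_field_derivative_def]]) (simp add: fun_eq_iff)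
  have sym: "L t \<beta> \<alpha> = L t \<alpha> \<beta>" "D t \<beta> \<alpha> = - D t \<alpha> \<beta>" for t \<alpha> \<beta>
    using lnk_sym[of e "zeta t \<alpha> - zeta t \<beta>"] minus_Im_blob_minus[of e "zeta t \<alpha> - zeta t \<beta>"] by (simp_all add: L_def D_def)
  have inner: "((\<lambda>t. integral I (q t \<alpha>)) has_derivative (\<lambda>v. integral I (\<lambda>\<beta>. v * (a t \<alpha> \<beta> + a t \<beta> \<alpha>)))) (at t within {0..T})"
    if t: "t \<in> {0..T}" for t \<alpha>
  proof (rule has_derivative_integral_param[OF _ t])
    show "((\<lambda>t. q t \<alpha> \<beta>) has_derivative (\<lambda>v. v * (a t \<alpha> \<beta> + a t \<beta> \<alpha>))) (at t within {0..T})" if t: "t \<in> {0..T}" for t \<beta>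
      unfolding q_def
      by (rule has_derivative_eq_rhs[OF has_derivative_mult[OF \<gamma>_der[OF t] has_derivative_mult[OF \<gamma>_der[OF t] L_der[OF t]]]])
        (auto simp: fun_eq_iff a_def sym[of t \<alpha> \<beta>] algebra_simps)
    show "continuous_on ({0..T} \<times> I) (\<lambda>(t, \<beta>). v * (a t \<alpha> \<beta> + a t \<beta> \<alpha>))" for v
      unfolding case_prod_beta' by (intro continuous_intros ac) auto
    show "continuous_on I (q t \<alpha>)" if "t \<in> {0..T}" for t
      by (intro ac continuous_intros) (use that in auto)
  qed simp
  have inner_c: "continuous_on ({0..T} \<times> I) (\<lambda>p. integral I (\<lambda>\<beta>. a (fst p) (snd p) \<beta> + a (fst p) \<beta> (snd p)))"
  proof -
    have "continuous_on (({0..T} \<times> I) \<times> cbox (-pi) pi) (\<lambda>(p, \<beta>). a (fst p) (snd p) \<beta> + a (fst p) \<beta> (snd p))"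
      unfolding case_prod_beta' by (intro continuous_intros ac) auto
    from integral_continuous_on_param[OF this] show ?thesis by simp
  qed
  have F_der: "(F has_derivative (\<lambda>v. integral I (\<lambda>\<alpha>. v * integral I (\<lambda>\<beta>. a t \<alpha> \<beta> + a t \<beta> \<alpha>)))) (at t within {0..T})"
    if t: "t \<in> {0..T}" for t
    unfolding F_def[abs_def]
  proof (rule has_derivative_integral_param[OF _ t])
    show "((\<lambda>t. integral I (q t \<alpha>)) has_derivative (\<lambda>v. v * integral I (\<lambda>\<beta>. a t \<alpha> \<beta> + a t \<beta> \<alpha>))) (at t within {0..T})"
      if t: "t \<in> {0..T}" for t \<alpha>
      using inner[OF t, of \<alpha>] by simp
    show "continuous_on ({0..T} \<times> I) (\<lambda>(t, \<alpha>). v * integral I (\<lambda>\<beta>. a t \<alpha> \<beta> + a t \<beta> \<alpha>))" for v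
      using inner_c unfolding case_prod_beta' by (intro continuous_intros)
    show "continuous_on I (\<lambda>\<alpha>. integral I (q t \<alpha>))" if "t \<in> {0..T}" for t
    proof -
      have "continuous_on (I \<times> cbox (-pi) pi) (\<lambda>(\<alpha>, \<beta>). q t \<alpha> \<beta>)"
        unfolding case_prod_beta' by (intro continuous_intros ac) (use that in auto)
      from integral_continuous_on_param[OF this] show ?thesis by simp
    qed
  qed simp
  have F'_c: "continuous_on {0..T} F'"
  proof -
    have "continuous_on ({0..T} \<times> cbox (-pi) pi) (\<lambda>(t, \<alpha>). integral I (\<lambda>\<beta>. a t \<alpha> \<beta> + a t \<beta> \<alpha>))"
      using inner_c by (simp add: case_prod_beta')
    from integral_continuous_on_param[OF this] show ?thesis by (simp add: F'_def[abs_def])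
  qed
  have LH: "(LINT \<alpha>:I|lborel. f \<alpha>) = integral I f" if "continuous_on I f" for f :: "real \<Rightarrow> real"
    by (rule set_borel_integral_eq_integral[OF borel_integrable_atLeastAtMost'[OF that]])
  have EF: "Et e t = - F t / (4 * pi)" if t: "t \<in> {0..T}" for t
  proof -
    interpret s: sheet_reg "\<lambda>\<alpha>. h \<alpha> t" "\<lambda>\<alpha>. \<gamma> \<alpha> t" R G "\<lambda>\<alpha>. h1 \<alpha> t" M C0 by (rule reg[OF t])
    have P: "s.\<Psi> e z = integral I (\<lambda>\<beta>. \<gamma> \<beta> t *\<^sub>R lnk e (z - zeta t \<beta>))" for z
      unfolding s.\<Psi>_def zeta_def by (rule sheet_conv_HK[OF s.h_cont s.g_cont lnk_continuous[OF e]])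
    have "continuous_on I (\<lambda>\<alpha>. \<gamma> \<alpha> t * s.\<Psi> e (zeta t \<alpha>))"
    proof -
      have "continuous_on UNIV (s.\<Psi> e)" unfolding s.\<Psi>_def by (rule sheet_conv_continuous[OF s.h_cont s.g_cont lnk_continuous[OF e]])
      moreover have "continuous_on I (\<lambda>\<alpha>. zeta t \<alpha>)"
        using cont_comp(5)[of I "\<lambda>_. t" "\<lambda>\<alpha>. \<alpha>"] t by auto
      ultimately have "continuous_on I (\<lambda>\<alpha>. s.\<Psi> e (zeta t \<alpha>))" by (rule continuous_on_compose2) simp
      then show ?thesis by (intro continuous_intros cont_space t)
    qed
    then have "(LINT \<alpha>:I|lborel. \<gamma> \<alpha> t * s.\<Psi> e (zeta t \<alpha>)) = integral I (\<lambda>\<alpha>. \<gamma> \<alpha> t * s.\<Psi> e (zeta t \<alpha>))" by (rule LH)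
    also have "\<dots> = F t" by (simp add: F_def P q_def[abs_def] L_def)
    finally show ?thesis by (simp add: Et_def)
  qed
  have A: "(LINT \<alpha>:I|lborel. \<gamma> \<alpha> t * \<Psi>t e t (zeta t \<alpha>)) = F' t / 2" if t: "t \<in> {0..T}" for t
  proof -
    have c: "continuous_on UNIV (\<lambda>\<alpha>. - (\<gamma> \<alpha> t * ht \<alpha> t))" by (intro continuous_intros cont_space t)
    have bc: "continuous_on UNIV (\<lambda>w. - Im (blob e w))" by (intro continuous_intros blob_continuous[OF e])
    have z: "continuous_on A (\<lambda>\<beta>. w - zeta t \<beta>)" for A w by (intro continuous_intros cont_comp) (use t in auto)
    have P: "\<gamma> \<alpha> t * \<Psi>t e t (zeta t \<alpha>) = integral I (a t \<alpha>)" for \<alpha>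
    proof -
      have i: "(\<lambda>\<beta>. \<gamma>t \<beta> t * L t \<alpha> \<beta>) integrable_on I" "(\<lambda>\<beta>. - (\<gamma> \<beta> t * ht \<beta> t) * D t \<alpha> \<beta>) integrable_on I"
        by (intro integrable_continuous_real continuous_intros Lc cont_space t; use t in auto)+
      have "\<Psi>t e t (zeta t \<alpha>) = integral I (\<lambda>\<beta>. \<gamma>t \<beta> t * L t \<alpha> \<beta>) + integral I (\<lambda>\<beta>. - (\<gamma> \<beta> t * ht \<beta> t) * D t \<alpha> \<beta>)"
        unfolding \<Psi>t_def sheet_conv_HK[OF cont_space(1)[OF t] cont_space(4)[OF t] lnk_continuous[OF e]]
          sheet_conv_HK[OF cont_space(1)[OF t] c bc] by (simp add: L_def D_def zeta_def)
      then show ?thesis unfolding Henstock_Kurzweil_Integration.integral_add[OF i, symmetric] by (simp add: a_def[abs_def])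
    qed
    have a2: "continuous_on (cbox (-pi, -pi) (pi, pi)) (\<lambda>(\<alpha>, \<beta>). a t \<alpha> \<beta>)" "continuous_on (cbox (-pi, -pi) (pi, pi)) (\<lambda>(\<alpha>, \<beta>). a t \<beta> \<alpha>)"
      unfolding case_prod_beta' by (intro ac continuous_intros; use t in auto)+
    have c1: "continuous_on I (\<lambda>\<alpha>. integral I (a t \<alpha>))" "continuous_on I (\<lambda>\<alpha>. integral I (\<lambda>\<beta>. a t \<beta> \<alpha>))"
    proof -
      have "continuous_on (I \<times> cbox (-pi) pi) (\<lambda>(\<alpha>, \<beta>). a t \<alpha> \<beta>)" "continuous_on (I \<times> cbox (-pi) pi) (\<lambda>(\<alpha>, \<beta>). a t \<beta> \<alpha>)"
        unfolding case_prod_beta' by (intro ac continuous_intros; use t in auto)+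
      then show "continuous_on I (\<lambda>\<alpha>. integral I (a t \<alpha>))" "continuous_on I (\<lambda>\<alpha>. integral I (\<lambda>\<beta>. a t \<beta> \<alpha>))"
        using integral_continuous_on_param by fastforce+
    qed
    have "F' t = integral I (\<lambda>\<alpha>. integral I (a t \<alpha>) + integral I (\<lambda>\<beta>. a t \<beta> \<alpha>))"
      unfolding F'_def
    proof (rule integral_cong)
      fix \<alpha>
      have "a t \<alpha> integrable_on I" "(\<lambda>\<beta>. a t \<beta> \<alpha>) integrable_on I"
        by (intro integrable_continuous_real ac continuous_intros; use t in auto)+
      then show "integral I (\<lambda>\<beta>. a t \<alpha> \<beta> + a t \<beta> \<alpha>) = integral I (a t \<alpha>) + integral I (\<lambda>\<beta>. a t \<beta> \<alpha>)"
        by (rule Henstock_Kurzweil_Integration.integral_add)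
    qed
    also have "\<dots> = integral I (\<lambda>\<alpha>. integral I (a t \<alpha>)) + integral I (\<lambda>\<alpha>. integral I (\<lambda>\<beta>. a t \<beta> \<alpha>))"
      by (intro Henstock_Kurzweil_Integration.integral_add integrable_continuous_real c1)
    also have "integral I (\<lambda>\<alpha>. integral I (\<lambda>\<beta>. a t \<beta> \<alpha>)) = integral I (\<lambda>\<alpha>. integral I (a t \<alpha>))"
      using integral_swap_continuous[OF a2(1)] by simp
    finally have "F' t = 2 * integral I (\<lambda>\<alpha>. integral I (a t \<alpha>))" by simp
    moreover have "(LINT \<alpha>:I|lborel. \<gamma> \<alpha> t * \<Psi>t e t (zeta t \<alpha>)) = integral I (\<lambda>\<alpha>. integral I (a t \<alpha>))"
      unfolding P by (rule LH[OF c1(1)])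
    ultimately show ?thesis by simp
  qed
  show ?thesis
  proof (intro exI[of _ "\<lambda>t. - F' t / (4 * pi)"] conjI ballI)
    show "continuous_on {0..T} (\<lambda>t. - F' t / (4 * pi))" by (intro continuous_intros F'_c) simp
    fix t assume t: "t \<in> {0..T}"
    have "(F has_real_derivative F' t) (at t within {0..T})"
      using F_der[OF t] unfolding F'_def has_field_derivative_def by (simp add: mult.commute[of _ "integral _ _"])
    then have "((\<lambda>t. - F t / (4 * pi)) has_real_derivative - F' t / (4 * pi)) (at t within {0..T})"
      by (intro DERIV_cdivide DERIV_minus)
    then show "(Et e has_real_derivative - F' t / (4 * pi)) (at t within {0..T})"
      by (rule has_field_derivative_transform_within[OF _ zero_less_one t]) (simp add: EF)
    show "- (LINT \<alpha>:I|lborel. \<gamma> \<alpha> t * \<Psi>t e t (zeta t \<alpha>)) / (4 * pi) = - F' t / (4 * pi) / 2"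
      by (simp add: A[OF t])
  qed
qed

end

section \<open>Conservation of energy\<close>

locale moving_cutoff = moving_sheet T h \<gamma> h1 ht \<gamma>t R G M C0 + cutoff X X' X'' N
  for T h \<gamma> h1 ht \<gamma>t R G M C0 X X' X'' N +
  assumes RN: "R < N"
    and smooth: "Ck_on k ({0..T} \<times> UNIV) (\<lambda>(t, \<alpha>). h \<alpha> t)" "Ck_on k ({0..T} \<times> UNIV) (\<lambda>(t, \<alpha>). \<gamma> \<alpha> t)"
    and X_smooth: "Ck_on k UNIV X" "Ck_on k UNIV X'"
begin

lemma sheet_at: "t \<in> {0..T} \<Longrightarrow> sheet_reg_cutoff (\<lambda>\<alpha>. h \<alpha> t) (\<lambda>\<alpha>. \<gamma> \<alpha> t) R G (\<lambda>\<alpha>. h1 \<alpha> t) M C0 X X' X'' N"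
  by (intro sheet_reg_cutoff.intro sheet_cutoff.intro sheet_cutoff_axioms.intro reg sheet_reg.axioms(1)[OF reg] RN cutoff_axioms)

text \<open>The integrand is smooth jointly in time, position and sheet parameter, so smoothness
  passes through the integral by \<open>Ck_on_integral\<close>.\<close>

lemma Ck_on_moving_sheet_conv:
  fixes F :: "complex \<Rightarrow> 'b::euclidean_space"
  assumes F: "\<And>k. Ck_on k UNIV F"
  shows "Ck_on k ({0..T} \<times> UNIV) (\<lambda>(t, z). sheet_conv (\<lambda>\<alpha>. h \<alpha> t) (\<lambda>\<alpha>. \<gamma> \<alpha> t) F z)"
proof -
  let ?S = "({0..T} \<times> (UNIV :: complex set)) \<times> (UNIV :: real set)"
  have p: "Ck_on k ?S (\<lambda>q. (fst (fst q), snd q))"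
    by (intro Ck_on_linear bounded_linear_Pair bounded_linear_compose[OF bounded_linear_fst bounded_linear_fst] bounded_linear_snd)
  have im: "(\<lambda>q. (fst (fst q), snd q)) ` ?S \<subseteq> {0..T} \<times> UNIV" by auto
  have hk: "Ck_on k ?S (\<lambda>q. h (snd q) (fst (fst q)))" and gk: "Ck_on k ?S (\<lambda>q. \<gamma> (snd q) (fst (fst q)))"
    using Ck_on_compose[OF p smooth(1) im] Ck_on_compose[OF p smooth(2) im] by simp_all
  have w: "Ck_on k ?S (\<lambda>q. snd (fst q) - (of_real (snd q) + \<i> * of_real (h (snd q) (fst (fst q)))))"
    by (intro Ck_on_diff Ck_on_add Ck_on_linear_compose[OF bounded_linear_mult_right] Ck_on_linear_compose[OF bounded_linear_of_real] hk
        Ck_on_linear bounded_linear_snd bounded_linear_compose[OF bounded_linear_snd bounded_linear_fst])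
  have "Ck_on k ?S (\<lambda>q. \<gamma> (snd q) (fst (fst q)) *\<^sub>R F (snd (fst q) - (of_real (snd q) + \<i> * of_real (h (snd q) (fst (fst q))))))"
    by (intro Ck_on_scaleR gk Ck_on_compose[OF w F]) auto
  from Ck_on_integral[OF _ this, of "-pi" pi]
  have "Ck_on k ({0..T} \<times> UNIV) (\<lambda>p. integral {-pi..pi} (\<lambda>\<alpha>. \<gamma> \<alpha> (fst p) *\<^sub>R F (snd p - (of_real \<alpha> + \<i> * of_real (h \<alpha> (fst p))))))"
    by (simp add: convex_Times)
  then show ?thesis
  proof (rule Ck_on_cong)
    fix p :: "real \<times> complex" assume p: "p \<in> {0..T} \<times> UNIV"
    then have t: "fst p \<in> {0..T}" by auto
    show "integral {-pi..pi} (\<lambda>\<alpha>. \<gamma> \<alpha> (fst p) *\<^sub>R F (snd p - (of_real \<alpha> + \<i> * of_real (h \<alpha> (fst p)))))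
      = (case p of (t, z) \<Rightarrow> sheet_conv (\<lambda>\<alpha>. h \<alpha> t) (\<lambda>\<alpha>. \<gamma> \<alpha> t) F z)"
      using sheet_conv_HK[OF cont_space(1)[OF t] cont_space(2)[OF t] Ck_on_continuous[OF F[of 0]], of "snd p"]
      by (simp add: case_prod_beta' Complex_eq)
  qed
qed

text \<open>\<open>sheet_cutoff.psi\<close> written out, because that constant belongs to a frozen
  time and here \<open>t\<close> has to vary.\<close>

definition test :: "real \<Rightarrow> real \<Rightarrow> complex \<Rightarrow> complex" where
  "test e t z = (of_real (c z) * (\<i> * cnj (sheet_conv (\<lambda>\<alpha>. h \<alpha> t) (\<lambda>\<alpha>. \<gamma> \<alpha> t) (blob e) z))
     - of_real (c1 z * sheet_conv (\<lambda>\<alpha>. h \<alpha> t) (\<lambda>\<alpha>. \<gamma> \<alpha> t) (lnk e) z)) / (4 * pi)"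

definition test_t :: "real \<Rightarrow> real \<Rightarrow> complex \<Rightarrow> complex" where
  "test_t e t z = (of_real (c z) * (\<i> * cnj (Vt e t z)) - of_real (c1 z * \<Psi>t e t z)) / (4 * pi)"

lemma test_eq:
  assumes "t \<in> {0..T}"
  shows "test e t = sheet_cutoff.psi (\<lambda>\<alpha>. h \<alpha> t) (\<lambda>\<alpha>. \<gamma> \<alpha> t) X X' N e"
proof -
  interpret s: sheet_reg_cutoff "\<lambda>\<alpha>. h \<alpha> t" "\<lambda>\<alpha>. \<gamma> \<alpha> t" R G "\<lambda>\<alpha>. h1 \<alpha> t" M C0 X X' X'' N by (rule sheet_at[OF assms])
  show ?thesis by (simp add: fun_eq_iff test_def s.psi_def s.V_def s.\<Psi>_def)
qed

lemma test_smooth: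
  assumes e: "0 < e" shows "smooth_on ({0..T} \<times> UNIV) (\<lambda>(t, z). test e t z)"
  unfolding smooth_on_def
proof
  fix k
  let ?S = "{0..T} \<times> (UNIV :: complex set)"
  have b: "Ck_on k ?S (\<lambda>p. sheet_conv (\<lambda>\<alpha>. h \<alpha> (fst p)) (\<lambda>\<alpha>. \<gamma> \<alpha> (fst p)) (blob e) (snd p))"
    and l: "Ck_on k ?S (\<lambda>p. sheet_conv (\<lambda>\<alpha>. h \<alpha> (fst p)) (\<lambda>\<alpha>. \<gamma> \<alpha> (fst p)) (lnk e) (snd p))"
    using Ck_on_moving_sheet_conv[of "blob e" k, OF Ck_on_blob[OF e]] Ck_on_moving_sheet_conv[of "lnk e" k, OF Ck_on_lnk[OF e]]
    by (simp_all add: case_prod_beta')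
  have i: "Ck_on k ?S (\<lambda>p. Im (snd p) / N)"
    by (intro Ck_on_linear bounded_linear_compose[OF bounded_linear_divide] bounded_linear_compose[OF bounded_linear_Im] bounded_linear_snd)
  have c: "Ck_on k ?S (\<lambda>p. c (snd p))" and c1: "Ck_on k ?S (\<lambda>p. c1 (snd p))"
    unfolding c_def c1_def
    by (intro Ck_on_linear_compose[OF bounded_linear_divide] Ck_on_compose[OF i X_smooth(1)] Ck_on_compose[OF i X_smooth(2)] subset_UNIV)+
  show "Ck_on k ?S (\<lambda>(t, z). test e t z)"
    unfolding test_def case_prod_beta'
    by (intro Ck_on_linear_compose[OF bounded_linear_divide] Ck_on_diff Ck_on_mult Ck_on_linear_compose[OF bounded_linear_of_real]
        Ck_on_linear_compose[OF bounded_linear_mult_right] Ck_on_linear_compose[OF bounded_linear_cnj] b l c c1)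
qed

lemma test_field_test:
  assumes e: "0 < e" shows "test_field T (test e)"
  unfolding test_field_def
proof (intro conjI ballI exI allI impI)
  show "smooth_on ({0..T} \<times> UNIV) (\<lambda>(t, z). test e t z)" by (rule test_smooth[OF e])
  fix t assume t: "t \<in> {0..T}"
  interpret s: sheet_reg_cutoff "\<lambda>\<alpha>. h \<alpha> t" "\<lambda>\<alpha>. \<gamma> \<alpha> t" R G "\<lambda>\<alpha>. h1 \<alpha> t" M C0 X X' X'' N by (rule sheet_at[OF t])
  show "x_periodic (test e t)" unfolding test_eq[OF t] by (rule s.psi_periodic)
  show "test e t z = 0" if "2 * N < \<bar>Im z\<bar>" for z using s.psi_far[OF that] by (simp add: test_eq[OF t])
qed

lemma test_frechet:
  assumes e: "0 < e" and t: "t \<in> {0..T}"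
  shows "frechet_derivative (test e t) (at z) = (\<lambda>v. Re v *\<^sub>R sheet_cutoff.psi_x (\<lambda>\<alpha>. h \<alpha> t) (\<lambda>\<alpha>. \<gamma> \<alpha> t) X X' N e z
     + Im v *\<^sub>R sheet_cutoff.psi_y (\<lambda>\<alpha>. h \<alpha> t) (\<lambda>\<alpha>. \<gamma> \<alpha> t) X X' X'' N e z)"
proof -
  interpret s: sheet_reg_cutoff "\<lambda>\<alpha>. h \<alpha> t" "\<lambda>\<alpha>. \<gamma> \<alpha> t" R G "\<lambda>\<alpha>. h1 \<alpha> t" M C0 X X' X'' N by (rule sheet_at[OF t])
  show ?thesis unfolding test_eq[OF t] by (rule frechet_derivative_at[symmetric, OF s.psi_der[OF e]])
qed

lemma test_divergence:
  assumes e: "0 < e" and t: "t \<in> {0..T}" shows "divergence (test e t) z = 0"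
proof -
  interpret s: sheet_reg_cutoff "\<lambda>\<alpha>. h \<alpha> t" "\<lambda>\<alpha>. \<gamma> \<alpha> t" R G "\<lambda>\<alpha>. h1 \<alpha> t" M C0 X X' X'' N by (rule sheet_at[OF t])
  show ?thesis using s.psi_div[OF e, of z] by (simp add: divergence_def test_frechet[OF e t])
qed

lemma test_time:
  assumes e: "0 < e" and t: "t \<in> {0..T}"
  shows "vector_derivative (\<lambda>t. test e t z) (at t within {0..T}) = test_t e t z"
proof (rule vector_derivative_within_closed_interval[OF T t])
  have 1: "((\<lambda>t. sheet_conv (\<lambda>\<alpha>. h \<alpha> t) (\<lambda>\<alpha>. \<gamma> \<alpha> t) (blob e) z) has_derivative (\<lambda>v. v *\<^sub>R Vt e t z)) (at t within {0..T})"
    unfolding Vt_def by (rule sheet_conv_time[OF t blob_der[OF e] blob_xy_continuous(2)[OF e], unfolded has_vector_derivative_def])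
  have "continuous_on UNIV (\<lambda>w. - Im (blob e w))" by (intro continuous_intros blob_continuous[OF e])
  from sheet_conv_time[OF t lnk_der[OF e] this, unfolded has_vector_derivative_def, folded \<Psi>t_def]
  have 2: "((\<lambda>t. sheet_conv (\<lambda>\<alpha>. h \<alpha> t) (\<lambda>\<alpha>. \<gamma> \<alpha> t) (lnk e) z) has_derivative (\<lambda>v. v *\<^sub>R \<Psi>t e t z)) (at t within {0..T})" .
  have 3: "((\<lambda>t. complex_of_real (c z) * (\<i> * cnj (sheet_conv (\<lambda>\<alpha>. h \<alpha> t) (\<lambda>\<alpha>. \<gamma> \<alpha> t) (blob e) z))) has_derivative
      (\<lambda>v. of_real (c z) * (\<i> * cnj (v *\<^sub>R Vt e t z)))) (at t within {0..T})"
    by (intro has_derivative_mult_right has_derivative_cnj 1)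
  have 4: "((\<lambda>t. complex_of_real (c1 z * sheet_conv (\<lambda>\<alpha>. h \<alpha> t) (\<lambda>\<alpha>. \<gamma> \<alpha> t) (lnk e) z)) has_derivative
      (\<lambda>v. of_real (c1 z * (v *\<^sub>R \<Psi>t e t z)))) (at t within {0..T})"
    by (intro has_derivative_of_real has_derivative_mult_right 2)
  show "((\<lambda>t. test e t z) has_vector_derivative test_t e t z) (at t within {0..T})"
    unfolding has_vector_derivative_def test_def
    by (rule has_derivative_eq_rhs[OF has_derivative_divide_const[OF has_derivative_diff[OF 3 4]]])
      (simp add: fun_eq_iff test_t_def scaleR_conv_of_real diff_divide_distrib algebra_simps)
qed

lemma test_t_continuous:
  assumes "t \<in> {0..T}" "0 < e" shows "continuous_on A (test_t e t)"
proof -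
  have "continuous_on A (\<Psi>t e t)"
    using has_derivative_continuous[OF \<Psi>t_der[OF assms]] by (auto intro: continuous_at_imp_continuous_on)
  then show ?thesis unfolding test_t_def[abs_def] by (intro continuous_intros c_cont Vt_cont assms) auto
qed

text \<open>\<open>test_t\<close> is the perpendicular gradient of the truncated
  \<open>\<Psi>t\<close>, divided by \<open>4 * pi\<close>, so \<open>stream_test\<close> applies to
  it as it does to \<open>psi\<close>.\<close>

lemma test_t_pairing:
  assumes e: "0 < e" and t: "t \<in> {0..T}"
  shows "(LINT z:strip|lborel. sheet.vel (\<lambda>\<alpha>. h \<alpha> t) (\<lambda>\<alpha>. \<gamma> \<alpha> t) z \<bullet> test_t e t z)
     = - (LINT \<alpha>:I|lborel. \<gamma> \<alpha> t * \<Psi>t e t (zeta t \<alpha>)) / (4 * pi)"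
proof -
  interpret s: sheet_reg_cutoff "\<lambda>\<alpha>. h \<alpha> t" "\<lambda>\<alpha>. \<gamma> \<alpha> t" R G "\<lambda>\<alpha>. h1 \<alpha> t" M C0 X X' X'' N by (rule sheet_at[OF t])
  define \<phi> where "\<phi> z = c z * \<Psi>t e t z / (4 * pi)" for z
  let ?x = "\<lambda>z. c z * Re (Vt e t z) / (4 * pi)" and ?y = "\<lambda>z. (c1 z * \<Psi>t e t z + c z * - Im (Vt e t z)) / (4 * pi)"
  have \<Psi>c: "continuous_on UNIV (\<Psi>t e t)"
    using has_derivative_continuous[OF \<Psi>t_der[OF t e]] by (auto intro: continuous_at_imp_continuous_on)
  have "(LINT z:strip|lborel. s.vel z \<bullet> Complex (- ?y z) (?x z)) = - (LINT \<alpha>:I|lborel. \<gamma> \<alpha> t * \<phi> (s.zeta \<alpha>))"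
  proof (rule s.stream_test)
    show "(\<phi> has_derivative (\<lambda>v. Re v * ?x z + Im v * ?y z)) (at z)" for z
      unfolding \<phi>_def[abs_def]
      by (rule has_derivative_eq_rhs[OF has_derivative_divide_const[OF has_derivative_mult[OF c_der \<Psi>t_der[OF t e]]]])
        (simp add: fun_eq_iff add_divide_distrib diff_divide_distrib algebra_simps)
    have "\<Psi>t e t (z + of_real (2 * pi)) = \<Psi>t e t z" for z
    proof -
      have b: "- Im (blob e (w + of_real (2 * pi))) = - Im (blob e w)" for w by (simp only: blob_add_2pi)
      show ?thesis
        unfolding \<Psi>t_def by (simp only: sheet_conv_periodic[of "lnk e", OF lnk_add_2pi] sheet_conv_periodic[of "\<lambda>w. - Im (blob e w)", OF b])
    qed
    then show "x_periodic \<phi>" unfolding x_periodic_def \<phi>_def by (simp only: c_periodic simp_thms)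
    show "continuous_on UNIV ?x" "continuous_on UNIV ?y"
      by (intro continuous_intros c_cont Vt_cont[OF t e] \<Psi>c; simp)+
  qed (simp add: \<phi>_def c_far)
  moreover have "Complex (- ?y z) (?x z) = test_t e t z" for z
    by (simp add: test_t_def complex_eq_iff diff_divide_distrib add_divide_distrib)
  moreover have "s.zeta \<alpha> = zeta t \<alpha>" for \<alpha> by (simp add: s.zeta_def zeta_def)
  ultimately show ?thesis
    using s.zeta_near(1) by (simp add: \<phi>_def set_lebesgue_integral_def)
qed

end

section \<open>The energy balance of a given solution\<close>

context moving_cutoff
begin

definition K :: real where "K = G\<^sup>2 * sqrt (2 * cosh (2 * R)) * sheet_reg.LC R G M C0 * C0 * 2"

abbreviation velocity :: "real \<Rightarrow> complex \<Rightarrow> complex" where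
  "velocity t \<equiv> sheet.vel (\<lambda>\<alpha>. h \<alpha> t) (\<lambda>\<alpha>. \<gamma> \<alpha> t)"

lemma velocity_measurable: "t \<in> {0..T} \<Longrightarrow> velocity t \<in> borel_measurable borel"
  by (rule sheet.vel_meas[OF sheet_reg.axioms(1)[OF reg]])

lemma vortex_sheet_velocity:
  assumes u: "classical_vortex_sheet T h \<gamma> u" and t: "t \<in> {0..T}"
  shows "AE z in lborel. u t z = velocity t z"
proof -
  interpret s: sheet_reg_cutoff "\<lambda>\<alpha>. h \<alpha> t" "\<lambda>\<alpha>. \<gamma> \<alpha> t" R G "\<lambda>\<alpha>. h1 \<alpha> t" M C0 X X' X'' N by (rule sheet_at[OF t])
  show ?thesis using AE_off_graph[OF s.h_meas]
  proof eventually_elim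
    case (elim z)
    let ?f = "\<lambda>\<alpha>. \<gamma> \<alpha> t *\<^sub>R blob 0 (z - Complex \<alpha> (h \<alpha> t))"
    have "z \<notin> range (sheet_point h t)" using elim by (auto simp: sheet_point_def)
    then have "cnj (u t z) = 1 / (4 * of_real pi * \<i>) *
          (LINT \<alpha>:{-pi..pi}|lebesgue. cot ((z - sheet_point h t \<alpha>) / 2) * of_real (\<gamma> \<alpha> t))"
      using u t unfolding classical_vortex_sheet_def by blast
    also have "(\<lambda>\<alpha>. cot ((z - sheet_point h t \<alpha>) / 2) * of_real (\<gamma> \<alpha> t)) = ?f"
      by (simp add: fun_eq_iff cot_half sheet_point_def scaleR_conv_of_real mult.commute)
    also have "(LINT \<alpha>:{-pi..pi}|lebesgue. ?f \<alpha>) = sheet_conv (\<lambda>\<alpha>. h \<alpha> t) (\<lambda>\<alpha>. \<gamma> \<alpha> t) (blob 0) z"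
      unfolding sheet_conv_def Complex_eq
      by (rule set_lebesgue_eq_lborel) (use s.h_meas s.g_meas in measurable)
    finally have "cnj (cnj (u t z)) = cnj (1 / (4 * of_real pi * \<i>) * sheet_conv (\<lambda>\<alpha>. h \<alpha> t) (\<lambda>\<alpha>. \<gamma> \<alpha> t) (blob 0) z)"
      by (rule arg_cong)
    moreover have "cnj (1 / (4 * of_real pi * \<i>)) = \<i> / (4 * pi)" by (simp add: complex_eq_iff Re_divide Im_divide power2_eq_square)
    ultimately show ?case by (simp only: s.vel_def complex_cnj_cnj complex_cnj_mult)
  qed
qed

lemma vortex_sheet_transfer:
  fixes H :: "complex \<Rightarrow> complex \<Rightarrow> real"
  assumes u: "classical_vortex_sheet T h \<gamma> u" and t: "t \<in> {0..T}"
    and H: "continuous_on UNIV (\<lambda>p. H (fst p) (snd p))" "\<And>z. H 0 z = 0"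
  shows "(LINT z:strip|lebesgue. H (u t z) z) = (LINT z:strip|lborel. H (velocity t z) z)"
    and "set_integrable lebesgue strip (\<lambda>z. H (u t z) z) \<longleftrightarrow> integrable lborel (\<lambda>z. indicator strip z *\<^sub>R H (velocity t z) z)"
proof -
  have "set_borel_measurable lebesgue strip (u t)"
    using u t unfolding classical_vortex_sheet_def weak_euler_solution_def weakly_continuous_L2_def L2_field_def by blast
  from strip_transfer[OF this vortex_sheet_velocity[OF u t] velocity_measurable[OF t] H]
  show "(LINT z:strip|lebesgue. H (u t z) z) = (LINT z:strip|lborel. H (velocity t z) z)"
    and "set_integrable lebesgue strip (\<lambda>z. H (u t z) z) \<longleftrightarrow> integrable lborel (\<lambda>z. indicator strip z *\<^sub>R H (velocity t z) z)" .
qed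

lemma vortex_sheet_pairing:
  assumes u: "classical_vortex_sheet T h \<gamma> u" and t: "t \<in> {0..T}" and w: "continuous_on UNIV w"
  shows "(LINT z:strip|lebesgue. u t z \<bullet> w z) = (LINT z:strip|lborel. velocity t z \<bullet> w z)"
  by (rule vortex_sheet_transfer(1)[OF u t]) (auto intro!: continuous_intros continuous_on_compose2[OF w])

lemma Et_pairing:
  assumes u: "classical_vortex_sheet T h \<gamma> u" and t: "t \<in> {0..T}" and e: "0 < e"
  shows "(LINT z:strip|lebesgue. u t z \<bullet> test e t z) = Et e t"
proof -
  interpret s: sheet_reg_cutoff "\<lambda>\<alpha>. h \<alpha> t" "\<lambda>\<alpha>. \<gamma> \<alpha> t" R G "\<lambda>\<alpha>. h1 \<alpha> t" M C0 X X' X'' N by (rule sheet_at[OF t])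
  have "continuous_on UNIV (s.psi e)"
    using has_derivative_continuous[OF s.psi_der[OF e]] by (auto intro: continuous_at_imp_continuous_on)
  then have "(LINT z:strip|lebesgue. u t z \<bullet> test e t z) = (LINT z:strip|lborel. velocity t z \<bullet> s.psi e z)"
    unfolding test_eq[OF t] by (rule vortex_sheet_pairing[OF u t])
  also have "\<dots> = Et e t"
    unfolding s.psi_pairing[OF e] Et_def by (simp add: zeta_def s.zeta_def[abs_def])
  finally show ?thesis .
qed

lemma vortex_sheet_nonlinear_bound:
  assumes u: "classical_vortex_sheet T h \<gamma> u" and t: "t \<in> {0..T}" and e: "0 < e"
  shows "\<bar>LINT z:strip|lebesgue. tensor_grad (u t z) (test e t) z\<bar> \<le> K * e powr (1/4)"
proof -
  interpret s: sheet_reg_cutoff "\<lambda>\<alpha>. h \<alpha> t" "\<lambda>\<alpha>. \<gamma> \<alpha> t" R G "\<lambda>\<alpha>. h1 \<alpha> t" M C0 X X' X'' N by (rule sheet_at[OF t])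
  let ?H = "\<lambda>v z. \<Sum>i\<in>Basis. \<Sum>j\<in>Basis. (v \<bullet> i) * (v \<bullet> j) * ((Re j *\<^sub>R s.psi_x e z + Im j *\<^sub>R s.psi_y e z) \<bullet> i)"
  have "(LINT z:strip|lebesgue. ?H (u t z) z) = (LINT z:strip|lborel. ?H (velocity t z) z)"
    by (rule vortex_sheet_transfer(1)[OF u t])
      (auto intro!: continuous_intros continuous_on_compose2[OF s.psi_xy_cont(1)[OF e]] continuous_on_compose2[OF s.psi_xy_cont(2)[OF e]])
  moreover have "tensor_grad (u t z) (test e t) z = ?H (u t z) z" for z
    unfolding tensor_grad_def test_frechet[OF e t] ..
  ultimately show ?thesis using s.nonlinear_bound[OF e] by (simp add: K_def)
qed

lemma Et_increment:
  assumes u: "classical_vortex_sheet T h \<gamma> u" and t: "t \<in> {0..T}" and e: "0 < e"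
  shows "\<bar>Et e t - Et e 0\<bar> \<le> 2 * (K * e powr (1/4) * t)"
proof -
  obtain E' where E'_cont: "continuous_on {0..T} E'"
    and E'_der: "\<And>t. t \<in> {0..T} \<Longrightarrow> (Et e has_real_derivative E' t) (at t within {0..T})"
    and E'_eq: "\<And>t. t \<in> {0..T} \<Longrightarrow> - (LINT \<alpha>:I|lborel. \<gamma> \<alpha> t * \<Psi>t e t (zeta t \<alpha>)) / (4 * pi) = E' t / 2"
    using Et_derivative[OF e] by blast
  have t': "0 \<le> t" "t \<le> T" "0 \<in> {0..T}" using t T by auto
  have sub: "s \<in> {0..T}" if "s \<in> {0..t}" for s using that t' by auto
  have "weak_euler_solution T u" using u unfolding classical_vortex_sheet_def by blast
  then have weak: "(LINT z:strip|lebesgue. u t z \<bullet> test e t z) - (LINT z:strip|lebesgue. u 0 z \<bullet> test e 0 z)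
           - (LINT s:{0..t}|lebesgue. LINT z:strip|lebesgue. u s z \<bullet> vector_derivative (\<lambda>r. test e r z) (at s within {0..T}))
           = (LINT s:{0..t}|lebesgue. LINT z:strip|lebesgue. tensor_grad (u s z) (test e s) z)"
    using test_field_test[OF e] test_divergence[OF e] t unfolding weak_euler_solution_def by blast
  have time: "(LINT s:{0..t}|lebesgue. LINT z:strip|lebesgue. u s z \<bullet> vector_derivative (\<lambda>r. test e r z) (at s within {0..T}))
      = (Et e t - Et e 0) / 2"
  proof -
    have "(LINT s:{0..t}|lebesgue. LINT z:strip|lebesgue. u s z \<bullet> vector_derivative (\<lambda>r. test e r z) (at s within {0..T}))
        = (LINT s:{0..t}|lebesgue. E' s / 2)"
    proof (rule set_lebesgue_integral_cong, simp, intro allI impI)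
      fix s assume "s \<in> {0..t}"
      then have s: "s \<in> {0..T}" by (rule sub)
      show "(LINT z:strip|lebesgue. u s z \<bullet> vector_derivative (\<lambda>r. test e r z) (at s within {0..T})) = E' s / 2"
        unfolding test_time[OF e s] vortex_sheet_pairing[OF u s test_t_continuous[OF s e]] test_t_pairing[OF e s]
        by (rule E'_eq[OF s])
    qed
    also have "\<dots> = integral {0..t} (\<lambda>s. E' s / 2)"
    proof (rule set_lebesgue_integral_eq_integral(2), rule absolutely_integrable_continuous_real)
      show "continuous_on {0..t} (\<lambda>s. E' s / 2)"
        by (intro continuous_intros continuous_on_subset[OF E'_cont]) (use t' in auto)
    qed
    also have "\<dots> = Et e t / 2 - Et e 0 / 2"
    proof (rule integral_unique, rule fundamental_theorem_of_calculus[OF t'(1)])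
      fix s assume s: "s \<in> {0..t}"
      have "(Et e has_real_derivative E' s) (at s within {0..t})"
        by (rule DERIV_subset[OF E'_der[OF sub[OF s]]]) (use t' in auto)
      from DERIV_cdivide[OF this, of 2] show "((\<lambda>s. Et e s / 2) has_vector_derivative E' s / 2) (at s within {0..t})"
        by (simp add: has_real_derivative_iff_has_vector_derivative)
    qed
    finally show ?thesis by (simp add: diff_divide_distrib)
  qed
  have "0 \<le> K * e powr (1/4)"
    using vortex_sheet_nonlinear_bound[OF u t e] by linarith
  then have "\<bar>LINT s:{0..t}|lebesgue. LINT z:strip|lebesgue. tensor_grad (u s z) (test e s) z\<bar> \<le> K * e powr (1/4) * t"
    by (intro set_integral_bound_interval vortex_sheet_nonlinear_bound[OF u _ e] sub t'(1))
  moreover have "(LINT s:{0..t}|lebesgue. LINT z:strip|lebesgue. tensor_grad (u s z) (test e s) z) = (Et e t - Et e 0) / 2"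
    unfolding weak[symmetric] time Et_pairing[OF u t e] Et_pairing[OF u t'(3) e] by (simp add: field_simps)
  ultimately show ?thesis by simp
qed

text \<open>The square integrability demanded of a weak solution passes to \<open>vel\<close> by
  almost everywhere equality; this is what \<open>sheet_energy\<close> asks for besides the
  circulation.\<close>

lemma Et_limit:
  assumes u: "classical_vortex_sheet T h \<gamma> u" and t: "t \<in> {0..T}"
    and circulation: "(LINT \<alpha>:I|lebesgue. \<gamma> \<alpha> t) = 0"
  shows "(\<lambda>n. Et (inverse (real (Suc n))) t) \<longlonglongrightarrow> (LINT z:strip|lebesgue. (norm (u t z))\<^sup>2)"
proof -
  interpret s: sheet_reg_cutoff "\<lambda>\<alpha>. h \<alpha> t" "\<lambda>\<alpha>. \<gamma> \<alpha> t" R G "\<lambda>\<alpha>. h1 \<alpha> t" M C0 X X' X'' N by (rule sheet_at[OF t])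
  have H: "continuous_on UNIV (\<lambda>p :: complex \<times> complex. (norm (fst p))\<^sup>2)" by (intro continuous_intros)
  have "set_integrable lebesgue strip (\<lambda>z. (norm (u t z))\<^sup>2)"
    using u t unfolding classical_vortex_sheet_def weak_euler_solution_def weakly_continuous_L2_def L2_field_def by blast
  moreover have "(LINT \<alpha>:I|lborel. \<gamma> \<alpha> t) = 0"
    using circulation set_lebesgue_eq_lborel[OF s.g_meas] by simp
  ultimately interpret se: sheet_energy "\<lambda>\<alpha>. h \<alpha> t" "\<lambda>\<alpha>. \<gamma> \<alpha> t" R G
    using vortex_sheet_transfer(2)[OF u t H] by unfold_locales auto
  have "Et e t = - (LINT \<alpha>:I|lborel. \<gamma> \<alpha> t * s.\<Psi> e (s.zeta \<alpha>)) / (4 * pi)" for e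
    by (simp add: Et_def zeta_def s.zeta_def[abs_def])
  then show ?thesis using se.energy_limit vortex_sheet_transfer(1)[OF u t H] by simp
qed

theorem energy_conserved:
  assumes u: "classical_vortex_sheet T h \<gamma> u" and circulation: "\<And>t. t \<in> {0..T} \<Longrightarrow> (LINT \<alpha>:I|lebesgue. \<gamma> \<alpha> t) = 0"
    and t: "t \<in> {0..T}"
  shows "(LINT z:strip|lebesgue. (norm (u t z))\<^sup>2) = (LINT z:strip|lebesgue. (norm (u 0 z))\<^sup>2)"
proof -
  let ?e = "\<lambda>n. inverse (real (Suc n))"
  have 0: "0 \<in> {0..T}" using T by simp
  have "(\<lambda>n. ?e n powr (1/4)) \<longlonglongrightarrow> 0 powr (1/4)"
    by (rule tendsto_powr'[OF LIMSEQ_inverse_real_of_nat tendsto_const]) (auto intro!: always_eventually)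
  from tendsto_mult_left[OF tendsto_mult_right[OF tendsto_mult_left[OF this, of K], of t], of 2]
  have lim0: "(\<lambda>n. 2 * (K * ?e n powr (1/4) * t)) \<longlonglongrightarrow> 0" by simp
  have "(\<lambda>n. Et (?e n) t - Et (?e n) 0) \<longlonglongrightarrow> 0"
    by (rule Lim_null_comparison[OF _ lim0]) (use Et_increment[OF u t] in \<open>auto simp del: of_nat_Suc\<close>)
  moreover have "(\<lambda>n. Et (?e n) t - Et (?e n) 0) \<longlonglongrightarrow>
      (LINT z:strip|lebesgue. (norm (u t z))\<^sup>2) - (LINT z:strip|lebesgue. (norm (u 0 z))\<^sup>2)"
    by (intro tendsto_diff Et_limit u t 0 circulation)
  ultimately show ?thesis using LIMSEQ_unique by fastforce
qed

end

theorem corollary5p1: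
  fixes T :: real
    and h \<gamma> :: "real \<Rightarrow> real \<Rightarrow> real"
    and u :: "real \<Rightarrow> complex \<Rightarrow> complex"
  assumes "0 < T"
    and "smooth_on ({0..T} \<times> UNIV) (\<lambda>(t, \<alpha>). h \<alpha> t)"
    and "smooth_on ({0..T} \<times> UNIV) (\<lambda>(t, \<alpha>). \<gamma> \<alpha> t)"
    and "\<And>t \<alpha>. t \<in> {0..T} \<Longrightarrow> h (\<alpha> + 2 * pi) t = h \<alpha> t"
    and "\<And>t \<alpha>. t \<in> {0..T} \<Longrightarrow> \<gamma> (\<alpha> + 2 * pi) t = \<gamma> \<alpha> t"
    and "classical_vortex_sheet T h \<gamma> u"
    and "\<And>t. t \<in> {0..T} \<Longrightarrow> (LINT \<alpha>:{-pi..pi}|lebesgue. \<gamma> \<alpha> t) = 0"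
  shows "\<forall>t\<in>{0..T}.
    (LINT z:strip|lebesgue. (norm (u t z))\<^sup>2) = (LINT z:strip|lebesgue. (norm (u 0 z))\<^sup>2)"
proof -
  obtain h1 ht R where h: "continuous_on ({0..T} \<times> UNIV) (\<lambda>(t, \<alpha>). h \<alpha> t)" "continuous_on ({0..T} \<times> UNIV) (\<lambda>(t, \<alpha>). ht \<alpha> t)"
    "\<And>t \<alpha>. t \<in> {0..T} \<Longrightarrow> ((\<lambda>\<alpha>. h \<alpha> t) has_real_derivative h1 \<alpha> t) (at \<alpha>)"
    "\<And>t \<alpha>. t \<in> {0..T} \<Longrightarrow> ((\<lambda>t. h \<alpha> t) has_real_derivative ht \<alpha> t) (at t within {0..T})"
    "\<And>t \<alpha>. t \<in> {0..T} \<Longrightarrow> \<bar>h \<alpha> t\<bar> \<le> R" "\<And>t \<alpha> \<beta>. t \<in> {0..T} \<Longrightarrow> \<bar>h1 \<alpha> t - h1 \<beta> t\<bar> \<le> R * \<bar>\<alpha> - \<beta>\<bar>"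
    using smooth_sheet_function[OF assms(2,4)] by blast
  obtain \<gamma>1 \<gamma>t G where \<gamma>: "continuous_on ({0..T} \<times> UNIV) (\<lambda>(t, \<alpha>). \<gamma> \<alpha> t)" "continuous_on ({0..T} \<times> UNIV) (\<lambda>(t, \<alpha>). \<gamma>t \<alpha> t)"
    "\<And>t \<alpha>. t \<in> {0..T} \<Longrightarrow> ((\<lambda>\<alpha>. \<gamma> \<alpha> t) has_real_derivative \<gamma>1 \<alpha> t) (at \<alpha>)"
    "\<And>t \<alpha>. t \<in> {0..T} \<Longrightarrow> ((\<lambda>t. \<gamma> \<alpha> t) has_real_derivative \<gamma>t \<alpha> t) (at t within {0..T})"
    "\<And>t \<alpha>. t \<in> {0..T} \<Longrightarrow> \<bar>\<gamma> \<alpha> t\<bar> \<le> G" "\<And>t \<alpha> \<beta>. t \<in> {0..T} \<Longrightarrow> \<bar>\<gamma> \<alpha> t - \<gamma> \<beta> t\<bar> \<le> G * \<bar>\<alpha> - \<beta>\<bar>"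
    using smooth_sheet_function[OF assms(3,5)] by blast
  \<comment> \<open>\<open>smooth_sheet_function\<close> returns one bound for a function and its
    Lipschitz constants, so \<open>R\<close> and \<open>G\<close> also bound the variation of slope
    and density.\<close>
  define M where "M = max R G"
  have M: "R * \<bar>x\<bar> \<le> M * \<bar>x\<bar>" "G * \<bar>x\<bar> \<le> M * \<bar>x\<bar>" for x by (auto simp: M_def intro!: mult_right_mono)
  obtain C0 where C0: "0 \<le> C0" "\<And>c. \<bar>c\<bar> \<le> pi \<Longrightarrow> (\<integral>\<^sup>+s. indicator {-pi..pi} s * sing_periodic (3/4) (s - c) \<partial>lborel) \<le> ennreal C0"
    using nn_integral_sing_periodic[of "3/4"] by auto
  obtain X X' :: "real \<Rightarrow> real" where X: "\<And>k. Ck_on k UNIV X" "\<And>k. Ck_on k UNIV X'"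
    "\<And>s. (X has_real_derivative X' s) (at s)" "\<And>s. \<bar>s\<bar> \<le> 1 \<Longrightarrow> X s = 1" "\<And>s. 2 \<le> \<bar>s\<bar> \<Longrightarrow> X s = 0"
    "\<And>s. \<bar>s\<bar> < 1 \<Longrightarrow> X' s = 0" "\<And>s. 2 < \<bar>s\<bar> \<Longrightarrow> X' s = 0"
    by (rule smooth_cutoff_exists) blast
  note X' = smooth_real_derivative(1)[OF X(2)] and X'' = Ck_on_continuous[OF smooth_real_derivative(2)[OF X(2), of 0]]
  have reg: "sheet_reg (\<lambda>\<alpha>. h \<alpha> t) (\<lambda>\<alpha>. \<gamma> \<alpha> t) R G (\<lambda>\<alpha>. h1 \<alpha> t) M C0" if t: "t \<in> {0..T}" for t
  proof
    show "continuous_on UNIV (\<lambda>\<alpha>. h \<alpha> t)" "continuous_on UNIV (\<lambda>\<alpha>. \<gamma> \<alpha> t)"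
      using h(3)[OF t] \<gamma>(3)[OF t] by (auto intro!: DERIV_continuous_on)
    show "\<bar>h1 \<alpha> t - h1 \<beta> t\<bar> \<le> M * \<bar>\<alpha> - \<beta>\<bar>" "\<bar>\<gamma> \<alpha> t - \<gamma> \<beta> t\<bar> \<le> M * \<bar>\<alpha> - \<beta>\<bar>" for \<alpha> \<beta>
      using h(6)[OF t, of \<alpha> \<beta>] \<gamma>(6)[OF t, of \<alpha> \<beta>] M[of "\<alpha> - \<beta>"] by auto
  qed (use assms(4,5) h(3,5) \<gamma>(5) C0 t in auto)
  have N: "0 < R + 1" using h(5)[of 0 0] assms(1) by auto
  \<comment> \<open>One height above the sheet suffices for the weak formulation, since
    \<open>Et\<close> does not depend on it; heights tending to infinity occur only inside
    \<open>energy_limit\<close>.\<close>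
  interpret moving_cutoff T h \<gamma> h1 ht \<gamma>t R G M C0 X X' "deriv X'" "R + 1"
  proof (intro moving_cutoff.intro moving_sheet.intro cutoff.intro moving_cutoff_axioms.intro)
    show "sheet_reg (\<lambda>\<alpha>. h \<alpha> t) (\<lambda>\<alpha>. \<gamma> \<alpha> t) R G (\<lambda>\<alpha>. h1 \<alpha> t) M C0" if "t \<in> {0..T}" for t by (rule reg[OF that])
    show "Ck_on k ({0..T} \<times> UNIV) (\<lambda>(t, \<alpha>). h \<alpha> t)" "Ck_on k ({0..T} \<times> UNIV) (\<lambda>(t, \<alpha>). \<gamma> \<alpha> t)" for k
      using assms(2,3) unfolding smooth_on_def by blast+
  qed (rule assms(1) h(1,2,4) \<gamma>(1,2,4) X X' X'' N less_add_one; assumption?)+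
  show ?thesis using energy_conserved[OF assms(6,7)] by blast
qed

end
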